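(* Let $A_N$ and $B_N$ be real random overlapping (non-symmetric) matrices as defined in the context, whose entries are i.i.d. real random variables with all moments finite, mean $0$, second moment $1$ and fourth moment $m_4$. Let $T_k$ denote the Chebyshev polynomials of the first kind, $T_k(\cos\theta)=\cos k\theta$, and let $\gamma:=\frac{\Delta_1\Delta_2}{\sqrt{a_1a_2b_1b_2}}$. Then for all integers $k,l\ge1$, as $N\to\infty$, the joint distribution of the centered linear statistics $\mathcal N^o(T_k,W_{A_N})$ and $\mathcal N^o(T_l,W_{B_N})$ converges (weakly) to a two-variate Gaussian distribution with the covariance (between the two coordinates) equal to $$\begin{cases}\delta_{kl}\,\frac{k}{2}\,\gamma^k, & \text{if } k>1,\\[2pt] \delta_{kl}\,\frac{m_4-1}{4}\,\gamma, & \text{if } k=1,\end{cases}$$ where $\delta_{kl}$ is the Kronecker delta.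
   Context: Setting. $X=(X_{ij})_{i,j\ge1}$ is an infinite random matrix with independent identically distributed real entries having all moments finite, with $\mathbb E X_{ij}=0$, $\mathbb E X_{ij}^2=1$, $\mathbb E X_{ij}^4=m_4$. For each $N$, $A_N$ and $B_N$ are finite submatrices of $X$ (each obtained by selecting a set of rows and a set of columns): $A_N$ has $a_1^{(N)}$ rows and $a_2^{(N)}$ columns, $B_N$ has $b_1^{(N)}$ rows and $b_2^{(N)}$ columns, and they have $\Delta_1^{(N)}$ rows and $\Delta_2^{(N)}$ columns in common. There is a parameter $t_N\to\infty$ such that $a_i^{(N)}/t_N\to a_i$, $b_i^{(N)}/t_N\to b_i$, $\Delta_i^{(N)}/t_N\to\Delta_i$ for $i=1,2$, where all limits are positive. Normalized sample covariance matrices: $$W_{A_N}:=\frac{1}{2\sqrt{a_1^{(N)}a_2^{(N)}}}\left[A_NA_N^*-(a_1^{(N)}+a_2^{(N)})I_{a_1^{(N)}}\right],\quad W_{B_N}:=\frac{1}{2\sqrt{b_1^{(N)}b_2^{(N)}}}\left[B_NB_N^*-(b_1^{(N)}+b_2^{(N)})I_{b_1^{(N)}}\right],$$ where $I_n$ is the $n\times n$ identity matrix. Linear statistics: for $f:\mathbb R\to\mathbb R$, $\mathcal N(f,W_{A_N}):=\mathrm{Tr}[f(W_{A_N})]=\sum_i f(\lambda_i)$, where $\lambda_i$ are the eigenvalues of $W_{A_N}$, and $\mathcal N^o(f,W_{A_N}):=\mathcal N(f,W_{A_N})-\mathbb E\,\mathcal N(f,W_{A_N})$; similarly for $W_{B_N}$.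 *)

theory Defs
  imports
    "HOL-Probability.Probability"
    "Jordan_Normal_Form.Spectral_Radius"
    "Jordan_Normal_Form.DL_Submatrix"
begin

hide_const (open) Finite_Cartesian_Product.mat Finite_Cartesian_Product.transpose

subsection \<open>Chebyshev polynomials of the first kind\<close>

definition chebyshev_T :: "nat \<Rightarrow> real poly" where
  "chebyshev_T k = (THE p. \<forall>\<theta>. poly p (cos \<theta>) = cos (real k * \<theta>))"

text \<open>The description is proper: existence by the three-term recursion, uniqueness because
  \<open>cos\<close> takes infinitely many values.\<close>

lemma ex1_chebyshev: "\<exists>!p :: real poly. \<forall>\<theta>. poly p (cos \<theta>) = cos (real k * \<theta>)"
proof -
  have "\<exists>p q :: real poly. \<forall>\<theta>. poly p (cos \<theta>) = cos (real k * \<theta>)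
      \<and> poly q (cos \<theta>) = cos (real (Suc k) * \<theta>)"
  proof (induction k)
    case 0
    show ?case by (rule exI[of _ 1], rule exI[of _ "[:0, 1:]"]) simp
  next
    case (Suc k)
    then obtain p q :: "real poly" where
      p: "\<And>\<theta>. poly p (cos \<theta>) = cos (real k * \<theta>)" and
      q: "\<And>\<theta>. poly q (cos \<theta>) = cos (real (Suc k) * \<theta>)" by blast
    have aux: "cos (u + v) + cos (u - v) = 2 * cos v * cos u" for u v :: real
      by (simp add: cos_add cos_diff)
    have "poly ([:0, 2:] * q - p) (cos \<theta>) = cos (real (Suc (Suc k)) * \<theta>)" for \<theta>
    proof -
      have "cos (real (Suc (Suc k)) * \<theta>) + cos (real k * \<theta>)
          = cos (real (Suc k) * \<theta> + \<theta>) + cos (real (Suc k) * \<theta> - \<theta>)"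
        by (simp add: algebra_simps)
      also have "\<dots> = 2 * cos \<theta> * cos (real (Suc k) * \<theta>)"
        by (rule aux)
      finally have "2 * cos \<theta> * cos (real (Suc k) * \<theta>) - cos (real k * \<theta>)
          = cos (real (Suc (Suc k)) * \<theta>)" by linarith
      moreover have "poly ([:0, 2:] * q - p) (cos \<theta>)
          = 2 * cos \<theta> * cos (real (Suc k) * \<theta>) - cos (real k * \<theta>)"
        by (simp only: poly_diff poly_mult p q) simp
      ultimately show ?thesis by simp
    qed
    with q show ?case by blast
  qed
  then obtain p :: "real poly" where p: "\<forall>\<theta>. poly p (cos \<theta>) = cos (real k * \<theta>)" by blast
  show ?thesis
  proof (rule ex1I[of _ p])
    show "\<forall>\<theta>. poly p (cos \<theta>) = cos (real k * \<theta>)" by (fact p)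
  next
    fix q :: "real poly"
    assume q: "\<forall>\<theta>. poly q (cos \<theta>) = cos (real k * \<theta>)"
    have "{-1..1} \<subseteq> {x. poly (q - p) x = 0}"
      using p q by (auto simp: poly_diff) (metis cos_arccos)
    moreover have "infinite {-1..1::real}" by (simp add: infinite_Icc)
    ultimately have "infinite {x. poly (q - p) x = 0}" using finite_subset by blast
    then have "q - p = 0" using poly_roots_finite by blast
    then show "q = p" by simp
  qed
qed

lemma poly_chebyshev_T_cos: "poly (chebyshev_T k) (cos \<theta>) = cos (real k * \<theta>)"
  unfolding chebyshev_T_def using theI'[OF ex1_chebyshev[of k]] by blast

subsection \<open>Sample covariance matrices and linear statistics\<close>

text \<open>\<open>submat x I J\<close> is the submatrix of the infinite matrix \<open>x\<close> with rows \<open>I\<close> and columns \<open>J\<close>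
  (finite sets), taken in increasing order: \<open>pick I i\<close> is the \<open>i\<close>-th smallest element of \<open>I\<close>.\<close>

definition submat :: "(nat \<Rightarrow> nat \<Rightarrow> 'a) \<Rightarrow> nat set \<Rightarrow> nat set \<Rightarrow> 'a mat" where
  "submat x I J = mat (card I) (card J) (\<lambda>(i, j). x (pick I i) (pick J j))"

definition norm_sample_cov :: "real mat \<Rightarrow> real mat" where
  "norm_sample_cov A =
     (1 / (2 * sqrt (real (dim_row A) * real (dim_col A)))) \<cdot>\<^sub>m
       (A * transpose_mat A - (real (dim_row A) + real (dim_col A)) \<cdot>\<^sub>m 1\<^sub>m (dim_row A))"

text \<open>Eigenvalues are counted with algebraic multiplicity. For a real symmetric matrix, such as
  \<open>norm_sample_cov A\<close>, all complex eigenvalues are real, so this is the sum over the full spectrum.\<close>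

definition lin_stat :: "(real \<Rightarrow> real) \<Rightarrow> real mat \<Rightarrow> real" where
  "lin_stat f W = (\<Sum>e\<in>spectrum W. real (order e (char_poly W)) * f e)"

definition centered :: "'a measure \<Rightarrow> ('a \<Rightarrow> real) \<Rightarrow> 'a \<Rightarrow> real" where
  "centered M Y = (\<lambda>\<omega>. Y \<omega> - (\<integral>\<omega>'. Y \<omega>' \<partial>M))"

subsection \<open>Bivariate Gaussian laws and weak convergence\<close>

definition gaussian_law :: "real measure \<Rightarrow> bool" where
  "gaussian_law \<nu> \<longleftrightarrow>
     (\<exists>m. \<nu> = return borel m) \<or> (\<exists>m \<sigma>. \<sigma> > 0 \<and> \<nu> = density lborel (normal_density m \<sigma>))"

text \<open>A law on the plane is Gaussian iff all its one-dimensional linear images are. Degenerate laws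
  are included; they do occur as limits, e.g. if \<open>m\<^sub>4 = 1\<close> and \<open>k = 1\<close>.\<close>

definition bivariate_gaussian :: "(real \<times> real) measure \<Rightarrow> bool" where
  "bivariate_gaussian \<mu> \<longleftrightarrow>
     sets \<mu> = sets borel \<and> (\<forall>s t. gaussian_law (distr \<mu> borel (\<lambda>(x, y). s * x + t * y)))"

definition covariance :: "'a measure \<Rightarrow> ('a \<Rightarrow> real) \<Rightarrow> ('a \<Rightarrow> real) \<Rightarrow> real" where
  "covariance M Y Z = (\<integral>\<omega>. centered M Y \<omega> * centered M Z \<omega> \<partial>M)"

definition converges_weakly ::
  "(nat \<Rightarrow> 'a :: topological_space measure) \<Rightarrow> 'a measure \<Rightarrow> bool" where
  "converges_weakly \<mu>s \<mu> \<longleftrightarrow>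
     (\<forall>\<phi> :: 'a \<Rightarrow> real. continuous_on UNIV \<phi> \<longrightarrow> bounded (range \<phi>) \<longrightarrow>
        (\<lambda>n. \<integral>x. \<phi> x \<partial>\<mu>s n) \<longlonglongrightarrow> (\<integral>x. \<phi> x \<partial>\<mu>))"

end

theory Submission
  imports Defs
begin

text \<open>\<open>Tr T\<^sub>k(W)\<close> is a linear combination of sums over closed walks on the complete bipartite graph of rows and
  columns, each walk contributing the product of the entries along its edges. Up to an error that tends to \<open>0\<close>
  in mean square, only the simple cycles of length \<open>2 k\<close> matter (for \<open>k = 1\<close> the centered squares of the entries):
  by the Efron--Stein inequality the variance is at most an energy form, essentially the squared gradient in the
  entries. With \<open>T\<^sub>k(W) = F(H)\<close>, \<open>H = A A\<^sup>*\<close>, its leading term is a multiple of \<open>Tr (F'(H)\<^sup>2 H)\<close>, and \<open>F'\<close> is a multiple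
  of a Chebyshev polynomial of the second kind. These are orthonormal
  for the Marchenko--Pastur moments, so the energy has a limit, and the simple cycles alone already exhaust it.
  The energy contains a further term, from walks that share a double edge; it hardly depends on the law of the entries,
  and for random signs the same comparison shows that it is negligible.
  Weighted sums over simple cycles satisfy Wick's recursion for moments up to a factor \<open>1/n\<close> for \<open>n\<close> rows and columns,
  because overlapping cycles lose vertices; hence all their linear combinations are asymptotically Gaussian. The covariance counts pairs of
  cycles with the same edges, which lie in the common submatrix; this gives \<open>\<gamma>\<^sup>k\<close>.\<close>

subsection \<open>Walks on a complete bipartite graph\<close>

text \<open>A direct computation of the variance of Tr T_k(W) would have to exhibit the cancellation
  between walks of different lengths. Instead two values are compared. The cycles have the
  coefficient \<open>1 / (2 * h^k)\<close>, and about \<open>2 * k * h^(2 * k)\<close> ordered pairs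
  of rooted oriented cycles have equal edges, so that their sum has variance k/2. Each cycle is a
  product of 2k distinct centered entries, which makes its energy 2k times its variance, altogether
  k^2. The gradient computation gives k^2 for the whole polynomial as well, and cycles are
  orthogonal in energy to all other walks; nothing is left for these. The term with double edges has
  the coefficient \<open>m 4 - 5\<close>, whose sign depends on the law. The comparison is
  conclusive where the sign is negative; this is the reason for the detour through random signs. The
  case k = 1 is exceptional: the closed walk u, v, u passes one edge twice, and its centered
  contribution is x^2 - 1, of variance m_4 - 1. The scale is the geometric mean h of the two
  dimensions, with W = (H / h - \<kappa>) / 2. Edges are unordered, so that an entry has the same
  label in either direction of a walk.\<close>

fun path_edges :: "'v list \<Rightarrow> 'v set list" where
  "path_edges (u # v # xs) = {u, v} # path_edges (v # xs)"
| "path_edges _ = []"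

lemma length_path_edges [simp]: "length (path_edges xs) = length xs - 1"
  by (induction xs rule: path_edges.induct) auto

lemma path_edges_append:
  "path_edges (xs @ u # ys) = path_edges (xs @ [u]) @ path_edges (u # ys)"
proof (induction xs)
  case (Cons a xs)
  then show ?case by (cases xs) auto
qed simp

lemma path_edges_rev: "path_edges (rev xs) = rev (path_edges xs)"
proof (induction xs rule: path_edges.induct)
  case (1 u v xs)
  have "path_edges (rev (u # v # xs)) = path_edges (rev xs @ v # [u])" by simp
  also have "\<dots> = path_edges (rev xs @ [v]) @ path_edges [v, u]" by (rule path_edges_append)
  finally show ?case using 1 by (simp add: insert_commute)
qed auto

lemma path_edges_subset: "e \<in> set (path_edges xs) \<Longrightarrow> e \<subseteq> set xs"
  by (induction xs rule: path_edges.induct) auto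

lemma Union_path_edges: "length xs \<ge> 2 \<Longrightarrow> \<Union> (set (path_edges xs)) = set xs"
proof (induction xs rule: path_edges.induct)
  case (1 u v xs)
  then show ?case by (cases xs) auto
qed auto

lemma path_edges_nth: "Suc s < length xs \<Longrightarrow> path_edges xs ! s = {xs ! s, xs ! Suc s}"
proof (induction xs arbitrary: s rule: path_edges.induct)
  case (1 u v xs)
  then show ?case by (cases s) auto
qed auto

lemma path_edges_split:
  assumes "path_edges xs = as @ e # bs"
  obtains ys u v zs where "xs = ys @ u # v # zs" "e = {u, v}"
    "path_edges (ys @ [u]) = as" "path_edges (v # zs) = bs"
proof -
  have "\<exists>ys u v zs. xs = ys @ u # v # zs \<and> e = {u, v} \<and>
      path_edges (ys @ [u]) = as \<and> path_edges (v # zs) = bs"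
    using assms
  proof (induction xs arbitrary: as rule: path_edges.induct)
    case (1 u v xs)
    show ?case
    proof (cases as)
      case Nil
      then show ?thesis using 1 by (intro exI[of _ "[]"]) auto
    next
      case (Cons a as')
      with 1 obtain ys u' v' zs where *: "v # xs = ys @ u' # v' # zs" "e = {u', v'}"
        "path_edges (ys @ [u']) = as'" "path_edges (v' # zs) = bs" by fastforce
      have "path_edges ((u # ys) @ [u']) = as"
        using * Cons 1(2) by (cases ys) auto
      with * show ?thesis by (intro exI[of _ "u # ys"]) auto
    qed
  qed auto
  then show ?thesis using that by blast
qed

text \<open>Every new vertex of a path is reached by a new edge.\<close>
lemma card_extend:
  assumes "xs \<noteq> []" "hd xs \<in> A" "finite A" "\<And>e. e \<in> F \<Longrightarrow> e \<subseteq> A"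
  shows "card (A \<union> set xs) \<le> card A + card (set (path_edges xs) - F)"
  using assms
proof (induction xs arbitrary: A F rule: path_edges.induct)
  case (1 u v xs)
  show ?case
  proof (cases "v \<in> A")
    case True
    have "card (A \<union> set (v # xs)) \<le> card A + card (set (path_edges (v # xs)) - F)"
      using 1 True by (intro "1.IH") auto
    also have "\<dots> \<le> card A + card (set (path_edges (u # v # xs)) - F)"
      by (intro add_left_mono card_mono) auto
    finally show ?thesis using 1(3) by (simp add: insert_absorb)
  next
    case False
    define F' where "F' = insert {u, v} F"
    have "card (insert v A \<union> set (v # xs)) \<le>
        card (insert v A) + card (set (path_edges (v # xs)) - F')"
      using 1 unfolding F'_def by (intro "1.IH") auto
    moreover have "insert {u, v} (set (path_edges (v # xs)) - F') \<subseteq> set (path_edges (u # v # xs)) - F"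
      using 1(5) False unfolding F'_def by auto
    then have "card (insert {u, v} (set (path_edges (v # xs)) - F')) \<le> card (set (path_edges (u # v # xs)) - F)"
      by (intro card_mono) auto
    moreover have "card (insert {u, v} (set (path_edges (v # xs)) - F')) = Suc (card (set (path_edges (v # xs)) - F'))"
      by (intro card_insert_disjoint) (auto simp: F'_def)
    moreover have "A \<union> set (u # v # xs) = insert v A \<union> set (v # xs)" using 1(3) by auto
    ultimately show ?thesis using 1 False by simp
  qed
qed (auto simp: insert_absorb)

lemma card_path_le: "xs \<noteq> [] \<Longrightarrow> card (set xs) \<le> 1 + card (set (path_edges xs))"
  using card_extend[of xs "{hd xs}" "{}"] by (simp add: insert_absorb)

text \<open>Supplies the hypothesis on the head of the walk in \<open>card_extend\<close> when a
  closed walk meets \<open>A\<close> elsewhere than at its base point. The repeated base vertex is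
  dropped before the two pieces are exchanged.\<close>

lemma closed_rotate:
  assumes "xs \<noteq> []" "hd xs = last xs" "u \<in> set xs"
  obtains ys where "ys \<noteq> []" "hd ys = u" "set ys = set xs" "set (path_edges ys) = set (path_edges xs)"
proof -
  obtain as bs where xs: "xs = as @ u # bs" using assms(3) by (meson split_list)
  define ys where "ys = butlast (u # bs) @ as @ [u]"
  have last: "last (u # bs) = hd (as @ [u])" using assms xs by (cases as) auto
  have A: "path_edges xs = path_edges (as @ [u]) @ path_edges (u # bs)"
    unfolding xs by (rule path_edges_append)
  obtain a as' where a: "as @ [u] = a # as'" by (cases "as @ [u]") auto
  have ub: "u # bs = butlast (u # bs) @ [a]" using last a by (metis append_butlast_last_id list.distinct(1) list.sel(1))
  have "path_edges ys = path_edges (butlast (u # bs) @ a # as')" unfolding ys_def a ..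
  also have "\<dots> = path_edges (u # bs) @ path_edges (as @ [u])"
    using ub a path_edges_append[of "butlast (u # bs)" a as'] by simp
  finally have B: "set (path_edges ys) = set (path_edges xs)" using A by auto
  have "set ys = set (butlast (u # bs)) \<union> set (as @ [u])" unfolding ys_def by simp
  also have "\<dots> = set xs"
  proof -
    have "set (u # bs) = insert a (set (butlast (u # bs)))" by (subst ub) simp
    moreover have "a \<in> set (as @ [u])" using a by simp
    ultimately show ?thesis unfolding xs by auto
  qed
  finally have C: "set ys = set xs" .
  have "hd ys = u" unfolding ys_def using last a by (cases bs) auto
  with B C show ?thesis using that[of ys] unfolding ys_def by simp
qed

text \<open>An edge passed exactly once lies on a cycle of the graph of the walk: restarting the
  walk just behind this edge and stopping just before it gives a path through the same vertices that
  misses the edge. This saves the 1 of \<open>card_path_le\<close>.\<close>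

lemma card_closed_once:
  assumes "xs \<noteq> []" "hd xs = last xs" "count_list (path_edges xs) e = 1"
  shows "card (set xs) \<le> card (set (path_edges xs))"
proof -
  have "e \<in> set (path_edges xs)" using assms(3) by (metis count_notin zero_neq_one)
  then obtain as bs where ab: "path_edges xs = as @ e # bs" by (meson split_list)
  then have nin: "e \<notin> set as" "e \<notin> set bs" using assms(3) by (auto simp: count_list_0_iff)
  from ab obtain ys u v zs where *: "xs = ys @ u # v # zs" "e = {u, v}"
    "path_edges (ys @ [u]) = as" "path_edges (v # zs) = bs" by (rule path_edges_split)
  obtain a as' where a: "ys @ [u] = a # as'" by (cases "ys @ [u]") auto
  have la: "last (v # zs) = a" using assms(2) * a by (cases ys) auto
  have vz: "v # zs = butlast (v # zs) @ [a]" using la by (metis append_butlast_last_id list.distinct(1))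
  define p where "p = butlast (v # zs) @ a # as'"
  have "path_edges p = bs @ as"
    using path_edges_append[of "butlast (v # zs)" a as'] vz a * unfolding p_def by metis
  then have E: "set (path_edges p) = set (path_edges xs) - {e}" using ab nin by auto
  have "set (v # zs) = insert a (set (butlast (v # zs)))"
    by (subst vz) simp
  then have V: "set p = set xs"
    proof -
    have "set p = set (v # zs) \<union> set (ys @ [u])"
      unfolding p_def a using \<open>set (v # zs) = insert a (set (butlast (v # zs)))\<close> by auto
    then show ?thesis unfolding * by auto
  qed
  have "card (set xs) \<le> 1 + card (set (path_edges xs) - {e})"
    using card_path_le[of p] V E by (simp add: p_def)
  also have "\<dots> = card (set (path_edges xs))"
    using \<open>e \<in> set (path_edges xs)\<close> using card_Suc_Diff1[of "set (path_edges xs)" e] by simp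
  finally show ?thesis .
qed

lemma card_join_closed:
  assumes "xs \<noteq> []" "ys \<noteq> []" "hd ys = last ys" "set xs \<inter> set ys \<noteq> {}"
  shows "card (set xs \<union> set ys) \<le> card (set xs) + card (set (path_edges ys) - set (path_edges xs))"
proof -
  obtain u where u: "u \<in> set xs" "u \<in> set ys" using assms by blast
  obtain zs where zs: "zs \<noteq> []" "hd zs = u" "set zs = set ys" "set (path_edges zs) = set (path_edges ys)"
    using closed_rotate[OF assms(2,3) u(2)] by metis
  show ?thesis proof -
    have "card (set xs \<union> set zs) \<le> card (set xs) + card (set (path_edges zs) - set (path_edges xs))"
      using zs u path_edges_subset by (intro card_extend) blast+
    then show ?thesis using zs by simp
  qed
qed

lemma card_two_closed:
  assumes "xs \<noteq> []" "ys \<noteq> []" "hd ys = last ys" "set xs \<inter> set ys \<noteq> {}"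
  shows "card (set xs \<union> set ys) \<le> 1 + card (set (path_edges xs) \<union> set (path_edges ys))"
proof -
  have "card (set xs \<union> set ys) \<le> 1 + card (set (path_edges xs)) + card (set (path_edges ys) - set (path_edges xs))"
    using card_join_closed[OF assms] card_path_le[OF assms(1)] by linarith
  also have "\<dots> = 1 + card (set (path_edges xs) \<union> set (path_edges ys))"
    by (subst Un_Diff_cancel[symmetric], subst card_Un_disjoint) auto
  finally show ?thesis .
qed

text \<open>The walk with the single edge is counted by \<open>card_closed_once\<close>, without the
  extra 1, and the other one is attached at a common vertex.\<close>

lemma card_two_closed_once:
  assumes "xs \<noteq> []" "ys \<noteq> []" "hd xs = last xs" "hd ys = last ys" "set xs \<inter> set ys \<noteq> {}"
    and "count_list (path_edges xs) e = 1 \<or> count_list (path_edges ys) e = 1"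
  shows "card (set xs \<union> set ys) \<le> card (set (path_edges xs) \<union> set (path_edges ys))"
proof -
  have *: "card (set xs \<union> set ys) \<le> card (set (path_edges xs) \<union> set (path_edges ys))"
    if "xs \<noteq> []" "ys \<noteq> []" "hd xs = last xs" "hd ys = last ys" "set xs \<inter> set ys \<noteq> {}"
       "count_list (path_edges xs) e = 1" for xs ys :: "'a list"
  proof -
    have "card (set xs \<union> set ys) \<le> card (set (path_edges xs)) + card (set (path_edges ys) - set (path_edges xs))"
      using card_join_closed[of xs ys] card_closed_once[of xs e] that by linarith
    also have "\<dots> = card (set (path_edges xs) \<union> set (path_edges ys))"
      by (subst Un_Diff_cancel[symmetric], subst card_Un_disjoint) auto
    finally show ?thesis .
  qed
  from assms(6) show ?thesis
  proof
    assume "count_list (path_edges xs) e = 1"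
    then show ?thesis using *[of xs ys] assms by blast
  next
    assume "count_list (path_edges ys) e = 1"
    then show ?thesis using *[of ys xs] assms by (simp add: Un_commute Int_commute)
  qed
qed

section \<open>Multiplicities and the number of distinct values of a list\<close>

lemma sum_count_list: "sum (count_list xs) (set xs) = length xs"
  by (simp add: sum_count_set)

lemma card_le_half_length:
  assumes "\<And>x. x \<in> set xs \<Longrightarrow> count_list xs x \<ge> 2"
  shows "2 * card (set xs) \<le> length xs"
proof -
  have "2 * card (set xs) = (\<Sum>x\<in>set xs. 2)" by simp
  also have "\<dots> \<le> sum (count_list xs) (set xs)" by (intro sum_mono assms)
  finally show ?thesis by (simp add: sum_count_list)
qed

text \<open>A value of multiplicity above 2 improves on \<open>card_le_half_length\<close>; this
  excess is what later makes a family of walks negligible.\<close>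

lemma card_le_length_special:
  assumes "a \<in> set xs" "\<And>x. x \<in> set xs \<Longrightarrow> x \<noteq> a \<Longrightarrow> count_list xs x \<ge> 2"
  shows "2 * (card (set xs) - 1) + count_list xs a \<le> length xs"
proof -
  have "2 * (card (set xs) - 1) = (\<Sum>x\<in>set xs - {a}. 2)" using assms(1) by simp
  also have "\<dots> \<le> sum (count_list xs) (set xs - {a})" by (intro sum_mono assms(2)) auto
  finally have "2 * (card (set xs) - 1) + count_list xs a \<le> sum (count_list xs) (set xs)"
    using assms(1) by (simp add: sum.remove[of "set xs" a])
  then show ?thesis by (simp add: sum_count_list)
qed

lemma card_le_length_special2:
  assumes "a \<in> set xs" "b \<in> set xs" "a \<noteq> b"
    "\<And>x. x \<in> set xs \<Longrightarrow> x \<noteq> a \<Longrightarrow> x \<noteq> b \<Longrightarrow> count_list xs x \<ge> 2"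
  shows "2 * (card (set xs) - 2) + count_list xs a + count_list xs b \<le> length xs"
proof -
  have "2 * (card (set xs) - 2) = (\<Sum>x\<in>set xs - {a} - {b}. 2)" using assms(1-3) by simp
  also have "\<dots> \<le> sum (count_list xs) (set xs - {a} - {b})" by (intro sum_mono assms(4)) auto
  finally have "2 * (card (set xs) - 2) + count_list xs a + count_list xs b \<le> sum (count_list xs) (set xs)"
    using assms(1-3) by (simp add: sum.remove[of "set xs" a] sum.remove[of "set xs - {a}" b])
  then show ?thesis by (simp add: sum_count_list)
qed

text \<open>A list with at most \<open>d\<close> distinct values is a word over \<open>d\<close>
  indices composed with a table of \<open>d\<close> values. The two factors count the words and the
  tables.\<close>

lemma card_few_values:
  assumes "finite V" "V \<noteq> {}"
  shows "card {xs. set xs \<subseteq> V \<and> length xs = L \<and> card (set xs) \<le> d} \<le> d ^ L * card V ^ d"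
proof -
  obtain v0 where v0: "v0 \<in> V" using assms by blast
  let ?A = "{ys. set ys \<subseteq> V \<and> length ys = d}"
  let ?B = "{js. set js \<subseteq> {..<d} \<and> length js = L}"
  have "{xs. set xs \<subseteq> V \<and> length xs = L \<and> card (set xs) \<le> d} \<subseteq> (\<lambda>(ys, js). map ((!) ys) js) ` (?A \<times> ?B)"
  proof
    fix xs assume "xs \<in> {xs. set xs \<subseteq> V \<and> length xs = L \<and> card (set xs) \<le> d}"
    then have xs: "set xs \<subseteq> V" "length xs = L" "card (set xs) \<le> d" by auto
    obtain zs where zs: "set zs = set xs" "distinct zs" using finite_distinct_list[OF finite_set[of xs]] by auto
    then have len: "length zs \<le> d" using xs(3) distinct_card[OF zs(2)] zs(1) by simp
    \<comment> \<open>Padding with \<open>v0\<close> gives all tables the same length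
      \<open>d\<close>.\<close>
    define ys where "ys = zs @ replicate (d - length zs) v0"
    have ys: "ys \<in> ?A" using zs xs len v0 unfolding ys_def by auto
    have "\<forall>x\<in>set xs. \<exists>j<d. ys ! j = x"
    proof
      fix x assume "x \<in> set xs"
      then obtain j where "j < length zs" "zs ! j = x" using zs(1) by (metis in_set_conv_nth)
      then show "\<exists>j<d. ys ! j = x" using len unfolding ys_def
        by (intro exI[of _ j]) (simp add: nth_append)
    qed
    then obtain j where j: "\<forall>x\<in>set xs. j x < d \<and> ys ! j x = x" by (rule bchoice[THEN exE])
    have eq: "xs = map ((!) ys) (map j xs)" using j by (intro nth_equalityI) auto
    have "map j xs \<in> ?B" using j xs(2) by auto
    with ys have mem: "(ys, map j xs) \<in> ?A \<times> ?B" by blast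
    have "xs = (\<lambda>(ys, js). map ((!) ys) js) (ys, map j xs)" unfolding prod.case by (rule eq)
    then show "xs \<in> (\<lambda>(ys, js). map ((!) ys) js) ` (?A \<times> ?B)" using mem by (rule image_eqI)
  qed
  then have "card {xs. set xs \<subseteq> V \<and> length xs = L \<and> card (set xs) \<le> d} \<le> card (?A \<times> ?B)"
    by (rule surj_card_le[rotated]) (intro finite_cartesian_product finite_lists_length_eq assms(1) finite_lessThan)
  also have "\<dots> = card V ^ d * d ^ L"
    by (simp add: card_cartesian_product card_lists_length_eq assms)
  finally show ?thesis by (simp add: mult.commute)
qed

section \<open>Alternating paths and closed walks\<close>

fun paths :: "'v set \<Rightarrow> 'v set \<Rightarrow> nat \<Rightarrow> 'v list set" where
  "paths S T 0 = (\<lambda>v. [v]) ` S"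
| "paths S T (Suc L) = (\<lambda>(v, xs). v # xs) ` (S \<times> paths T S L)"

lemma finite_paths [simp]: "finite S \<Longrightarrow> finite T \<Longrightarrow> finite (paths S T L)"
  by (induction L arbitrary: S T) auto

lemma length_paths: "xs \<in> paths S T L \<Longrightarrow> length xs = Suc L"
  by (induction L arbitrary: S T xs) auto

lemma set_paths: "xs \<in> paths S T L \<Longrightarrow> set xs \<subseteq> S \<union> T"
proof (induction L arbitrary: S T xs)
  case (Suc L)
  then show ?case by fastforce
qed auto

lemma hd_paths: "xs \<in> paths S T L \<Longrightarrow> hd xs \<in> S"
  by (cases L) auto


lemma card_paths: "finite S \<Longrightarrow> finite T \<Longrightarrow> card (paths S T (Suc (2 * n))) = (card S * card T) ^ Suc n"
proof (induction n)
  case 0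
  have "card (paths S T (Suc 0)) = card (S \<times> (\<lambda>v. [v]) ` T)"
    unfolding paths.simps by (subst card_image) (auto simp: inj_on_def)
  also have "\<dots> = card S * card T" by (simp add: card_cartesian_product card_image inj_on_def)
  finally show ?case by simp
next
  case (Suc n)
  have "paths S T (Suc (2 * Suc n)) = (\<lambda>(u, v, xs). u # v # xs) ` (S \<times> T \<times> paths S T (Suc (2 * n)))"
    by (auto simp: image_iff)
  also have "card \<dots> = card (S \<times> T \<times> paths S T (Suc (2 * n)))"
    by (subst card_image) (auto simp: inj_on_def)
  finally show ?case using Suc by (simp add: card_cartesian_product)
qed

lemma paths_iff:
  "xs \<in> paths S T L \<longleftrightarrow> length xs = Suc L \<and> (\<forall>s\<le>L. xs ! s \<in> (if even s then S else T))"
proof (induction L arbitrary: S T xs)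
  case 0
  then show ?case by (auto simp: length_Suc_conv image_iff)
next
  case (Suc L)
  show ?case
  proof (cases xs)
    case (Cons v ys)
    have "xs \<in> paths S T (Suc L) \<longleftrightarrow> v \<in> S \<and> ys \<in> paths T S L" using Cons by auto
    also have "\<dots> \<longleftrightarrow> v \<in> S \<and> length ys = Suc L \<and> (\<forall>s\<le>L. ys ! s \<in> (if even s then T else S))"
      using Suc by simp
    also have "\<dots> \<longleftrightarrow> length xs = Suc (Suc L) \<and> (\<forall>s\<le>Suc L. xs ! s \<in> (if even s then S else T))"
      (is "?l \<longleftrightarrow> ?r")
    proof
      assume l: ?l
      have "xs ! s \<in> (if even s then S else T)" if "s \<le> Suc L" for s
        using l that Cons by (cases s) (auto split: if_splits)
      then show ?r using l Cons by auto
    next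
      assume r: ?r
      have "ys ! s \<in> (if even s then T else S)" if "s \<le> L" for s
        using r[THEN conjunct2, rule_format, of "Suc s"] that Cons by auto
      moreover have "v \<in> S" using r[THEN conjunct2, rule_format, of 0] Cons by auto
      ultimately show ?l using r Cons by auto
    qed
    finally show ?thesis .
  qed auto
qed

lemma nth_paths: "xs \<in> paths S T L \<Longrightarrow> s \<le> L \<Longrightarrow> xs ! s \<in> (if even s then S else T)"
  by (simp add: paths_iff)

lemma paths_mono: "S \<subseteq> S' \<Longrightarrow> T \<subseteq> T' \<Longrightarrow> paths S T L \<subseteq> paths S' T' L"
  unfolding paths_iff subset_iff by (metis (full_types))

text \<open>The index set of the expansion of Tr H^n with H = A A^T. Base point and direction belong
  to the datum; the base point stands at both ends of the list, which has \<open>2 * n + 1\<close>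
  positions and \<open>2 * n\<close> edges.\<close>

definition cwalks :: "'v set \<Rightarrow> 'v set \<Rightarrow> nat \<Rightarrow> 'v list set" where
  "cwalks S T n = {xs \<in> paths S T (2 * n). hd xs = last xs}"

lemma cwalksD:
  assumes "xs \<in> cwalks S T n"
  shows "xs \<in> paths S T (2 * n)" "hd xs = last xs" "length xs = Suc (2 * n)" "xs \<noteq> []" "set xs \<subseteq> S \<union> T"
    "length (path_edges xs) = 2 * n"
proof -
  show "xs \<in> paths S T (2 * n)" "hd xs = last xs" using assms by (auto simp: cwalks_def)
  then show "length xs = Suc (2 * n)" "set xs \<subseteq> S \<union> T" using length_paths set_paths by blast+
  then show "xs \<noteq> []" "length (path_edges xs) = 2 * n" by auto
qed

lemma finite_cwalks [simp]: "finite S \<Longrightarrow> finite T \<Longrightarrow> finite (cwalks S T n)"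
  by (simp add: cwalks_def)

definition bip_edges :: "'v set \<Rightarrow> 'v set \<Rightarrow> 'v set set" where
  "bip_edges S T = (\<lambda>(u, v). {u, v}) ` (S \<times> T)"

lemma bip_edges_sym: "bip_edges S T = bip_edges T S"
  by (auto simp: bip_edges_def insert_commute image_iff)

lemma finite_bip_edges [simp]: "finite S \<Longrightarrow> finite T \<Longrightarrow> finite (bip_edges S T)"
  by (simp add: bip_edges_def)

lemma path_edges_bip: "xs \<in> paths S T L \<Longrightarrow> set (path_edges xs) \<subseteq> bip_edges S T"
proof (induction L arbitrary: S T xs)
  case (Suc L)
  then obtain v ys where v: "xs = v # ys" "v \<in> S" "ys \<in> paths T S L" by auto
  then obtain u zs where u: "ys = u # zs" "u \<in> T" by (cases L) auto
  show ?case using Suc.IH[OF v(3)] v u bip_edges_sym[of S T] by (auto simp: bip_edges_def)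
qed auto

subsection \<open>Products of independent entries\<close>

text \<open>The expectation of the product of independent entries along the list, where
  \<open>m p\<close> is their common moment of order \<open>p\<close> (see
  \<open>expectation_list_prod\<close>).\<close>

definition mom :: "(nat \<Rightarrow> real) \<Rightarrow> 'e list \<Rightarrow> real" where
  "mom m es = (\<Prod>e\<in>set es. m (count_list es e))"

definition list_prod :: "('e \<Rightarrow> real) \<Rightarrow> 'e list \<Rightarrow> real" where
  "list_prod x es = prod_list (map x es)"

lemma list_prod_append [simp]: "list_prod x (es @ fs) = list_prod x es * list_prod x fs"
  by (simp add: list_prod_def)

lemma list_prod_simps [simp]: "list_prod x [] = 1" "list_prod x (e # es) = x e * list_prod x es"
  by (simp_all add: list_prod_def)

lemma list_prod_count:
  assumes "finite F" "set es \<subseteq> F"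
  shows "list_prod x es = (\<Prod>e\<in>F. x e ^ count_list es e)"
  using assms(2)
proof (induction es)
  case (Cons a es)
  have "(\<Prod>e\<in>F. x e ^ count_list (a # es) e) = (\<Prod>e\<in>F. (if a = e then x e else 1) * x e ^ count_list es e)"
    by (intro prod.cong) auto
  also have "\<dots> = (\<Prod>e\<in>F. if a = e then x e else 1) * (\<Prod>e\<in>F. x e ^ count_list es e)"
    by (rule prod.distrib)
  also have "(\<Prod>e\<in>F. if a = e then x e else 1) = x a"
    using Cons.prems assms(1) by (simp add: prod.delta')
  finally show ?case using Cons by simp
qed simp

lemma count_list_append [simp]: "count_list (xs @ ys) x = count_list xs x + count_list ys x"
  by (induction xs) auto

lemma count_list_removeAll [simp]: "count_list (removeAll a xs) x = (if x = a then 0 else count_list xs x)"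
  by (induction xs) auto

text \<open>Much of the walk counting refers to the moment sequence alone. Keeping the probability
  space out of it allows two laws to be compared in one statement, as in
  \<open>bb_universal\<close>.\<close>

locale moments =
  fixes m :: "nat \<Rightarrow> real"
  assumes m0: "m 0 = 1" and m1: "m 1 = 0" and m2: "m 2 = 1"
begin

lemma m1' [simp]: "m (Suc 0) = 0" using m1 by simp

lemma mom_superset:
  assumes "finite F" "set es \<subseteq> F"
  shows "mom m es = (\<Prod>e\<in>F. m (count_list es e))"
  unfolding mom_def using assms
  by (intro prod.mono_neutral_left) (auto simp: m0 count_list_0_iff)

lemma mom_once: "count_list es e = 1 \<Longrightarrow> mom m es = 0"
  unfolding mom_def using m1 by (intro prod_zero) (auto intro!: bexI[of _ e] intro: ccontr simp: count_notin)

lemma mom_nonzero: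
  assumes "mom m es \<noteq> 0" "e \<in> set es"
  shows "count_list es e \<ge> 2"
proof -
  have "count_list es e \<noteq> 0" using assms(2) by (simp add: count_list_0_iff)
  moreover have "count_list es e \<noteq> 1" using mom_once assms(1) by metis
  ultimately show ?thesis by linarith
qed

lemma mom_twice: "(\<And>e. e \<in> set es \<Longrightarrow> count_list es e = 2) \<Longrightarrow> mom m es = 1"
  unfolding mom_def by (simp add: m2)

lemma mom_disjoint: "set es \<inter> set fs = {} \<Longrightarrow> mom m (es @ fs) = mom m es * mom m fs"
proof -
  assume d: "set es \<inter> set fs = {}"
  have "mom m (es @ fs) = (\<Prod>e\<in>set es. m (count_list (es @ fs) e)) * (\<Prod>e\<in>set fs. m (count_list (es @ fs) e))"
    unfolding mom_def set_append by (rule prod.union_disjoint) (use d in auto)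
  also have "(\<Prod>e\<in>set es. m (count_list (es @ fs) e)) = mom m es"
    unfolding mom_def using d by (intro prod.cong refl) (auto simp: disjoint_iff count_list_0_iff intro!: arg_cong[of _ _ m])
  also have "(\<Prod>e\<in>set fs. m (count_list (es @ fs) e)) = mom m fs"
    unfolding mom_def using d by (intro prod.cong refl) (auto simp: disjoint_iff count_list_0_iff intro!: arg_cong[of _ _ m])
  finally show ?thesis .
qed

lemma mom_cong: "(\<And>e. count_list es e = count_list fs e) \<Longrightarrow> mom m es = mom m fs"
proof -
  assume *: "\<And>e. count_list es e = count_list fs e"
  have "set es = set fs" using * by (metis count_list_0_iff subsetI subset_antisym)
  then show ?thesis unfolding mom_def using * by simp
qed

lemma mom_remove:
  assumes "e \<in> set es"
  shows "mom m es = m (count_list es e) * mom m (removeAll e es)"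
proof -
  have "mom m es = m (count_list es e) * (\<Prod>e\<in>set es - {e}. m (count_list es e))"
    unfolding mom_def using assms by (simp add: prod.remove)
  also have "(\<Prod>e\<in>set es - {e}. m (count_list es e)) = mom m (removeAll e es)"
    unfolding mom_def by (intro prod.cong) auto
  finally show ?thesis .
qed

lemma mom_remove_append:
  "mom m (es @ fs) = m (count_list es e + count_list fs e) * mom m (removeAll e es @ removeAll e fs)"
proof (cases "e \<in> set (es @ fs)")
  case True
  then show ?thesis using mom_remove[OF True] by simp
next
  case False
  then have "count_list es e = 0" "count_list fs e = 0" "removeAll e es = es" "removeAll e fs = fs"
    by (auto simp: count_list_0_iff)
  then show ?thesis by (simp add: m0)
qed

definition mom_bound :: "nat \<Rightarrow> real" where
  "mom_bound L = (1 + (\<Sum>p\<le>L. \<bar>m p\<bar>)) ^ L"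

lemma abs_mom_le:
  assumes "length es \<le> L"
  shows "\<bar>mom m es\<bar> \<le> mom_bound L"
proof -
  define B where "B = 1 + (\<Sum>p\<le>L. \<bar>m p\<bar>)"
  have B1: "B \<ge> 1" unfolding B_def by (simp add: sum_nonneg)
  have B: "\<bar>m p\<bar> \<le> B" if "p \<le> L" for p
    using member_le_sum[of p "{..L}" "\<lambda>p. \<bar>m p\<bar>"] that unfolding B_def by simp
  have "\<bar>mom m es\<bar> = (\<Prod>e\<in>set es. \<bar>m (count_list es e)\<bar>)" unfolding mom_def by (rule abs_prod)
  also have "\<dots> \<le> (\<Prod>e\<in>set es. B)"
  proof (intro prod_mono conjI B)
    fix e show "count_list es e \<le> L" using count_le_length[of es e] assms by linarith
  qed auto
  also have "\<dots> = B ^ card (set es)" by simp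
  also have "\<dots> \<le> B ^ L" using card_length[of es] assms B1 by (intro power_increasing) linarith+
  finally show ?thesis unfolding mom_bound_def B_def .
qed

lemma mom_bound_ge_1: "mom_bound L \<ge> 1"
  unfolding mom_bound_def by (intro one_le_power) (simp add: sum_nonneg)

text \<open>For the products F and G of the entries along the two lists, this is the sum over all
  edges of the expected conditional covariance of F and G given the other entries. An edge missing
  from one list contributes 0 because \<open>m 0 = 1\<close>, hence the intersection.\<close>

definition energy :: "'e list \<Rightarrow> 'e list \<Rightarrow> real" where
  "energy es fs = (\<Sum>e\<in>set es \<inter> set fs.
     (m (count_list es e + count_list fs e) - m (count_list es e) * m (count_list fs e))
     * mom m (removeAll e es @ removeAll e fs))"

end

section \<open>Moment functionals and arrays of independent entries\<close>

definition poly_mom :: "(nat \<Rightarrow> real) \<Rightarrow> real poly \<Rightarrow> real" where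
  "poly_mom m p = (\<Sum>i\<le>degree p. coeff p i * m i)"

lemma poly_mom_ge: "degree p \<le> n \<Longrightarrow> poly_mom m p = (\<Sum>i\<le>n. coeff p i * m i)"
  unfolding poly_mom_def by (rule sum.mono_neutral_left) (auto simp: coeff_eq_0)

lemma poly_mom_add [simp]: "poly_mom m (p + q) = poly_mom m p + poly_mom m q"
  by (simp add: poly_mom_ge[of _ "max (degree p) (degree q)"] degree_add_le sum.distrib algebra_simps)

lemma poly_mom_smult [simp]: "poly_mom m (Polynomial.smult c p) = c * poly_mom m p"
  by (simp add: poly_mom_ge[of _ "degree p" m] degree_smult_le sum_distrib_left algebra_simps)

lemma poly_mom_minus [simp]: "poly_mom m (- p) = - poly_mom m p"
  using poly_mom_smult[of m "-1" p] by simp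

lemma poly_mom_diff [simp]: "poly_mom m (p - q) = poly_mom m p - poly_mom m q"
  using poly_mom_add[of m p "-q"] by simp

lemma poly_mom_monom [simp]: "poly_mom m (monom c i) = c * m i"
proof -
  have "poly_mom m (monom c i) = (\<Sum>j\<le>i. coeff (monom c i) j * m j)"
    by (rule poly_mom_ge) (rule degree_monom_le)
  also have "\<dots> = (\<Sum>j\<le>i. if i = j then c * m j else 0)" by (intro sum.cong) auto
  finally show ?thesis by simp
qed

locale iid_array = prob_space M + moments m
  for M :: "'a measure" and Xe :: "'e \<Rightarrow> 'a \<Rightarrow> real" and I :: "'e set" and m :: "nat \<Rightarrow> real" +
  assumes indep: "indep_vars (\<lambda>_. borel) Xe I"
    and integrable_power: "\<And>e p. e \<in> I \<Longrightarrow> integrable M (\<lambda>\<omega>. Xe e \<omega> ^ p)"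
    and expectation_power: "\<And>e p. e \<in> I \<Longrightarrow> expectation (\<lambda>\<omega>. Xe e \<omega> ^ p) = m p"
begin

lemma integrable_poly: "e \<in> I \<Longrightarrow> integrable M (\<lambda>\<omega>. poly p (Xe e \<omega>))"
  unfolding poly_altdef by (intro Bochner_Integration.integrable_sum integrable_mult_right integrable_power)

lemma expectation_poly: "e \<in> I \<Longrightarrow> expectation (\<lambda>\<omega>. poly p (Xe e \<omega>)) = poly_mom m p"
  unfolding poly_altdef poly_mom_def
  by (subst Bochner_Integration.integral_sum) (auto intro!: sum.cong simp: integrable_power expectation_power)

text \<open>Stated for an arbitrary polynomial of each entry: monomials give the walks, centered
  monomials the ANOVA components, and \<open>x^2 - 1\<close> the cycles of length 2.\<close>

lemma
  assumes "finite F" "F \<subseteq> I"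
  shows integrable_prod_poly: "integrable M (\<lambda>\<omega>. \<Prod>e\<in>F. poly (g e) (Xe e \<omega>))"
    and expectation_prod_poly: "expectation (\<lambda>\<omega>. \<Prod>e\<in>F. poly (g e) (Xe e \<omega>)) = (\<Prod>e\<in>F. poly_mom m (g e))"
proof -
  have "indep_vars (\<lambda>_. borel) Xe F" using indep assms(2) by (rule indep_vars_subset)
  then have *: "indep_vars (\<lambda>_. borel) (\<lambda>e \<omega>. poly (g e) (Xe e \<omega>)) F"
    by (rule indep_vars_compose2) (auto intro!: borel_measurable_continuous_onI continuous_intros)
  show "integrable M (\<lambda>\<omega>. \<Prod>e\<in>F. poly (g e) (Xe e \<omega>))"
    by (rule indep_vars_integrable[OF assms(1) *]) (use assms integrable_poly in auto)
  show "expectation (\<lambda>\<omega>. \<Prod>e\<in>F. poly (g e) (Xe e \<omega>)) = (\<Prod>e\<in>F. poly_mom m (g e))"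
    by (subst indep_vars_lebesgue_integral[OF assms(1) *])
      (use assms in \<open>auto intro!: prod.cong expectation_poly integrable_poly\<close>)
qed

lemma
  assumes "set es \<subseteq> I"
  shows integrable_list_prod: "integrable M (\<lambda>\<omega>. list_prod (\<lambda>e. Xe e \<omega>) es)"
    and expectation_list_prod: "expectation (\<lambda>\<omega>. list_prod (\<lambda>e. Xe e \<omega>) es) = mom m es"
proof -
  have *: "list_prod (\<lambda>e. Xe e \<omega>) es = (\<Prod>e\<in>set es. poly (monom 1 (count_list es e)) (Xe e \<omega>))" for \<omega>
    by (simp add: list_prod_count[OF finite_set[of es] subset_refl] poly_monom)
  show "integrable M (\<lambda>\<omega>. list_prod (\<lambda>e. Xe e \<omega>) es)"
    unfolding * by (rule integrable_prod_poly) (use assms in auto)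
  show "expectation (\<lambda>\<omega>. list_prod (\<lambda>e. Xe e \<omega>) es) = mom m es"
    unfolding * by (subst expectation_prod_poly) (use assms in \<open>auto simp: mom_def\<close>)
qed

lemma
  assumes "finite W" "\<And>w. w \<in> W \<Longrightarrow> set (l w) \<subseteq> I"
  shows integrable_sum_list_prod: "integrable M (\<lambda>\<omega>. \<Sum>w\<in>W. c w * list_prod (\<lambda>e. Xe e \<omega>) (l w))"
    and expectation_sum_list_prod:
      "expectation (\<lambda>\<omega>. \<Sum>w\<in>W. c w * list_prod (\<lambda>e. Xe e \<omega>) (l w)) = (\<Sum>w\<in>W. c w * mom m (l w))"
  using assms by (auto intro!: Bochner_Integration.integrable_sum integrable_mult_right integrable_list_prod sum.cong
      simp: Bochner_Integration.integral_sum integrable_list_prod expectation_list_prod)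

lemma
  assumes "finite W" "\<And>w. w \<in> W \<Longrightarrow> set (l w) \<subseteq> I"
    and "finite W'" "\<And>w. w \<in> W' \<Longrightarrow> set (l' w) \<subseteq> I"
  shows integrable_sum_list_prod2: "integrable M (\<lambda>\<omega>. (\<Sum>w\<in>W. c w * list_prod (\<lambda>e. Xe e \<omega>) (l w)) *
          (\<Sum>w\<in>W'. c' w * list_prod (\<lambda>e. Xe e \<omega>) (l' w)))"
    and expectation_sum_list_prod2:
      "expectation (\<lambda>\<omega>. (\<Sum>w\<in>W. c w * list_prod (\<lambda>e. Xe e \<omega>) (l w)) *
          (\<Sum>w\<in>W'. c' w * list_prod (\<lambda>e. Xe e \<omega>) (l' w))) =
       (\<Sum>w\<in>W. \<Sum>w'\<in>W'. c w * c' w' * mom m (l w @ l' w'))"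
proof -
  have *: "(\<Sum>w\<in>W. c w * list_prod (\<lambda>e. Xe e \<omega>) (l w)) * (\<Sum>w\<in>W'. c' w * list_prod (\<lambda>e. Xe e \<omega>) (l' w)) =
     (\<Sum>(w, w')\<in>W \<times> W'. c w * c' w' * list_prod (\<lambda>e. Xe e \<omega>) (l w @ l' w'))" for \<omega>
    unfolding sum_product sum.cartesian_product by (intro sum.cong) (auto simp: algebra_simps)
  show "integrable M (\<lambda>\<omega>. (\<Sum>w\<in>W. c w * list_prod (\<lambda>e. Xe e \<omega>) (l w)) *
          (\<Sum>w\<in>W'. c' w * list_prod (\<lambda>e. Xe e \<omega>) (l' w)))"
    unfolding * case_prod_unfold by (intro integrable_sum_list_prod) (use assms in force)+
  show "expectation (\<lambda>\<omega>. (\<Sum>w\<in>W. c w * list_prod (\<lambda>e. Xe e \<omega>) (l w)) *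
          (\<Sum>w\<in>W'. c' w * list_prod (\<lambda>e. Xe e \<omega>) (l' w))) =
       (\<Sum>w\<in>W. \<Sum>w'\<in>W'. c w * c' w' * mom m (l w @ l' w'))"
    unfolding * case_prod_unfold
    by (subst expectation_sum_list_prod) (use assms in \<open>force simp: sum.cartesian_product case_prod_unfold\<close>)+
qed

text \<open>The energy form \<open>energy\<close> weights the component of the ANOVA decomposition indexed by
  a set \<open>S\<close> of variables with \<open>card S\<close>; the covariance weights it with \<open>1\<close> if \<open>S\<close> is nonempty.\<close>

lemma efron_stein:
  assumes W: "finite W" and l: "\<And>w. w \<in> W \<Longrightarrow> set (l w) \<subseteq> I"
  shows "(\<Sum>w\<in>W. \<Sum>w'\<in>W. c w * c w' * (mom m (l w @ l w') - mom m (l w) * mom m (l w')))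
     \<le> (\<Sum>w\<in>W. \<Sum>w'\<in>W. c w * c w' * energy (l w) (l w'))"
proof -
  define F where "F = (\<Union>w\<in>W. set (l w))"
  have F: "finite F" "F \<subseteq> I" using W l by (auto simp: F_def)
  define i where "i w e = count_list (l w) e" for w e
  define K where "K w w' e = m (i w e + i w' e)" for w w' e
  define L where "L w w' e = m (i w e) * m (i w' e)" for w w' e
  \<comment> \<open>The covariance of the components of two products at the set \<open>S\<close>:
    covariances for the variables in \<open>S\<close>, products of means for all others.\<close>
  define Q where "Q S w w' = (\<Prod>e\<in>S. K w w' e - L w w' e) * (\<Prod>e\<in>F - S. L w w' e)" for S w w'
  have sub: "set (l w) \<subseteq> F" if "w \<in> W" for w using that by (auto simp: F_def)
  \<comment> \<open>This is the second moment of the component at \<open>S\<close> of the whole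
    linear combination; the means of the variables outside \<open>S\<close> are constants and go
    into \<open>d\<close>.\<close>
  have Q: "0 \<le> (\<Sum>w\<in>W. \<Sum>w'\<in>W. c w * c w' * Q S w w')" if "S \<subseteq> F" for S
  proof -
    have fS: "finite S" "S \<subseteq> I" using that F by (auto intro: finite_subset)
    define d where "d w = c w * (\<Prod>e\<in>F - S. m (i w e))" for w
    define g where "g w e = monom 1 (i w e) - [:m (i w e):]" for w e
    define G where "G \<omega> = (\<Sum>w\<in>W. d w * (\<Prod>e\<in>S. poly (g w e) (Xe e \<omega>)))" for \<omega>
    have G2: "G \<omega> * G \<omega> = (\<Sum>w\<in>W. \<Sum>w'\<in>W. d w * d w' * (\<Prod>e\<in>S. poly (g w e * g w' e) (Xe e \<omega>)))" for \<omega>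
      unfolding G_def sum_product by (intro sum.cong refl) (simp add: prod.distrib algebra_simps)
    have "0 \<le> expectation (\<lambda>\<omega>. G \<omega> * G \<omega>)" by (intro integral_nonneg_AE) auto
    also have "\<dots> = (\<Sum>w\<in>W. \<Sum>w'\<in>W. d w * d w' * (\<Prod>e\<in>S. poly_mom m (g w e * g w' e)))"
      unfolding G2 using fS
      by (simp add: Bochner_Integration.integral_sum Bochner_Integration.integrable_sum integrable_prod_poly expectation_prod_poly
          del: poly_mult)
    also have "\<dots> = (\<Sum>w\<in>W. \<Sum>w'\<in>W. c w * c w' * Q S w w')"
    proof (intro sum.cong refl)
      fix w w'
      have "poly_mom m (g w e * g w' e) = K w w' e - L w w' e" for e
      proof -
        have "g w e * g w' e = monom 1 (i w e + i w' e) - Polynomial.smult (m (i w' e)) (monom 1 (i w e))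
            - Polynomial.smult (m (i w e)) (monom 1 (i w' e)) + [:m (i w e) * m (i w' e):]"
          unfolding g_def by (simp add: algebra_simps mult_monom)
        then show ?thesis unfolding K_def L_def
          by (simp add: monom_0[symmetric] m0)
      qed
      then have "d w * d w' * (\<Prod>e\<in>S. poly_mom m (g w e * g w' e)) =
          d w * d w' * (\<Prod>e\<in>S. K w w' e - L w w' e)" by simp
      also have "\<dots> = c w * c w' * Q S w w'"
        unfolding d_def Q_def by (simp add: L_def prod.distrib)
      finally show "d w * d w' * (\<Prod>e\<in>S. poly_mom m (g w e * g w' e)) = c w * c w' * Q S w w'" .
    qed
    finally show ?thesis .
  qed
  have cov: "mom m (l w @ l w') - mom m (l w) * mom m (l w') = (\<Sum>S\<in>Pow F - {{}}. Q S w w')"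
    if "w \<in> W" "w' \<in> W" for w w'
  proof -
    have "mom m (l w @ l w') = (\<Prod>e\<in>F. (K w w' e - L w w' e) + L w w' e)"
      by (subst mom_superset[OF F(1)]) (use sub that in \<open>auto simp: K_def i_def\<close>)
    also have "\<dots> = (\<Sum>S\<in>Pow F. Q S w w')" unfolding Q_def by (rule prod_add[OF F(1)])
    also have "\<dots> = Q {} w w' + (\<Sum>S\<in>Pow F - {{}}. Q S w w')"
      by (rule sum.remove) (use F in auto)
    also have "Q {} w w' = mom m (l w) * mom m (l w')"
      using mom_superset[OF F(1) sub] that by (simp add: Q_def L_def i_def prod.distrib)
    finally show ?thesis by simp
  qed
  have energy: "energy (l w) (l w') = (\<Sum>S\<in>Pow F. real (card S) * Q S w w')" if "w \<in> W" "w' \<in> W" for w w'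
  proof -
    have "energy (l w) (l w') = (\<Sum>e\<in>F. (K w w' e - L w w' e) * mom m (removeAll e (l w) @ removeAll e (l w')))"
      unfolding energy_def K_def L_def i_def using sub that F(1)
    proof (intro sum.mono_neutral_left ballI)
      fix e assume "e \<in> F - set (l w) \<inter> set (l w')"
      then have "count_list (l w) e = 0 \<or> count_list (l w') e = 0" by (auto simp: count_list_0_iff)
      then show "(m (count_list (l w) e + count_list (l w') e) - m (count_list (l w) e) * m (count_list (l w') e))
          * mom m (removeAll e (l w) @ removeAll e (l w')) = 0" by (auto simp: m0)
    qed auto
    \<comment> \<open>Each \<open>e\<close> collects the sets that contain it, so that after the
      exchange of sums every \<open>S\<close> is counted \<open>card S\<close> times.\<close>
    also have "\<dots> = (\<Sum>e\<in>F. \<Sum>S\<in>Pow F. if e \<in> S then Q S w w' else 0)"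
    proof (intro sum.cong refl)
      fix e assume e: "e \<in> F"
      have "mom m (removeAll e (l w) @ removeAll e (l w')) = (\<Prod>e'\<in>F - {e}. (K w w' e' - L w w' e') + L w w' e')"
        by (subst mom_superset[of "F - {e}"]) (use sub that F in \<open>auto simp: K_def i_def\<close>)
      also have "\<dots> = (\<Sum>S\<in>Pow (F - {e}). (\<Prod>e\<in>S. K w w' e - L w w' e) * (\<Prod>e\<in>F - {e} - S. L w w' e))"
        by (rule prod_add) (use F in auto)
      finally have "(K w w' e - L w w' e) * mom m (removeAll e (l w) @ removeAll e (l w')) =
         (\<Sum>S\<in>Pow (F - {e}). Q (insert e S) w w')"
        unfolding sum_distrib_left Q_def
      proof (elim ssubst, unfold sum_distrib_left, intro sum.cong refl)
        fix S assume S: "S \<in> Pow (F - {e})"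
        then have "finite S" "e \<notin> S" "F - insert e S = F - {e} - S" using F(1) by (auto intro: finite_subset)
        then show "(K w w' e - L w w' e) * ((\<Prod>e\<in>S. K w w' e - L w w' e) * (\<Prod>e\<in>F - {e} - S. L w w' e)) =
          (\<Prod>e\<in>insert e S. K w w' e - L w w' e) * (\<Prod>e\<in>F - insert e S. L w w' e)"
          by (simp add: mult.assoc)
      qed
      also have "\<dots> = (\<Sum>S\<in>{S\<in>Pow F. e \<in> S}. Q S w w')"
        by (rule sum.reindex_bij_witness[of _ "\<lambda>S. S - {e}" "insert e"]) (use e in auto)
      also have "\<dots> = (\<Sum>S\<in>Pow F. if e \<in> S then Q S w w' else 0)"
        by (subst sum.inter_filter) (use F in auto)
      finally show "(K w w' e - L w w' e) * mom m (removeAll e (l w) @ removeAll e (l w')) = \<dots>" .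
    qed
    also have "\<dots> = (\<Sum>S\<in>Pow F. \<Sum>e\<in>F. if e \<in> S then Q S w w' else 0)" by (rule sum.swap)
    also have "\<dots> = (\<Sum>S\<in>Pow F. real (card S) * Q S w w')"
    proof (intro sum.cong refl)
      fix S assume "S \<in> Pow F"
      then have "{e\<in>F. e \<in> S} = S" by auto
      then show "(\<Sum>e\<in>F. if e \<in> S then Q S w w' else 0) = real (card S) * Q S w w'"
        using sum.inter_filter[OF F(1), of "\<lambda>_. Q S w w'" "\<lambda>e. e \<in> S"] by simp
    qed
    finally show ?thesis .
  qed
  have "(\<Sum>w\<in>W. \<Sum>w'\<in>W. c w * c w' * (mom m (l w @ l w') - mom m (l w) * mom m (l w')))
      = (\<Sum>w\<in>W. \<Sum>w'\<in>W. \<Sum>S\<in>Pow F - {{}}. c w * c w' * Q S w w')"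
    by (intro sum.cong refl) (simp add: cov sum_distrib_left)
  also have "\<dots> = (\<Sum>w\<in>W. \<Sum>S\<in>Pow F - {{}}. \<Sum>w'\<in>W. c w * c w' * Q S w w')"
    by (intro sum.cong refl sum.swap)
  also have "\<dots> = (\<Sum>S\<in>Pow F - {{}}. \<Sum>w\<in>W. \<Sum>w'\<in>W. c w * c w' * Q S w w')"
    by (rule sum.swap)
  also have "\<dots> \<le> (\<Sum>S\<in>Pow F - {{}}. real (card S) * (\<Sum>w\<in>W. \<Sum>w'\<in>W. c w * c w' * Q S w w'))"
  proof (rule sum_mono)
    fix S assume S: "S \<in> Pow F - {{}}"
    then have "finite S" using F(1) by (auto intro: finite_subset)
    then have "card S \<ge> 1" using S by (simp add: Suc_le_eq card_gt_0_iff)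
    then have "1 \<le> real (card S)" by simp
    then show "(\<Sum>w\<in>W. \<Sum>w'\<in>W. c w * c w' * Q S w w') \<le> real (card S) * (\<Sum>w\<in>W. \<Sum>w'\<in>W. c w * c w' * Q S w w')"
      using Q[of S] S mult_right_mono[of 1 "real (card S)"] by auto
  qed
  also have "\<dots> = (\<Sum>S\<in>Pow F. real (card S) * (\<Sum>w\<in>W. \<Sum>w'\<in>W. c w * c w' * Q S w w'))"
    by (rule sum.mono_neutral_left) (use F in auto)
  also have "\<dots> = (\<Sum>S\<in>Pow F. \<Sum>w\<in>W. \<Sum>w'\<in>W. c w * c w' * (real (card S) * Q S w w'))"
    by (simp add: sum_distrib_left algebra_simps)
  also have "\<dots> = (\<Sum>w\<in>W. \<Sum>S\<in>Pow F. \<Sum>w'\<in>W. c w * c w' * (real (card S) * Q S w w'))"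
    by (rule sum.swap)
  also have "\<dots> = (\<Sum>w\<in>W. \<Sum>w'\<in>W. \<Sum>S\<in>Pow F. c w * c w' * (real (card S) * Q S w w'))"
    by (intro sum.cong refl sum.swap)
  also have "\<dots> = (\<Sum>w\<in>W. \<Sum>w'\<in>W. c w * c w' * energy (l w) (l w'))"
    by (intro sum.cong refl) (simp add: energy sum_distrib_left)
  finally show ?thesis .
qed

end

text \<open>Realizes a moment sequence by the coordinates of a product space. It is applied to
  random signs, which makes the identities for arrays available for a comparison law.\<close>

lemma iid_array_product:
  fixes N :: "real measure"
  assumes N: "prob_space N" "sets N = sets borel" and "moments m"
    and "\<And>p. integrable N (\<lambda>x. x ^ p)" "\<And>p. (\<integral>x. x ^ p \<partial>N) = m p"
  shows "iid_array (Pi\<^sub>M (UNIV :: 'e set) (\<lambda>_. N)) (\<lambda>e \<omega>. \<omega> e) UNIV m"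
proof -
  interpret moments m by fact
  interpret P: product_prob_space "\<lambda>_::'e. N" UNIV using N(1) by (simp add: product_prob_spaceI)
  have comp: "distr (Pi\<^sub>M UNIV (\<lambda>_. N)) borel (\<lambda>\<omega>. \<omega> e) = N" for e :: 'e
  proof -
    have "distr (Pi\<^sub>M UNIV (\<lambda>_. N)) borel (\<lambda>\<omega>. \<omega> e) = distr (Pi\<^sub>M UNIV (\<lambda>_. N)) N (\<lambda>\<omega>. \<omega> e)"
      by (rule distr_cong) (use N in auto)
    also have "\<dots> = N" by (rule P.PiM_component) simp
    finally show ?thesis .
  qed
  have rv [measurable]: "(\<lambda>\<omega>. \<omega> e) \<in> borel_measurable (Pi\<^sub>M UNIV (\<lambda>_. N))" for e :: 'e
  proof -
    have "(\<lambda>\<omega>. \<omega> e) \<in> measurable (Pi\<^sub>M UNIV (\<lambda>_. N)) N" by measurable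
    then show ?thesis using N(2) measurable_cong_sets by blast
  qed
  have mb: "(\<lambda>x::real. x ^ p) \<in> borel_measurable borel" for p by simp
  have i: "integrable (Pi\<^sub>M UNIV (\<lambda>_. N)) (\<lambda>\<omega>. \<omega> e ^ p)" for e :: 'e and p
    using assms(4)[of p] by (subst (asm) comp[of e, symmetric]) (simp add: integrable_distr_eq)
  have ex: "(\<integral>\<omega>. \<omega> e ^ p \<partial>Pi\<^sub>M UNIV (\<lambda>_. N)) = m p" for e :: 'e and p
    using assms(5)[of p] by (subst (asm) comp[of e, symmetric]) (simp add: integral_distr)
  have "P.indep_vars (\<lambda>_. borel) (\<lambda>e \<omega>. \<omega> e) (UNIV :: 'e set)"
  proof (subst P.indep_vars_iff_distr_eq_PiM)
    have s: "sets (Pi\<^sub>M UNIV (\<lambda>_::'e. borel :: real measure)) = sets (Pi\<^sub>M UNIV (\<lambda>_. N))"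
      by (intro sets_PiM_cong) (use N in auto)
    show "distr (Pi\<^sub>M (UNIV :: 'e set) (\<lambda>_. N)) (Pi\<^sub>M UNIV (\<lambda>_. borel)) (\<lambda>x. \<lambda>i\<in>UNIV. x i) =
      Pi\<^sub>M UNIV (\<lambda>i. distr (Pi\<^sub>M UNIV (\<lambda>_. N)) borel (\<lambda>\<omega>. \<omega> i))"
      using distr_id2[OF s] by (simp add: comp restrict_UNIV)
  qed (use rv in auto)
  then show ?thesis
    by unfold_locales (use i ex in auto)
qed

subsection \<open>Sums over walks\<close>

text \<open>The factors left over when the product rule differentiates at position
  \<open>p\<close>.\<close>

definition skip :: "nat \<Rightarrow> 'e list \<Rightarrow> 'e list" where
  "skip p es = take p es @ drop (Suc p) es"

lemma skip_simps [simp]: "skip 0 (e # es) = es" "skip (Suc p) (e # es) = e # skip p es"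
  by (simp_all add: skip_def)

lemma count_list_skip:
  assumes "p < length es"
  shows "count_list es x = count_list (skip p es) x + (if x = es ! p then 1 else 0)"
proof -
  have "es = take p es @ es ! p # drop (Suc p) es" by (rule id_take_nth_drop[OF assms])
  then have "count_list es x = count_list (take p es @ es ! p # drop (Suc p) es) x" by simp
  then show ?thesis by (auto simp: skip_def)
qed

lemma set_skip_subset: "set (skip p es) \<subseteq> set es"
  unfolding skip_def using set_take_subset set_drop_subset by fastforce

lemma count_list_card: "count_list es x = card {p. p < length es \<and> es ! p = x}"
  by (simp add: count_list_eq_length_filter length_filter_conv_card eq_commute)

context
  fixes S T :: "'v set" and x :: "'v set \<Rightarrow> real"
  assumes fin: "finite S" "finite T" and disj: "S \<inter> T = {}"
begin

text \<open>The block matrix with off-diagonal blocks A and A^T. The weight is a parameter because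
  the derivative of \<open>walk_sum\<close> inserts a second weight besides
  \<open>x\<close>.\<close>

definition adj :: "('v set \<Rightarrow> real) \<Rightarrow> 'v \<Rightarrow> 'v \<Rightarrow> real" where
  "adj y u v = (if u \<in> S \<and> v \<in> T \<or> u \<in> T \<and> v \<in> S then y {u, v} else 0)"

text \<open>The entries of the power \<open>L\<close> of \<open>adj x\<close>; for even
  \<open>L\<close> the block on \<open>S\<close> is H^(L/2).\<close>

primrec walk_sum :: "nat \<Rightarrow> 'v \<Rightarrow> 'v \<Rightarrow> real" where
  "walk_sum 0 u v = (if u = v then 1 else 0)"
| "walk_sum (Suc L) u v = (\<Sum>z\<in>S \<union> T. adj x u z * walk_sum L z v)"

lemma adj_sym: "adj y u v = adj y v u"
  by (auto simp: adj_def insert_commute)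

lemma walk_sum_add: "u \<in> S \<union> T \<Longrightarrow> walk_sum (a + b) u v = (\<Sum>z\<in>S \<union> T. walk_sum a u z * walk_sum b z v)"
proof (induction a arbitrary: u)
  case 0
  have "(\<Sum>z\<in>S \<union> T. walk_sum 0 u z * walk_sum b z v) = (\<Sum>z\<in>S \<union> T. if u = z then walk_sum b z v else 0)"
    by (intro sum.cong) auto
  then show ?case using 0 fin by simp
next
  case (Suc a)
  have "walk_sum (Suc a + b) u v = (\<Sum>z\<in>S \<union> T. \<Sum>z'\<in>S \<union> T. adj x u z * walk_sum a z z' * walk_sum b z' v)"
    using Suc.IH by (simp add: sum_distrib_left mult.assoc)
  also have "\<dots> = (\<Sum>z'\<in>S \<union> T. \<Sum>z\<in>S \<union> T. adj x u z * walk_sum a z z' * walk_sum b z' v)" by (rule sum.swap)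
  finally show ?case by (simp add: sum_distrib_right)
qed

lemma walk_sum_sym: "u \<in> S \<union> T \<Longrightarrow> v \<in> S \<union> T \<Longrightarrow> walk_sum L u v = walk_sum L v u"
proof (induction L arbitrary: u v)
  case (Suc L)
  have "walk_sum (Suc L) u v = (\<Sum>z\<in>S \<union> T. walk_sum L v z * adj x z u)"
    using Suc by (simp add: adj_sym mult.commute)
  also have "\<dots> = (\<Sum>z\<in>S \<union> T. walk_sum L v z * walk_sum 1 z u)"
  proof (intro sum.cong refl)
    fix z assume "z \<in> S \<union> T"
    have "walk_sum 1 z u = (\<Sum>z'\<in>S \<union> T. if z' = u then adj x z z' else 0)"
      by (simp add: if_distrib cong: if_cong)
    then show "walk_sum L v z * adj x z u = walk_sum L v z * walk_sum 1 z u" using Suc.prems(1) fin by simp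
  qed
  also have "\<dots> = walk_sum (L + 1) v u" using walk_sum_add[of v L 1 u] Suc.prems by simp
  finally show ?case by simp
qed auto

lemma walk_sum_parity: "u \<in> S \<union> T \<Longrightarrow> v \<in> S \<union> T \<Longrightarrow> walk_sum L u v \<noteq> 0 \<Longrightarrow> (u \<in> S \<longleftrightarrow> v \<in> S) = even L"
proof (induction L arbitrary: u)
  case (Suc L)
  have "(\<Sum>z\<in>S \<union> T. adj x u z * walk_sum L z v) \<noteq> 0" using Suc.prems(3) by simp
  then obtain z where z: "z \<in> S \<union> T" "adj x u z * walk_sum L z v \<noteq> 0"
    by (rule sum.not_neutral_contains_not_neutral)
  then have "(z \<in> S \<longleftrightarrow> v \<in> S) = even L" using Suc by simp
  moreover have "u \<in> S \<longleftrightarrow> z \<notin> S" using z disj Suc.prems by (auto simp: adj_def split: if_splits)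
  ultimately show ?case by auto
qed (auto split: if_splits)

lemma sum_paths_Suc:
  assumes A: "A \<inter> B = {}" "finite A" "finite B" and u: "u \<in> A"
  shows "(\<Sum>w\<in>{w \<in> paths A B (Suc L). hd w = u \<and> last w = v}. f w) =
     (\<Sum>z\<in>B. \<Sum>w\<in>{w \<in> paths B A L. hd w = z \<and> last w = v}. f (u # w))"
proof -
  have "(\<Sum>z\<in>B. \<Sum>w\<in>{w \<in> paths B A L. hd w = z \<and> last w = v}. f (u # w)) =
     (\<Sum>(z, w)\<in>(SIGMA z:B. {w \<in> paths B A L. hd w = z \<and> last w = v}). f (u # w))"
    using A by (intro sum.Sigma) auto
  also have "\<dots> = (\<Sum>w\<in>{w \<in> paths A B (Suc L). hd w = u \<and> last w = v}. f w)"
  proof (rule sum.reindex_bij_witness[of _ "\<lambda>w. (hd (tl w), tl w)" "\<lambda>(z, w). u # w"])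
    fix w assume "w \<in> {w \<in> paths A B (Suc L). hd w = u \<and> last w = v}"
    then obtain w' where w: "w = u # w'" "w' \<in> paths B A L" "last w = v" by auto
    then have "w' \<noteq> []" using length_paths by fastforce
    with w hd_paths[OF w(2)] show "(hd (tl w), tl w) \<in> (SIGMA z:B. {w \<in> paths B A L. hd w = z \<and> last w = v})"
      "(case (hd (tl w), tl w) of (z, w) \<Rightarrow> u # w) = w" by auto
  next
    fix a assume "a \<in> (SIGMA z:B. {w \<in> paths B A L. hd w = z \<and> last w = v})"
    then obtain z w where a: "a = (z, w)" "z \<in> B" "w \<in> paths B A L" "hd w = z" "last w = v" by auto
    moreover have "w \<noteq> []" using length_paths[OF a(3)] by auto
    ultimately show "(case a of (z, w) \<Rightarrow> u # w) \<in> {w \<in> paths A B (Suc L). hd w = u \<and> last w = v}"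
      "(hd (tl (case a of (z, w) \<Rightarrow> u # w)), tl (case a of (z, w) \<Rightarrow> u # w)) = a"
      using u by auto
  qed auto
  finally show ?thesis ..
qed

lemma path_edges_Cons: "w \<noteq> [] \<Longrightarrow> path_edges (u # w) = {u, hd w} # path_edges w"
  by (cases w) auto

lemma sum_paths_eq_mp:
  assumes "(A = S \<and> B = T) \<or> (A = T \<and> B = S)" "u \<in> A"
  shows "(\<Sum>w\<in>{w \<in> paths A B L. hd w = u \<and> last w = v}. list_prod x (path_edges w)) = walk_sum L u v"
  using assms
proof (induction L arbitrary: A B u)
  case 0
  then have "{w \<in> paths A B 0. hd w = u \<and> last w = v} = (if u = v then {[u]} else {})" by auto
  then show ?case by simp
next
  case (Suc L)
  have AB: "A \<inter> B = {}" "finite A" "finite B" "A \<union> B = S \<union> T" using Suc.prems fin disj by auto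
  have "(\<Sum>w\<in>{w \<in> paths A B (Suc L). hd w = u \<and> last w = v}. list_prod x (path_edges w)) =
    (\<Sum>z\<in>B. \<Sum>w\<in>{w \<in> paths B A L. hd w = z \<and> last w = v}. list_prod x (path_edges (u # w)))"
    using AB Suc.prems by (intro sum_paths_Suc) auto
  also have "\<dots> = (\<Sum>z\<in>B. \<Sum>w\<in>{w \<in> paths B A L. hd w = z \<and> last w = v}. x {u, z} * list_prod x (path_edges w))"
  proof (intro sum.cong refl)
    fix z w assume "w \<in> {w \<in> paths B A L. hd w = z \<and> last w = v}"
    then show "list_prod x (path_edges (u # w)) = x {u, z} * list_prod x (path_edges w)"
      using length_paths[of w B A L] by (subst path_edges_Cons) auto
  qed
  also have "\<dots> = (\<Sum>z\<in>B. x {u, z} * walk_sum L z v)"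
    unfolding sum_distrib_left[symmetric] using Suc.prems by (intro sum.cong refl arg_cong2[of _ _ _ _ "(*)"] Suc.IH) auto
  also have "\<dots> = (\<Sum>z\<in>B. adj x u z * walk_sum L z v)"
    using Suc.prems by (intro sum.cong refl) (auto simp: adj_def)
  also have "\<dots> = (\<Sum>z\<in>S \<union> T. adj x u z * walk_sum L z v)"
    using AB Suc.prems fin disj by (intro sum.mono_neutral_left) (auto simp: adj_def)
  finally show ?case by simp
qed

lemma sum_cwalks_group:
  "(\<Sum>w\<in>cwalks S T n. f w) = (\<Sum>u\<in>S. \<Sum>w\<in>{w \<in> paths S T (2 * n). hd w = u \<and> last w = u}. f w)"
proof -
  have "(\<Sum>w\<in>cwalks S T n. f w) = (\<Sum>u\<in>S. \<Sum>w\<in>{w \<in> cwalks S T n. hd w = u}. f w)"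
    by (rule sum.group[symmetric]) (use fin hd_paths[of _ S T "2 * n"] in \<open>force simp: cwalks_def\<close>)+
  also have "\<dots> = (\<Sum>u\<in>S. \<Sum>w\<in>{w \<in> paths S T (2 * n). hd w = u \<and> last w = u}. f w)"
    by (intro sum.cong refl) (auto simp: cwalks_def)
  finally show ?thesis .
qed

lemma sum_cwalks_eq_mp: "(\<Sum>w\<in>cwalks S T n. list_prod x (path_edges w)) = (\<Sum>u\<in>S. walk_sum (2 * n) u u)"
  unfolding sum_cwalks_group by (intro sum.cong refl sum_paths_eq_mp) auto

text \<open>The derivative of \<open>walk_sum\<close> in the direction \<open>y\<close>, by the
  product rule for the first step and the rest.\<close>

primrec walk_sum_deriv :: "('v set \<Rightarrow> real) \<Rightarrow> nat \<Rightarrow> 'v \<Rightarrow> 'v \<Rightarrow> real" where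
  "walk_sum_deriv y 0 u v = 0"
| "walk_sum_deriv y (Suc L) u v = (\<Sum>z\<in>S \<union> T. adj y u z * walk_sum L z v + adj x u z * walk_sum_deriv y L z v)"

lemma sum_paths_eq_deriv:
  assumes "(A = S \<and> B = T) \<or> (A = T \<and> B = S)" "u \<in> A"
  shows "(\<Sum>w\<in>{w \<in> paths A B L. hd w = u \<and> last w = v}.
       \<Sum>p<L. y (path_edges w ! p) * list_prod x (skip p (path_edges w))) = walk_sum_deriv y L u v"
  using assms
proof (induction L arbitrary: A B u)
  case (Suc L)
  have AB: "A \<inter> B = {}" "finite A" "finite B" "A \<union> B = S \<union> T" using Suc.prems fin disj by auto
  let ?f = "\<lambda>L w. \<Sum>p<L. y (path_edges w ! p) * list_prod x (skip p (path_edges w))"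
  have "(\<Sum>w\<in>{w \<in> paths A B (Suc L). hd w = u \<and> last w = v}. ?f (Suc L) w) =
    (\<Sum>z\<in>B. \<Sum>w\<in>{w \<in> paths B A L. hd w = z \<and> last w = v}. ?f (Suc L) (u # w))"
    using AB Suc.prems by (intro sum_paths_Suc) auto
  also have "\<dots> = (\<Sum>z\<in>B. \<Sum>w\<in>{w \<in> paths B A L. hd w = z \<and> last w = v}.
      y {u, z} * list_prod x (path_edges w) + x {u, z} * ?f L w)"
  proof (intro sum.cong refl)
    fix z w assume "w \<in> {w \<in> paths B A L. hd w = z \<and> last w = v}"
    then have "path_edges (u # w) = {u, z} # path_edges w"
      using length_paths[of w B A L] by (subst path_edges_Cons) auto
    then show "?f (Suc L) (u # w) = y {u, z} * list_prod x (path_edges w) + x {u, z} * ?f L w"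
      by (simp add: sum.lessThan_Suc_shift sum_distrib_left algebra_simps del: sum.lessThan_Suc)
  qed
  also have "\<dots> = (\<Sum>z\<in>B. y {u, z} * walk_sum L z v + x {u, z} * walk_sum_deriv y L z v)"
    unfolding sum.distrib sum_distrib_left[symmetric] using Suc.prems
    by (intro arg_cong2[of _ _ _ _ "(+)"] sum.cong refl arg_cong2[of _ _ _ _ "(*)"] Suc.IH sum_paths_eq_mp) auto
  also have "\<dots> = (\<Sum>z\<in>B. adj y u z * walk_sum L z v + adj x u z * walk_sum_deriv y L z v)"
    using Suc.prems by (intro sum.cong refl) (auto simp: adj_def)
  also have "\<dots> = (\<Sum>z\<in>S \<union> T. adj y u z * walk_sum L z v + adj x u z * walk_sum_deriv y L z v)"
    using AB Suc.prems fin disj by (intro sum.mono_neutral_left) (auto simp: adj_def)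
  finally show ?case by simp
qed simp

text \<open>The derivative of a matrix power: the direction is the symmetric matrix unit at
  \<open>{a, b}\<close>, inserted at step \<open>p\<close> in either orientation.\<close>

lemma walk_sum_deriv_eq:
  assumes "a \<in> S" "b \<in> T" "u \<in> S \<union> T"
  shows "walk_sum_deriv (\<lambda>e. if e = {a, b} then 1 else 0) L u v =
     (\<Sum>p<L. walk_sum p u a * walk_sum (L - 1 - p) b v + walk_sum p u b * walk_sum (L - 1 - p) a v)"
  using assms(3)
proof (induction L arbitrary: u)
  case (Suc L)
  let ?y = "\<lambda>e. if e = {a, b} then 1 else 0 :: real"
  have ab: "a \<noteq> b" using assms disj by auto
  have 1: "(\<Sum>z\<in>S \<union> T. adj ?y u z * walk_sum L z v) = walk_sum 0 u a * walk_sum L b v + walk_sum 0 u b * walk_sum L a v"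
  proof -
    have "(\<Sum>z\<in>S \<union> T. adj ?y u z * walk_sum L z v) =
      (\<Sum>z\<in>S \<union> T. (if z = b then walk_sum 0 u a * walk_sum L b v else 0) + (if z = a then walk_sum 0 u b * walk_sum L a v else 0))"
      using assms Suc.prems disj ab by (intro sum.cong refl) (auto simp: adj_def doubleton_eq_iff)
    then show ?thesis using assms fin by (simp add: sum.distrib)
  qed
  have 2: "(\<Sum>z\<in>S \<union> T. adj x u z * walk_sum_deriv ?y L z v) =
     (\<Sum>p<L. walk_sum (Suc p) u a * walk_sum (L - 1 - p) b v + walk_sum (Suc p) u b * walk_sum (L - 1 - p) a v)"
  proof -
    have "(\<Sum>z\<in>S \<union> T. adj x u z * walk_sum_deriv ?y L z v) = (\<Sum>z\<in>S \<union> T. \<Sum>p<L.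
        adj x u z * walk_sum p z a * walk_sum (L - 1 - p) b v + adj x u z * walk_sum p z b * walk_sum (L - 1 - p) a v)"
      using Suc.IH by (intro sum.cong refl) (simp add: sum_distrib_left algebra_simps)
    also have "\<dots> = (\<Sum>p<L. \<Sum>z\<in>S \<union> T.
        adj x u z * walk_sum p z a * walk_sum (L - 1 - p) b v + adj x u z * walk_sum p z b * walk_sum (L - 1 - p) a v)"
      by (rule sum.swap)
    finally show ?thesis by (simp add: sum.distrib sum_distrib_right)
  qed
  have "walk_sum_deriv ?y (Suc L) u v = walk_sum 0 u a * walk_sum L b v + walk_sum 0 u b * walk_sum L a v +
     (\<Sum>p<L. walk_sum (Suc p) u a * walk_sum (L - 1 - p) b v + walk_sum (Suc p) u b * walk_sum (L - 1 - p) a v)"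
    using 1 2 by (simp only: walk_sum_deriv.simps sum.distrib)
  also have "\<dots> = (\<Sum>p<Suc L. walk_sum p u a * walk_sum (Suc L - 1 - p) b v + walk_sum p u b * walk_sum (Suc L - 1 - p) a v)"
    unfolding sum.lessThan_Suc_shift by simp
  finally show ?case .
qed simp

text \<open>By cyclicity of the trace every insertion gives the same entry of the power. Only base
  points in \<open>S\<close> are summed, so that parity admits exactly one of the two orientations
  for each \<open>p\<close>; hence the factor \<open>2 * n\<close> and not
  \<open>4 * n\<close>.\<close>

lemma sum_walk_sum_deriv_eq:
  assumes ab: "a \<in> S" "b \<in> T" and n: "n \<ge> 1"
  shows "(\<Sum>u\<in>S. walk_sum_deriv (\<lambda>e. if e = {a, b} then 1 else 0) (2 * n) u u) = 2 * real n * walk_sum (2 * n - 1) a b"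
proof -
  have *: "(\<Sum>u\<in>S. walk_sum p u a * walk_sum (2 * n - 1 - p) b u + walk_sum p u b * walk_sum (2 * n - 1 - p) a u) = walk_sum (2 * n - 1) a b"
    if p: "p < 2 * n" for p
  proof -
    \<comment> \<open>The end \<open>c\<close> of the inserted edge is reached after
      \<open>p\<close> steps, and the walk goes on from the other end \<open>d\<close>.\<close>
    have ext: "(\<Sum>u\<in>S. walk_sum p u c * walk_sum (2 * n - 1 - p) d u) =
        (if even p \<longleftrightarrow> c \<in> S then walk_sum (2 * n - 1) a b else 0)"
      if cd: "c \<in> S \<and> d \<in> T \<and> c = a \<and> d = b \<or> c \<in> T \<and> d \<in> S \<and> c = b \<and> d = a" for c d
    proof (cases "even p \<longleftrightarrow> c \<in> S")
      case True
      have "(\<Sum>u\<in>S. walk_sum p u c * walk_sum (2 * n - 1 - p) d u) = (\<Sum>u\<in>S \<union> T. walk_sum p u c * walk_sum (2 * n - 1 - p) d u)"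
      proof (rule sum.mono_neutral_left)
        show "\<forall>u\<in>S \<union> T - S. walk_sum p u c * walk_sum (2 * n - 1 - p) d u = 0"
        proof
          fix u assume u: "u \<in> S \<union> T - S"
          then have "walk_sum p u c = 0" using walk_sum_parity[of u c p] True cd disj by fastforce
          then show "walk_sum p u c * walk_sum (2 * n - 1 - p) d u = 0" by simp
        qed
      qed (use fin in auto)
      also have "\<dots> = (\<Sum>u\<in>S \<union> T. walk_sum (2 * n - 1 - p) d u * walk_sum p u c)" by (simp add: mult.commute)
      also have "\<dots> = walk_sum (2 * n - 1 - p + p) d c" using walk_sum_add[of d "2 * n - 1 - p" p c] cd by auto
      also have "2 * n - 1 - p + p = 2 * n - 1" using p by simp
      also have "walk_sum (2 * n - 1) d c = walk_sum (2 * n - 1) a b" using walk_sum_sym[of d c] cd by auto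
      finally show ?thesis using True by simp
    next
      case False
      have "walk_sum p u c * walk_sum (2 * n - 1 - p) d u = 0" if "u \<in> S" for u
        using walk_sum_parity[of u c p] False cd disj that by fastforce
      then show ?thesis using False by (auto intro!: sum.neutral)
    qed
    have "b \<notin> S" using ab disj by auto
    then show ?thesis using ext[of a b] ext[of b a] ab by (simp add: sum.distrib)
  qed
  have "(\<Sum>u\<in>S. walk_sum_deriv (\<lambda>e. if e = {a, b} then 1 else 0) (2 * n) u u) =
     (\<Sum>u\<in>S. \<Sum>p<2 * n. walk_sum p u a * walk_sum (2 * n - 1 - p) b u + walk_sum p u b * walk_sum (2 * n - 1 - p) a u)"
    using ab by (intro sum.cong refl walk_sum_deriv_eq) auto
  also have "\<dots> = (\<Sum>p<2 * n. \<Sum>u\<in>S. walk_sum p u a * walk_sum (2 * n - 1 - p) b u + walk_sum p u b * walk_sum (2 * n - 1 - p) a u)"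
    by (rule sum.swap)
  also have "\<dots> = (\<Sum>p<2 * n. walk_sum (2 * n - 1) a b)" by (intro sum.cong refl *) auto
  finally show ?thesis by simp
qed

text \<open>The gradient of \<open>Tr H\<^sup>n\<close> with respect to the entries of the matrix has scalar products
  \<open>4 n n' Tr H\<^bsup>n + n' - 1\<^esup>\<close>.\<close>
lemma gradient_cwalks:
  assumes n: "n \<ge> 1" "n' \<ge> 1"
  shows "(\<Sum>e\<in>bip_edges S T.
     (\<Sum>w\<in>cwalks S T n. \<Sum>p<2 * n. (if path_edges w ! p = e then 1 else 0) * list_prod x (skip p (path_edges w))) *
     (\<Sum>w\<in>cwalks S T n'. \<Sum>p<2 * n'. (if path_edges w ! p = e then 1 else 0) * list_prod x (skip p (path_edges w))))
     = 4 * real n * real n' * (\<Sum>w\<in>cwalks S T (n + n' - 1). list_prod x (path_edges w))"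
proof -
  define D where "D n e = (\<Sum>w\<in>cwalks S T n. \<Sum>p<2 * n. (if path_edges w ! p = e then 1 else 0) * list_prod x (skip p (path_edges w)))" for n e
  have D: "D n {a, b} = 2 * real n * walk_sum (2 * n - 1) a b" if "a \<in> S" "b \<in> T" "n \<ge> 1" for a b n
  proof -
    have "D n {a, b} = (\<Sum>u\<in>S. walk_sum_deriv (\<lambda>e. if e = {a, b} then 1 else 0) (2 * n) u u)"
      unfolding D_def sum_cwalks_group by (intro sum.cong refl sum_paths_eq_deriv) auto
    then show ?thesis using sum_walk_sum_deriv_eq that by simp
  qed
  have inj: "inj_on (\<lambda>(u, v). {u, v}) (S \<times> T)"
    using disj by (auto simp: inj_on_def doubleton_eq_iff)
  have "(\<Sum>e\<in>bip_edges S T. D n e * D n' e) = (\<Sum>(a, b)\<in>S \<times> T. D n {a, b} * D n' {a, b})"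
    unfolding bip_edges_def by (subst sum.reindex[OF inj]) (auto intro!: sum.cong)
  also have "\<dots> = (\<Sum>(a, b)\<in>S \<times> T. 4 * real n * real n' * (walk_sum (2 * n - 1) a b * walk_sum (2 * n' - 1) a b))"
    using n D by (intro sum.cong refl) auto
  also have "\<dots> = 4 * real n * real n' * (\<Sum>a\<in>S. \<Sum>b\<in>T. walk_sum (2 * n - 1) a b * walk_sum (2 * n' - 1) a b)"
    by (simp add: sum.cartesian_product sum_distrib_left case_prod_unfold)
  also have "(\<Sum>a\<in>S. \<Sum>b\<in>T. walk_sum (2 * n - 1) a b * walk_sum (2 * n' - 1) a b) = (\<Sum>a\<in>S. walk_sum (2 * (n + n' - 1)) a a)"
  proof (intro sum.cong refl)
    fix a assume a: "a \<in> S"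
    have "(\<Sum>b\<in>T. walk_sum (2 * n - 1) a b * walk_sum (2 * n' - 1) a b) = (\<Sum>b\<in>T. walk_sum (2 * n - 1) a b * walk_sum (2 * n' - 1) b a)"
      using a walk_sum_sym by (intro sum.cong refl) auto
    also have "\<dots> = (\<Sum>b\<in>S \<union> T. walk_sum (2 * n - 1) a b * walk_sum (2 * n' - 1) b a)"
    proof (rule sum.mono_neutral_left)
      show "\<forall>b\<in>S \<union> T - T. walk_sum (2 * n - 1) a b * walk_sum (2 * n' - 1) b a = 0"
      proof
        fix b assume b: "b \<in> S \<union> T - T"
        have "odd (2 * n - 1)" using n by simp
        then have "walk_sum (2 * n - 1) a b = 0" using walk_sum_parity[of a b "2 * n - 1"] a b by auto
        then show "walk_sum (2 * n - 1) a b * walk_sum (2 * n' - 1) b a = 0" by simp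
      qed
    qed (use fin in auto)
    also have "\<dots> = walk_sum (2 * n - 1 + (2 * n' - 1)) a a" using a by (subst walk_sum_add) auto
    also have "2 * n - 1 + (2 * n' - 1) = 2 * (n + n' - 1)" using n by simp
    finally show "(\<Sum>b\<in>T. walk_sum (2 * n - 1) a b * walk_sum (2 * n' - 1) a b) = walk_sum (2 * (n + n' - 1)) a a" .
  qed
  also have "\<dots> = (\<Sum>w\<in>cwalks S T (n + n' - 1). list_prod x (path_edges w))" by (rule sum_cwalks_eq_mp[symmetric])
  finally show ?thesis unfolding D_def .
qed

end

subsection \<open>The recursion for the traces\<close>

lemma path_edges_nonempty: "e \<in> set (path_edges xs) \<Longrightarrow> e \<noteq> {}"
  by (induction xs rule: path_edges.induct) auto

text \<open>The common form of the error estimates: a nonzero term is determined by a list with at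
  most \<open>d\<close> distinct vertices, and such lists are only of the order
  \<open>card V ^ d\<close>.\<close>

lemma sum_few_values:
  fixes g :: "'i \<Rightarrow> real" and \<phi> :: "'i \<Rightarrow> 'v list"
  assumes Q: "finite Q" and V: "finite V" and L: "L > 0" and inj: "inj_on \<phi> Q" and B: "B \<ge> 0"
    and \<phi>: "\<And>x. x \<in> Q \<Longrightarrow> set (\<phi> x) \<subseteq> V \<and> length (\<phi> x) = L"
    and g: "\<And>x. x \<in> Q \<Longrightarrow> g x \<noteq> 0 \<Longrightarrow> card (set (\<phi> x)) \<le> d \<and> \<bar>g x\<bar> \<le> B"
  shows "\<bar>\<Sum>x\<in>Q. g x\<bar> \<le> B * real d ^ L * real (card V) ^ d"
proof -
  define P where "P = {x \<in> Q. g x \<noteq> 0}"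
  have "card P \<le> d ^ L * card V ^ d"
  proof (cases "V = {}")
    case True
    then have "P = {}" using \<phi> L unfolding P_def by fastforce
    then show ?thesis by simp
  next
    case False
    have "card P = card (\<phi> ` P)"
      by (rule card_image[symmetric]) (use inj in \<open>auto simp: P_def inj_on_def\<close>)
    also have "\<dots> \<le> card {xs. set xs \<subseteq> V \<and> length xs = L \<and> card (set xs) \<le> d}"
    proof (rule card_mono)
      have "{xs. set xs \<subseteq> V \<and> length xs = L \<and> card (set xs) \<le> d} \<subseteq> {xs. set xs \<subseteq> V \<and> length xs = L}" by auto
      then show "finite {xs. set xs \<subseteq> V \<and> length xs = L \<and> card (set xs) \<le> d}"
        using finite_lists_length_eq[OF V] finite_subset by blast
      show "\<phi> ` P \<subseteq> {xs. set xs \<subseteq> V \<and> length xs = L \<and> card (set xs) \<le> d}"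
        using \<phi> g unfolding P_def by auto
    qed
    also have "\<dots> \<le> d ^ L * card V ^ d" by (rule card_few_values[OF V False])
    finally show ?thesis .
  qed
  then have card: "real (card P) \<le> real d ^ L * real (card V) ^ d"
    by (metis of_nat_le_iff of_nat_mult of_nat_power)
  have "(\<Sum>x\<in>Q. g x) = (\<Sum>x\<in>P. g x)"
    unfolding P_def by (rule sum.mono_neutral_right) (use Q in auto)
  then have "\<bar>\<Sum>x\<in>Q. g x\<bar> \<le> (\<Sum>x\<in>P. \<bar>g x\<bar>)" by (simp add: sum_abs)
  also have "\<dots> \<le> (\<Sum>x\<in>P. B)" by (intro sum_mono) (use g in \<open>auto simp: P_def\<close>)
  also have "\<dots> = B * real (card P)" by simp
  also have "\<dots> \<le> B * (real d ^ L * real (card V) ^ d)" by (intro mult_left_mono card B)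
  finally show ?thesis by (simp add: mult.assoc)
qed

lemma path_edges_take: "path_edges (take (Suc q) xs) = take q (path_edges xs)"
proof (induction xs arbitrary: q rule: path_edges.induct)
  case (1 u v xs)
  then show ?case by (cases q) auto
qed auto

lemma path_edges_drop: "path_edges (drop q xs) = drop q (path_edges xs)"
proof (induction xs arbitrary: q rule: path_edges.induct)
  case (1 u v xs)
  then show ?case by (cases q) auto
next
  case ("2_2" v)
  then show ?case by (cases q) auto
qed auto

lemma path_edges_join:
  "as \<noteq> [] \<Longrightarrow> bs \<noteq> [] \<Longrightarrow> path_edges (as @ bs) = path_edges as @ {last as, hd bs} # path_edges bs"
proof (induction as)
  case (Cons a as)
  then show ?case by (cases as; cases bs) auto
qed simp

context moments
begin

text \<open>The first edge occurs once or twice in the whole list. Once makes the moment vanish;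
  twice means a unique partner, which is removed together with it at the price of
  \<open>m 2 = 1\<close>.\<close>

lemma mom_pairing:
  assumes "count_list es e \<le> 1"
  shows "mom m (e # es) = (\<Sum>q<length es. if es ! q = e then mom m (skip q es) else 0)"
proof (cases "count_list es e = 0")
  case True
  then have "mom m (e # es) = 0" by (intro mom_once[of _ e]) auto
  moreover have "es ! q \<noteq> e" if "q < length es" for q using True that nth_mem by (auto simp: count_list_0_iff)
  ultimately show ?thesis by (auto intro!: sum.neutral)
next
  case False
  then have c: "count_list es e = 1" using assms by linarith
  then have "card {q. q < length es \<and> es ! q = e} = 1" by (simp add: count_list_card)
  then obtain q where q: "{q. q < length es \<and> es ! q = e} = {q}" by (auto simp: card_1_singleton_iff)
  then have q': "q < length es" "es ! q = e" by auto
  have "(\<Sum>q<length es. if es ! q = e then mom m (skip q es) else 0) =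
     (\<Sum>q\<in>{q. q < length es \<and> es ! q = e}. mom m (skip q es))"
    by (subst sum.inter_filter[symmetric]) (auto intro!: sum.cong)
  also have "\<dots> = mom m (skip q es)" unfolding q by simp
  also have "\<dots> = mom m (removeAll e es)"
  proof (rule mom_cong)
    fix x show "count_list (skip q es) x = count_list (removeAll e es) x"
      using count_list_skip[OF q'(1), of x] q' c by (cases "x = e") auto
  qed
  also have "\<dots> = mom m (e # es)" using mom_remove[of e "e # es"] c m2 by (simp add: numeral_2_eq_2)
  finally show ?thesis ..
qed

text \<open>The expectation of Tr H^n, expressed through the moment sequence.\<close>

definition tr :: "'v set \<Rightarrow> 'v set \<Rightarrow> nat \<Rightarrow> real" where
  "tr S T n = (\<Sum>w\<in>cwalks S T n. mom m (path_edges w))"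

lemma tr_0: "finite S \<Longrightarrow> tr S T 0 = card S"
proof -
  have "cwalks S T 0 = (\<lambda>v. [v]) ` S" by (auto simp: cwalks_def)
  then show ?thesis by (simp add: tr_def sum.reindex inj_on_def mom_def)
qed

text \<open>Every edge is covered twice, so that at most \<open>n\<close> edges are present, and the
  second path starts on the first one: a connected graph with \<open>n\<close> edges.\<close>

lemma card_Un_half:
  assumes "as \<noteq> []" "bs \<noteq> []" "hd bs \<in> set as" "mom m (path_edges as @ path_edges bs) \<noteq> 0"
    "length as + length bs \<le> 2 * n + 2"
  shows "card (set as \<union> set bs) \<le> n + 1"
proof -
  let ?E = "path_edges as @ path_edges bs"
  have "2 * card (set ?E) \<le> length ?E" by (rule card_le_half_length) (rule mom_nonzero[OF assms(4)])
  moreover have "length ?E + 2 \<le> 2 * n + 2" using assms(1,2,5) by (cases as; cases bs) auto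
  ultimately have "card (set ?E) \<le> n" by linarith
  moreover have "card (set as \<union> set bs) \<le> card (set as) + card (set (path_edges bs) - set (path_edges as))"
    using assms(1-3) path_edges_subset by (intro card_extend) blast+
  moreover have "card (set as) \<le> 1 + card (set (path_edges as))" by (rule card_path_le[OF assms(1)])
  moreover have "card (set ?E) = card (set (path_edges as)) + card (set (path_edges bs) - set (path_edges as))"
    unfolding set_append by (subst Un_Diff_cancel[symmetric], subst card_Un_disjoint) auto
  ultimately show ?thesis by linarith
qed

context
  fixes S T :: "'v set" and n :: nat
  assumes fin: "finite S" "finite T" and disj: "S \<inter> T = {}"
begin

text \<open>The first step of the walk is matched with the step at position \<open>q\<close> of the
  tail; \<open>a\<close> is the part between the two steps and \<open>b\<close> the part behind the
  second one.\<close>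

lemma cwalk_parts:
  assumes "w \<in> cwalks S T (Suc n)" "q < 2 * n + 1"
  defines "a \<equiv> take (Suc q) (tl w)" and "b \<equiv> drop (Suc (Suc q)) w"
  shows "w = hd w # a @ b" "a \<noteq> []" "b \<noteq> []" "length a = Suc q" "length b = 2 * n + 1 - q"
    "path_edges w = {hd w, hd a} # path_edges a @ {last a, hd b} # path_edges b"
    "path_edges (tl w) ! q = {last a, hd b}"
    "skip q (path_edges (tl w)) = path_edges a @ path_edges b"
    "last b = hd w" "hd a \<in> T" "hd w \<in> S" "length (path_edges (tl w)) = 2 * n + 1"
    "path_edges w = {hd w, hd a} # path_edges (tl w)"
proof -
  note w = cwalksD[OF assms(1)]
  obtain v w' where vw: "w = v # w'" using w(4) by (cases w) auto
  have lw: "length w' = 2 * n + 2" using w(3) vw by simp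
  have ab: "a @ b = w'" unfolding a_def b_def vw by simp
  show 1: "w = hd w # a @ b" "a \<noteq> []" "b \<noteq> []" "length a = Suc q" "length b = 2 * n + 1 - q"
    using ab lw vw assms(2) unfolding a_def b_def by auto
  have "path_edges w = {v, hd w'} # path_edges w'" unfolding vw using ab 1 by (cases w') auto
  then show "path_edges w = {hd w, hd a} # path_edges a @ {last a, hd b} # path_edges b"
    "path_edges w = {hd w, hd a} # path_edges (tl w)"
    using path_edges_join[OF 1(2,3)] ab 1(2) vw by auto
  have "path_edges (tl w) = path_edges a @ {last a, hd b} # path_edges b" using path_edges_join[OF 1(2,3)] ab vw by simp
  then show "path_edges (tl w) ! q = {last a, hd b}" "skip q (path_edges (tl w)) = path_edges a @ path_edges b"
    using 1(4) by (auto simp: nth_append skip_def)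
  show "last b = hd w" using w(2) 1 by (metis last_append last_ConsR append_is_Nil_conv)
  have p: "w \<in> paths S T (Suc (2 * n + 1))" using w(1) by simp
  then have "v \<in> S" "w' \<in> paths T S (2 * n + 1)" using vw by auto
  then show "hd a \<in> T" "hd w \<in> S" using hd_paths[of w' T S] vw hd_append2[OF 1(2), of b] unfolding ab by auto
  show "length (path_edges (tl w)) = 2 * n + 1" using lw vw by simp
qed

text \<open>Where the pairing is not exact, the first edge has multiplicity at least 3 and all
  others at least 2. This leaves at most \<open>n\<close> edges and \<open>n + 1\<close> vertices,
  one vertex less than in the main term.\<close>

lemma walk_sum_pairing_error:
  "\<bar>tr S T (Suc n) - (\<Sum>w\<in>cwalks S T (Suc n). \<Sum>q<2 * n + 1.
      if path_edges (tl w) ! q = hd (path_edges w) then mom m (skip q (path_edges (tl w))) else 0)\<bar>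
    \<le> (2 * n + 2) * mom_bound (2 * n + 2) * real (n + 1) ^ (2 * n + 3) * real (card (S \<union> T)) ^ (n + 1)"
proof -
  let ?g = "\<lambda>w. mom m (path_edges w) - (\<Sum>q<2 * n + 1.
      if path_edges (tl w) ! q = hd (path_edges w) then mom m (skip q (path_edges (tl w))) else 0)"
  have "\<bar>\<Sum>w\<in>cwalks S T (Suc n). ?g w\<bar> \<le> ((2 * n + 2) * mom_bound (2 * n + 2)) * real (n + 1) ^ (2 * n + 3) * real (card (S \<union> T)) ^ (n + 1)"
  proof (rule sum_few_values[where \<phi> = id])
    fix w assume w: "w \<in> cwalks S T (Suc n)"
    show "set (id w) \<subseteq> S \<union> T \<and> length (id w) = 2 * n + 3" using cwalksD[OF w] by simp
    assume g: "?g w \<noteq> 0"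
    define e where "e = hd (path_edges w)"
    have pw: "path_edges w = e # path_edges (tl w)" "length (path_edges (tl w)) = 2 * n + 1"
      using cwalk_parts[OF w, of 0] by (auto simp: e_def)
    have c: "count_list (path_edges (tl w)) e \<ge> 2"
    proof (rule ccontr)
      assume "\<not> ?thesis"
      then have "mom m (path_edges w) = (\<Sum>q<2 * n + 1. if path_edges (tl w) ! q = e then mom m (skip q (path_edges (tl w))) else 0)"
        using mom_pairing[of "path_edges (tl w)" e] pw by simp
      then show False using g e_def by simp
    qed
    \<comment> \<open>Either the moment of the walk itself or one of the paired terms is nonzero,
      and both force multiplicity 2.\<close>
    have "count_list (path_edges w) x \<ge> 2" if x: "x \<in> set (path_edges w)" "x \<noteq> e" for x
    proof (cases "mom m (path_edges w) = 0")
      case False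
      then show ?thesis using mom_nonzero[OF _ x(1)] by simp
    next
      case True
      then have "(\<Sum>q<2 * n + 1. if path_edges (tl w) ! q = hd (path_edges w) then mom m (skip q (path_edges (tl w))) else 0) \<noteq> 0"
        using g by linarith
      then obtain q where "q \<in> {..<2 * n + 1}"
        "(if path_edges (tl w) ! q = hd (path_edges w) then mom m (skip q (path_edges (tl w))) else 0) \<noteq> 0"
        by (rule sum.not_neutral_contains_not_neutral)
      then have q: "q < 2 * n + 1" "path_edges (tl w) ! q = e" "mom m (skip q (path_edges (tl w))) \<noteq> 0"
        unfolding e_def by (simp_all split: if_splits)
      have "count_list (path_edges w) x = count_list (skip q (path_edges (tl w))) x"
        using count_list_skip[of q "path_edges (tl w)" x] q x pw by simp
      moreover from this have "x \<in> set (skip q (path_edges (tl w)))" using x(1) by (metis count_list_0_iff)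
      ultimately show ?thesis using mom_nonzero[OF q(3)] by simp
    qed
    then have "2 * (card (set (path_edges w)) - 1) + count_list (path_edges w) e \<le> length (path_edges w)"
      by (intro card_le_length_special) (use pw in auto)
    moreover have "count_list (path_edges w) e \<ge> 3" using c pw by simp
    ultimately have "card (set (path_edges w)) \<le> n" using pw by simp
    then have "card (set w) \<le> n + 1" using card_path_le[OF cwalksD(4)[OF w]] by linarith
    moreover have "\<bar>?g w\<bar> \<le> mom_bound (2 * n + 2) + (\<Sum>q<2 * n + 1. mom_bound (2 * n + 2))"
    proof (rule order_trans[OF abs_triangle_ineq4 add_mono])
      show "\<bar>mom m (path_edges w)\<bar> \<le> mom_bound (2 * n + 2)" using pw by (intro abs_mom_le) simp
      show "\<bar>\<Sum>q<2 * n + 1. if path_edges (tl w) ! q = hd (path_edges w) then mom m (skip q (path_edges (tl w))) else 0\<bar>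
         \<le> (\<Sum>q<2 * n + 1. mom_bound (2 * n + 2))"
      proof (rule order_trans[OF sum_abs sum_mono])
        fix q assume "q \<in> {..<2 * n + 1}"
        have "length (skip q (path_edges (tl w))) \<le> 2 * n + 2" unfolding skip_def using pw by simp
        then show "\<bar>if path_edges (tl w) ! q = hd (path_edges w) then mom m (skip q (path_edges (tl w))) else 0\<bar> \<le> mom_bound (2 * n + 2)"
          using abs_mom_le[of "skip q (path_edges (tl w))" "2 * n + 2"] mom_bound_ge_1[of "2 * n + 2"] by auto
      qed
    qed
    ultimately show "card (set (id w)) \<le> n + 1 \<and> \<bar>?g w\<bar> \<le> (2 * n + 2) * mom_bound (2 * n + 2)"
      by (simp add: algebra_simps)
  qed (use fin mom_bound_ge_1[of "2 * n + 2"] in auto)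
  then show ?thesis unfolding tr_def by (simp add: sum_subtractf)
qed

text \<open>At an odd position the first edge is passed again in the same direction. Then the heads
  of \<open>w\<close> and of \<open>b\<close> both lie on \<open>a\<close>, and the pair of steps
  gains no vertex.\<close>

lemma walk_sum_odd_error:
  assumes q: "q < 2 * n + 1" "odd q"
  shows "\<bar>\<Sum>w\<in>cwalks S T (Suc n). if path_edges (tl w) ! q = hd (path_edges w) then mom m (skip q (path_edges (tl w))) else 0\<bar>
    \<le> mom_bound (2 * n + 2) * real (n + 1) ^ (2 * n + 3) * real (card (S \<union> T)) ^ (n + 1)"
proof (rule sum_few_values[where \<phi> = id])
  fix w assume w: "w \<in> cwalks S T (Suc n)"
  show "set (id w) \<subseteq> S \<union> T \<and> length (id w) = 2 * n + 3" using cwalksD[OF w] by simp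
  assume g: "(if path_edges (tl w) ! q = hd (path_edges w) then mom m (skip q (path_edges (tl w))) else 0) \<noteq> 0"
  define a where "a = take (Suc q) (tl w)"
  define b where "b = drop (Suc (Suc q)) w"
  note P = cwalk_parts[OF w q(1), folded a_def b_def]
  have e: "{last a, hd b} = {hd w, hd a}" using g P by (auto split: if_splits)
  have mm: "mom m (path_edges a @ path_edges b) \<noteq> 0" using g P by (auto split: if_splits)
  have lastS: "last a \<in> S"
  proof -
    have "w ! (Suc q) = a ! q" using P(4) by (subst P(1)) (simp add: nth_append)
    then have "w ! (Suc q) = last a" using P(2,4) by (simp add: last_conv_nth)
    moreover have "w ! Suc q \<in> S" using nth_paths[OF cwalksD(1)[OF w], of "Suc q"] q by simp
    ultimately show ?thesis by simp
  qed
  then have "last a \<noteq> hd a" using P(10) disj by auto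
  then have "last a = hd w" "hd b = hd a" using e by (auto simp: doubleton_eq_iff)
  then have "hd b \<in> set a" "hd w \<in> set a" using P(2) hd_in_set last_in_set by metis+
  then have sw: "set w = set a \<union> set b" by (subst P(1)) auto
  have "card (set a \<union> set b) \<le> n + 1"
    using P \<open>hd b \<in> set a\<close> mm q by (intro card_Un_half) auto
  moreover have "\<bar>mom m (skip q (path_edges (tl w)))\<bar> \<le> mom_bound (2 * n + 2)"
    using P by (intro abs_mom_le) (simp add: skip_def)
  ultimately show "card (set (id w)) \<le> n + 1 \<and>
     \<bar>if path_edges (tl w) ! q = hd (path_edges w) then mom m (skip q (path_edges (tl w))) else 0\<bar> \<le> mom_bound (2 * n + 2)"
    using sw mom_bound_ge_1[of "2 * n + 2"] by auto
qed (use fin mom_bound_ge_1[of "2 * n + 2"] in auto)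

text \<open>At an even position the first edge is passed back, and the walk falls apart into a
  closed walk based in \<open>T\<close> and one based in \<open>S\<close>. The two base points are
  the ends of the removed edge, which allows the walk to be put together again.\<close>

lemma walk_sum_even_eq:
  assumes s: "s \<le> n"
  shows "(\<Sum>w\<in>cwalks S T (Suc n). if path_edges (tl w) ! (2 * s) = hd (path_edges w) then mom m (skip (2 * s) (path_edges (tl w))) else 0)
    = (\<Sum>(a, b)\<in>cwalks T S s \<times> cwalks S T (n - s). mom m (path_edges a @ path_edges b))"
proof -
  let ?W = "{w \<in> cwalks S T (Suc n). path_edges (tl w) ! (2 * s) = hd (path_edges w)}"
  have "(\<Sum>w\<in>cwalks S T (Suc n). if path_edges (tl w) ! (2 * s) = hd (path_edges w) then mom m (skip (2 * s) (path_edges (tl w))) else 0)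
    = (\<Sum>w\<in>?W. mom m (skip (2 * s) (path_edges (tl w))))"
    by (rule sum.inter_filter[symmetric]) (use fin in auto)
  also have "\<dots> = (\<Sum>(a, b)\<in>cwalks T S s \<times> cwalks S T (n - s). mom m (path_edges a @ path_edges b))"
  proof (rule sum.reindex_bij_witness[of _ "\<lambda>(a, b). hd b # a @ b" "\<lambda>w. (take (Suc (2 * s)) (tl w), drop (Suc (Suc (2 * s))) w)"])
    fix w assume w: "w \<in> ?W"
    define a where "a = take (Suc (2 * s)) (tl w)"
    define b where "b = drop (Suc (Suc (2 * s))) w"
    have w': "w \<in> cwalks S T (Suc n)" and q: "2 * s < 2 * n + 1" using w s by auto
    note P = cwalk_parts[OF w' q, folded a_def b_def]
    have e: "{last a, hd b} = {hd w, hd a}" using w P by auto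
    have nthw: "w ! (Suc i) = a ! i" if "i < Suc (2 * s)" for i using P(4) that by (subst P(1)) (simp add: nth_append)
    have nthw2: "w ! (i + Suc (Suc (2 * s))) = b ! i" for i using P(4) by (subst P(1)) (simp add: nth_append)
    have "last a = w ! Suc (2 * s)" using nthw[of "2 * s"] P(2,4) by (simp add: last_conv_nth)
    then have "last a \<in> T" using nth_paths[OF cwalksD(1)[OF w'], of "Suc (2 * s)"] s by simp
    then have "last a \<noteq> hd w" using P(11) disj by auto
    then have la: "last a = hd a" "hd b = hd w" using e by (auto simp: doubleton_eq_iff)
    have "a \<in> paths T S (2 * s)"
    proof -
      have "a ! i \<in> (if even i then T else S)" if "i \<le> 2 * s" for i
        using nth_paths[OF cwalksD(1)[OF w'], of "Suc i"] nthw[of i] that s by (auto split: if_splits)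
      then show ?thesis unfolding paths_iff using P(4) by simp
    qed
    moreover have "b \<in> paths S T (2 * (n - s))"
    proof -
      have "b ! i \<in> (if even i then S else T)" if "i \<le> 2 * (n - s)" for i
        using nth_paths[OF cwalksD(1)[OF w'], of "i + Suc (Suc (2 * s))"] nthw2[of i] that s by simp
      then show ?thesis unfolding paths_iff using P(5) s by simp
    qed
    ultimately show "(take (Suc (2 * s)) (tl w), drop (Suc (Suc (2 * s))) w) \<in> cwalks T S s \<times> cwalks S T (n - s)"
      using la P(9) unfolding a_def[symmetric] b_def[symmetric] cwalks_def by simp
    show "(case (take (Suc (2 * s)) (tl w), drop (Suc (Suc (2 * s))) w) of (a, b) \<Rightarrow> hd b # a @ b) = w"
      unfolding a_def[symmetric] b_def[symmetric] using la P(1) by simp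
    show "(case (take (Suc (2 * s)) (tl w), drop (Suc (Suc (2 * s))) w) of (a, b) \<Rightarrow> mom m (path_edges a @ path_edges b))
       = mom m (skip (2 * s) (path_edges (tl w)))"
      unfolding a_def[symmetric] b_def[symmetric] using P(8) by simp
  next
    fix x assume "x \<in> cwalks T S s \<times> cwalks S T (n - s)"
    then obtain a b where x: "x = (a, b)" and a: "a \<in> cwalks T S s" and b: "b \<in> cwalks S T (n - s)" by auto
    note A = cwalksD[OF a] and B = cwalksD[OF b]
    let ?w = "hd b # a @ b"
    have "?w ! i \<in> (if even i then S else T)" if i: "i \<le> 2 * Suc n" for i
    proof (cases i)
      case 0
      then show ?thesis using hd_paths[OF B(1)] by simp
    next
      case (Suc j)
      show ?thesis
      proof (cases "j < length a")
        case True
        then have "a ! j \<in> (if even j then T else S)" using nth_paths[OF A(1), of j] A(3) by simp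
        then show ?thesis using Suc True by (auto simp: nth_append split: if_splits)
      next
        case False
        then have "b ! (j - length a) \<in> (if even (j - length a) then S else T)"
          using i Suc A(3) s by (intro nth_paths[OF B(1)]) simp
        moreover have "even (j - length a) \<longleftrightarrow> odd j" using False A(3) by simp
        ultimately show ?thesis using Suc False by (auto simp: nth_append split: if_splits)
      qed
    qed
    then have pw: "?w \<in> paths S T (2 * Suc n)" unfolding paths_iff using A(3) B(3) s by simp
    then have "?w \<in> cwalks S T (Suc n)" using B(2,4) unfolding cwalks_def by auto
    moreover have "path_edges (a @ b) = path_edges a @ {last a, hd b} # path_edges b"
      using A(4) B(4) by (rule path_edges_join)
    then have "path_edges (tl ?w) ! (2 * s) = {last a, hd b}" using A(6) by (simp add: nth_append)
    moreover have "hd (path_edges ?w) = {hd b, hd a}" using A(4) by (cases a) auto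
    ultimately show "(case x of (a, b) \<Rightarrow> hd b # a @ b) \<in> ?W" using x A(2) by (auto simp: insert_commute)
    show "(take (Suc (2 * s)) (tl (case x of (a, b) \<Rightarrow> hd b # a @ b)), drop (Suc (Suc (2 * s))) (case x of (a, b) \<Rightarrow> hd b # a @ b)) = x"
      using x A(3) by simp
  qed
  finally show ?thesis .
qed

text \<open>Without a common edge the moment factorizes exactly. In a nonzero term with a common
  edge the two walks form a connected graph, and double covering leaves at most \<open>n\<close>
  edges, hence \<open>n + 1\<close> vertices.\<close>

lemma walk_sum_factor_error:
  assumes s: "s \<le> n"
  shows "\<bar>(\<Sum>(a, b)\<in>cwalks T S s \<times> cwalks S T (n - s). mom m (path_edges a @ path_edges b)) - tr T S s * tr S T (n - s)\<bar>
    \<le> (2 * mom_bound (2 * n + 2) ^ 2) * real (n + 1) ^ (2 * n + 2) * real (card (S \<union> T)) ^ (n + 1)"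
proof -
  let ?g = "\<lambda>(a, b). mom m (path_edges a @ path_edges b) - mom m (path_edges a) * mom m (path_edges b)"
  have B1: "mom_bound (2 * n + 2) \<ge> 1" by (rule mom_bound_ge_1)
  have "\<bar>\<Sum>x\<in>cwalks T S s \<times> cwalks S T (n - s). ?g x\<bar> \<le> (2 * mom_bound (2 * n + 2) ^ 2) * real (n + 1) ^ (2 * n + 2) * real (card (S \<union> T)) ^ (n + 1)"
  proof (rule sum_few_values[where \<phi> = "\<lambda>(a, b). a @ b"])
    show "inj_on (\<lambda>(a, b). a @ b) (cwalks T S s \<times> cwalks S T (n - s))"
      by (auto simp: inj_on_def dest!: cwalksD(3))
    fix x assume "x \<in> cwalks T S s \<times> cwalks S T (n - s)"
    then obtain a b where x: "x = (a, b)" and a: "a \<in> cwalks T S s" and b: "b \<in> cwalks S T (n - s)" by auto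
    note A = cwalksD[OF a] and B = cwalksD[OF b]
    show "set ((\<lambda>(a, b). a @ b) x) \<subseteq> S \<union> T \<and> length ((\<lambda>(a, b). a @ b) x) = 2 * n + 2"
      using x A(3,5) B(3,5) s by auto
    assume g: "?g x \<noteq> 0"
    have "set (path_edges a) \<inter> set (path_edges b) \<noteq> {}" using g x mom_disjoint by auto
    then obtain e where e: "e \<in> set (path_edges a)" "e \<in> set (path_edges b)" by auto
    then have i: "set a \<inter> set b \<noteq> {}" using path_edges_subset[OF e(1)] path_edges_subset[OF e(2)] path_edges_nonempty[OF e(1)] by blast
    have "count_list (path_edges a @ path_edges b) y \<ge> 2" if y: "y \<in> set (path_edges a @ path_edges b)" for y
    proof (cases "mom m (path_edges a @ path_edges b) = 0")
      case False
      then show ?thesis using mom_nonzero[OF _ y] by simp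
    next
      case True
      then have "mom m (path_edges a) \<noteq> 0" "mom m (path_edges b) \<noteq> 0" using g x by auto
      from mom_nonzero[OF this(1), of y] mom_nonzero[OF this(2), of y] show ?thesis using y by auto
    qed
    then have "2 * card (set (path_edges a @ path_edges b)) \<le> length (path_edges a @ path_edges b)"
      by (rule card_le_half_length)
    then have "card (set (path_edges a) \<union> set (path_edges b)) \<le> n" using A(6) B(6) s by simp
    then have "card (set a \<union> set b) \<le> n + 1" using card_two_closed[OF A(4) B(4) B(2) i] by linarith
    moreover have "\<bar>mom m (path_edges a @ path_edges b)\<bar> \<le> mom_bound (2 * n + 2)"
      "\<bar>mom m (path_edges a)\<bar> \<le> mom_bound (2 * n + 2)" "\<bar>mom m (path_edges b)\<bar> \<le> mom_bound (2 * n + 2)"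
      using A(6) B(6) s by (intro abs_mom_le; simp)+
    then have "\<bar>?g x\<bar> \<le> mom_bound (2 * n + 2) + mom_bound (2 * n + 2) * mom_bound (2 * n + 2)"
      unfolding x prod.case using B1 by (intro order_trans[OF abs_triangle_ineq4 add_mono]) (auto simp: abs_mult intro!: mult_mono)
    moreover have "mom_bound (2 * n + 2) \<le> mom_bound (2 * n + 2) * mom_bound (2 * n + 2)" using B1 by simp
    ultimately show "card (set ((\<lambda>(a, b). a @ b) x)) \<le> n + 1 \<and> \<bar>?g x\<bar> \<le> 2 * mom_bound (2 * n + 2) ^ 2"
      using x by (simp add: power2_eq_square)
  qed (use fin B1 in auto)
  moreover have "tr T S s * tr S T (n - s) = (\<Sum>(a, b)\<in>cwalks T S s \<times> cwalks S T (n - s). mom m (path_edges a) * mom m (path_edges b))"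
    unfolding tr_def sum_product sum.cartesian_product ..
  ultimately show ?thesis by (simp add: sum_subtractf case_prod_unfold)
qed

end

text \<open>The Catalan recursion for expected traces. The sides alternate because the part between
  the matched steps is based on the other side. Main terms have the order \<open>n + 2\<close> in
  the number of vertices.\<close>

lemma walk_sum_recursion:
  "\<exists>C. \<forall>S T :: 'v set. finite S \<longrightarrow> finite T \<longrightarrow> S \<inter> T = {} \<longrightarrow>
     \<bar>tr S T (Suc n) - (\<Sum>s\<le>n. tr T S s * tr S T (n - s))\<bar> \<le> C * real (card (S \<union> T)) ^ (n + 1)"
proof -
  define C1 where "C1 = real (2 * n + 2) * mom_bound (2 * n + 2) * real (n + 1) ^ (2 * n + 3)"
  define C2 where "C2 = mom_bound (2 * n + 2) * real (n + 1) ^ (2 * n + 3)"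
  define C3 where "C3 = (2 * mom_bound (2 * n + 2) ^ 2) * real (n + 1) ^ (2 * n + 2)"
  have "\<bar>tr S T (Suc n) - (\<Sum>s\<le>n. tr T S s * tr S T (n - s))\<bar> \<le>
      (C1 + real n * C2 + real (n + 1) * C3) * real (card (S \<union> T)) ^ (n + 1)"
    if ST: "finite S" "finite T" "S \<inter> T = {}" for S T :: "'v set"
  proof -
    define K where "K = real (card (S \<union> T)) ^ (n + 1)"
    let ?A = "\<lambda>q. \<Sum>w\<in>cwalks S T (Suc n). if path_edges (tl w) ! q = hd (path_edges w) then mom m (skip q (path_edges (tl w))) else 0"
    let ?P = "\<lambda>s. \<Sum>(a, b)\<in>cwalks T S s \<times> cwalks S T (n - s). mom m (path_edges a @ path_edges b)"
    have 1: "\<bar>tr S T (Suc n) - (\<Sum>q<2 * n + 1. ?A q)\<bar> \<le> C1 * K"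
      unfolding C1_def K_def by (subst sum.swap) (rule walk_sum_pairing_error[OF ST])
    have split: "(\<Sum>q<2 * n + 1. f q) = (\<Sum>s\<le>n. f (2 * s)) + (\<Sum>s<n. f (2 * s + 1))" for f :: "nat \<Rightarrow> real" and n
      by (induction n) (auto simp: algebra_simps)
    have 2: "\<bar>(\<Sum>s<n. ?A (2 * s + 1))\<bar> \<le> (\<Sum>s<n. C2 * K)"
    proof (rule order_trans[OF sum_abs sum_mono])
      fix s assume "s \<in> {..<n}"
      then show "\<bar>?A (2 * s + 1)\<bar> \<le> C2 * K"
        unfolding C2_def K_def using walk_sum_odd_error[OF ST, of "2 * s + 1" n] by simp
    qed
    have 3: "(\<Sum>s\<le>n. ?A (2 * s)) = (\<Sum>s\<le>n. ?P s)" by (rule sum.cong[OF refl]) (rule walk_sum_even_eq[OF ST], simp)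
    have 4: "\<bar>(\<Sum>s\<le>n. ?P s - tr T S s * tr S T (n - s))\<bar> \<le> (\<Sum>s\<le>n. C3 * K)"
    proof (rule order_trans[OF sum_abs sum_mono])
      fix s assume "s \<in> {..n}"
      then show "\<bar>?P s - tr T S s * tr S T (n - s)\<bar> \<le> C3 * K"
        unfolding C3_def K_def using walk_sum_factor_error[OF ST, of s n] by simp
    qed
    have a: "(\<Sum>q<2 * n + 1. ?A q) = (\<Sum>s\<le>n. ?P s) + (\<Sum>s<n. ?A (2 * s + 1))"
      unfolding split 3 ..
    have aux: "a = p + od \<Longrightarrow> u - t = (u - a) + od + (p - t)" for a p od u t :: real by simp
    have eq: "tr S T (Suc n) - (\<Sum>s\<le>n. tr T S s * tr S T (n - s)) = (tr S T (Suc n) - (\<Sum>q<2 * n + 1. ?A q)) +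
        (\<Sum>s<n. ?A (2 * s + 1)) + (\<Sum>s\<le>n. ?P s - tr T S s * tr S T (n - s))"
      unfolding sum_subtractf by (rule aux[OF a])
    have tri: "\<bar>x + y + z\<bar> \<le> a + b + c" if "\<bar>x\<bar> \<le> a" "\<bar>y\<bar> \<le> b" "\<bar>z\<bar> \<le> c" for x y z a b c :: real
      using that by linarith
    have "C1 * K + (\<Sum>s<n. C2 * K) + (\<Sum>s\<le>n. C3 * K) = (C1 + real n * C2 + real (n + 1) * C3) * K"
      by (simp add: distrib_right)
    then show ?thesis unfolding eq K_def[symmetric] using tri[OF 1 2 4] by (simp only:)
  qed
  then show ?thesis by blast
qed

end

subsection \<open>The energy form on closed walks\<close>

lemma path_edges_glue:
  "as \<noteq> [] \<Longrightarrow> bs \<noteq> [] \<Longrightarrow> last as = hd bs \<Longrightarrow> path_edges (as @ tl bs) = path_edges as @ path_edges bs"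
proof -
  assume *: "as \<noteq> []" "bs \<noteq> []" "last as = hd bs"
  obtain b bs' where b: "bs = b # bs'" using *(2) by (cases bs) auto
  have as: "as = butlast as @ [b]" using * b by (metis append_butlast_last_id list.sel(1))
  have "path_edges (butlast as @ b # bs') = path_edges (butlast as @ [b]) @ path_edges (b # bs')"
    by (rule path_edges_append)
  then show ?thesis using as b by (metis append.assoc append_Cons append_Nil list.sel(3))
qed

lemma removeAll_skip:
  assumes "p < length es" "es ! p = e"
  shows "removeAll e (skip p es) = removeAll e es"
proof -
  have "removeAll e (take p es @ es ! p # drop (Suc p) es) = removeAll e es"
    using id_take_nth_drop[OF assms(1)] by simp
  then show ?thesis using assms(2) by (simp add: skip_def)
qed

lemma distinct_count_list: "distinct xs \<Longrightarrow> x \<in> set xs \<Longrightarrow> count_list xs x = 1"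
  by (induction xs) (auto simp: count_notin)

lemma count_list_pos: "x \<in> set xs \<Longrightarrow> count_list xs x \<ge> 1"
  by (induction xs) auto

context moments
begin

text \<open>The energy with \<open>m (i + j) - m i * m j\<close> replaced by \<open>i * j * m (i + j - 2)\<close>. On walks with nonnegligible
  contribution the two differ only if \<open>e\<close> is traversed twice by both, and then by \<open>m 4 - 5\<close>, which \<open>bb\<close> accounts for.\<close>
definition dd :: "'e list \<Rightarrow> 'e list \<Rightarrow> real" where
  "dd es fs = (\<Sum>e\<in>set es \<inter> set fs. real (count_list es e) * real (count_list fs e) *
     m (count_list es e + count_list fs e - 2) * mom m (removeAll e es @ removeAll e fs))"

definition bb :: "'e list \<Rightarrow> 'e list \<Rightarrow> real" where
  "bb es fs = (\<Sum>e\<in>set es \<inter> set fs. if count_list es e = 2 \<and> count_list fs e = 2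
     then mom m (removeAll e es @ removeAll e fs) else 0)"

text \<open>If \<open>e\<close> is passed once by one of the walks, this edge closes a cycle, the
  vertices are at most as many as the edges, and the total multiplicity of at least 3 leaves
  \<open>n + n' - 1\<close> edges. Otherwise the total multiplicity is at least 5, which costs one
  more edge and makes up for the additional vertex.\<close>

lemma comb_energy:
  assumes w: "w \<in> cwalks S T n" "w' \<in> cwalks S T n'"
    and e: "e \<in> set (path_edges w)" "e \<in> set (path_edges w')"
    and ne: "\<not> (count_list (path_edges w) e = 1 \<and> count_list (path_edges w') e = 1)"
      "\<not> (count_list (path_edges w) e = 2 \<and> count_list (path_edges w') e = 2)"
    and mm: "mom m (removeAll e (path_edges w) @ removeAll e (path_edges w')) \<noteq> 0"
  shows "card (set w \<union> set w') \<le> n + n' - 1"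
proof -
  note A = cwalksD[OF w(1)] and B = cwalksD[OF w(2)]
  let ?L = "path_edges w @ path_edges w'"
  define i where "i = count_list (path_edges w) e"
  define j where "j = count_list (path_edges w') e"
  have ij: "i \<ge> 1" "j \<ge> 1" using count_list_pos[OF e(1)] count_list_pos[OF e(2)] unfolding i_def j_def by auto
  have int: "set w \<inter> set w' \<noteq> {}"
    using path_edges_subset[OF e(1)] path_edges_subset[OF e(2)] path_edges_nonempty[OF e(1)] by blast
  have "count_list ?L x \<ge> 2" if "x \<in> set ?L" "x \<noteq> e" for x
    using mom_nonzero[OF mm, of x] that by auto
  then have "2 * (card (set ?L) - 1) + count_list ?L e \<le> length ?L"
    by (intro card_le_length_special) (use e in auto)
  then have E: "2 * (card (set ?L) - 1) + (i + j) \<le> 2 * n + 2 * n'"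
    using A(6) B(6) by (simp add: i_def j_def)
  have E0: "card (set ?L) \<ge> 1" using e by (simp add: Suc_le_eq card_gt_0_iff) auto
  show ?thesis
  proof (cases "i = 1 \<or> j = 1")
    case True
    then have "i + j \<ge> 3" using ne ij unfolding i_def[symmetric] j_def[symmetric] by auto
    then have "card (set ?L) \<le> n + n' - 1" using E E0 by linarith
    moreover have "card (set w \<union> set w') \<le> card (set (path_edges w) \<union> set (path_edges w'))"
      using True A B int unfolding i_def j_def by (intro card_two_closed_once[of w w' e]) auto
    ultimately show ?thesis by simp
  next
    case False
    then have "i + j \<ge> 5" using ne ij unfolding i_def[symmetric] j_def[symmetric] by auto
    then have "card (set ?L) + 1 \<le> n + n' - 1" using E E0 by linarith
    then show ?thesis using card_two_closed[OF A(4) B(4) B(2) int] by simp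
  qed
qed

lemma energy_error:
  "\<exists>C. \<forall>S T :: 'v set. finite S \<longrightarrow> finite T \<longrightarrow>
     \<bar>(\<Sum>w\<in>cwalks S T n. \<Sum>w'\<in>cwalks S T n'. energy (path_edges w) (path_edges w')
        - dd (path_edges w) (path_edges w') - (m 4 - 5) * bb (path_edges w) (path_edges w'))\<bar>
     \<le> C * real (card (S \<union> T)) ^ (n + n' - 1)"
proof -
  \<comment> \<open>At \<open>(1, 1)\<close> the difference is \<open>m 2 - m 0 = 0\<close>, because
    \<open>m 1 = 0\<close>. At \<open>(2, 2)\<close> the energy has \<open>m 4 - 1\<close> and
    \<open>dd\<close> has 4, whence the correction \<open>m 4 - 5\<close>.\<close>
  define co where "co i j = m (i + j) - m i * m j - real i * real j * m (i + j - 2)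
     - (if i = 2 \<and> j = 2 then m 4 - 5 else 0)" for i j
  define K where "K = (\<Sum>i\<le>2 * n. \<Sum>j\<le>2 * n'. \<bar>co i j\<bar>)"
  have K0: "K \<ge> 0" unfolding K_def by (intro sum_nonneg) auto
  have K: "\<bar>co i j\<bar> \<le> K" if "i \<le> 2 * n" "j \<le> 2 * n'" for i j
  proof -
    have "\<bar>co i j\<bar> \<le> (\<Sum>j\<le>2 * n'. \<bar>co i j\<bar>)" using that by (intro member_le_sum) auto
    also have "\<dots> \<le> K" unfolding K_def using that
      by (intro member_le_sum[of i _ "\<lambda>i. \<Sum>j\<le>2 * n'. \<bar>co i j\<bar>"]) (auto intro: sum_nonneg)
    finally show ?thesis .
  qed
  \<comment> \<open>At most \<open>2 * n\<close> edges are common to both walks; \<open>K\<close>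
    bounds the coefficient and \<open>mom_bound\<close> the moment of what remains.\<close>
  define B where "B = real (2 * n) * (K * mom_bound (2 * n + 2 * n'))"
  have B0: "B \<ge> 0" unfolding B_def using K0 mom_bound_ge_1[of "2 * n + 2 * n'"] by simp
  have "\<bar>(\<Sum>w\<in>cwalks S T n. \<Sum>w'\<in>cwalks S T n'. energy (path_edges w) (path_edges w')
        - dd (path_edges w) (path_edges w') - (m 4 - 5) * bb (path_edges w) (path_edges w'))\<bar>
     \<le> B * real (n + n' - 1) ^ (2 * n + 2 * n' + 2) * real (card (S \<union> T)) ^ (n + n' - 1)"
    if ST: "finite S" "finite T" for S T :: "'v set"
  proof -
    let ?g = "\<lambda>(w, w'). energy (path_edges w) (path_edges w')
        - dd (path_edges w) (path_edges w') - (m 4 - 5) * bb (path_edges w) (path_edges w')"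
    have "\<bar>\<Sum>x\<in>cwalks S T n \<times> cwalks S T n'. ?g x\<bar> \<le> B * real (n + n' - 1) ^ (2 * n + 2 * n' + 2) * real (card (S \<union> T)) ^ (n + n' - 1)"
    proof (rule sum_few_values[where \<phi> = "\<lambda>(a, b). a @ b"])
      show "inj_on (\<lambda>(a, b). a @ b) (cwalks S T n \<times> cwalks S T n')"
        by (auto simp: inj_on_def dest!: cwalksD(3))
      fix x assume "x \<in> cwalks S T n \<times> cwalks S T n'"
      then obtain w w' where x: "x = (w, w')" and w: "w \<in> cwalks S T n" and w': "w' \<in> cwalks S T n'" by auto
      note A = cwalksD[OF w] and B = cwalksD[OF w']
      show "set ((\<lambda>(a, b). a @ b) x) \<subseteq> S \<union> T \<and> length ((\<lambda>(a, b). a @ b) x) = 2 * n + 2 * n' + 2"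
        using x A(3,5) B(3,5) by auto
      let ?i = "count_list (path_edges w)" and ?j = "count_list (path_edges w')"
      let ?r = "\<lambda>e. mom m (removeAll e (path_edges w) @ removeAll e (path_edges w'))"
      have g: "?g x = (\<Sum>e\<in>set (path_edges w) \<inter> set (path_edges w'). co (?i e) (?j e) * ?r e)"
        unfolding x prod.case energy_def dd_def bb_def sum_distrib_left sum_subtractf[symmetric]
        by (intro sum.cong refl) (auto simp: co_def algebra_simps)
      assume "?g x \<noteq> 0"
      then have "(\<Sum>e\<in>set (path_edges w) \<inter> set (path_edges w'). co (?i e) (?j e) * ?r e) \<noteq> 0" unfolding g .
      then obtain e where e: "e \<in> set (path_edges w) \<inter> set (path_edges w')" "co (?i e) (?j e) * ?r e \<noteq> 0"
        by (rule sum.not_neutral_contains_not_neutral)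
      have "co 1 1 = 0" "co 2 2 = 0" by (simp_all add: co_def m0 m2 numeral_2_eq_2[symmetric])
      then have "\<not> (?i e = 1 \<and> ?j e = 1)" "\<not> (?i e = 2 \<and> ?j e = 2)" "?r e \<noteq> 0" using e(2) by auto
      then have c: "card (set w \<union> set w') \<le> n + n' - 1" using e(1) by (intro comb_energy[OF w w', of e]) auto
      have "\<bar>?g x\<bar> \<le> (\<Sum>e\<in>set (path_edges w) \<inter> set (path_edges w'). K * mom_bound (2 * n + 2 * n'))"
        unfolding g
      proof (rule order_trans[OF sum_abs sum_mono])
        fix e
        have "?i e \<le> 2 * n" "?j e \<le> 2 * n'" using count_le_length[of "path_edges w" e] count_le_length[of "path_edges w'" e] A(6) B(6) by auto
        moreover have "\<bar>?r e\<bar> \<le> mom_bound (2 * n + 2 * n')"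
          using length_removeAll_less_eq[of e "path_edges w"] length_removeAll_less_eq[of e "path_edges w'"] A(6) B(6) by (intro abs_mom_le) simp
        ultimately show "\<bar>co (?i e) (?j e) * ?r e\<bar> \<le> K * mom_bound (2 * n + 2 * n')"
          unfolding abs_mult using K K0 by (intro mult_mono) auto
      qed
      also have "\<dots> = real (card (set (path_edges w) \<inter> set (path_edges w'))) * (K * mom_bound (2 * n + 2 * n'))" by simp
      also have "\<dots> \<le> real (2 * n) * (K * mom_bound (2 * n + 2 * n'))"
      proof (rule mult_right_mono)
        have "card (set (path_edges w) \<inter> set (path_edges w')) \<le> card (set (path_edges w))" by (intro card_mono) auto
        also have "\<dots> \<le> 2 * n" using card_length[of "path_edges w"] A(6) by simp
        finally show "real (card (set (path_edges w) \<inter> set (path_edges w'))) \<le> real (2 * n)" by simp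
        show "0 \<le> K * mom_bound (2 * n + 2 * n')" using K0 mom_bound_ge_1[of "2 * n + 2 * n'"] by simp
      qed
      finally show "card (set ((\<lambda>(a, b). a @ b) x)) \<le> n + n' - 1 \<and> \<bar>?g x\<bar> \<le> B" using c x by (simp add: B_def)
    qed (use ST B0 in auto)
    then show ?thesis by (simp add: sum.cartesian_product)
  qed
  then show ?thesis by (intro exI[of _ "B * real (n + n' - 1) ^ (2 * n + 2 * n' + 2)"]) auto
qed

text \<open>When an edge passed twice by both walks is removed, the rest has moment 1 under every
  law if all its edges occur exactly twice. If the moments differ, one edge has multiplicity 4 and
  another at least 3; this leaves \<open>n + n' - 2\<close> edges, hence \<open>n + n' - 1\<close>
  vertices.\<close>

lemma bb_universal:
  assumes "moments m'"
  shows "\<exists>C. \<forall>S T :: 'v set. finite S \<longrightarrow> finite T \<longrightarrow>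
     \<bar>(\<Sum>w\<in>cwalks S T n. \<Sum>w'\<in>cwalks S T n'. bb (path_edges w) (path_edges w')
        - moments.bb m' (path_edges w) (path_edges w'))\<bar>
     \<le> C * real (card (S \<union> T)) ^ (n + n' - 1)"
proof -
  interpret m': moments m' by fact
  define M where "M = mom_bound (2 * n + 2 * n') + m'.mom_bound (2 * n + 2 * n')"
  have M0: "M \<ge> 0" unfolding M_def using mom_bound_ge_1[of "2 * n + 2 * n'"] m'.mom_bound_ge_1[of "2 * n + 2 * n'"] by simp
  define B where "B = real (2 * n) * M"
  have B0: "B \<ge> 0" unfolding B_def using M0 by simp
  have "\<bar>(\<Sum>w\<in>cwalks S T n. \<Sum>w'\<in>cwalks S T n'. bb (path_edges w) (path_edges w') - m'.bb (path_edges w) (path_edges w'))\<bar>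
     \<le> B * real (n + n' - 1) ^ (2 * n + 2 * n' + 2) * real (card (S \<union> T)) ^ (n + n' - 1)"
    if ST: "finite S" "finite T" for S T :: "'v set"
  proof -
    let ?g = "\<lambda>(w, w'). bb (path_edges w) (path_edges w') - m'.bb (path_edges w) (path_edges w')"
    have "\<bar>\<Sum>x\<in>cwalks S T n \<times> cwalks S T n'. ?g x\<bar> \<le> B * real (n + n' - 1) ^ (2 * n + 2 * n' + 2) * real (card (S \<union> T)) ^ (n + n' - 1)"
    proof (rule sum_few_values[where \<phi> = "\<lambda>(a, b). a @ b"])
      show "inj_on (\<lambda>(a, b). a @ b) (cwalks S T n \<times> cwalks S T n')"
        by (auto simp: inj_on_def dest!: cwalksD(3))
      fix x assume "x \<in> cwalks S T n \<times> cwalks S T n'"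
      then obtain w w' where x: "x = (w, w')" and w: "w \<in> cwalks S T n" and w': "w' \<in> cwalks S T n'" by auto
      note A = cwalksD[OF w] and B = cwalksD[OF w']
      show "set ((\<lambda>(a, b). a @ b) x) \<subseteq> S \<union> T \<and> length ((\<lambda>(a, b). a @ b) x) = 2 * n + 2 * n' + 2"
        using x A(3,5) B(3,5) by auto
      let ?i = "count_list (path_edges w)" and ?j = "count_list (path_edges w')"
      let ?R = "\<lambda>e. removeAll e (path_edges w) @ removeAll e (path_edges w')"
      let ?t = "\<lambda>e. if ?i e = 2 \<and> ?j e = 2 then mom m (?R e) - mom m' (?R e) else 0"
      have g: "?g x = (\<Sum>e\<in>set (path_edges w) \<inter> set (path_edges w'). ?t e)"
        unfolding x prod.case bb_def m'.bb_def sum_subtractf[symmetric]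
        by (intro sum.cong refl) auto
      assume "?g x \<noteq> 0"
      then have "(\<Sum>e\<in>set (path_edges w) \<inter> set (path_edges w'). ?t e) \<noteq> 0" unfolding g .
      then obtain e where e: "e \<in> set (path_edges w) \<inter> set (path_edges w')" "?t e \<noteq> 0"
        by (rule sum.not_neutral_contains_not_neutral)
      have ij: "?i e = 2" "?j e = 2" "mom m (?R e) \<noteq> mom m' (?R e)" using e(2) by (auto split: if_splits)
      have ge2: "count_list (?R e) y \<ge> 2" if "y \<in> set (?R e)" for y
        using mom_nonzero[of "?R e" y] m'.mom_nonzero[of "?R e" y] that ij(3) by fastforce
      obtain e' where e': "e' \<in> set (?R e)" "count_list (?R e) e' \<noteq> 2"
        using mom_twice[of "?R e"] m'.mom_twice[of "?R e"] ij(3) by fastforce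
      then have e'3: "count_list (?R e) e' \<ge> 3" using ge2[OF e'(1)] by linarith
      have e'e: "e' \<noteq> e" using e'(1) by auto
      let ?L = "path_edges w @ path_edges w'"
      have "2 * (card (set ?L) - 2) + count_list ?L e + count_list ?L e' \<le> length ?L"
      proof (rule card_le_length_special2)
        fix y assume "y \<in> set ?L" "y \<noteq> e"
        then show "count_list ?L y \<ge> 2" using ge2[of y] by auto
      qed (use e(1) e'(1) e'e in auto)
      moreover have "count_list ?L e = 4" "count_list ?L e' \<ge> 3" using ij e'3 e'e by auto
      moreover have "card (set ?L) \<ge> 2"
        using card_mono[of "set ?L" "{e, e'}"] e(1) e'(1) e'e by auto
      ultimately have "card (set ?L) + 1 \<le> n + n' - 1" using A(6) B(6) by simp
      moreover have "set w \<inter> set w' \<noteq> {}"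
        using path_edges_subset[of e w] path_edges_subset[of e w'] path_edges_nonempty[of e w] e(1) by blast
      ultimately have c: "card (set w \<union> set w') \<le> n + n' - 1"
        using card_two_closed[OF A(4) B(4) B(2)] by simp
      have "\<bar>?g x\<bar> \<le> (\<Sum>e\<in>set (path_edges w) \<inter> set (path_edges w'). M)"
        unfolding g
      proof (rule order_trans[OF sum_abs sum_mono])
        fix e
        have "length (?R e) \<le> 2 * n + 2 * n'"
          using length_removeAll_less_eq[of e "path_edges w"] length_removeAll_less_eq[of e "path_edges w'"] A(6) B(6) by simp
        then have "\<bar>mom m (?R e)\<bar> \<le> mom_bound (2 * n + 2 * n')" "\<bar>mom m' (?R e)\<bar> \<le> m'.mom_bound (2 * n + 2 * n')"
          by (auto intro: abs_mom_le m'.abs_mom_le)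
        then show "\<bar>?t e\<bar> \<le> M" using M0 by (auto simp: M_def)
      qed
      also have "\<dots> = real (card (set (path_edges w) \<inter> set (path_edges w'))) * M" by simp
      also have "\<dots> \<le> real (2 * n) * M"
      proof (rule mult_right_mono[OF _ M0])
        have "card (set (path_edges w) \<inter> set (path_edges w')) \<le> card (set (path_edges w))" by (intro card_mono) auto
        also have "\<dots> \<le> 2 * n" using card_length[of "path_edges w"] A(6) by simp
        finally show "real (card (set (path_edges w) \<inter> set (path_edges w'))) \<le> real (2 * n)" by simp
      qed
      finally show "card (set ((\<lambda>(a, b). a @ b) x)) \<le> n + n' - 1 \<and> \<bar>?g x\<bar> \<le> B" using c x by (simp add: B_def)
    qed (use ST B0 in auto)
    then show ?thesis by (simp add: sum.cartesian_product)
  qed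
  then show ?thesis by (intro exI[of _ "B * real (n + n' - 1) ^ (2 * n + 2 * n' + 2)"]) auto
qed

text \<open>For an edge passed once by \<open>es\<close> the product of means vanishes, so that its
  term is the whole mixed moment; and unless this is 0, all edges of \<open>es\<close> occur in
  \<open>fs\<close>. In ANOVA terms the product along \<open>es\<close> lives on its full edge set
  alone.\<close>

lemma energy_distinct:
  assumes "distinct es"
  shows "energy es fs = real (length es) * mom m (es @ fs)"
proof -
  have "energy es fs = (\<Sum>e\<in>set es \<inter> set fs. mom m (es @ fs))"
    unfolding energy_def
  proof (intro sum.cong refl)
    fix e assume "e \<in> set es \<inter> set fs"
    then have "count_list es e = 1" using assms by (simp add: distinct_count_list)
    then show "(m (count_list es e + count_list fs e) - m (count_list es e) * m (count_list fs e)) *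
         mom m (removeAll e es @ removeAll e fs) = mom m (es @ fs)"
      using mom_remove_append[of es fs e] by simp
  qed
  also have "\<dots> = real (card (set es \<inter> set fs)) * mom m (es @ fs)" by simp
  also have "\<dots> = real (length es) * mom m (es @ fs)"
  proof (cases "mom m (es @ fs) = 0")
    case False
    have "set es \<subseteq> set fs"
    proof
      fix e assume e: "e \<in> set es"
      then have "count_list es e = 1" using assms by (simp add: distinct_count_list)
      then have "count_list fs e \<noteq> 0" using mom_nonzero[OF False, of e] e by auto
      then show "e \<in> set fs" by (metis count_list_0_iff)
    qed
    then show ?thesis using distinct_card[OF assms] by (simp add: inf_absorb1)
  qed simp
  finally show ?thesis .
qed

end

text \<open>One occurrence of \<open>e\<close> in either list can be marked and deleted in as many
  ways as the product of the multiplicities, which leaves their sum minus 2. Hence \<open>dd\<close>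
  is the expected scalar product of the gradients of the two products.\<close>

lemma (in moments) dd_eq_skip:
  assumes "length es = a" "length fs = b" "finite F" "set es \<subseteq> F"
  shows "(\<Sum>e\<in>F. \<Sum>p<a. \<Sum>q<b. (if es ! p = e then 1 else 0) * (if fs ! q = e then 1 else 0) *
     mom m (skip p es @ skip q fs)) = dd es fs"
proof -
  have "(\<Sum>p<a. \<Sum>q<b. (if es ! p = e then 1 else 0) * (if fs ! q = e then 1 else 0) * mom m (skip p es @ skip q fs)) =
     real (count_list es e) * real (count_list fs e) *
     m (count_list es e + count_list fs e - 2) * mom m (removeAll e es @ removeAll e fs)" for e
  proof -
    let ?c = "m (count_list es e + count_list fs e - 2) * mom m (removeAll e es @ removeAll e fs)"
    have *: "mom m (skip p es @ skip q fs) = ?c" if "p < a" "q < b" "es ! p = e" "fs ! q = e" for p q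
      using mom_remove_append[of "skip p es" "skip q fs" e] that assms(1,2)
        count_list_skip[of p es e] count_list_skip[of q fs e]
      by (simp add: removeAll_skip)
    have "(\<Sum>p<a. \<Sum>q<b. (if es ! p = e then 1 else 0) * (if fs ! q = e then 1 else 0) * mom m (skip p es @ skip q fs)) =
      (\<Sum>p<a. \<Sum>q<b. (if es ! p = e then 1 else 0) * (if fs ! q = e then 1 else 0) * ?c)"
      by (intro sum.cong refl) (auto simp: *)
    also have "\<dots> = (\<Sum>p<a. if es ! p = e then 1 else 0) * (\<Sum>q<b. if fs ! q = e then 1 else 0) * ?c"
      by (subst sum_product) (simp only: sum_distrib_right)
    also have "(\<Sum>p<a. if es ! p = e then 1 else 0 :: real) = real (count_list es e)"
      unfolding count_list_card assms(1)[symmetric] by (subst sum.inter_filter[symmetric]) auto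
    also have "(\<Sum>q<b. if fs ! q = e then 1 else 0 :: real) = real (count_list fs e)"
      unfolding count_list_card assms(2)[symmetric] by (subst sum.inter_filter[symmetric]) auto
    finally show ?thesis by (simp add: mult.assoc)
  qed
  then show ?thesis unfolding dd_def
  proof (simp, intro sum.mono_neutral_right ballI)
    fix e assume "e \<in> F - set es \<inter> set fs"
    then have "count_list es e = 0 \<or> count_list fs e = 0" by (auto simp: count_list_0_iff)
    then show "real (count_list es e) * real (count_list fs e) * m (count_list es e + count_list fs e - 2) *
       mom m (removeAll e es @ removeAll e fs) = 0" by auto
  qed (use assms(3,4) in auto)
qed

text \<open>The expectation of the pathwise identity \<open>gradient_cwalks\<close>.\<close>

lemma sum_dd_cwalks:
  fixes S T :: "'v set"
  assumes "iid_array M Xe I m" and fin: "finite S" "finite T" "S \<inter> T = {}" and I: "bip_edges S T \<subseteq> I"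
    and n: "n \<ge> 1" "n' \<ge> 1"
  shows "(\<Sum>w\<in>cwalks S T n. \<Sum>w'\<in>cwalks S T n'. moments.dd m (path_edges w) (path_edges w'))
     = 4 * real n * real n' * moments.tr m S T (n + n' - 1)"
proof -
  interpret iid_array M Xe I m by fact
  have sub: "set (path_edges w) \<subseteq> bip_edges S T" if "w \<in> cwalks S T n" for w n
    using path_edges_bip[OF cwalksD(1)[OF that]] .
  let ?x = "\<lambda>\<omega> e. Xe e \<omega>"
  let ?i = "\<lambda>e w p. if path_edges w ! p = e then 1 else 0 :: real"
  let ?W = "\<lambda>n. cwalks S T n \<times> {..<2 * n}"
  have *: "(\<Sum>w\<in>cwalks S T n. \<Sum>p<2 * n. ?i e w p * list_prod (?x \<omega>) (skip p (path_edges w))) =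
     (\<Sum>wp\<in>?W n. ?i e (fst wp) (snd wp) * list_prod (?x \<omega>) (skip (snd wp) (path_edges (fst wp))))" for n e \<omega>
    by (simp add: sum.cartesian_product case_prod_unfold)
  have fW: "finite (?W n)" for n using fin by simp
  have sW: "set (skip (snd wp) (path_edges (fst wp))) \<subseteq> I" if "wp \<in> ?W n" for wp n
    using that set_skip_subset[of "snd wp" "path_edges (fst wp)"] sub[of "fst wp" n] I by fastforce
  have "expectation (\<lambda>\<omega>. \<Sum>e\<in>bip_edges S T.
     (\<Sum>w\<in>cwalks S T n. \<Sum>p<2 * n. ?i e w p * list_prod (?x \<omega>) (skip p (path_edges w))) *
     (\<Sum>w\<in>cwalks S T n'. \<Sum>p<2 * n'. ?i e w p * list_prod (?x \<omega>) (skip p (path_edges w))))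
     = 4 * real n * real n' * tr S T (n + n' - 1)"
    unfolding gradient_cwalks[OF fin n] tr_def
    using expectation_sum_list_prod[of "cwalks S T (n + n' - 1)" path_edges "\<lambda>_. 1"] fin sub I by fastforce
  also have "expectation (\<lambda>\<omega>. \<Sum>e\<in>bip_edges S T.
     (\<Sum>w\<in>cwalks S T n. \<Sum>p<2 * n. ?i e w p * list_prod (?x \<omega>) (skip p (path_edges w))) *
     (\<Sum>w\<in>cwalks S T n'. \<Sum>p<2 * n'. ?i e w p * list_prod (?x \<omega>) (skip p (path_edges w)))) =
     (\<Sum>e\<in>bip_edges S T. \<Sum>wp\<in>?W n. \<Sum>wq\<in>?W n'. ?i e (fst wp) (snd wp) * ?i e (fst wq) (snd wq) *
       mom m (skip (snd wp) (path_edges (fst wp)) @ skip (snd wq) (path_edges (fst wq))))"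
    unfolding *
    by (subst Bochner_Integration.integral_sum, rule integrable_sum_list_prod2[OF fW sW fW sW], assumption+,
        intro sum.cong refl expectation_sum_list_prod2[OF fW sW fW sW])
  also have "\<dots> = (\<Sum>w\<in>cwalks S T n. \<Sum>w'\<in>cwalks S T n'. dd (path_edges w) (path_edges w'))"
  proof -
    let ?h = "\<lambda>e w p w' q. ?i e w p * ?i e w' q * mom m (skip p (path_edges w) @ skip q (path_edges w'))"
    have "(\<Sum>wp\<in>?W n. \<Sum>wq\<in>?W n'. ?h e (fst wp) (snd wp) (fst wq) (snd wq)) =
       (\<Sum>w\<in>cwalks S T n. \<Sum>w'\<in>cwalks S T n'. \<Sum>p<2 * n. \<Sum>q<2 * n'. ?h e w p w' q)" for e
    proof -
      have "(\<Sum>wp\<in>?W n. \<Sum>wq\<in>?W n'. ?h e (fst wp) (snd wp) (fst wq) (snd wq)) =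
        (\<Sum>w\<in>cwalks S T n. \<Sum>p<2 * n. \<Sum>w'\<in>cwalks S T n'. \<Sum>q<2 * n'. ?h e w p w' q)"
        unfolding sum.cartesian_product' by simp
      also have "\<dots> = (\<Sum>w\<in>cwalks S T n. \<Sum>w'\<in>cwalks S T n'. \<Sum>p<2 * n. \<Sum>q<2 * n'. ?h e w p w' q)"
        by (intro sum.cong refl sum.swap)
      finally show ?thesis .
    qed
    then have "(\<Sum>e\<in>bip_edges S T. \<Sum>wp\<in>?W n. \<Sum>wq\<in>?W n'. ?h e (fst wp) (snd wp) (fst wq) (snd wq)) =
       (\<Sum>e\<in>bip_edges S T. \<Sum>w\<in>cwalks S T n. \<Sum>w'\<in>cwalks S T n'. \<Sum>p<2 * n. \<Sum>q<2 * n'. ?h e w p w' q)"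
      by simp
    also have "\<dots> = (\<Sum>w\<in>cwalks S T n. \<Sum>e\<in>bip_edges S T. \<Sum>w'\<in>cwalks S T n'. \<Sum>p<2 * n. \<Sum>q<2 * n'. ?h e w p w' q)"
      by (rule sum.swap)
    also have "\<dots> = (\<Sum>w\<in>cwalks S T n. \<Sum>w'\<in>cwalks S T n'. \<Sum>e\<in>bip_edges S T. \<Sum>p<2 * n. \<Sum>q<2 * n'. ?h e w p w' q)"
      by (intro sum.cong refl sum.swap)
    also have "\<dots> = (\<Sum>w\<in>cwalks S T n. \<Sum>w'\<in>cwalks S T n'. dd (path_edges w) (path_edges w'))"
      by (intro sum.cong refl dd_eq_skip) (use cwalksD(6) sub fin in auto)
    finally show ?thesis .
  qed
  finally show ?thesis .
qed

subsection \<open>Cycles\<close>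

text \<open>Rooted and oriented cycles. For \<open>k = 1\<close> these are the walks u, v, u, which
  pass the same edge twice; hence the restriction to \<open>k \<ge> 2\<close> wherever distinct
  edges matter.\<close>

definition simple_walks :: "'v set \<Rightarrow> 'v set \<Rightarrow> nat \<Rightarrow> 'v list set" where
  "simple_walks S T k = {w \<in> cwalks S T k. distinct (butlast w)}"

lemma finite_simple_walks [simp]: "finite S \<Longrightarrow> finite T \<Longrightarrow> finite (simple_walks S T k)"
  by (simp add: simple_walks_def)

lemma butlast_closed:
  assumes "w \<in> cwalks S T k" "k \<ge> 1"
  shows "set (butlast w) = set w" "length (butlast w) = 2 * k" "w = butlast w @ [hd w]" "hd (butlast w) = hd w"
proof -
  note A = cwalksD[OF assms(1)]
  show l: "length (butlast w) = 2 * k" using A(3) by simp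
  show w: "w = butlast w @ [hd w]" using A by (metis append_butlast_last_id)
  show h: "hd (butlast w) = hd w" using l assms(2) w
    by (metis append_is_Nil_conv hd_append2 list.size(3) mult_is_0 not_one_le_zero zero_neq_numeral)
  have "hd w \<in> set (butlast w)" using h l assms(2)
    by (metis hd_in_set list.size(3) mult_is_0 not_one_le_zero zero_neq_numeral)
  moreover have "set w = insert (hd w) (set (butlast w))" by (subst w) simp
  ultimately show "set (butlast w) = set w" by auto
qed

text \<open>Equal edges passed in the same direction have the same starting vertex. In opposite
  directions they are consecutive steps back and forth, and the walk would close after two
  steps.\<close>

lemma distinct_path_edges:
  assumes w: "w \<in> simple_walks S T k" and k: "k \<ge> 2" and disj: "S \<inter> T = {}"
  shows "distinct (path_edges w)"
proof -
  have wc: "w \<in> cwalks S T k" and d: "distinct (butlast w)" using w by (auto simp: simple_walks_def)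
  note A = cwalksD[OF wc]
  have lb: "length (butlast w) = 2 * k" using A(3) by simp
  have nb: "w ! s = butlast w ! s" if "s < 2 * k" for s using that lb by (simp add: nth_butlast)
  have inj: "s = t" if "w ! s = w ! t" "s < 2 * k" "t < 2 * k" for s t
    using that d lb nb by (metis nth_eq_iff_index_eq)
  have w0: "w ! (2 * k) = w ! 0" using A(2,3,4) by (simp add: hd_conv_nth last_conv_nth)
  have pty: "w ! s \<in> S \<longleftrightarrow> even s" if "s \<le> 2 * k" for s
    using nth_paths[OF A(1) that] disj by (auto split: if_splits)
  have *: False if st: "s < t" "t < 2 * k" and eq: "{w ! s, w ! Suc s} = {w ! t, w ! Suc t}" for s t
  proof (cases "even s \<longleftrightarrow> even t")
    case True
    have "w ! s \<noteq> w ! Suc t" using pty[of s] pty[of "Suc t"] st True by auto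
    then have "w ! s = w ! t" using eq by (auto simp: doubleton_eq_iff)
    then show False using inj[of s t] st by simp
  next
    case False
    have "w ! s \<noteq> w ! t" using pty[of s] pty[of t] st False by auto
    then have e: "w ! s = w ! Suc t" "w ! Suc s = w ! t" using eq by (auto simp: doubleton_eq_iff)
    then have t: "t = Suc s" using inj[of "Suc s" t] st by simp
    show False
    proof (cases "Suc t < 2 * k")
      case True
      then show False using e(1) inj[of s "Suc t"] st by simp
    next
      case False
      then have "Suc t = 2 * k" using st by simp
      then have "w ! s = w ! 0" using e(1) w0 by simp
      then have "s = 0" using inj[of s 0] st by simp
      then show False using t \<open>Suc t = 2 * k\<close> k by simp
    qed
  qed
  show ?thesis
    unfolding distinct_conv_nth
  proof (intro allI impI)
    fix i j assume ij: "i < length (path_edges w)" "j < length (path_edges w)" "i \<noteq> j"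
    have nth: "path_edges w ! s = {w ! s, w ! Suc s}" if "s < 2 * k" for s
      using that A(3) by (intro path_edges_nth) simp
    show "path_edges w ! i \<noteq> path_edges w ! j"
      using *[of i j] *[of j i] nth[of i] nth[of j] ij A(6) by (metis linorder_neqE_nat)
  qed
qed

lemma card_set_simple_walk: "w \<in> simple_walks S T k \<Longrightarrow> k \<ge> 1 \<Longrightarrow> card (set w) = 2 * k"
  using butlast_closed[of w S T k] distinct_card[of "butlast w"] by (auto simp: simple_walks_def)

text \<open>Equal edges give equal vertices, \<open>2 * k\<close> of them on \<open>2 * k\<close>
  positions, which leaves no room for a repetition.\<close>

lemma simple_walk_if_same_edges:
  assumes w: "w \<in> simple_walks S T k" and k: "k \<ge> 2" and disj: "S \<inter> T = {}"
    and w': "w' \<in> cwalks S' T' k" and eq: "set (path_edges w) = set (path_edges w')"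
  shows "w' \<in> simple_walks S' T' k"
proof -
  have wc: "w \<in> cwalks S T k" using w by (auto simp: simple_walks_def)
  have "set w' = set w"
    using Union_path_edges[of w] Union_path_edges[of w'] cwalksD(3)[OF wc] cwalksD(3)[OF w'] eq k by simp
  then have "card (set (butlast w')) = length (butlast w')"
    using card_set_simple_walk[OF w] butlast_closed[OF w'] k by simp
  then show ?thesis using w' card_distinct unfolding simple_walks_def by blast
qed

text \<open>Every edge of the cycle occurs there only once and has to be covered by
  \<open>w'\<close>, which has at most \<open>2 * k\<close> steps and hence no other edges.\<close>

lemma (in moments) mom_simple:
  assumes w: "w \<in> simple_walks S T k" and k: "k \<ge> 2" and disj: "S \<inter> T = {}"
    and w': "w' \<in> cwalks S' T' n" and n: "n \<le> k" and mm: "mom m (path_edges w @ path_edges w') \<noteq> 0"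
  shows "n = k" "w' \<in> simple_walks S' T' k" "set (path_edges w) = set (path_edges w')"
proof -
  have wc: "w \<in> cwalks S T k" using w by (auto simp: simple_walks_def)
  note d = distinct_path_edges[OF w k disj]
  have sub: "set (path_edges w) \<subseteq> set (path_edges w')"
  proof
    fix e assume e: "e \<in> set (path_edges w)"
    then have "count_list (path_edges w) e = 1" using d by (simp add: distinct_count_list)
    then have "count_list (path_edges w') e \<noteq> 0" using mom_nonzero[OF mm, of e] e by auto
    then show "e \<in> set (path_edges w')" by (metis count_list_0_iff)
  qed
  have c: "card (set (path_edges w)) = 2 * k" using distinct_card[OF d] cwalksD(6)[OF wc] by simp
  have c': "card (set (path_edges w')) \<le> 2 * n" using card_length[of "path_edges w'"] cwalksD(6)[OF w'] by simp
  have le: "card (set (path_edges w)) \<le> card (set (path_edges w'))" using sub by (intro card_mono) auto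
  show nk: "n = k" using c c' le n by simp
  show eq: "set (path_edges w) = set (path_edges w')"
    using sub c c' le nk by (intro card_subset_eq) auto
  show "w' \<in> simple_walks S' T' k" using simple_walk_if_same_edges[OF w k disj _ eq] w' nk by simp
qed

lemma (in moments) mom_simple_eq:
  assumes w: "w \<in> simple_walks S T k" "w' \<in> simple_walks S' T' k" and k: "k \<ge> 2" and disj: "S \<inter> T = {}" "S' \<inter> T' = {}"
  shows "mom m (path_edges w @ path_edges w') = (if set (path_edges w) = set (path_edges w') then 1 else 0)"
proof (cases "set (path_edges w) = set (path_edges w')")
  case True
  have "count_list (path_edges w) e = 1" "count_list (path_edges w') e = 1" if "e \<in> set (path_edges w)" for e
    using distinct_path_edges[OF w(1) k disj(1)] distinct_path_edges[OF w(2) k disj(2)] that True by (simp_all add: distinct_count_list)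
  then have "mom m (path_edges w @ path_edges w') = 1" using True by (intro mom_twice) auto
  then show ?thesis using True by simp
next
  case False
  have "w' \<in> cwalks S' T' k" using w(2) by (simp add: simple_walks_def)
  then show ?thesis using mom_simple(3)[OF w(1) k disj(1)] False by auto
qed

text \<open>Restarts a closed walk at position \<open>q\<close>. Both pieces contain the old base
  point, whence the \<open>tl\<close>; an even \<open>q\<close> keeps the new base point in
  \<open>S\<close>.\<close>

definition rot :: "nat \<Rightarrow> 'v list \<Rightarrow> 'v list" where
  "rot q w = drop q w @ tl (take (Suc q) w)"

lemma rot_cwalk:
  assumes w: "w \<in> cwalks S T k" and q: "q < 2 * k" "even q"
  shows "rot q w \<in> cwalks S T k" "path_edges (rot q w) = drop q (path_edges w) @ take q (path_edges w)"
proof -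
  note A = cwalksD[OF w]
  have ne: "drop q w \<noteq> []" "take (Suc q) w \<noteq> []" using A(3,4) q by auto
  have "last (drop q w) = hd (take (Suc q) w)" using A(2,3,4) q by (simp add: hd_take)
  from path_edges_glue[OF ne this] show pe: "path_edges (rot q w) = drop q (path_edges w) @ take q (path_edges w)"
    unfolding rot_def by (simp add: path_edges_drop path_edges_take)
  have len: "length (rot q w) = Suc (2 * k)" unfolding rot_def using A(3) q by simp
  have w0: "w ! (2 * k) = w ! 0" using A(2,3,4) by (simp add: hd_conv_nth last_conv_nth)
  have nth: "rot q w ! i = (if i + q \<le> 2 * k then w ! (i + q) else w ! (i + q - 2 * k))" if "i \<le> 2 * k" for i
  proof (cases "i + q \<le> 2 * k")
    case True
    then have "i < Suc (2 * k) - q" by linarith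
    then show ?thesis unfolding rot_def using A(3) True by (simp add: nth_append add.commute)
  next
    case False
    then have "Suc (i + q - Suc (2 * k)) = i + q - 2 * k" "\<not> i < Suc (2 * k) - q" by linarith+
    then show ?thesis unfolding rot_def using that A(3) q False by (simp add: nth_append nth_tl)
  qed
  have "rot q w ! i \<in> (if even i then S else T)" if i: "i \<le> 2 * k" for i
  proof (cases "i + q \<le> 2 * k")
    case True
    then show ?thesis using nth[OF i] nth_paths[OF A(1) True] q by auto
  next
    case False
    have "i + q - 2 * k \<le> 2 * k" using i q by linarith
    from nth_paths[OF A(1) this] show ?thesis using nth[OF i] False q by (auto split: if_splits)
  qed
  then have "rot q w \<in> paths S T (2 * k)" unfolding paths_iff using len by simp
  moreover have "hd (rot q w) = last (rot q w)"
  proof -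
    have "rot q w \<noteq> []" using len by auto
    then show ?thesis using nth[of 0] nth[of "2 * k"] len q w0 by (auto simp: hd_conv_nth last_conv_nth)
  qed
  ultimately show "rot q w \<in> cwalks S T k" by (simp add: cwalks_def)
qed

lemma rev_cwalk: "w \<in> cwalks S T k \<Longrightarrow> rev w \<in> cwalks S T k"
proof -
  assume w: "w \<in> cwalks S T k"
  note A = cwalksD[OF w]
  have "rev w ! s \<in> (if even s then S else T)" if "s \<le> 2 * k" for s
    using nth_paths[OF A(1), of "2 * k - s"] that A(3) by (auto simp: rev_nth split: if_splits)
  then show ?thesis using A by (simp add: cwalks_def paths_iff hd_rev last_rev)
qed

text \<open>One closed walk for each choice of the first edge and the direction, starting on the side \<open>S\<close>.\<close>
lemma card_companions:
  assumes w: "w \<in> simple_walks S T k" and k: "k \<ge> 2" and fin: "finite S" "finite T" and disj: "S \<inter> T = {}"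
  shows "2 * k \<le> card {w' \<in> simple_walks S T k. set (path_edges w') = set (path_edges w)}"
proof -
  have wc: "w \<in> cwalks S T k" using w by (auto simp: simple_walks_def)
  note A = cwalksD[OF wc]
  note d = distinct_path_edges[OF w k disj]
  \<comment> \<open>The walk whose first edge is the edge at position \<open>p\<close>. At odd
    \<open>p\<close> this edge is passed from \<open>T\<close> to \<open>S\<close>, so that the walk
    is reversed before it is rotated.\<close>
  define c where "c p = (if even p then rot p w else rot (2 * k - 1 - p) (rev w))" for p
  have c: "c p \<in> cwalks S T k \<and> set (path_edges (c p)) = set (path_edges w) \<and> hd (path_edges (c p)) = path_edges w ! p"
    if p: "p < 2 * k" for p
  proof (cases "even p")
    case True
    have "set (drop p (path_edges w) @ take p (path_edges w)) = set (path_edges w)"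
      using set_append[of "take p (path_edges w)" "drop p (path_edges w)"] by auto
    then show ?thesis using rot_cwalk[OF wc p True] True p A(6) unfolding c_def by (simp add: hd_drop_conv_nth)
  next
    case False
    let ?q = "2 * k - 1 - p" and ?r = "rev (path_edges w)"
    have q: "?q < 2 * k" "even ?q" using p False by auto
    have "set (drop ?q ?r @ take ?q ?r) = set (path_edges w)"
      using set_append[of "take ?q ?r" "drop ?q ?r"] by auto
    moreover have "?r ! ?q = path_edges w ! p" using p A(6) by (simp add: rev_nth)
    ultimately show ?thesis using rot_cwalk[OF rev_cwalk[OF wc] q] False p A(6)
      unfolding c_def path_edges_rev by (simp add: hd_drop_conv_nth)
  qed
  have "inj_on c {..<2 * k}"
  proof (rule inj_onI)
    fix x y assume xy: "x \<in> {..<2 * k}" "y \<in> {..<2 * k}" "c x = c y"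
    then have "path_edges w ! x = path_edges w ! y" using c[of x] c[of y] by simp
    then show "x = y" using nth_eq_iff_index_eq[OF d, of x y] xy A(6) by simp
  qed
  then have "2 * k = card (c ` {..<2 * k})" by (simp add: card_image)
  also have "\<dots> \<le> card {w' \<in> simple_walks S T k. set (path_edges w') = set (path_edges w)}"
    using c simple_walk_if_same_edges[OF w k disj] fin by (intro card_mono) auto
  finally show ?thesis .
qed

subsection \<open>Chebyshev polynomials and Marchenko--Pastur moments\<close>

context
  fixes \<phi> :: "nat \<Rightarrow> real"
begin

text \<open>The quotient \<open>(x^i - y^i) / (x - y)\<close> is the sum of the
  \<open>x^a * y^(i - 1 - a)\<close>; the powers of \<open>y\<close> are replaced by their
  moments.\<close>

definition theta_monom :: "nat \<Rightarrow> real poly" where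
  "theta_monom i = (\<Sum>a<i. monom (\<phi> (i - 1 - a)) a)"

text \<open>Partial application of \<open>poly_mom \<phi>\<close> to the difference quotient \<open>(p x - p y) / (x - y)\<close>.\<close>
definition theta :: "real poly \<Rightarrow> real poly" where
  "theta p = (\<Sum>i\<le>degree p. Polynomial.smult (coeff p i) (theta_monom i))"

lemma theta_ge: "degree p \<le> n \<Longrightarrow> theta p = (\<Sum>i\<le>n. Polynomial.smult (coeff p i) (theta_monom i))"
  unfolding theta_def by (rule sum.mono_neutral_left) (auto simp: coeff_eq_0)

lemma theta_add: "theta (p + q) = theta p + theta q"
  by (simp add: theta_ge[of _ "max (degree p) (degree q)"] degree_add_le sum.distrib smult_add_left)

lemma theta_smult: "theta (Polynomial.smult c p) = Polynomial.smult c (theta p)"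
  by (simp add: theta_ge[of _ "degree p"] degree_smult_le smult_sum2)

lemma theta_diff: "theta (p - q) = theta p - theta q"
  using theta_add[of p "Polynomial.smult (-1) q"] theta_smult[of "-1" q] by simp

lemma theta_monom_Suc: "theta_monom (Suc i) = pCons 0 (theta_monom i) + [:\<phi> i:]"
proof -
  have "theta_monom (Suc i) = monom (\<phi> i) 0 + (\<Sum>a<i. monom (\<phi> (i - Suc a)) (Suc a))"
    unfolding theta_monom_def sum.lessThan_Suc_shift by simp
  also have "(\<Sum>a<i. monom (\<phi> (i - Suc a)) (Suc a)) = [:0, 1:] * theta_monom i"
    unfolding theta_monom_def sum_distrib_left by (intro sum.cong refl) (simp add: monom_Suc)
  finally show ?thesis by (simp add: monom_0)
qed

lemma theta_pCons: "theta (pCons 0 p) = pCons 0 (theta p) + [:poly_mom \<phi> p:]"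
proof -
  have d: "degree (pCons 0 p) \<le> Suc (degree p)" by (rule degree_pCons_le)
  have "theta (pCons 0 p) = (\<Sum>i\<le>Suc (degree p). Polynomial.smult (coeff (pCons 0 p) i) (theta_monom i))"
    by (rule theta_ge[OF d])
  also have "\<dots> = (\<Sum>i\<le>degree p. Polynomial.smult (coeff p i) (theta_monom (Suc i)))"
    by (subst sum.atMost_Suc_shift) (simp add: theta_monom_def)
  also have "\<dots> = (\<Sum>i\<le>degree p. [:0, 1:] * Polynomial.smult (coeff p i) (theta_monom i) + [:coeff p i * \<phi> i:])"
    by (intro sum.cong refl) (simp add: theta_monom_Suc smult_add_right)
  also have "\<dots> = [:0, 1:] * theta p + (\<Sum>i\<le>degree p. [:coeff p i * \<phi> i:])"
    unfolding sum.distrib theta_def sum_distrib_left ..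
  also have "(\<Sum>i\<le>degree p. [:coeff p i * \<phi> i:]) = [:poly_mom \<phi> p:]"
    unfolding poly_mom_def by (induction "degree p") (auto simp: sum_to_poly)
  finally show ?thesis by simp
qed

end

lemma poly_mom_pCons: "poly_mom m (pCons 0 p) = (\<Sum>i\<le>degree p. coeff p i * m (Suc i))"
proof -
  have "poly_mom m (pCons 0 p) = (\<Sum>i\<le>Suc (degree p). coeff (pCons 0 p) i * m i)"
    by (rule poly_mom_ge) (rule degree_pCons_le)
  then show ?thesis by (subst (asm) sum.atMost_Suc_shift) simp
qed

lemma poly_mom_sum: "poly_mom m (\<Sum>i\<in>A. f i) = (\<Sum>i\<in>A. poly_mom m (f i))"
  by (induction A rule: infinite_finite_induct) (auto simp: poly_mom_def[of _ 0])

text \<open>Chebyshev polynomials of the second kind in the variable \<open>(x - \<kappa>) / 2\<close>.\<close>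
fun chebU :: "real \<Rightarrow> nat \<Rightarrow> real poly" where
  "chebU \<kappa> 0 = 1"
| "chebU \<kappa> (Suc 0) = [:- \<kappa>, 1:]"
| "chebU \<kappa> (Suc (Suc q)) = [:- \<kappa>, 1:] * chebU \<kappa> (Suc q) - chebU \<kappa> q"

text \<open>The moment recursion of the semicircle law of variance 1 around \<kappa>. It occurs with
  \<open>\<phi> i\<close> the limit of the normalized trace of H^(i + 1): the Marchenko--Pastur law
  weighted with x is this semicircle law.\<close>

definition mp_moments :: "real \<Rightarrow> (nat \<Rightarrow> real) \<Rightarrow> bool" where
  "mp_moments \<kappa> \<phi> \<longleftrightarrow> \<phi> 0 = 1 \<and> (\<forall>n. \<phi> (Suc n) = \<kappa> * \<phi> n + (\<Sum>a<n. \<phi> a * \<phi> (n - 1 - a)))"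

lemma mult_shift: "[:- \<kappa>, 1:] * p = pCons 0 p - Polynomial.smult \<kappa> (p :: real poly)"
  by simp

context
  fixes \<phi> :: "nat \<Rightarrow> real" and \<kappa> :: real
  assumes walk_sum: "mp_moments \<kappa> \<phi>"
begin

text \<open>The recursion read as an identity for polynomials, the Schwinger--Dyson equation of the
  semicircle law; it follows from monomials by linearity.\<close>

lemma poly_mom_theta: "poly_mom \<phi> ([:- \<kappa>, 1:] * p) = poly_mom \<phi> (theta \<phi> p)"
proof -
  have "poly_mom \<phi> (theta_monom \<phi> i) = (\<Sum>a<i. \<phi> a * \<phi> (i - 1 - a))" for i
    unfolding theta_monom_def poly_mom_sum by (simp add: mult.commute)
  then have *: "\<phi> (Suc i) = \<kappa> * \<phi> i + poly_mom \<phi> (theta_monom \<phi> i)" for i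
    using walk_sum unfolding mp_moments_def by simp
  have "poly_mom \<phi> (pCons 0 p) = \<kappa> * poly_mom \<phi> p + poly_mom \<phi> (theta \<phi> p)"
    unfolding poly_mom_pCons theta_def poly_mom_sum poly_mom_smult
    by (simp add: * poly_mom_def sum.distrib sum_distrib_left algebra_simps)
  then show ?thesis unfolding mult_shift by simp
qed

lemma theta_shift: "theta \<phi> ([:- \<kappa>, 1:] * p) = [:- \<kappa>, 1:] * theta \<phi> p + [:poly_mom \<phi> p:]"
  unfolding mult_shift theta_diff theta_smult theta_pCons by simp

text \<open>\<open>theta\<close> lowers the index of the Chebyshev polynomials by one. Both claims
  are proved together, since the mean of \<open>chebU \<kappa> q\<close> is obtained by
  \<open>poly_mom_theta\<close> from \<open>theta\<close> at the index below.\<close>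

lemma theta_chebU: "theta \<phi> (chebU \<kappa> q) = (if q = 0 then 0 else chebU \<kappa> (q - 1)) \<and>
    poly_mom \<phi> (chebU \<kappa> q) = (if q = 0 then 1 else 0)"
proof (induction q rule: less_induct)
  case (less q)
  have t1: "theta \<phi> 1 = 0" by (simp add: theta_def theta_monom_def)
  have p1: "poly_mom \<phi> 1 = 1" using walk_sum by (simp add: poly_mom_def mp_moments_def)
  consider "q = 0" | "q = 1" | r where "q = Suc (Suc r)" by (metis One_nat_def not0_implies_Suc)
  then show ?case
  proof cases
    case 1
    then show ?thesis using t1 p1 by simp
  next
    case 2
    have "theta \<phi> ([:- \<kappa>, 1:] * 1) = [:1:]" unfolding theta_shift t1 p1 by simp
    moreover have "poly_mom \<phi> ([:- \<kappa>, 1:] * 1) = 0" unfolding poly_mom_theta t1 by (simp add: poly_mom_def)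
    ultimately show ?thesis using 2 by (simp add: one_pCons)
  next
    case (3 r)
    note IH = less[of r] less[of "Suc r"]
    have "theta \<phi> (chebU \<kappa> q) = [:- \<kappa>, 1:] * chebU \<kappa> r - (if r = 0 then 0 else chebU \<kappa> (r - 1))"
      unfolding 3 chebU.simps theta_diff theta_shift using IH 3 by simp
    also have "\<dots> = chebU \<kappa> (Suc r)" by (cases r) auto
    finally have "theta \<phi> (chebU \<kappa> q) = chebU \<kappa> (Suc r)" .
    moreover have "poly_mom \<phi> (chebU \<kappa> q) = poly_mom \<phi> (theta \<phi> (chebU \<kappa> (Suc r))) - poly_mom \<phi> (chebU \<kappa> r)"
      unfolding 3 chebU.simps poly_mom_diff poly_mom_theta ..
    ultimately show ?thesis using IH 3 by simp
  qed
qed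

lemma chebU_mult_shift: "[:- \<kappa>, 1:] * chebU \<kappa> (Suc q) = chebU \<kappa> (Suc (Suc q)) + chebU \<kappa> q"
  by simp

text \<open>The three-term recursion moves a factor \<open>[:- \<kappa>, 1:]\<close> from the second
  polynomial to the first, until only the mean of single polynomials is left.\<close>

lemma chebU_orthonormal: "poly_mom \<phi> (chebU \<kappa> a * chebU \<kappa> b) = (if a = b then 1 else 0)"
proof (induction b arbitrary: a rule: less_induct)
  case (less b)
  consider "b = 0" | "b = 1" | r where "b = Suc (Suc r)" by (metis One_nat_def not0_implies_Suc)
  then show ?case
  proof cases
    case 1
    then show ?thesis using theta_chebU[of a] by simp
  next
    case 2
    show ?thesis
    proof (cases a)
      case 0
      then show ?thesis using 2 theta_chebU[of 1] by simp
    next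
      case (Suc a')
      have "chebU \<kappa> a * chebU \<kappa> b = chebU \<kappa> (Suc (Suc a')) + chebU \<kappa> a'"
        using chebU_mult_shift[of a'] 2 Suc by (simp add: mult.commute)
      then show ?thesis using theta_chebU[of "Suc (Suc a')"] theta_chebU[of a'] 2 Suc
        by (simp del: chebU.simps)
    qed
  next
    case (3 r)
    show ?thesis
    proof (cases a)
      case 0
      then show ?thesis using 3 theta_chebU[of b] by (simp del: chebU.simps(3))
    next
      case (Suc a')
      have "chebU \<kappa> a * chebU \<kappa> b = ([:- \<kappa>, 1:] * chebU \<kappa> (Suc a')) * chebU \<kappa> (Suc r) - chebU \<kappa> a * chebU \<kappa> r"
        unfolding 3 Suc chebU.simps(3)[of \<kappa> r] by (simp only: algebra_simps)
      also have "\<dots> = chebU \<kappa> (Suc (Suc a')) * chebU \<kappa> (Suc r) + chebU \<kappa> a' * chebU \<kappa> (Suc r) - chebU \<kappa> a * chebU \<kappa> r"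
        unfolding chebU_mult_shift by (simp only: algebra_simps)
      finally show ?thesis using less[of "Suc r" "Suc (Suc a')"] less[of "Suc r" a'] less[of r a] 3 Suc
        by (simp del: chebU.simps)
    qed
  qed
qed

end

section \<open>Chebyshev polynomials of the first kind in the shifted variable\<close>

lemma chebyshev_T_unique:
  assumes "\<And>\<theta>. poly p (cos \<theta>) = cos (real k * \<theta>)"
  shows "chebyshev_T k = p"
  using ex1_chebyshev[of k] poly_chebyshev_T_cos[of k] assms by blast

lemma chebyshev_T_0: "chebyshev_T 0 = 1"
  by (rule chebyshev_T_unique) simp

lemma chebyshev_T_1: "chebyshev_T (Suc 0) = [:0, 1:]"
  by (rule chebyshev_T_unique) simp

lemma chebyshev_T_Suc_Suc: "chebyshev_T (Suc (Suc k)) = [:0, 2:] * chebyshev_T (Suc k) - chebyshev_T k"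
proof (rule chebyshev_T_unique)
  fix \<theta> :: real
  have "cos (real (Suc k) * \<theta> + \<theta>) + cos (real (Suc k) * \<theta> - \<theta>) = 2 * cos \<theta> * cos (real (Suc k) * \<theta>)"
    by (simp add: cos_add cos_diff)
  then show "poly ([:0, 2:] * chebyshev_T (Suc k) - chebyshev_T k) (cos \<theta>) = cos (real (Suc (Suc k)) * \<theta>)"
    by (simp add: poly_chebyshev_T_cos algebra_simps)
qed

text \<open>The polynomial that turns H / h into T_k(W), since
  \<open>W = (H / h - \<kappa>) / 2\<close> with \<kappa> the sum of the two dimensions divided by
  \<open>h\<close>.\<close>

definition chebT :: "real \<Rightarrow> nat \<Rightarrow> real poly" where
  "chebT \<kappa> k = chebyshev_T k \<circ>\<^sub>p [:- \<kappa> / 2, 1 / 2:]"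

lemma chebT_0: "chebT \<kappa> 0 = 1"
  by (simp add: chebT_def chebyshev_T_0)

lemma chebT_1: "chebT \<kappa> (Suc 0) = [:- \<kappa> / 2, 1 / 2:]"
  by (simp add: chebT_def chebyshev_T_1 pcompose_pCons)

lemma chebT_Suc_Suc: "chebT \<kappa> (Suc (Suc k)) = [:- \<kappa>, 1:] * chebT \<kappa> (Suc k) - chebT \<kappa> k"
proof -
  have "[:0, 2:] \<circ>\<^sub>p [:- \<kappa> / 2, 1 / 2:] = [:- \<kappa>, 1:]" by (simp add: pcompose_pCons)
  then show ?thesis unfolding chebT_def chebyshev_T_Suc_Suc pcompose_diff pcompose_mult by simp
qed

text \<open>The identity 2 T_k = U_k - U_(k - 2); it enters when the recursion of
  \<open>chebT\<close> is differentiated.\<close>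

lemma chebT_chebU: "Polynomial.smult 2 (chebT \<kappa> (Suc (Suc k))) = chebU \<kappa> (Suc (Suc k)) - chebU \<kappa> k"
proof (induction k rule: less_induct)
  case (less k)
  have base: "Polynomial.smult 2 (chebT \<kappa> (Suc 0)) = [:- \<kappa>, 1:]" by (simp add: chebT_1)
  have rec: "Polynomial.smult 2 (chebT \<kappa> (Suc (Suc k))) = [:- \<kappa>, 1:] * Polynomial.smult 2 (chebT \<kappa> (Suc k)) - Polynomial.smult 2 (chebT \<kappa> k)" for k
    unfolding chebT_Suc_Suc by (simp add: smult_diff_right)
  consider "k = 0" | "k = 1" | r where "k = Suc (Suc r)" by (metis One_nat_def not0_implies_Suc)
  then show ?case
  proof cases
    case 1
    then show ?thesis by (simp add: rec base chebT_0 one_pCons)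
  next
    case 2
    have *: "Polynomial.smult 2 (chebT \<kappa> (Suc (Suc 0))) = chebU \<kappa> (Suc (Suc 0)) - chebU \<kappa> 0" by (simp add: rec base chebT_0 one_pCons)
    have gen: "X * (U - 1) - X = X * U - X - X" for X U :: "real poly" by (simp add: right_diff_distrib)
    show ?thesis unfolding 2 One_nat_def rec[of "Suc 0"] * base chebU.simps(3)[of \<kappa> "Suc 0"] chebU.simps(1,2) by (rule gen)
  next
    case (3 r)
    have "Polynomial.smult 2 (chebT \<kappa> (Suc (Suc k))) =
      [:- \<kappa>, 1:] * (chebU \<kappa> (Suc (Suc (Suc r))) - chebU \<kappa> (Suc r)) - (chebU \<kappa> (Suc (Suc r)) - chebU \<kappa> r)"
      unfolding rec[of k] using less[of r] less[of "Suc r"] 3 by simp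
    also have "\<dots> = chebU \<kappa> (Suc (Suc k)) - chebU \<kappa> k"
      unfolding 3 chebU.simps(3)[of \<kappa> "Suc (Suc r)"] chebU.simps(3)[of \<kappa> r] by (simp only: algebra_simps)
    finally show ?thesis .
  qed
qed

text \<open>The classical T_k' = k U_(k - 1); the 2 on the left undoes the inner derivative 1/2 of
  the shifted variable.\<close>

lemma pderiv_chebT: "Polynomial.smult 2 (pderiv (chebT \<kappa> (Suc k))) = Polynomial.smult (real (Suc k)) (chebU \<kappa> k)"
proof (induction k rule: less_induct)
  case (less k)
  have rec: "Polynomial.smult 2 (pderiv (chebT \<kappa> (Suc (Suc k)))) = Polynomial.smult 2 (chebT \<kappa> (Suc k)) +
     [:- \<kappa>, 1:] * Polynomial.smult 2 (pderiv (chebT \<kappa> (Suc k))) - Polynomial.smult 2 (pderiv (chebT \<kappa> k))" for k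
    unfolding chebT_Suc_Suc pderiv_diff pderiv_mult by (simp add: pderiv_pCons smult_diff_right smult_add_right)
  consider "k = 0" | "k = 1" | r where "k = Suc (Suc r)" by (metis One_nat_def not0_implies_Suc)
  then show ?case
  proof cases
    case 1
    then show ?thesis by (simp add: chebT_1 pderiv_pCons one_pCons)
  next
    case 2
    have "Polynomial.smult 2 (pderiv (chebT \<kappa> (Suc 0))) = 1" by (simp add: chebT_1 pderiv_pCons one_pCons)
    then show ?thesis using 2 rec[of 0] by (simp add: chebT_0 chebT_1 pderiv_1)
  next
    case (3 r)
    have "Polynomial.smult 2 (pderiv (chebT \<kappa> (Suc k))) = (chebU \<kappa> (Suc (Suc r)) - chebU \<kappa> r) +
      [:- \<kappa>, 1:] * Polynomial.smult (real (Suc (Suc r))) (chebU \<kappa> (Suc r)) - Polynomial.smult (real (Suc r)) (chebU \<kappa> r)"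
      unfolding 3 rec[of "Suc r"] chebT_chebU using less[of r] less[of "Suc r"] 3 by simp
    also have "\<dots> = (chebU \<kappa> (Suc (Suc r)) - chebU \<kappa> r) +
      Polynomial.smult (real (Suc (Suc r))) (chebU \<kappa> (Suc (Suc r)) + chebU \<kappa> r) - Polynomial.smult (real (Suc r)) (chebU \<kappa> r)"
      unfolding mult_smult_right by (simp only: chebU.simps(3) diff_add_cancel)
    also have "\<dots> = Polynomial.smult (real (Suc k)) (chebU \<kappa> k)"
      unfolding 3 by (rule poly_eqI) (simp add: algebra_simps del: chebU.simps)
    finally show ?thesis .
  qed
qed

lemma degree_chebT: "degree (chebT \<kappa> k) \<le> k"
proof (induction k rule: less_induct)
  case (less k)
  consider "k = 0" | "k = 1" | r where "k = Suc (Suc r)" by (metis One_nat_def not0_implies_Suc)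
  then show ?case
  proof cases
    case (3 r)
    have "degree ([:- \<kappa>, 1:] * chebT \<kappa> (Suc r)) \<le> 1 + Suc r"
      using degree_mult_le[of "[:- \<kappa>, 1:]" "chebT \<kappa> (Suc r)"] less[of "Suc r"] 3 by simp
    then show ?thesis unfolding 3 chebT_Suc_Suc using less[of r] 3 by (intro degree_diff_le) auto
  qed (auto simp: chebT_0 chebT_1)
qed

text \<open>The leading coefficient 2^(n - 1) of T_n times the factor 2^(-n) from the scaling of the
  variable.\<close>

lemma coeff_chebT_self: "coeff (chebT \<kappa> (Suc k)) (Suc k) = 1 / 2"
proof (induction k)
  case 0
  then show ?case by (simp add: chebT_1)
next
  case (Suc k)
  have "coeff (chebT \<kappa> (Suc k)) (Suc (Suc k)) = 0" "coeff (chebT \<kappa> k) (Suc (Suc k)) = 0"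
    using degree_chebT[of \<kappa> "Suc k"] degree_chebT[of \<kappa> k] by (auto intro!: coeff_eq_0)
  then show ?case unfolding chebT_Suc_Suc mult_shift using Suc by simp
qed

text \<open>Before the limit \<kappa> depends on \<open>N\<close>, and the polynomials vary with it.
  With bounded degrees, coefficientwise convergence suffices because \<open>poly_mom\<close> is then
  a fixed finite sum.\<close>

definition coeffs_tendsto :: "(nat \<Rightarrow> real poly) \<Rightarrow> real poly \<Rightarrow> bool" where
  "coeffs_tendsto P p \<longleftrightarrow> (\<forall>i. (\<lambda>N. coeff (P N) i) \<longlonglongrightarrow> coeff p i)"

lemma coeffs_tendsto_mult: "coeffs_tendsto P p \<Longrightarrow> coeffs_tendsto Q q \<Longrightarrow> coeffs_tendsto (\<lambda>N. P N * Q N) (p * q)"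
  unfolding coeffs_tendsto_def coeff_mult by (auto intro!: tendsto_intros)

lemma coeffs_tendsto_diff: "coeffs_tendsto P p \<Longrightarrow> coeffs_tendsto Q q \<Longrightarrow> coeffs_tendsto (\<lambda>N. P N - Q N) (p - q)"
  unfolding coeffs_tendsto_def coeff_diff by (auto intro!: tendsto_intros)

lemma coeffs_tendsto_const: "coeffs_tendsto (\<lambda>N. p) p"
  unfolding coeffs_tendsto_def by auto

lemma coeffs_tendsto_linear: "\<kappa>N \<longlonglongrightarrow> \<kappa> \<Longrightarrow> coeffs_tendsto (\<lambda>N. [:- \<kappa>N N, 1:]) [:- \<kappa>, 1:]"
  unfolding coeffs_tendsto_def coeff_pCons by (auto split: nat.split intro!: tendsto_intros)

lemma coeffs_tendsto_chebU: "\<kappa>N \<longlonglongrightarrow> \<kappa> \<Longrightarrow> coeffs_tendsto (\<lambda>N. chebU (\<kappa>N N) q) (chebU \<kappa> q)"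
proof (induction q rule: less_induct)
  case (less q)
  consider "q = 0" | "q = 1" | r where "q = Suc (Suc r)" by (metis One_nat_def not0_implies_Suc)
  then show ?case
  proof cases
    case (3 r)
    then show ?thesis unfolding 3 chebU.simps
      by (intro coeffs_tendsto_diff coeffs_tendsto_mult coeffs_tendsto_linear less) (auto simp: 3)
  qed (auto intro: coeffs_tendsto_const coeffs_tendsto_linear less.prems)
qed

lemma coeffs_tendsto_chebT: "\<kappa>N \<longlonglongrightarrow> \<kappa> \<Longrightarrow> coeffs_tendsto (\<lambda>N. chebT (\<kappa>N N) q) (chebT \<kappa> q)"
proof (induction q rule: less_induct)
  case (less q)
  consider "q = 0" | "q = 1" | r where "q = Suc (Suc r)" by (metis One_nat_def not0_implies_Suc)
  then show ?case
  proof cases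
    case 2
    have "(\<lambda>N. - \<kappa>N N / 2) \<longlonglongrightarrow> - \<kappa> / 2" by (intro tendsto_intros less.prems) auto
    then show ?thesis unfolding 2 by (auto simp: chebT_1 coeffs_tendsto_def coeff_pCons split: nat.split)
  next
    case (3 r)
    then show ?thesis unfolding 3 chebT_Suc_Suc
      by (intro coeffs_tendsto_diff coeffs_tendsto_mult coeffs_tendsto_linear less) (auto simp: 3)
  qed (simp add: chebT_0 coeffs_tendsto_const)
qed

lemma tendsto_poly_mom:
  assumes "coeffs_tendsto P p" "\<And>i. (\<lambda>N. \<phi>N N i) \<longlonglongrightarrow> \<phi> i" "\<And>N. degree (P N) \<le> d"
  shows "(\<lambda>N. poly_mom (\<phi>N N) (P N)) \<longlonglongrightarrow> poly_mom \<phi> p"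
proof -
  have "coeff p i = 0" if "i > d" for i
  proof -
    have "(\<lambda>N. coeff (P N) i) = (\<lambda>N. 0)" by (intro ext coeff_eq_0 le_less_trans[OF assms(3) that])
    then have "(\<lambda>N. 0 :: real) \<longlonglongrightarrow> coeff p i" using assms(1) unfolding coeffs_tendsto_def by metis
    then show ?thesis by (simp add: LIMSEQ_const_iff)
  qed
  then have "degree p \<le> d" by (rule degree_le[rule_format])
  then show ?thesis
    using assms unfolding coeffs_tendsto_def by (simp add: poly_mom_ge[of _ d]) (intro tendsto_intros, auto)
qed

subsection \<open>Limits of traces and energies\<close>

lemma poly_mom_mult:
  assumes "degree p \<le> d" "degree q \<le> d'"
  shows "poly_mom m (p * q) = (\<Sum>i\<le>d. \<Sum>j\<le>d'. coeff p i * coeff q j * m (i + j))"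
proof -
  have "p * q = (\<Sum>i\<le>d. monom (coeff p i) i) * (\<Sum>j\<le>d'. monom (coeff q j) j)"
    using poly_as_sum_of_monoms'[OF assms(1)] poly_as_sum_of_monoms'[OF assms(2)] by simp
  also have "\<dots> = (\<Sum>i\<le>d. \<Sum>j\<le>d'. monom (coeff p i * coeff q j) (i + j))"
    unfolding sum_product by (simp add: mult_monom)
  finally show ?thesis by (simp add: poly_mom_sum)
qed

text \<open>\<open>h\<close> is the geometric mean of the dimensions; at this scale
  \<open>\<alpha> * \<beta> = 1\<close>, and the weighted limit law has variance 1.\<close>

locale sizes =
  fixes S T :: "nat \<Rightarrow> 'v set" and h :: "nat \<Rightarrow> real" and \<alpha> \<beta> :: real
  assumes finS: "finite (S N)" and finT: "finite (T N)" and disj: "S N \<inter> T N = {}"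
    and neS: "S N \<noteq> {}" and neT: "T N \<noteq> {}"
    and h_def: "h N = sqrt (real (card (S N)) * real (card (T N)))"
    and h_top: "filterlim h at_top sequentially"
    and lim_S: "(\<lambda>N. real (card (S N)) / h N) \<longlonglongrightarrow> \<alpha>"
    and lim_T: "(\<lambda>N. real (card (T N)) / h N) \<longlonglongrightarrow> \<beta>"
begin

lemma h_pos: "h N > 0"
  unfolding h_def using finS[of N] finT[of N] neS[of N] neT[of N] by (simp add: card_gt_0_iff)

lemma h_square: "h N ^ 2 = real (card (S N)) * real (card (T N))"
  unfolding h_def by simp

lemma h_inverse: "(\<lambda>N. 1 / h N) \<longlonglongrightarrow> 0"
  using tendsto_inverse_0_at_top[OF h_top] by (simp add: inverse_eq_divide)

definition \<kappa>N :: "nat \<Rightarrow> real" where "\<kappa>N N = (real (card (S N)) + real (card (T N))) / h N"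

lemma lim_\<kappa>: "\<kappa>N \<longlonglongrightarrow> \<alpha> + \<beta>"
  unfolding \<kappa>N_def add_divide_distrib by (intro tendsto_add lim_S lim_T)

lemma limits_mult: "\<alpha> * \<beta> = 1"
proof -
  have "(\<lambda>N. real (card (S N)) / h N * (real (card (T N)) / h N)) \<longlonglongrightarrow> \<alpha> * \<beta>"
    by (intro tendsto_mult lim_S lim_T)
  moreover have "(\<lambda>N. real (card (S N)) / h N * (real (card (T N)) / h N)) = (\<lambda>N. 1)"
  proof
    fix N
    have "real (card (S N)) / h N * (real (card (T N)) / h N) = (real (card (S N)) * real (card (T N))) / h N ^ 2"
      by (simp add: power2_eq_square)
    also have "real (card (S N)) * real (card (T N)) = h N ^ 2" by (rule h_square[symmetric])
    also have "h N ^ 2 / h N ^ 2 = 1" using h_pos[of N] by simp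
    finally show "real (card (S N)) / h N * (real (card (T N)) / h N) = 1" .
  qed
  ultimately show ?thesis by (simp add: LIMSEQ_const_iff)
qed

lemma card_Un: "real (card (S N \<union> T N)) = \<kappa>N N * h N"
  using card_Un_disjoint[OF finS finT disj, of N] h_pos[of N] by (simp add: \<kappa>N_def)

lemma vertices_bound: "\<exists>K>0. \<forall>N. real (card (S N \<union> T N)) \<le> K * h N"
proof -
  have "Bseq \<kappa>N" by (intro convergent_imp_Bseq convergentI) (rule lim_\<kappa>)
  then obtain K where K: "K > 0" "\<And>N. norm (\<kappa>N N) \<le> K" by (auto elim: BseqE)
  have "real (card (S N \<union> T N)) \<le> K * h N" for N
    unfolding card_Un using K(2)[of N] h_pos[of N] by (intro mult_right_mono) auto
  then show ?thesis using K(1) by blast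
qed

text \<open>The normalization has one power of the size more than the quantity, and the number of
  vertices is at most a multiple of \<open>h\<close>.\<close>

lemma negligible:
  assumes X: "\<And>N. \<bar>X N\<bar> \<le> C * real (card (S N \<union> T N)) ^ d" and a: "Bseq a"
  shows "(\<lambda>N. a N / h N ^ Suc d * X N) \<longlonglongrightarrow> 0"
proof -
  obtain K where K: "K > 0" "\<And>N. real (card (S N \<union> T N)) \<le> K * h N" using vertices_bound by blast
  obtain A where A: "A > 0" "\<And>N. norm (a N) \<le> A" using a by (auto elim: BseqE)
  have "norm (a N / h N ^ Suc d * X N) \<le> A * \<bar>C\<bar> * K ^ d * (1 / h N)" for N
  proof -
    have "\<bar>X N\<bar> \<le> \<bar>C\<bar> * real (card (S N \<union> T N)) ^ d"
    proof (rule order_trans[OF X])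
      show "C * real (card (S N \<union> T N)) ^ d \<le> \<bar>C\<bar> * real (card (S N \<union> T N)) ^ d"
        by (intro mult_right_mono) auto
    qed
    also have "\<dots> \<le> \<bar>C\<bar> * (K * h N) ^ d" by (intro mult_left_mono power_mono K) auto
    finally have "\<bar>X N\<bar> \<le> \<bar>C\<bar> * K ^ d * h N ^ d" by (simp add: power_mult_distrib)
    then have "\<bar>a N\<bar> * \<bar>X N\<bar> \<le> A * (\<bar>C\<bar> * K ^ d * h N ^ d)" using A by (intro mult_mono) auto
    then have "\<bar>a N\<bar> * \<bar>X N\<bar> / h N ^ Suc d \<le> A * (\<bar>C\<bar> * K ^ d * h N ^ d) / h N ^ Suc d"
      using h_pos[of N] by (intro divide_right_mono) auto
    also have "\<dots> = A * \<bar>C\<bar> * K ^ d * (1 / h N)" using h_pos[of N] by (simp add: field_simps)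
    finally show ?thesis using h_pos[of N] by (simp add: abs_mult)
  qed
  moreover have "(\<lambda>N. A * \<bar>C\<bar> * K ^ d * (1 / h N)) \<longlonglongrightarrow> 0"
    using tendsto_mult_left[OF h_inverse, of "A * \<bar>C\<bar> * K ^ d"] by simp
  ultimately show ?thesis by (intro Lim_null_comparison[of "\<lambda>N. a N / h N ^ Suc d * X N" "\<lambda>N. A * \<bar>C\<bar> * K ^ d * (1 / h N)"] always_eventually allI) auto
qed

end

context sizes
begin

text \<open>Traces based in \<open>S\<close> and in \<open>T\<close> are followed together, since
  the recursion alternates between them. From index 1 on their limits agree, like the traces of
  powers of A A^T and A^T A; at index 0 they are \<alpha> and \<beta>. The two outer terms of the
  convolution therefore give \<alpha> + \<beta> times the preceding moment.\<close>

lemma trace_limits: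
  assumes "moments m"
  shows "\<exists>\<phi>. mp_moments (\<alpha> + \<beta>) \<phi> \<and> (\<forall>i. (\<lambda>N. moments.tr m (S N) (T N) (Suc i) / h N ^ (i + 2)) \<longlonglongrightarrow> \<phi> i)"
proof -
  interpret moments m by fact
  define a where "a n N = tr (S N) (T N) n / h N ^ Suc n" for n N
  define b where "b n N = tr (T N) (S N) n / h N ^ Suc n" for n N
  have rec: "(\<lambda>N. a (Suc n) N - (\<Sum>s\<le>n. b s N * a (n - s) N)) \<longlonglongrightarrow> 0"
     "(\<lambda>N. b (Suc n) N - (\<Sum>s\<le>n. a s N * b (n - s) N)) \<longlonglongrightarrow> 0" for n
  proof -
    obtain C where C: "\<forall>S T :: 'v set. finite S \<longrightarrow> finite T \<longrightarrow> S \<inter> T = {} \<longrightarrow>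
     \<bar>tr S T (Suc n) - (\<Sum>s\<le>n. tr T S s * tr S T (n - s))\<bar> \<le> C * real (card (S \<union> T)) ^ (n + 1)"
      using walk_sum_recursion[where 'v = 'v and n = n] by blast
    have 1: "(\<lambda>N. 1 / h N ^ Suc (n + 1) * (tr (S N) (T N) (Suc n) - (\<Sum>s\<le>n. tr (T N) (S N) s * tr (S N) (T N) (n - s)))) \<longlonglongrightarrow> 0"
      using C finS finT disj by (intro negligible[where C = C]) auto
    have 2: "(\<lambda>N. 1 / h N ^ Suc (n + 1) * (tr (T N) (S N) (Suc n) - (\<Sum>s\<le>n. tr (S N) (T N) s * tr (T N) (S N) (n - s)))) \<longlonglongrightarrow> 0"
    proof (intro negligible[where C = C])
      fix N
      show "\<bar>tr (T N) (S N) (Suc n) - (\<Sum>s\<le>n. tr (S N) (T N) s * tr (T N) (S N) (n - s))\<bar> \<le> C * real (card (S N \<union> T N)) ^ (n + 1)"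
        using C[rule_format, OF finT[of N] finS[of N]] disj[of N] by (simp add: Un_commute Int_commute)
    qed auto
    have pw: "h N ^ Suc s * h N ^ Suc (n - s) = h N ^ Suc (n + 1)" if "s \<le> n" for s N
    proof -
      have "h N ^ Suc s * h N ^ Suc (n - s) = h N ^ (Suc s + Suc (n - s))" by (rule power_add[symmetric])
      also have "Suc s + Suc (n - s) = Suc (n + 1)" using that by simp
      finally show ?thesis .
    qed
    have e1: "1 / h N ^ Suc (n + 1) * (tr (S N) (T N) (Suc n) - (\<Sum>s\<le>n. tr (T N) (S N) s * tr (S N) (T N) (n - s)))
      = a (Suc n) N - (\<Sum>s\<le>n. b s N * a (n - s) N)" for N
    proof -
      have "(\<Sum>s\<le>n. b s N * a (n - s) N) = (\<Sum>s\<le>n. tr (T N) (S N) s * tr (S N) (T N) (n - s) / h N ^ Suc (n + 1))"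
        unfolding a_def b_def times_divide_times_eq by (rule sum.cong[OF refl], subst pw) auto
      then show ?thesis unfolding a_def by (simp add: sum_divide_distrib[symmetric] diff_divide_distrib)
    qed
    have e2: "1 / h N ^ Suc (n + 1) * (tr (T N) (S N) (Suc n) - (\<Sum>s\<le>n. tr (S N) (T N) s * tr (T N) (S N) (n - s)))
      = b (Suc n) N - (\<Sum>s\<le>n. a s N * b (n - s) N)" for N
    proof -
      have "(\<Sum>s\<le>n. a s N * b (n - s) N) = (\<Sum>s\<le>n. tr (S N) (T N) s * tr (T N) (S N) (n - s) / h N ^ Suc (n + 1))"
        unfolding a_def b_def times_divide_times_eq by (rule sum.cong[OF refl], subst pw) auto
      then show ?thesis unfolding b_def by (simp add: sum_divide_distrib[symmetric] diff_divide_distrib)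
    qed
    show "(\<lambda>N. a (Suc n) N - (\<Sum>s\<le>n. b s N * a (n - s) N)) \<longlonglongrightarrow> 0"
     "(\<lambda>N. b (Suc n) N - (\<Sum>s\<le>n. a s N * b (n - s) N)) \<longlonglongrightarrow> 0"
      using 1 2 unfolding e1 e2 by auto
  qed
  have a0: "a 0 \<longlonglongrightarrow> \<alpha>" and b0: "b 0 \<longlonglongrightarrow> \<beta>"
    using lim_S lim_T unfolding a_def b_def by (simp_all add: tr_0 finS finT)
  have conv: "\<forall>n\<le>k. convergent (a n) \<and> convergent (b n)" for k
  proof (induction k)
    case 0
    then show ?case using a0 b0 by (auto intro: convergentI)
  next
    case (Suc k)
    then have c: "a n \<longlonglongrightarrow> lim (a n)" "b n \<longlonglongrightarrow> lim (b n)" if "n \<le> k" for n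
      using that by (auto simp: convergent_LIMSEQ_iff)
    have "(\<lambda>N. (a (Suc k) N - (\<Sum>s\<le>k. b s N * a (k - s) N)) + (\<Sum>s\<le>k. b s N * a (k - s) N)) \<longlonglongrightarrow>
        0 + (\<Sum>s\<le>k. lim (b s) * lim (a (k - s)))"
      by (intro tendsto_intros rec c) auto
    then have "convergent (a (Suc k))" by (auto intro: convergentI)
    moreover have "(\<lambda>N. (b (Suc k) N - (\<Sum>s\<le>k. a s N * b (k - s) N)) + (\<Sum>s\<le>k. a s N * b (k - s) N)) \<longlonglongrightarrow>
        0 + (\<Sum>s\<le>k. lim (a s) * lim (b (k - s)))"
      by (intro tendsto_intros rec c) auto
    then have "convergent (b (Suc k))" by (auto intro: convergentI)
    ultimately show ?case using Suc by (auto simp: le_Suc_eq)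
  qed
  define g where "g n = lim (a n)" for n
  define g' where "g' n = lim (b n)" for n
  have ga: "a n \<longlonglongrightarrow> g n" and gb: "b n \<longlonglongrightarrow> g' n" for n
    using conv[of n] unfolding g_def g'_def by (auto simp: convergent_LIMSEQ_iff)
  have g0: "g 0 = \<alpha>" "g' 0 = \<beta>" using LIMSEQ_unique[OF ga a0] LIMSEQ_unique[OF gb b0] by auto
  have gS: "g (Suc n) = (\<Sum>s\<le>n. g' s * g (n - s))" for n
  proof -
    have "(\<lambda>N. a (Suc n) N - (\<Sum>s\<le>n. b s N * a (n - s) N)) \<longlonglongrightarrow> g (Suc n) - (\<Sum>s\<le>n. g' s * g (n - s))"
      by (intro tendsto_intros ga gb)
    from LIMSEQ_unique[OF this rec(1)[of n]] show ?thesis by simp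
  qed
  have g'S: "g' (Suc n) = g (Suc n)" for n
  proof -
    have "(\<lambda>N. b (Suc n) N - (\<Sum>s\<le>n. a s N * b (n - s) N)) \<longlonglongrightarrow> g' (Suc n) - (\<Sum>s\<le>n. g s * g' (n - s))"
      by (intro tendsto_intros ga gb)
    from LIMSEQ_unique[OF this rec(2)[of n]] have "g' (Suc n) = (\<Sum>s\<le>n. g s * g' (n - s))" by simp
    also have "\<dots> = (\<Sum>s\<le>n. g' s * g (n - s))"
      by (rule sum.reindex_bij_witness[of _ "\<lambda>s. n - s" "\<lambda>s. n - s"]) auto
    finally show ?thesis using gS by simp
  qed
  have "mp_moments (\<alpha> + \<beta>) (\<lambda>i. g (Suc i))"
    unfolding mp_moments_def
  proof (intro conjI allI)
    show "g (Suc 0) = 1" using gS[of 0] g0 limits_mult by (simp add: mult.commute)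
    fix n
    have "g (Suc (Suc n)) = g' 0 * g (Suc n) + (\<Sum>s\<le>n. g' (Suc s) * g (n - s))"
      unfolding gS[of "Suc n"] by (subst sum.atMost_Suc_shift) simp
    also have "(\<Sum>s\<le>n. g' (Suc s) * g (n - s)) = (\<Sum>s<n. g' (Suc s) * g (n - s)) + g' (Suc n) * g 0"
      by (simp add: lessThan_Suc_atMost[symmetric])
    also have "(\<Sum>s<n. g' (Suc s) * g (n - s)) = (\<Sum>s<n. g (Suc s) * g (Suc (n - 1 - s)))"
      by (intro sum.cong refl) (simp add: g'S Suc_diff_Suc)
    finally show "g (Suc (Suc n)) = (\<alpha> + \<beta>) * g (Suc n) + (\<Sum>s<n. g (Suc s) * g (Suc (n - 1 - s)))"
      by (simp add: g0 g'S algebra_simps)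
  qed
  moreover have "(\<lambda>N. tr (S N) (T N) (Suc i) / h N ^ (i + 2)) \<longlonglongrightarrow> g (Suc i)" for i
    using ga[of "Suc i"] unfolding a_def by simp
  ultimately show ?thesis by (intro exI[of _ "\<lambda>i. g (Suc i)"]) auto
qed

text \<open>The coefficient in Tr T_k(W) of the sum over the closed walks of index
  \<open>n\<close>.\<close>

definition cf :: "nat \<Rightarrow> nat \<Rightarrow> nat \<Rightarrow> real" where
  "cf k N n = coeff (chebT (\<kappa>N N) k) n / h N ^ n"

lemma Bseq_coeff: "Bseq (\<lambda>N. coeff (chebT (\<kappa>N N) k) n)"
  using coeffs_tendsto_chebT[OF lim_\<kappa>, of k] unfolding coeffs_tendsto_def
  by (intro convergent_imp_Bseq convergentI) (rule spec)

lemma negligible_pair: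
  assumes "\<And>N. \<bar>X N\<bar> \<le> C * real (card (S N \<union> T N)) ^ (n + n' - 1)" "n + n' \<ge> 1"
  shows "(\<lambda>N. cf k N n * cf k N n' * X N) \<longlonglongrightarrow> 0"
proof -
  have "(\<lambda>N. (coeff (chebT (\<kappa>N N) k) n * coeff (chebT (\<kappa>N N) k) n') / h N ^ Suc (n + n' - 1) * X N) \<longlonglongrightarrow> 0"
    by (intro negligible[OF assms(1)] Bseq_mult Bseq_coeff)
  moreover have "cf k N n * cf k N n' = (coeff (chebT (\<kappa>N N) k) n * coeff (chebT (\<kappa>N N) k) n') / h N ^ Suc (n + n' - 1)" for N
  proof -
    have "Suc (n + n' - 1) = n + n'" using assms(2) by simp
    then show ?thesis unfolding cf_def times_divide_times_eq power_add[symmetric] by (simp only:)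
  qed
  ultimately show ?thesis by (simp only:)
qed

text \<open>A form on pairs of walks, extended bilinearly to the expansion of Tr T_k(W) in both
  arguments.\<close>

definition pairsum :: "('v list \<Rightarrow> 'v list \<Rightarrow> real) \<Rightarrow> nat \<Rightarrow> nat \<Rightarrow> real" where
  "pairsum F k N = (\<Sum>n\<le>k. \<Sum>n'\<le>k. cf k N n * cf k N n' *
      (\<Sum>w\<in>cwalks (S N) (T N) n. \<Sum>w'\<in>cwalks (S N) (T N) n'. F w w'))"

lemma pairsum_diff: "pairsum (\<lambda>w w'. F w w' - G w w') k N = pairsum F k N - pairsum G k N"
  by (simp add: pairsum_def sum_subtractf algebra_simps)

lemma pairsum_cmult: "pairsum (\<lambda>w w'. c * F w w') k N = c * pairsum F k N"
  by (simp add: pairsum_def sum_distrib_left algebra_simps)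

text \<open>The exponent is one below the power of \<open>h\<close> in the coefficients, except at
  \<open>n = n' = 0\<close>, where truncated subtraction loses this gain; there the form has to
  vanish by itself.\<close>

lemma pairsum_negligible:
  assumes "\<And>n n'. \<exists>C. \<forall>S T :: 'v set. finite S \<longrightarrow> finite T \<longrightarrow>
     \<bar>\<Sum>w\<in>cwalks S T n. \<Sum>w'\<in>cwalks S T n'. F w w'\<bar> \<le> C * real (card (S \<union> T)) ^ (n + n' - 1)"
    and F0: "\<And>N w w'. w \<in> cwalks (S N) (T N) 0 \<Longrightarrow> w' \<in> cwalks (S N) (T N) 0 \<Longrightarrow> F w w' = 0"
  shows "(\<lambda>N. pairsum F k N) \<longlonglongrightarrow> 0"
proof -
  have "(\<lambda>N. cf k N n * cf k N n' * (\<Sum>w\<in>cwalks (S N) (T N) n. \<Sum>w'\<in>cwalks (S N) (T N) n'. F w w')) \<longlonglongrightarrow> 0" for n n'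
  proof (cases "n + n' \<ge> 1")
    case True
    from assms(1)[of n' n] obtain C where C: "\<forall>S T :: 'v set. finite S \<longrightarrow> finite T \<longrightarrow>
     \<bar>\<Sum>w\<in>cwalks S T n. \<Sum>w'\<in>cwalks S T n'. F w w'\<bar> \<le> C * real (card (S \<union> T)) ^ (n + n' - 1)"
      by (rule exE)
    show ?thesis
      by (rule negligible_pair[where C = C, OF _ True]) (rule C[rule_format, OF finS finT])
  next
    case False
    then have "n = 0" "n' = 0" by auto
    then have "(\<Sum>w\<in>cwalks (S N) (T N) n. \<Sum>w'\<in>cwalks (S N) (T N) n'. F w w') = 0" for N
      by (intro sum.neutral ballI) (simp add: F0[of _ N])
    then show ?thesis by simp
  qed
  then have "(\<lambda>N. \<Sum>n\<le>k. \<Sum>n'\<le>k. cf k N n * cf k N n' * (\<Sum>w\<in>cwalks (S N) (T N) n. \<Sum>w'\<in>cwalks (S N) (T N) n'. F w w')) \<longlonglongrightarrow> (\<Sum>n\<le>k. \<Sum>n'\<le>k. 0)"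
    by (intro tendsto_sum)
  then show ?thesis unfolding pairsum_def by simp
qed

lemma path_edges_cwalks_0: "w \<in> cwalks A B 0 \<Longrightarrow> path_edges w = []"
  using cwalksD(6)[of w A B 0] by (metis length_0_conv mult_0_right)

text \<open>By the scalar products of the gradients the sum is the mean of \<open>(2 * P')^2\<close>
  with \<open>P\<close> the polynomial \<open>chebT\<close>: the trace of index
  \<open>n + n' - 1\<close> is a moment of the weighted law. Here \<open>2 * P'\<close> is
  \<open>Suc k\<close> times \<open>chebU\<close> of index \<open>k\<close>, which has norm 1 in the
  limit.\<close>

lemma dd_limit:
  assumes iid: "iid_array M Xe I m" and I: "\<And>N. bip_edges (S N) (T N) \<subseteq> I"
  shows "(\<lambda>N. pairsum (\<lambda>w w'. moments.dd m (path_edges w) (path_edges w')) (Suc k) N) \<longlonglongrightarrow> real (Suc k) ^ 2"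
proof -
  interpret iid_array M Xe I m by fact
  obtain \<phi> where \<phi>: "mp_moments (\<alpha> + \<beta>) \<phi>" and lim: "\<And>i. (\<lambda>N. tr (S N) (T N) (Suc i) / h N ^ (i + 2)) \<longlonglongrightarrow> \<phi> i"
    using trace_limits[OF moments_axioms] by blast
  define \<phi>N where "\<phi>N N i = tr (S N) (T N) (Suc i) / h N ^ (i + 2)" for N i
  have eq: "pairsum (\<lambda>w w'. dd (path_edges w) (path_edges w')) (Suc k) N =
      real (Suc k) ^ 2 * poly_mom (\<phi>N N) (chebU (\<kappa>N N) k * chebU (\<kappa>N N) k)" for N
  proof -
    let ?c = "\<lambda>n. coeff (chebT (\<kappa>N N) (Suc k)) n"
    let ?P = "pderiv (chebT (\<kappa>N N) (Suc k))"
    have Q: "(\<Sum>w\<in>cwalks (S N) (T N) n. \<Sum>w'\<in>cwalks (S N) (T N) n'. dd (path_edges w) (path_edges w')) =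
       4 * real n * real n' * tr (S N) (T N) (n + n' - 1)" for n n'
    proof (cases "n = 0 \<or> n' = 0")
      case True
      then have "dd (path_edges w) (path_edges w') = 0" if "w \<in> cwalks (S N) (T N) n" "w' \<in> cwalks (S N) (T N) n'" for w w'
        using that path_edges_cwalks_0[of w "S N" "T N"] path_edges_cwalks_0[of w' "S N" "T N"] by (auto simp: dd_def)
      then show ?thesis using True by auto
    next
      case False
      then show ?thesis using sum_dd_cwalks[OF iid finS finT disj I] by simp
    qed
    have sh: "(\<Sum>n\<le>Suc k. \<Sum>n'\<le>Suc k. G n n') = (\<Sum>n\<le>k. \<Sum>n'\<le>k. G (Suc n) (Suc n'))"
      if "\<And>n. G 0 n = 0" "\<And>n. G n 0 = 0" for G :: "nat \<Rightarrow> nat \<Rightarrow> real"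
      using that unfolding sum.atMost_Suc_shift by simp
    have "pairsum (\<lambda>w w'. dd (path_edges w) (path_edges w')) (Suc k) N =
      (\<Sum>n\<le>Suc k. \<Sum>n'\<le>Suc k. cf (Suc k) N n * cf (Suc k) N n' * (4 * real n * real n' * tr (S N) (T N) (n + n' - 1)))"
      unfolding pairsum_def Q ..
    also have "\<dots> = (\<Sum>n\<le>k. \<Sum>n'\<le>k. cf (Suc k) N (Suc n) * cf (Suc k) N (Suc n') *
        (4 * real (Suc n) * real (Suc n') * tr (S N) (T N) (Suc (n + n'))))"
      by (subst sh) (simp_all del: sum.atMost_Suc of_nat_Suc)
    also have "\<dots> = (\<Sum>n\<le>k. \<Sum>n'\<le>k. 4 * (coeff ?P n * coeff ?P n' * \<phi>N N (n + n')))"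
      using h_pos[of N] by (intro sum.cong refl) (simp add: cf_def \<phi>N_def coeff_pderiv power_add field_simps)
    also have "\<dots> = 4 * poly_mom (\<phi>N N) (?P * ?P)"
    proof -
      have "degree ?P \<le> k" using degree_chebT[of "\<kappa>N N" "Suc k"] by (simp add: degree_pderiv)
      then show ?thesis by (simp add: poly_mom_mult sum_distrib_left)
    qed
    also have "\<dots> = poly_mom (\<phi>N N) (Polynomial.smult 2 ?P * Polynomial.smult 2 ?P)" by simp
    also have "\<dots> = real (Suc k) ^ 2 * poly_mom (\<phi>N N) (chebU (\<kappa>N N) k * chebU (\<kappa>N N) k)"
      unfolding pderiv_chebT by (simp add: power2_eq_square del: of_nat_Suc)
    finally show ?thesis .
  qed
  have "(\<lambda>N. poly_mom (\<phi>N N) (chebU (\<kappa>N N) k * chebU (\<kappa>N N) k)) \<longlonglongrightarrow> poly_mom \<phi> (chebU (\<alpha> + \<beta>) k * chebU (\<alpha> + \<beta>) k)"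
  proof (rule tendsto_poly_mom)
    show "coeffs_tendsto (\<lambda>N. chebU (\<kappa>N N) k * chebU (\<kappa>N N) k) (chebU (\<alpha> + \<beta>) k * chebU (\<alpha> + \<beta>) k)"
      by (intro coeffs_tendsto_mult coeffs_tendsto_chebU lim_\<kappa>)
    have d: "degree (chebU x k) \<le> k" for x
    proof -
      have "degree (Polynomial.smult (real (Suc k)) (chebU x k)) \<le> k"
        unfolding pderiv_chebT[symmetric] using degree_chebT[of x "Suc k"] by (simp add: degree_pderiv)
      then show ?thesis by (simp del: of_nat_Suc)
    qed
    show "degree (chebU (\<kappa>N N) k * chebU (\<kappa>N N) k) \<le> k + k" for N
      by (intro order_trans[OF degree_mult_le] add_mono d)
  qed (use lim in \<open>simp add: \<phi>N_def\<close>)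
  then have "(\<lambda>N. poly_mom (\<phi>N N) (chebU (\<kappa>N N) k * chebU (\<kappa>N N) k)) \<longlonglongrightarrow> 1"
    using chebU_orthonormal[OF \<phi>, of k k] by simp
  from tendsto_mult_left[OF this, of "real (Suc k) ^ 2"] show ?thesis unfolding eq by simp
qed

lemma energy_asymp:
  assumes "moments m"
  shows "(\<lambda>N. pairsum (\<lambda>w w'. moments.energy m (path_edges w) (path_edges w')) k N
     - pairsum (\<lambda>w w'. moments.dd m (path_edges w) (path_edges w')) k N
     - (m 4 - 5) * pairsum (\<lambda>w w'. moments.bb m (path_edges w) (path_edges w')) k N) \<longlonglongrightarrow> 0"
proof -
  interpret moments m by fact
  have "(\<lambda>N. pairsum (\<lambda>w w'. energy (path_edges w) (path_edges w') - dd (path_edges w) (path_edges w')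
      - (m 4 - 5) * bb (path_edges w) (path_edges w')) k N) \<longlonglongrightarrow> 0"
    by (rule pairsum_negligible[OF energy_error]) (simp add: path_edges_cwalks_0 energy_def dd_def bb_def)
  then show ?thesis unfolding pairsum_diff pairsum_cmult .
qed

lemma bb_asymp:
  assumes "moments m" "moments m'"
  shows "(\<lambda>N. pairsum (\<lambda>w w'. moments.bb m (path_edges w) (path_edges w')) k N
     - pairsum (\<lambda>w w'. moments.bb m' (path_edges w) (path_edges w')) k N) \<longlonglongrightarrow> 0"
proof -
  interpret moments m by fact
  interpret m': moments m' by fact
  have "(\<lambda>N. pairsum (\<lambda>w w'. bb (path_edges w) (path_edges w') - m'.bb (path_edges w) (path_edges w')) k N) \<longlonglongrightarrow> 0"
    by (rule pairsum_negligible[OF bb_universal[OF assms(2)]]) (simp add: path_edges_cwalks_0 bb_def m'.bb_def)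
  then show ?thesis unfolding pairsum_diff .
qed

end

subsection \<open>Reduction to cycles\<close>

lemma (in moments) energy_commute: "energy es fs = energy fs es"
proof -
  have "mom m (removeAll e es @ removeAll e fs) = mom m (removeAll e fs @ removeAll e es)" for e
    by (rule mom_cong) simp
  then show ?thesis unfolding energy_def by (simp add: Int_commute add.commute mult.commute)
qed

text \<open>For \<open>k \<ge> 2\<close> this is the second moment of the sum over all cycles, since
  the indicator is the mixed moment of two cycles (\<open>mom_simple_eq\<close>).\<close>

definition same_edge_pairs :: "'v set \<Rightarrow> 'v set \<Rightarrow> nat \<Rightarrow> real" where
  "same_edge_pairs S T k = (\<Sum>w\<in>simple_walks S T k. \<Sum>w'\<in>simple_walks S T k.
     if set (path_edges w) = set (path_edges w') then 1 else 0)"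

context sizes
begin

text \<open>Walks of all lengths in one index set, tagged with half their length;
  \<open>efron_stein\<close> is applied in this form.\<close>

definition walk_index :: "nat \<Rightarrow> nat \<Rightarrow> (nat \<times> 'v list) set" where
  "walk_index k N = (SIGMA n:{..k}. cwalks (S N) (T N) n)"

lemma finite_walk_index: "finite (walk_index k N)"
  unfolding walk_index_def using finS finT by auto

lemma pairsum_eq:
  "pairsum (\<lambda>w w'. F w w') k N = (\<Sum>x\<in>walk_index k N. \<Sum>y\<in>walk_index k N. cf k N (fst x) * cf k N (fst y) * F (snd x) (snd y))"
proof -
  have "(\<Sum>x\<in>walk_index k N. g x) = (\<Sum>n\<le>k. \<Sum>w\<in>cwalks (S N) (T N) n. g (n, w))" for g :: "_ \<Rightarrow> real"
    unfolding walk_index_def by (subst sum.Sigma) (use finS finT in \<open>auto simp: case_prod_unfold\<close>)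
  then have "(\<Sum>x\<in>walk_index k N. \<Sum>y\<in>walk_index k N. cf k N (fst x) * cf k N (fst y) * F (snd x) (snd y)) =
     (\<Sum>n\<le>k. \<Sum>w\<in>cwalks (S N) (T N) n. \<Sum>n'\<le>k. \<Sum>w'\<in>cwalks (S N) (T N) n'. cf k N n * cf k N n' * F w w')"
    by simp
  also have "\<dots> = (\<Sum>n\<le>k. \<Sum>n'\<le>k. \<Sum>w\<in>cwalks (S N) (T N) n. \<Sum>w'\<in>cwalks (S N) (T N) n'. cf k N n * cf k N n' * F w w')"
    by (intro sum.cong refl sum.swap)
  also have "\<dots> = pairsum F k N" unfolding pairsum_def sum_distrib_left ..
  finally show ?thesis ..
qed

text \<open>The coefficients of Tr T_k(W) after deletion of the simple cycles of length
  \<open>2 * k\<close>. The difference to \<open>cf\<close> is thus supported on these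
  cycles.\<close>

definition rest_cf :: "nat \<Rightarrow> nat \<Rightarrow> nat \<times> 'v list \<Rightarrow> real" where
  "rest_cf k N x = (if fst x = k \<and> snd x \<in> simple_walks (S N) (T N) k then 0 else cf k N (fst x))"

lemma sum_simple_part:
  "(\<Sum>x\<in>walk_index k N. (cf k N (fst x) - rest_cf k N x) * g x) = (\<Sum>w\<in>simple_walks (S N) (T N) k. cf k N k * g (k, w))"
proof -
  have "(\<Sum>w\<in>simple_walks (S N) (T N) k. cf k N k * g (k, w)) = (\<Sum>x\<in>(\<lambda>w. (k, w)) ` simple_walks (S N) (T N) k. (cf k N (fst x) - rest_cf k N x) * g x)"
    by (subst sum.reindex) (auto simp: inj_on_def rest_cf_def)
  also have "\<dots> = (\<Sum>x\<in>walk_index k N. (cf k N (fst x) - rest_cf k N x) * g x)"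
    using finite_walk_index by (intro sum.mono_neutral_left) (auto simp: walk_index_def simple_walks_def rest_cf_def)
  finally show ?thesis ..
qed

text \<open>A simple cycle has nonzero energy with a walk of at most \<open>2 * k\<close> steps only
  if that is a simple cycle on the same edges. So the mixed parts vanish, and on the cycles the
  energy is \<open>2 * k\<close> times the second moment.\<close>

lemma energy_split:
  assumes m: "moments m" and k: "k \<ge> 2"
  shows "pairsum (\<lambda>w w'. moments.energy m (path_edges w) (path_edges w')) k N =
     2 * real k * cf k N k ^ 2 * same_edge_pairs (S N) (T N) k +
     (\<Sum>x\<in>walk_index k N. \<Sum>y\<in>walk_index k N. rest_cf k N x * rest_cf k N y * moments.energy m (path_edges (snd x)) (path_edges (snd y)))"
proof -
  interpret moments m by fact
  let ?W = "walk_index k N"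
  let ?e = "\<lambda>x y. energy (path_edges (snd x)) (path_edges (snd y))"
  let ?c = "\<lambda>x. cf k N (fst x)" and ?r = "rest_cf k N"
  let ?y = "\<lambda>x. ?c x - ?r x"
  have energy: "energy (path_edges w) (path_edges w') = 2 * real k * mom m (path_edges w @ path_edges w')"
    if "w \<in> simple_walks (S N) (T N) k" for w w'
    using energy_distinct[OF distinct_path_edges[OF that k disj]] cwalksD(6)[of w "S N" "T N" k] that by (simp add: simple_walks_def)
  have z: "?r y * energy (path_edges w) (path_edges (snd y)) = 0"
    if "w \<in> simple_walks (S N) (T N) k" "y \<in> ?W" for w y
  proof (cases "mom m (path_edges w @ path_edges (snd y)) = 0")
    case False
    have "snd y \<in> cwalks (S N) (T N) (fst y)" "fst y \<le> k" using that by (auto simp: walk_index_def)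
    from mom_simple[OF that(1) k disj this False] show ?thesis by (simp add: rest_cf_def)
  qed (simp add: energy[OF that(1)])
  have yr: "(\<Sum>x\<in>?W. \<Sum>y\<in>?W. ?y x * ?r y * ?e x y) = 0"
  proof -
    have "(\<Sum>x\<in>?W. \<Sum>y\<in>?W. ?y x * ?r y * ?e x y) = (\<Sum>x\<in>?W. ?y x * (\<Sum>y\<in>?W. ?r y * ?e x y))"
      by (simp add: sum_distrib_left mult.assoc)
    also have "\<dots> = (\<Sum>w\<in>simple_walks (S N) (T N) k. cf k N k * (\<Sum>y\<in>?W. ?r y * energy (path_edges w) (path_edges (snd y))))"
      by (subst sum_simple_part) simp
    also have "\<dots> = 0" using z by (intro sum.neutral ballI) simp
    finally show ?thesis .
  qed
  have ry: "(\<Sum>x\<in>?W. \<Sum>y\<in>?W. ?r x * ?y y * ?e x y) = 0"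
  proof -
    have "(\<Sum>x\<in>?W. \<Sum>y\<in>?W. ?r x * ?y y * ?e x y) = (\<Sum>y\<in>?W. \<Sum>x\<in>?W. ?r x * ?y y * ?e x y)" by (rule sum.swap)
    also have "\<dots> = (\<Sum>x\<in>?W. \<Sum>y\<in>?W. ?y x * ?r y * ?e x y)"
      by (intro sum.cong refl) (simp add: energy_commute)
    finally show ?thesis using yr by simp
  qed
  have yy: "(\<Sum>x\<in>?W. \<Sum>y\<in>?W. ?y x * ?y y * ?e x y) = 2 * real k * cf k N k ^ 2 * same_edge_pairs (S N) (T N) k"
  proof -
    have "(\<Sum>x\<in>?W. \<Sum>y\<in>?W. ?y x * ?y y * ?e x y) = (\<Sum>x\<in>?W. ?y x * (\<Sum>y\<in>?W. ?y y * ?e x y))"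
      by (simp add: sum_distrib_left mult.assoc)
    also have "\<dots> = (\<Sum>w\<in>simple_walks (S N) (T N) k. cf k N k * (\<Sum>w'\<in>simple_walks (S N) (T N) k. cf k N k * energy (path_edges w) (path_edges w')))"
      by (simp add: sum_simple_part)
    also have "\<dots> = (\<Sum>w\<in>simple_walks (S N) (T N) k. cf k N k * (\<Sum>w'\<in>simple_walks (S N) (T N) k. cf k N k * (2 * real k *
        (if set (path_edges w) = set (path_edges w') then 1 else 0))))"
      using energy mom_simple_eq[OF _ _ k disj disj] by (intro sum.cong refl arg_cong2[of _ _ _ _ "(*)"]) simp
    also have "\<dots> = 2 * real k * cf k N k ^ 2 * same_edge_pairs (S N) (T N) k"
      unfolding same_edge_pairs_def sum_distrib_left by (intro sum.cong refl) (simp add: power2_eq_square)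
    finally show ?thesis .
  qed
  have "?c x * ?c y * ?e x y = ?y x * ?y y * ?e x y + ?y x * ?r y * ?e x y + ?r x * ?y y * ?e x y + ?r x * ?r y * ?e x y" for x y
    by (simp add: algebra_simps)
  then have "pairsum (\<lambda>w w'. energy (path_edges w) (path_edges w')) k N =
    (\<Sum>x\<in>?W. \<Sum>y\<in>?W. ?y x * ?y y * ?e x y + ?y x * ?r y * ?e x y + ?r x * ?y y * ?e x y + ?r x * ?r y * ?e x y)"
    unfolding pairsum_eq by simp
  also have "\<dots> = (\<Sum>x\<in>?W. \<Sum>y\<in>?W. ?y x * ?y y * ?e x y) + (\<Sum>x\<in>?W. \<Sum>y\<in>?W. ?y x * ?r y * ?e x y) +
     (\<Sum>x\<in>?W. \<Sum>y\<in>?W. ?r x * ?y y * ?e x y) + (\<Sum>x\<in>?W. \<Sum>y\<in>?W. ?r x * ?r y * ?e x y)"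
    by (simp only: sum.distrib)
  finally show ?thesis unfolding yr ry yy by simp
qed

text \<open>The Efron--Stein inequality for the rest alone, whose energy is the total energy minus
  that of the cycles.\<close>

lemma rest_variance:
  assumes iid: "iid_array M Xe I m" and I: "\<And>N. bip_edges (S N) (T N) \<subseteq> I" and k: "k \<ge> 2"
  shows "(\<Sum>x\<in>walk_index k N. \<Sum>y\<in>walk_index k N. rest_cf k N x * rest_cf k N y *
       (mom m (path_edges (snd x) @ path_edges (snd y)) - mom m (path_edges (snd x)) * mom m (path_edges (snd y))))
     \<le> pairsum (\<lambda>w w'. moments.energy m (path_edges w) (path_edges w')) k N - 2 * real k * cf k N k ^ 2 * same_edge_pairs (S N) (T N) k"
proof -
  interpret iid_array M Xe I m by fact
  have "set (path_edges (snd x)) \<subseteq> I" if x: "x \<in> walk_index k N" for x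
  proof -
    have "snd x \<in> cwalks (S N) (T N) (fst x)" using x by (auto simp: walk_index_def)
    then show ?thesis using path_edges_bip[OF cwalksD(1)] I[of N] by blast
  qed
  then show ?thesis
    unfolding energy_split[OF moments_axioms k] using efron_stein[OF finite_walk_index, of k N "\<lambda>x. path_edges (snd x)" "rest_cf k N"] by simp
qed

text \<open>Identifies the double sum as the variance of the random variable with coefficients
  \<open>r\<close>, whence it is nonnegative.\<close>

lemma rest_variance_nonneg:
  assumes iid: "iid_array M Xe I m" and I: "\<And>N. bip_edges (S N) (T N) \<subseteq> I"
  shows "(\<Sum>x\<in>walk_index k N. \<Sum>y\<in>walk_index k N. r x * r y *
       (mom m (path_edges (snd x) @ path_edges (snd y)) - mom m (path_edges (snd x)) * mom m (path_edges (snd y)))) =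
     (\<integral>\<omega>. ((\<Sum>x\<in>walk_index k N. r x * list_prod (\<lambda>e. Xe e \<omega>) (path_edges (snd x))) -
        (\<integral>\<omega>. (\<Sum>x\<in>walk_index k N. r x * list_prod (\<lambda>e. Xe e \<omega>) (path_edges (snd x))) \<partial>M))\<^sup>2 \<partial>M)"
proof -
  interpret iid_array M Xe I m by fact
  let ?W = "walk_index k N" and ?l = "\<lambda>x. path_edges (snd x)"
  have sub: "set (path_edges (snd x)) \<subseteq> I" if x: "x \<in> walk_index k N" for x
  proof -
    have "snd x \<in> cwalks (S N) (T N) (fst x)" using x by (auto simp: walk_index_def)
    then show ?thesis using path_edges_bip[OF cwalksD(1)] I[of N] by blast
  qed
  define F where "F \<omega> = (\<Sum>x\<in>?W. r x * list_prod (\<lambda>e. Xe e \<omega>) (?l x))" for \<omega>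
  have F1: "integrable M F" unfolding F_def by (intro integrable_sum_list_prod finite_walk_index sub)
  have F2: "integrable M (\<lambda>\<omega>. (F \<omega>)\<^sup>2)" unfolding F_def power2_eq_square by (intro integrable_sum_list_prod2 finite_walk_index sub)
  have v: "expectation (\<lambda>\<omega>. (F \<omega> - expectation F)\<^sup>2) = expectation (\<lambda>\<omega>. (F \<omega>)\<^sup>2) - (expectation F)\<^sup>2"
    using variance_eq[OF F1 F2] .
  have e2: "expectation (\<lambda>\<omega>. (F \<omega>)\<^sup>2) = (\<Sum>x\<in>?W. \<Sum>y\<in>?W. r x * r y * mom m (?l x @ ?l y))"
    unfolding F_def power2_eq_square by (intro expectation_sum_list_prod2 finite_walk_index sub)
  have e1: "expectation F = (\<Sum>x\<in>?W. r x * mom m (?l x))"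
    unfolding F_def by (intro expectation_sum_list_prod finite_walk_index sub)
  have e3: "(\<Sum>x\<in>?W. r x * mom m (?l x))\<^sup>2 = (\<Sum>x\<in>?W. \<Sum>y\<in>?W. r x * r y * (mom m (?l x) * mom m (?l y)))"
    unfolding power2_eq_square sum_product by (intro sum.cong refl) simp
  have "(\<Sum>x\<in>?W. \<Sum>y\<in>?W. r x * r y * (mom m (?l x @ ?l y) - mom m (?l x) * mom m (?l y))) =
     expectation (\<lambda>\<omega>. (F \<omega> - expectation F)\<^sup>2)"
    unfolding v e2 unfolding e1 e3 right_diff_distrib sum_subtractf ..
  then show ?thesis unfolding F_def .
qed

lemma cf_top: "k \<ge> 1 \<Longrightarrow> cf k N k = 1 / (2 * h N ^ k)"
  by (cases k) (auto simp: cf_def coeff_chebT_self)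

lemma cf_top_square:
  assumes "k \<ge> 1"
  shows "2 * real k * cf k N k ^ 2 * same_edge_pairs (S N) (T N) k = real k / 2 * (same_edge_pairs (S N) (T N) k / h N ^ (2 * k))"
proof -
  have "h N ^ (2 * k) = (h N ^ k)\<^sup>2" by (rule power_even_eq)
  then show ?thesis by (simp add: cf_top[OF assms] power_divide power_mult_distrib)
qed

text \<open>The rest has nonnegative energy, because its energy dominates a variance.\<close>

lemma energy_lower:
  assumes iid: "iid_array M Xe I m" and I: "\<And>N. bip_edges (S N) (T N) \<subseteq> I" and k: "k \<ge> 2"
  shows "real k / 2 * (same_edge_pairs (S N) (T N) k / h N ^ (2 * k)) \<le> pairsum (\<lambda>w w'. moments.energy m (path_edges w) (path_edges w')) k N"
proof -
  have "2 * real k * cf k N k ^ 2 * same_edge_pairs (S N) (T N) k = real k / 2 * (same_edge_pairs (S N) (T N) k / h N ^ (2 * k))"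
    using k by (intro cf_top_square) simp
  moreover have "0 \<le> pairsum (\<lambda>w w'. moments.energy m (path_edges w) (path_edges w')) k N - 2 * real k * cf k N k ^ 2 * same_edge_pairs (S N) (T N) k"
    by (rule order_trans[OF _ rest_variance[OF iid I k]]) (simp add: rest_variance_nonneg[OF iid I])
  ultimately show ?thesis by linarith
qed

text \<open>For a fixed edge \<open>e\<close> the summand is the second moment of a combination of
  the walks that pass \<open>e\<close> exactly twice, with \<open>e\<close> removed from
  them.\<close>

lemma bb_nonneg:
  assumes iid: "iid_array M Xe I m" and I: "\<And>N. bip_edges (S N) (T N) \<subseteq> I"
  shows "pairsum (\<lambda>w w'. moments.bb m (path_edges w) (path_edges w')) k N \<ge> 0"
proof -
  interpret iid_array M Xe I m by fact
  let ?W = "walk_index k N" and ?l = "\<lambda>x. path_edges (snd x)"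
  let ?B = "bip_edges (S N) (T N)"
  have sub: "set (path_edges (snd x)) \<subseteq> ?B" if x: "x \<in> walk_index k N" for x
  proof -
    have "snd x \<in> cwalks (S N) (T N) (fst x)" using x by (auto simp: walk_index_def)
    then show ?thesis using path_edges_bip[OF cwalksD(1)] by blast
  qed
  have fB: "finite ?B" using finS finT by simp
  let ?i = "\<lambda>x e. if count_list (?l x) e = 2 then 1 else 0 :: real"
  let ?r = "\<lambda>x y e. mom m (removeAll e (?l x) @ removeAll e (?l y))"
  have "bb (?l x) (?l y) = (\<Sum>e\<in>?B. ?i x e * ?i y e * ?r x y e)" if "x \<in> ?W" "y \<in> ?W" for x y
  proof -
    have "bb (?l x) (?l y) = (\<Sum>e\<in>set (?l x) \<inter> set (?l y). ?i x e * ?i y e * ?r x y e)"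
      unfolding bb_def by (intro sum.cong refl) auto
    also have "\<dots> = (\<Sum>e\<in>?B. ?i x e * ?i y e * ?r x y e)"
    proof (rule sum.mono_neutral_left[OF fB])
      show "set (?l x) \<inter> set (?l y) \<subseteq> ?B" using sub that by blast
      show "\<forall>e\<in>?B - set (?l x) \<inter> set (?l y). ?i x e * ?i y e * ?r x y e = 0"
      proof
        fix e assume "e \<in> ?B - set (?l x) \<inter> set (?l y)"
        then have "count_list (?l x) e = 0 \<or> count_list (?l y) e = 0" by (auto simp: count_list_0_iff)
        then show "?i x e * ?i y e * ?r x y e = 0" by auto
      qed
    qed
    finally show ?thesis .
  qed
  then have "pairsum (\<lambda>w w'. bb (path_edges w) (path_edges w')) k N =
      (\<Sum>x\<in>?W. \<Sum>y\<in>?W. \<Sum>e\<in>?B. (cf k N (fst x) * ?i x e) * (cf k N (fst y) * ?i y e) * ?r x y e)"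
    unfolding pairsum_eq by (intro sum.cong refl) (simp add: sum_distrib_left mult_ac)
  also have "\<dots> = (\<Sum>x\<in>?W. \<Sum>e\<in>?B. \<Sum>y\<in>?W. (cf k N (fst x) * ?i x e) * (cf k N (fst y) * ?i y e) * ?r x y e)"
    by (intro sum.cong refl sum.swap)
  also have "\<dots> = (\<Sum>e\<in>?B. \<Sum>x\<in>?W. \<Sum>y\<in>?W. (cf k N (fst x) * ?i x e) * (cf k N (fst y) * ?i y e) * ?r x y e)"
    by (rule sum.swap)
  also have "\<dots> \<ge> 0"
  proof (rule sum_nonneg)
    fix e assume "e \<in> ?B"
    have s: "set (removeAll e (?l x)) \<subseteq> I" if "x \<in> ?W" for x using sub[OF that] I[of N] by auto
    have "(\<Sum>x\<in>?W. \<Sum>y\<in>?W. (cf k N (fst x) * ?i x e) * (cf k N (fst y) * ?i y e) * ?r x y e) =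
      expectation (\<lambda>\<omega>. (\<Sum>x\<in>?W. (cf k N (fst x) * ?i x e) * list_prod (\<lambda>e. Xe e \<omega>) (removeAll e (?l x))) *
         (\<Sum>x\<in>?W. (cf k N (fst x) * ?i x e) * list_prod (\<lambda>e. Xe e \<omega>) (removeAll e (?l x))))"
      by (rule expectation_sum_list_prod2[symmetric]) (use finite_walk_index s in blast)+
    also have "\<dots> \<ge> 0" by (rule integral_nonneg_AE) simp
    finally show "0 \<le> (\<Sum>x\<in>?W. \<Sum>y\<in>?W. (cf k N (fst x) * ?i x e) * (cf k N (fst y) * ?i y e) * ?r x y e)" .
  qed
  finally show ?thesis .
qed

text \<open>Closing up an alternating path without repeated vertices gives a simple cycle. There are
  \<open>h^(2 * Suc k)\<close> alternating paths of \<open>2 * k + 2\<close> vertices, and those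
  with a repetition have lower order.\<close>

lemma card_simple_walks: "\<exists>C. \<forall>N. h N ^ (2 * Suc k) - C * real (card (S N \<union> T N)) ^ (2 * k + 1) \<le> real (card (simple_walks (S N) (T N) (Suc k)))"
proof -
  define C where "C = real (2 * k + 1) ^ (2 * k + 2)"
  have "h N ^ (2 * Suc k) - C * real (card (S N \<union> T N)) ^ (2 * k + 1) \<le> real (card (simple_walks (S N) (T N) (Suc k)))" for N
  proof -
    let ?P = "paths (S N) (T N) (Suc (2 * k))"
    let ?D = "{xs \<in> ?P. distinct xs}" and ?E = "{xs \<in> ?P. \<not> distinct xs}"
    have fP: "finite ?P" using finS finT by simp
    have "\<bar>\<Sum>xs\<in>?P. if distinct xs then 0 else 1 :: real\<bar> \<le> 1 * real (2 * k + 1) ^ (2 * k + 2) * real (card (S N \<union> T N)) ^ (2 * k + 1)"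
    proof (rule sum_few_values[where \<phi> = id])
      fix xs assume xs: "xs \<in> ?P"
      show "set (id xs) \<subseteq> S N \<union> T N \<and> length (id xs) = 2 * k + 2"
        using set_paths[OF xs] length_paths[OF xs] by simp
      assume "(if distinct xs then 0 else 1 :: real) \<noteq> 0"
      then have "card (set xs) < length xs" using card_length[of xs] card_distinct[of xs] by (auto split: if_splits simp: le_less)
      then show "card (set (id xs)) \<le> 2 * k + 1 \<and> \<bar>if distinct xs then 0 else 1 :: real\<bar> \<le> 1"
        using length_paths[OF xs] by auto
    qed (use fP finS finT in auto)
    moreover have "(\<Sum>xs\<in>?P. if distinct xs then 0 else 1 :: real) = real (card ?E)"
    proof -
      have "(\<Sum>xs\<in>?P. if distinct xs then 0 else 1 :: real) = (\<Sum>xs\<in>?P. if \<not> distinct xs then 1 else 0)"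
        by (intro sum.cong refl) auto
      also have "\<dots> = (\<Sum>xs\<in>?E. 1)" by (rule sum.inter_filter[OF fP, symmetric])
      finally show ?thesis by (simp del: paths.simps)
    qed
    ultimately have "real (card ?E) \<le> C * real (card (S N \<union> T N)) ^ (2 * k + 1)"
      unfolding C_def by (simp only: abs_of_nat mult_1)
    moreover have "card ?D + card ?E = card ?P"
    proof -
      have "?D \<inter> ?E = {}" "?D \<union> ?E = ?P" by blast+
      then show ?thesis using card_Un_disjoint[of ?D ?E] fP by (metis (no_types, lifting) finite_Un)
    qed
    moreover have "real (card ?P) = h N ^ (2 * Suc k)"
      unfolding card_paths[OF finS finT] power_mult h_square by simp
    moreover have "card ?D \<le> card (simple_walks (S N) (T N) (Suc k))"
    proof (rule card_inj_on_le[of "\<lambda>xs. xs @ [hd xs]"])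
      show "inj_on (\<lambda>xs. xs @ [hd xs]) ?D" by (auto simp: inj_on_def)
      show "finite (simple_walks (S N) (T N) (Suc k))" using finS finT by simp
      show "(\<lambda>xs. xs @ [hd xs]) ` ?D \<subseteq> simple_walks (S N) (T N) (Suc k)"
      proof
        fix w assume "w \<in> (\<lambda>xs. xs @ [hd xs]) ` ?D"
        then obtain xs where xs: "w = xs @ [hd xs]" "xs \<in> ?P" "distinct xs" by auto
        note l = length_paths[OF xs(2)]
        have "w ! s \<in> (if even s then S N else T N)" if "s \<le> 2 * Suc k" for s
        proof (cases "s < length xs")
          case True
          then show ?thesis using nth_paths[OF xs(2), of s] xs(1) l by (simp add: nth_append)
        next
          case False
          then have "s = 2 * Suc k" using that l by simp
          then show ?thesis using hd_paths[OF xs(2)] xs(1) l by (simp add: nth_append)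
        qed
        then have "w \<in> paths (S N) (T N) (2 * Suc k)" unfolding paths_iff using xs(1) l by simp
        moreover have "xs \<noteq> []" using l by auto
        ultimately show "w \<in> simple_walks (S N) (T N) (Suc k)" using xs unfolding simple_walks_def cwalks_def by simp
      qed
    qed
    ultimately show ?thesis by linarith
  qed
  then show ?thesis by blast
qed

text \<open>Each cycle has at least \<open>2 * k\<close> companions on the same edges, itself
  included, by \<open>card_companions\<close>.\<close>

lemma same_edges_lower:
  assumes k: "k \<ge> 2"
  shows "\<exists>L. L \<longlonglongrightarrow> 2 * real k \<and> (\<forall>N. L N \<le> same_edge_pairs (S N) (T N) k / h N ^ (2 * k))"
proof -
  obtain k' where k': "k = Suc k'" using k by (cases k) auto
  from card_simple_walks[of k'] obtain C where
    "\<forall>N. h N ^ (2 * Suc k') - C * real (card (S N \<union> T N)) ^ (2 * k' + 1) \<le> real (card (simple_walks (S N) (T N) (Suc k')))"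
    by (rule exE)
  then have C: "h N ^ (2 * k) - C * real (card (S N \<union> T N)) ^ (2 * k' + 1) \<le> real (card (simple_walks (S N) (T N) k))" for N
    unfolding k' by (rule spec)
  define X where "X N = C * real (card (S N \<union> T N)) ^ (2 * k' + 1)" for N
  have "(\<lambda>N. 1 / h N ^ Suc (2 * k' + 1) * X N) \<longlonglongrightarrow> 0"
    by (rule negligible[where C = "\<bar>C\<bar>"]) (auto simp: X_def abs_mult)
  then have "(\<lambda>N. X N / h N ^ (2 * k)) \<longlonglongrightarrow> 0" by (simp add: k')
  then have lim: "(\<lambda>N. 2 * real k * (1 - X N / h N ^ (2 * k))) \<longlonglongrightarrow> 2 * real k * (1 - 0)"
    by (intro tendsto_intros)
  have "2 * real k * (1 - X N / h N ^ (2 * k)) \<le> same_edge_pairs (S N) (T N) k / h N ^ (2 * k)" for N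
  proof -
    have "2 * real k * real (card (simple_walks (S N) (T N) k)) = (\<Sum>w\<in>simple_walks (S N) (T N) k. real (2 * k))" by simp
    also have "\<dots> \<le> same_edge_pairs (S N) (T N) k"
      unfolding same_edge_pairs_def
    proof (rule sum_mono)
      fix w assume w: "w \<in> simple_walks (S N) (T N) k"
      have "(\<Sum>w'\<in>simple_walks (S N) (T N) k. if set (path_edges w) = set (path_edges w') then 1 else 0 :: real) =
        (\<Sum>w'\<in>{w'\<in>simple_walks (S N) (T N) k. set (path_edges w) = set (path_edges w')}. 1)"
        by (rule sum.inter_filter[symmetric]) (use finS finT in auto)
      also have "\<dots> = real (card {w'\<in>simple_walks (S N) (T N) k. set (path_edges w') = set (path_edges w)})"
        by (simp add: eq_commute)
      finally show "real (2 * k) \<le> (\<Sum>w'\<in>simple_walks (S N) (T N) k. if set (path_edges w) = set (path_edges w') then 1 else 0)"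
        using card_companions[OF w k finS finT disj] by simp
    qed
    finally have "2 * real k * (h N ^ (2 * k) - X N) \<le> same_edge_pairs (S N) (T N) k"
      using C[of N] mult_left_mono[of "h N ^ (2 * k) - X N" "real (card (simple_walks (S N) (T N) k))" "2 * real k"] unfolding X_def by simp
    then have "2 * real k * (h N ^ (2 * k) - X N) / h N ^ (2 * k) \<le> same_edge_pairs (S N) (T N) k / h N ^ (2 * k)"
      using h_pos[of N] by (intro divide_right_mono) auto
    moreover have "2 * real k * (h N ^ (2 * k) - X N) / h N ^ (2 * k) = 2 * real k * (1 - X N / h N ^ (2 * k))"
      using h_pos[of N] by (simp add: field_simps)
    ultimately show ?thesis by simp
  qed
  with lim show ?thesis by (intro exI[of _ "\<lambda>N. 2 * real k * (1 - X N / h N ^ (2 * k))"]) auto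
qed

text \<open>The moments of a fair sign, for which \<open>m 4 - 5\<close> is -4.\<close>

definition sign_moment :: "nat \<Rightarrow> real" where "sign_moment p = (if even p then 1 else 0)"

lemma moments_sign: "moments sign_moment"
  by unfold_locales (auto simp: sign_moment_def)

lemma iid_array_sign: "\<exists>M. \<exists>Xe :: 'e \<Rightarrow> ('e \<Rightarrow> real) \<Rightarrow> real. iid_array M Xe UNIV sign_moment"
proof -
  define N where "N = distr (measure_pmf (pmf_of_set {-1, 1 :: real})) borel (\<lambda>x. x)"
  have "prob_space N" unfolding N_def by (rule measure_pmf.prob_space_distr) simp
  moreover have "integrable N (\<lambda>x. x ^ p)" for p
    unfolding N_def by (subst integrable_distr_eq) (auto intro!: integrable_measure_pmf_finite)
  moreover have "(\<integral>x. x ^ p \<partial>N) = sign_moment p" for p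
  proof -
    have "(\<integral>x. x ^ p \<partial>N) = (\<integral>x. x ^ p \<partial>measure_pmf (pmf_of_set {-1, 1 :: real}))"
      unfolding N_def by (subst integral_distr) auto
    also have "\<dots> = (\<Sum>x\<in>{-1, 1 :: real}. x ^ p) / 2"
      by (subst integral_pmf_of_set) auto
    finally show ?thesis by (cases "even p") (simp_all add: sign_moment_def)
  qed
  ultimately have "iid_array (Pi\<^sub>M UNIV (\<lambda>_. N)) (\<lambda>(e :: 'e) \<omega>. \<omega> e) UNIV sign_moment"
    by (intro iid_array_product moments_sign) (auto simp: N_def)
  then show ?thesis by blast
qed

text \<open>For signs the fourth moment is \<open>1\<close>, so that the energy is at most \<open>k\<^sup>2 - 4 * bb + o(1)\<close>, whereas the cycles
  alone already contribute \<open>k\<^sup>2 - o(1)\<close>. Hence the term with two double edges is negligible; it does not depend on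
  the law of the entries to leading order.\<close>
lemma bb_limit:
  assumes m: "moments m" and k: "k \<ge> 2"
  shows "(\<lambda>N. pairsum (\<lambda>w w'. moments.bb m (path_edges w) (path_edges w')) k N) \<longlonglongrightarrow> 0"
proof -
  obtain M and Xe :: "'v set \<Rightarrow> ('v set \<Rightarrow> real) \<Rightarrow> real" where iid: "iid_array M Xe UNIV sign_moment"
    using iid_array_sign by blast
  interpret iid_array M Xe UNIV sign_moment by fact
  let ?B = "\<lambda>N. pairsum (\<lambda>w w'. bb (path_edges w) (path_edges w')) k N"
  let ?E = "\<lambda>N. pairsum (\<lambda>w w'. energy (path_edges w) (path_edges w')) k N"
  let ?D = "\<lambda>N. pairsum (\<lambda>w w'. dd (path_edges w) (path_edges w')) k N"
  obtain k' where k': "k = Suc k'" using k by (cases k) auto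
  obtain L where L: "L \<longlonglongrightarrow> 2 * real k" "\<And>N. L N \<le> same_edge_pairs (S N) (T N) k / h N ^ (2 * k)" using same_edges_lower[OF k] by blast
  have D: "?D \<longlonglongrightarrow> real k ^ 2" unfolding k' by (rule dd_limit[OF iid]) simp
  have "(\<lambda>N. ?E N - ?D N - (sign_moment 4 - 5) * ?B N) \<longlonglongrightarrow> 0" by (rule energy_asymp[OF moments_sign])
  then have E: "(\<lambda>N. ?E N - ?D N + 4 * ?B N) \<longlonglongrightarrow> 0" by (simp add: sign_moment_def)
  have "?B N \<le> 1 / 4 * ((?E N - ?D N + 4 * ?B N) + ?D N - real k / 2 * L N)" for N
  proof -
    have aux: "r \<le> q \<Longrightarrow> q \<le> e \<Longrightarrow> b \<le> 1 / 4 * ((e - d + 4 * b) + d - r)" for r q e b d :: real by simp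
    have "real k / 2 * L N \<le> real k / 2 * (same_edge_pairs (S N) (T N) k / h N ^ (2 * k))"
      by (intro mult_left_mono L) auto
    then show ?thesis by (rule aux) (rule energy_lower[OF iid _ k], simp)
  qed
  moreover have "(\<lambda>N. 1 / 4 * ((?E N - ?D N + 4 * ?B N) + ?D N - real k / 2 * L N)) \<longlonglongrightarrow> 1 / 4 * (0 + real k ^ 2 - real k / 2 * (2 * real k))"
    by (intro tendsto_intros E D L)
  moreover have "1 / 4 * (0 + real k ^ 2 - real k / 2 * (2 * real k)) = 0" by (simp add: power2_eq_square)
  ultimately have "?B \<longlonglongrightarrow> 0"
    using bb_nonneg[OF iid, of k] by (intro tendsto_sandwich[OF _ _ tendsto_const, of 0 ?B]) (auto intro!: always_eventually)
  from tendsto_add[OF bb_asymp[OF m moments_sign, of k] this] show ?thesis by simp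
qed

lemma energy_limit:
  assumes iid: "iid_array M Xe I m" and I: "\<And>N. bip_edges (S N) (T N) \<subseteq> I" and k: "k \<ge> 2"
  shows "(\<lambda>N. pairsum (\<lambda>w w'. moments.energy m (path_edges w) (path_edges w')) k N) \<longlonglongrightarrow> real k ^ 2"
proof -
  interpret iid_array M Xe I m by fact
  obtain k' where k': "k = Suc k'" using k by (cases k) auto
  have D: "(\<lambda>N. pairsum (\<lambda>w w'. dd (path_edges w) (path_edges w')) k N) \<longlonglongrightarrow> real k ^ 2"
    unfolding k' by (rule dd_limit[OF iid I])
  from tendsto_add[OF tendsto_add[OF energy_asymp[OF moments_axioms, of k] D] tendsto_mult_left[OF bb_limit[OF moments_axioms k], of "m 4 - 5"]]
  show ?thesis by simp
qed

text \<open>The upper bound is read off from the energy of random signs: the part of the cycles is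
  at most the total, which tends to \<open>k^2\<close>.\<close>

lemma same_edges_limit:
  assumes k: "k \<ge> 2"
  shows "(\<lambda>N. same_edge_pairs (S N) (T N) k / h N ^ (2 * k)) \<longlonglongrightarrow> 2 * real k"
proof -
  obtain M and Xe :: "'v set \<Rightarrow> ('v set \<Rightarrow> real) \<Rightarrow> real" where iid: "iid_array M Xe UNIV sign_moment"
    using iid_array_sign by blast
  interpret iid_array M Xe UNIV sign_moment by fact
  let ?E = "\<lambda>N. pairsum (\<lambda>w w'. energy (path_edges w) (path_edges w')) k N"
  obtain L where L: "L \<longlonglongrightarrow> 2 * real k" "\<And>N. L N \<le> same_edge_pairs (S N) (T N) k / h N ^ (2 * k)" using same_edges_lower[OF k] by blast
  have E: "?E \<longlonglongrightarrow> real k ^ 2" by (rule energy_limit[OF iid _ k]) simp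
  have up: "same_edge_pairs (S N) (T N) k / h N ^ (2 * k) \<le> 2 / real k * ?E N" for N
  proof -
    have aux: "c > 0 \<Longrightarrow> c / 2 * q \<le> e \<Longrightarrow> q \<le> 2 / c * e" for c q e :: real by (simp add: field_simps)
    show ?thesis by (rule aux, use k in simp, rule energy_lower[OF iid _ k], simp)
  qed
  have "(\<lambda>N. 2 / real k * ?E N) \<longlonglongrightarrow> 2 / real k * real k ^ 2" by (intro tendsto_intros E)
  then have E2: "(\<lambda>N. 2 / real k * ?E N) \<longlonglongrightarrow> 2 * real k" using k by (simp add: power2_eq_square)
  show ?thesis
    by (rule tendsto_sandwich[OF _ _ L(1) E2]) (rule always_eventually, rule allI, rule L(2) up)+
qed

text \<open>The difference is the centered rest. Its variance is at most the total energy minus that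
  of the cycles, and both tend to \<open>k^2\<close>.\<close>

lemma reduction_to_cycles:
  assumes iid: "iid_array M Xe I m" and I: "\<And>N. bip_edges (S N) (T N) \<subseteq> I" and k: "k \<ge> 2"
  defines "Z \<equiv> \<lambda>N \<omega>. \<Sum>n\<le>k. cf k N n * (\<Sum>w\<in>cwalks (S N) (T N) n. list_prod (\<lambda>e. Xe e \<omega>) (path_edges w))"
  shows "(\<lambda>N. \<integral>\<omega>. (Z N \<omega> - (\<integral>\<omega>. Z N \<omega> \<partial>M) -
     cf k N k * (\<Sum>w\<in>simple_walks (S N) (T N) k. list_prod (\<lambda>e. Xe e \<omega>) (path_edges w)))\<^sup>2 \<partial>M) \<longlonglongrightarrow> 0"
proof -
  interpret iid_array M Xe I m by fact
  let ?E = "\<lambda>N. pairsum (\<lambda>w w'. energy (path_edges w) (path_edges w')) k N"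
  define D where "D N \<omega> = (\<Sum>x\<in>walk_index k N. rest_cf k N x * list_prod (\<lambda>e. Xe e \<omega>) (path_edges (snd x)))" for N \<omega>
  define Y where "Y N \<omega> = (\<Sum>w\<in>simple_walks (S N) (T N) k. cf k N k * list_prod (\<lambda>e. Xe e \<omega>) (path_edges w))" for N \<omega>
  have ZD: "Z N \<omega> = D N \<omega> + Y N \<omega>" for N \<omega>
  proof -
    have "Z N \<omega> = (\<Sum>x\<in>walk_index k N. cf k N (fst x) * list_prod (\<lambda>e. Xe e \<omega>) (path_edges (snd x)))"
      unfolding Z_def walk_index_def sum_distrib_left by (subst sum.Sigma) (use finS finT in \<open>auto simp: case_prod_unfold\<close>)
    also have "\<dots> = D N \<omega> + (\<Sum>x\<in>walk_index k N. (cf k N (fst x) - rest_cf k N x) * list_prod (\<lambda>e. Xe e \<omega>) (path_edges (snd x)))"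
      unfolding D_def sum.distrib[symmetric] by (intro sum.cong refl) (simp add: algebra_simps)
    finally show ?thesis unfolding sum_simple_part Y_def by simp
  qed
  have subW: "set (path_edges (snd x)) \<subseteq> I" if x: "x \<in> walk_index k N" for x N
  proof -
    have "snd x \<in> cwalks (S N) (T N) (fst x)" using x by (auto simp: walk_index_def)
    then show ?thesis using path_edges_bip[OF cwalksD(1)] I[of N] by blast
  qed
  have subY: "set (path_edges w) \<subseteq> I" if "w \<in> simple_walks (S N) (T N) k" for w N
    using that path_edges_bip[OF cwalksD(1)] I[of N] unfolding simple_walks_def by blast
  have intD: "integrable M (D N)" for N unfolding D_def by (intro integrable_sum_list_prod finite_walk_index subW)
  have fs: "finite (simple_walks (S N) (T N) k)" for N using finS finT by simp
  have intY: "integrable M (Y N)" for N unfolding Y_def by (intro integrable_sum_list_prod fs subY)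
  \<comment> \<open>Each cycle has an edge passed once, so that the cycle part is already
    centered.\<close>
  have EY: "expectation (Y N) = 0" for N
  proof -
    have "expectation (Y N) = (\<Sum>w\<in>simple_walks (S N) (T N) k. cf k N k * mom m (path_edges w))"
      unfolding Y_def by (intro expectation_sum_list_prod fs subY)
    also have "\<dots> = 0"
    proof (intro sum.neutral ballI)
      fix w assume w: "w \<in> simple_walks (S N) (T N) k"
      have "length (path_edges w) = 2 * k" using w by (auto simp: simple_walks_def dest: cwalksD(3))
      then have "path_edges w \<noteq> []" using k by (metis list.size(3) mult_is_0 not_numeral_le_zero zero_neq_numeral)
      then have "count_list (path_edges w) (hd (path_edges w)) = 1"
        using distinct_path_edges[OF w k disj] by (intro distinct_count_list) auto
      then show "cf k N k * mom m (path_edges w) = 0" using mom_once[of "path_edges w" "hd (path_edges w)"] by simp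
    qed
    finally show ?thesis .
  qed
  have EZ: "(\<integral>\<omega>. Z N \<omega> \<partial>M) = expectation (D N)" for N
    unfolding ZD using EY intD intY by simp
  have eq: "Z N \<omega> - (\<integral>\<omega>. Z N \<omega> \<partial>M) - cf k N k * (\<Sum>w\<in>simple_walks (S N) (T N) k. list_prod (\<lambda>e. Xe e \<omega>) (path_edges w))
     = D N \<omega> - expectation (D N)" for N \<omega>
    unfolding EZ unfolding ZD Y_def sum_distrib_left by simp
  have up: "expectation (\<lambda>\<omega>. (D N \<omega> - expectation (D N))\<^sup>2) \<le> ?E N - real k / 2 * (same_edge_pairs (S N) (T N) k / h N ^ (2 * k))" for N
  proof -
    have "2 * real k * cf k N k ^ 2 * same_edge_pairs (S N) (T N) k = real k / 2 * (same_edge_pairs (S N) (T N) k / h N ^ (2 * k))"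
      using k by (intro cf_top_square) simp
    then show ?thesis
      using rest_variance[OF iid I k, of N] unfolding rest_variance_nonneg[OF iid I] D_def by simp
  qed
  have "(\<lambda>N. ?E N - real k / 2 * (same_edge_pairs (S N) (T N) k / h N ^ (2 * k))) \<longlonglongrightarrow> real k ^ 2 - real k / 2 * (2 * real k)"
    by (intro tendsto_intros energy_limit[OF iid I k] same_edges_limit[OF k])
  then have lim: "(\<lambda>N. ?E N - real k / 2 * (same_edge_pairs (S N) (T N) k / h N ^ (2 * k))) \<longlonglongrightarrow> 0" by (simp add: power2_eq_square)
  show ?thesis unfolding eq
  proof (rule tendsto_sandwich[OF _ _ tendsto_const lim])
    show "\<forall>\<^sub>F N in sequentially. 0 \<le> expectation (\<lambda>\<omega>. (D N \<omega> - expectation (D N))\<^sup>2)"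
      by (intro always_eventually allI integral_nonneg_AE) simp
    show "\<forall>\<^sub>F N in sequentially. expectation (\<lambda>\<omega>. (D N \<omega> - expectation (D N))\<^sup>2) \<le> ?E N - real k / 2 * (same_edge_pairs (S N) (T N) k / h N ^ (2 * k))"
      by (rule always_eventually, rule allI, rule up)
  qed
qed

end

subsection \<open>Wick's recursion for sums over cycles\<close>

text \<open>Connectedness of walks, used below to show that two cycles of a tuple with a common edge
  have the same vertices.\<close>

lemma path_connected_set:
  assumes "\<And>e. e \<in> set (path_edges xs) \<Longrightarrow> e \<inter> A \<noteq> {} \<Longrightarrow> e \<subseteq> A" "set xs \<inter> A \<noteq> {}"
  shows "set xs \<subseteq> A"
  using assms
proof (induction xs rule: path_edges.induct)
  case (1 u v xs)
  have e: "{u, v} \<inter> A \<noteq> {} \<Longrightarrow> {u, v} \<subseteq> A" using 1(2)[of "{u, v}"] by simp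
  have IH: "set (v # xs) \<inter> A \<noteq> {} \<Longrightarrow> set (v # xs) \<subseteq> A" using 1(1) 1(2) by simp
  show ?case
  proof (cases "set (v # xs) \<inter> A = {}")
    case True
    then have "u \<in> A" using 1(3) by auto
    then have "v \<in> A" using e by auto
    then show ?thesis using True by auto
  next
    case False
    then have "set (v # xs) \<subseteq> A" by (rule IH)
    moreover from this have "u \<in> A" using e by auto
    ultimately show ?thesis by auto
  qed
qed auto

text \<open>Splits the positions of a tuple into two blocks, so that a product of two moments
  becomes a sum over the same tuples as the full moment.\<close>

lemma sum_PiE_split:
  fixes F G :: "('i \<Rightarrow> 'c) \<Rightarrow> real"
  assumes AB: "A \<inter> B = {}"
  shows "(\<Sum>c\<in>PiE A (\<lambda>_. J). F c) * (\<Sum>c\<in>PiE B (\<lambda>_. J). G c) =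
    (\<Sum>c\<in>PiE (A \<union> B) (\<lambda>_. J). F (restrict c A) * G (restrict c B))"
proof -
  have "(\<Sum>c\<in>PiE A (\<lambda>_. J). F c) * (\<Sum>c\<in>PiE B (\<lambda>_. J). G c) =
     (\<Sum>(c, d)\<in>PiE A (\<lambda>_. J) \<times> PiE B (\<lambda>_. J). F c * G d)"
    unfolding sum_product sum.cartesian_product ..
  also have "\<dots> = (\<Sum>c\<in>PiE (A \<union> B) (\<lambda>_. J). F (restrict c A) * G (restrict c B))"
  proof (rule sum.reindex_bij_witness[of _ "\<lambda>c. (restrict c A, restrict c B)"
      "\<lambda>(c, d). \<lambda>x. if x \<in> A then c x else d x"])
    fix x assume "x \<in> PiE A (\<lambda>_. J) \<times> PiE B (\<lambda>_. J)"
    then obtain c d where x: "x = (c, d)" "c \<in> PiE A (\<lambda>_. J)" "d \<in> PiE B (\<lambda>_. J)" by auto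
    have 1: "restrict (\<lambda>x. if x \<in> A then c x else d x) A = c"
      using x by (intro ext) (auto simp: PiE_def extensional_def)
    have 2: "restrict (\<lambda>x. if x \<in> A then c x else d x) B = d"
      using x AB by (intro ext) (auto simp: PiE_def extensional_def)
    show "(restrict (case x of (c, d) \<Rightarrow> \<lambda>x. if x \<in> A then c x else d x) A,
        restrict (case x of (c, d) \<Rightarrow> \<lambda>x. if x \<in> A then c x else d x) B) = x"
      using x 1 2 by simp
    show "(case x of (c, d) \<Rightarrow> \<lambda>x. if x \<in> A then c x else d x) \<in> PiE (A \<union> B) (\<lambda>_. J)"
      using x by (auto simp: PiE_def extensional_def)
    show "F (restrict (case x of (c, d) \<Rightarrow> \<lambda>x. if x \<in> A then c x else d x) A) *
        G (restrict (case x of (c, d) \<Rightarrow> \<lambda>x. if x \<in> A then c x else d x) B) = (case x of (c, d) \<Rightarrow> F c * G d)"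
      using x 1 2 by simp
  next
    fix c assume c: "c \<in> PiE (A \<union> B) (\<lambda>_. J)"
    show "(restrict c A, restrict c B) \<in> PiE A (\<lambda>_. J) \<times> PiE B (\<lambda>_. J)" using c by auto
    show "(case (restrict c A, restrict c B) of (c, d) \<Rightarrow> \<lambda>x. if x \<in> A then c x else d x) = c"
      using c by (intro ext) (auto simp: PiE_def extensional_def)
  qed
  finally show ?thesis .
qed

context iid_array
begin

text \<open>The joint moment of the factors at the positions in \<open>A\<close>: position
  \<open>s\<close> contributes \<open>g s\<close> at every entry in \<open>E s\<close>, and
  independence turns the expectation into a product over the entries.\<close>

definition tmom :: "('i \<Rightarrow> 'e set) \<Rightarrow> ('i \<Rightarrow> real poly) \<Rightarrow> 'i set \<Rightarrow> real" where
  "tmom E g A = (\<Prod>e\<in>(\<Union>s\<in>A. E s). poly_mom m (\<Prod>s\<in>{s\<in>A. e \<in> E s}. g s))"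

lemma
  assumes A: "finite A" and E: "\<And>s. s \<in> A \<Longrightarrow> finite (E s) \<and> E s \<subseteq> I"
  shows integrable_tmom: "integrable M (\<lambda>\<omega>. \<Prod>s\<in>A. \<Prod>e\<in>E s. poly (g s) (Xe e \<omega>))"
    and expectation_tmom: "expectation (\<lambda>\<omega>. \<Prod>s\<in>A. \<Prod>e\<in>E s. poly (g s) (Xe e \<omega>)) = tmom E g A"
proof -
  let ?F = "\<Union>s\<in>A. E s"
  have F: "finite ?F" "?F \<subseteq> I" using A E by auto
  have eq: "(\<Prod>s\<in>A. \<Prod>e\<in>E s. poly (g s) (Xe e \<omega>)) = (\<Prod>e\<in>?F. poly (\<Prod>s\<in>{s\<in>A. e \<in> E s}. g s) (Xe e \<omega>))" for \<omega>
  proof -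
    have "(\<Prod>s\<in>A. \<Prod>e\<in>E s. poly (g s) (Xe e \<omega>)) = (\<Prod>s\<in>A. \<Prod>e\<in>?F. if e \<in> E s then poly (g s) (Xe e \<omega>) else 1)"
    proof (rule prod.cong[OF refl])
      fix s assume s: "s \<in> A"
      then have "E s = {e \<in> ?F. e \<in> E s}" by auto
      then show "(\<Prod>e\<in>E s. poly (g s) (Xe e \<omega>)) = (\<Prod>e\<in>?F. if e \<in> E s then poly (g s) (Xe e \<omega>) else 1)"
        using prod.inter_filter[OF F(1), of "\<lambda>e. poly (g s) (Xe e \<omega>)" "\<lambda>e. e \<in> E s"] by simp
    qed
    also have "\<dots> = (\<Prod>e\<in>?F. \<Prod>s\<in>A. if e \<in> E s then poly (g s) (Xe e \<omega>) else 1)" by (rule prod.swap)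
    also have "\<dots> = (\<Prod>e\<in>?F. poly (\<Prod>s\<in>{s\<in>A. e \<in> E s}. g s) (Xe e \<omega>))"
      by (intro prod.cong refl) (simp only: poly_prod prod.inter_filter[OF A, symmetric])
    finally show ?thesis .
  qed
  show "integrable M (\<lambda>\<omega>. \<Prod>s\<in>A. \<Prod>e\<in>E s. poly (g s) (Xe e \<omega>))"
    unfolding eq by (rule integrable_prod_poly[OF F])
  show "expectation (\<lambda>\<omega>. \<Prod>s\<in>A. \<Prod>e\<in>E s. poly (g s) (Xe e \<omega>)) = tmom E g A"
    unfolding eq tmom_def by (rule expectation_prod_poly[OF F])
qed

lemma tmom_cong: "(\<And>s. s \<in> A \<Longrightarrow> E s = E' s \<and> g s = g' s) \<Longrightarrow> tmom E g A = tmom E' g' A"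
  unfolding tmom_def by (intro prod.cong arg_cong[of _ _ "poly_mom m"]) auto

text \<open>An entry that belongs to one position only contributes a factor of mean zero.\<close>

lemma tmom_zero:
  assumes "finite A" "\<And>s. s \<in> A \<Longrightarrow> finite (E s)" "s \<in> A" "e \<in> E s" "\<And>s'. s' \<in> A \<Longrightarrow> s' \<noteq> s \<Longrightarrow> e \<notin> E s'"
    and "poly_mom m (g s) = 0"
  shows "tmom E g A = 0"
proof -
  have "{s\<in>A. e \<in> E s} = {s}" using assms(3-5) by auto
  then have "poly_mom m (\<Prod>s\<in>{s\<in>A. e \<in> E s}. g s) = 0" using assms(6) by simp
  moreover have "finite (\<Union>s\<in>A. E s)" using assms(1,2) by auto
  ultimately show ?thesis unfolding tmom_def using assms(3,4) by (intro prod_zero) auto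
qed

lemma tmom_disjoint:
  assumes "finite A" "finite B" "\<And>s. s \<in> A \<union> B \<Longrightarrow> finite (E s)" "A \<inter> B = {}"
    and d: "\<And>s s'. s \<in> A \<Longrightarrow> s' \<in> B \<Longrightarrow> E s \<inter> E s' = {}"
  shows "tmom E g (A \<union> B) = tmom E g A * tmom E g B"
proof -
  have "tmom E g (A \<union> B) = (\<Prod>e\<in>(\<Union>s\<in>A. E s) \<union> (\<Union>s\<in>B. E s). poly_mom m (\<Prod>s\<in>{s\<in>A \<union> B. e \<in> E s}. g s))"
    unfolding tmom_def by (simp add: UN_Un)
  also have "\<dots> = (\<Prod>e\<in>(\<Union>s\<in>A. E s). poly_mom m (\<Prod>s\<in>{s\<in>A \<union> B. e \<in> E s}. g s)) *
     (\<Prod>e\<in>(\<Union>s\<in>B. E s). poly_mom m (\<Prod>s\<in>{s\<in>A \<union> B. e \<in> E s}. g s))"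
    using assms by (intro prod.union_disjoint) fastforce+
  also have "(\<Prod>e\<in>(\<Union>s\<in>A. E s). poly_mom m (\<Prod>s\<in>{s\<in>A \<union> B. e \<in> E s}. g s)) = tmom E g A"
    unfolding tmom_def
  proof (intro prod.cong refl)
    fix e assume "e \<in> (\<Union>s\<in>A. E s)"
    then have "{s\<in>A \<union> B. e \<in> E s} = {s\<in>A. e \<in> E s}" using d by fastforce
    then show "poly_mom m (\<Prod>s\<in>{s\<in>A \<union> B. e \<in> E s}. g s) = poly_mom m (\<Prod>s\<in>{s\<in>A. e \<in> E s}. g s)" by simp
  qed
  also have "(\<Prod>e\<in>(\<Union>s\<in>B. E s). poly_mom m (\<Prod>s\<in>{s\<in>A \<union> B. e \<in> E s}. g s)) = tmom E g B"
    unfolding tmom_def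
  proof (intro prod.cong refl)
    fix e assume "e \<in> (\<Union>s\<in>B. E s)"
    then have "{s\<in>A \<union> B. e \<in> E s} = {s\<in>B. e \<in> E s}" using d by fastforce
    then show "poly_mom m (\<Prod>s\<in>{s\<in>A \<union> B. e \<in> E s}. g s) = poly_mom m (\<Prod>s\<in>{s\<in>B. e \<in> E s}. g s)" by simp
  qed
  finally show ?thesis .
qed

text \<open>Positions carry one of two polynomials, so that every factor of \<open>tmom\<close> is
  the moment of some \<open>g True ^ i * g False ^ j\<close>; the bound is therefore uniform in the
  edge sets.\<close>

definition tbound :: "(bool \<Rightarrow> real poly) \<Rightarrow> nat \<Rightarrow> real" where
  "tbound g p = 1 + (\<Sum>i\<le>p. \<Sum>j\<le>p. \<bar>poly_mom m (g True ^ i * g False ^ j)\<bar>)"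

lemma tbound_ge_1: "tbound g p \<ge> 1"
  unfolding tbound_def by (simp add: sum_nonneg)

lemma abs_tmom_le:
  fixes \<tau> :: "'i \<Rightarrow> bool"
  assumes A: "finite A" "card A \<le> p" and c: "card (\<Union>s\<in>A. E s) \<le> L"
  shows "\<bar>tmom E (\<lambda>s. g (\<tau> s)) A\<bar> \<le> tbound g p ^ L"
proof -
  have "\<bar>poly_mom m (\<Prod>s\<in>{s\<in>A. e \<in> E s}. g (\<tau> s))\<bar> \<le> tbound g p" for e
  proof -
    let ?A = "{s\<in>A. e \<in> E s}"
    have fA: "finite ?A" using A by simp
    define i where "i = card {s\<in>?A. \<tau> s}"
    define j where "j = card {s\<in>?A. \<not> \<tau> s}"
    have ij: "i \<le> p" "j \<le> p" unfolding i_def j_def using A by (auto intro!: order_trans[OF card_mono A(2)])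
    have "(\<Prod>s\<in>?A. g (\<tau> s)) = (\<Prod>s\<in>{s\<in>?A. \<tau> s} \<union> {s\<in>?A. \<not> \<tau> s}. g (\<tau> s))"
      by (intro prod.cong) auto
    also have "\<dots> = (\<Prod>s\<in>{s\<in>?A. \<tau> s}. g (\<tau> s)) * (\<Prod>s\<in>{s\<in>?A. \<not> \<tau> s}. g (\<tau> s))"
      using A by (intro prod.union_disjoint) auto
    also have "\<dots> = g True ^ i * g False ^ j" unfolding i_def j_def by simp
    finally have eq: "(\<Prod>s\<in>?A. g (\<tau> s)) = g True ^ i * g False ^ j" .
    have "\<bar>poly_mom m (g True ^ i * g False ^ j)\<bar> \<le> (\<Sum>j\<le>p. \<bar>poly_mom m (g True ^ i * g False ^ j)\<bar>)"
      using ij by (intro member_le_sum[of j _ "\<lambda>j. \<bar>poly_mom m (g True ^ i * g False ^ j)\<bar>"]) auto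
    also have "\<dots> \<le> (\<Sum>i\<le>p. \<Sum>j\<le>p. \<bar>poly_mom m (g True ^ i * g False ^ j)\<bar>)"
      using ij by (intro member_le_sum[of i _ "\<lambda>i. \<Sum>j\<le>p. \<bar>poly_mom m (g True ^ i * g False ^ j)\<bar>"]) (auto intro: sum_nonneg)
    finally show ?thesis unfolding eq tbound_def by simp
  qed
  then have "\<bar>tmom E (\<lambda>s. g (\<tau> s)) A\<bar> \<le> (\<Prod>e\<in>(\<Union>s\<in>A. E s). tbound g p)"
    unfolding tmom_def abs_prod by (intro prod_mono) auto
  also have "\<dots> = tbound g p ^ card (\<Union>s\<in>A. E s)" by simp
  also have "\<dots> \<le> tbound g p ^ L" using c tbound_ge_1 by (intro power_increasing) auto
  finally show ?thesis .
qed

end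

text \<open>If the cycles of a tuple have at least half as many vertices as there are positions and every edge
  is covered twice, then every vertex lies on exactly two cycles, so that the cycles are matched in pairs.\<close>
lemma wick_exact:
  fixes w :: "nat \<Rightarrow> 'v list" and g :: "nat \<Rightarrow> real poly" and Xe :: "'v set \<Rightarrow> 'a \<Rightarrow> real"
  assumes iid: "iid_array M Xe I m"
    and p: "p \<ge> 2"
    and k: "\<And>s. s < p \<Longrightarrow> k s \<ge> 1"
    and w: "\<And>s. s < p \<Longrightarrow> w s \<in> simple_walks (S s) (T s) (k s)"
    and g: "\<And>s. s < p \<Longrightarrow> poly_mom m (g s) = 0"
    and many: "(\<Sum>s<p. k s) \<le> card (\<Union>s<p. set (w s))"
  shows "iid_array.tmom m (\<lambda>s. set (path_edges (w s))) g {..<p} =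
     (\<Sum>q\<in>{1..<p}. iid_array.tmom m (\<lambda>s. set (path_edges (w s))) g {0, q} *
        iid_array.tmom m (\<lambda>s. set (path_edges (w s))) g ({..<p} - {0, q}))"
proof -
  interpret iid_array M Xe I m by fact
  define E where "E s = set (path_edges (w s))" for s
  define V where "V s = set (w s)" for s
  have wc: "w s \<in> cwalks (S s) (T s) (k s)" if "s < p" for s using w[OF that] by (simp add: simple_walks_def)
  have VE: "\<Union> (E s) = V s" if "s < p" for s
    unfolding E_def V_def using cwalksD(3)[OF wc[OF that]] k[OF that] by (intro Union_path_edges) simp
  have fE: "finite (E s)" and fV: "finite (V s)" for s by (simp_all add: E_def V_def)
  have cV: "card (V s) = 2 * k s" if "s < p" for s
    unfolding V_def using w[OF that] k[OF that] by (rule card_set_simple_walk)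
  have Ene: "e \<noteq> {}" if "e \<in> E s" for e s using that path_edges_nonempty unfolding E_def by metis
  have Enonempty: "E s \<noteq> {}" if "s < p" for s using VE[OF that] cV[OF that] k[OF that] by force
  have rest: "{..<p} = {0, q} \<union> ({..<p} - {0, q})" if "q \<in> {1..<p}" for q using that by auto
  have "tmom E g {..<p} = (\<Sum>q\<in>{1..<p}. tmom E g {0, q} * tmom E g ({..<p} - {0, q}))"
  \<comment> \<open>An edge private to one cycle makes both sides vanish. Otherwise every edge lies
    on at least two cycles.\<close>
  proof (cases "\<exists>e s. s < p \<and> e \<in> E s \<and> (\<forall>s'<p. s' \<noteq> s \<longrightarrow> e \<notin> E s')")
    case True
    then obtain e s where es: "s < p" "e \<in> E s" "\<And>s'. s' < p \<Longrightarrow> s' \<noteq> s \<Longrightarrow> e \<notin> E s'" by blast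
    have "tmom E g {..<p} = 0" using es fE g[OF es(1)] by (intro tmom_zero[of _ E s e]) auto
    moreover have "tmom E g {0, q} * tmom E g ({..<p} - {0, q}) = 0" if q: "q \<in> {1..<p}" for q
    proof (cases "s \<in> {0, q}")
      case True
      then have "tmom E g {0, q} = 0" using es fE g[OF es(1)] q by (intro tmom_zero[of _ E s e]) auto
      then show ?thesis by simp
    next
      case False
      then have "tmom E g ({..<p} - {0, q}) = 0" using es fE g[OF es(1)] q by (intro tmom_zero[of _ E s e]) auto
      then show ?thesis by simp
    qed
    then have "(\<Sum>q\<in>{1..<p}. tmom E g {0, q} * tmom E g ({..<p} - {0, q})) = 0"
      by (intro sum.neutral ballI)
    ultimately show ?thesis by simp
  next
    case False
    then have cover: "\<exists>s'<p. s' \<noteq> s \<and> e \<in> E s'" if "s < p" "e \<in> E s" for e s using that by blast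
    let ?U = "\<Union>s<p. V s"
    let ?d = "\<lambda>v. card {s \<in> {..<p}. v \<in> V s}"
    have fU: "finite ?U" using fV by simp
    \<comment> \<open>A vertex inherits the double covering from an edge that contains it. The
      cycles have \<open>2 * (\<Sum>s<p. k s)\<close> vertices with multiplicity, so that
      \<open>many\<close> leaves no room for a third cycle at any vertex.\<close>
    have ge2: "?d v \<ge> 2" if v: "v \<in> ?U" for v
    proof -
      obtain s where s: "s < p" "v \<in> V s" using v by auto
      then obtain e where e: "e \<in> E s" "v \<in> e" using VE[OF s(1)] by blast
      obtain s' where s': "s' < p" "s' \<noteq> s" "e \<in> E s'" using cover[OF s(1) e(1)] by blast
      have "v \<in> V s'" using VE[OF s'(1)] s'(3) e(2) by blast
      then have "{s, s'} \<subseteq> {s \<in> {..<p}. v \<in> V s}" using s s' by auto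
      then have "card {s, s'} \<le> ?d v" by (intro card_mono) auto
      then show ?thesis using s'(2) by simp
    qed
    have "(\<Sum>v\<in>?U. ?d v) = (\<Sum>v\<in>?U. \<Sum>s<p. if v \<in> V s then 1 else 0)"
      by (intro sum.cong refl) (simp add: sum.inter_filter[symmetric])
    also have "\<dots> = (\<Sum>s<p. \<Sum>v\<in>?U. if v \<in> V s then 1 else 0)" by (rule sum.swap)
    also have "\<dots> = (\<Sum>s<p. card (V s))"
    proof (intro sum.cong refl)
      fix s assume "s \<in> {..<p}"
      then have "{v \<in> ?U. v \<in> V s} = V s" by auto
      then show "(\<Sum>v\<in>?U. if v \<in> V s then 1 else 0) = card (V s)"
        using sum.inter_filter[OF fU, of "\<lambda>_. 1 :: nat" "\<lambda>v. v \<in> V s"] by simp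
    qed
    also have "\<dots> = 2 * (\<Sum>s<p. k s)" using cV by (simp add: sum_distrib_left)
    also have "\<dots> \<le> (\<Sum>v\<in>?U. 2)" using many unfolding V_def by simp
    finally have le: "(\<Sum>v\<in>?U. ?d v) \<le> (\<Sum>v\<in>?U. 2)" .
    have eq2: "?d v = 2" if v: "v \<in> ?U" for v
    proof (rule ccontr)
      assume "?d v \<noteq> 2"
      then have "2 < ?d v" using ge2[OF v] by simp
      then have "(\<Sum>v\<in>?U. 2) < (\<Sum>v\<in>?U. ?d v)" using fU ge2 v by (intro sum_strict_mono_ex1) auto
      then show False using le by simp
    qed
    have two: "x = a \<or> x = b" if "v \<in> V a" "v \<in> V b" "v \<in> V x" "a < p" "b < p" "x < p" "a \<noteq> b" for v a b x
    proof -
      have vU: "v \<in> ?U" using that by blast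
      have "{a, b} = {s \<in> {..<p}. v \<in> V s}"
      proof (rule card_subset_eq)
        show "card {a, b} = card {s \<in> {..<p}. v \<in> V s}" unfolding eq2[OF vU] using that by simp
      qed (use that in auto)
      then show ?thesis using that by blast
    qed
    have p0: "0 < p" using p by simp
    obtain e0 where e0: "e0 \<in> E 0" using Enonempty[OF p0] by blast
    obtain q where q: "q < p" "q \<noteq> 0" "e0 \<in> E q" using cover[OF p0 e0] by blast
    \<comment> \<open>If an edge of \<open>a\<close> touches \<open>V b\<close>, the second cycle
      through this edge meets \<open>a\<close> and \<open>b\<close> in a vertex and must be
      \<open>b\<close> itself. By connectedness this spreads from \<open>e0\<close> over the whole
      cycle.\<close>
    have sub: "V a \<subseteq> V b \<and> E a \<subseteq> E b" if ab: "a < p" "b < p" "a \<noteq> b" "e0 \<in> E a" "e0 \<in> E b" for a b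
    proof -
      have step: "e \<in> E b" if e: "e \<in> E a" "e \<inter> V b \<noteq> {}" for e
      proof -
        obtain v where v: "v \<in> e" "v \<in> V b" using e by blast
        obtain s' where s': "s' < p" "s' \<noteq> a" "e \<in> E s'" using cover[OF ab(1) e(1)] by blast
        have "v \<in> V s'" "v \<in> V a" using VE[OF s'(1)] VE[OF ab(1)] s'(3) e(1) v(1) by blast+
        then have "s' = b" using two[of v a b s'] v ab s' by blast
        then show ?thesis using s' by simp
      qed
      have "set (w a) \<subseteq> V b"
      proof (rule path_connected_set)
        fix e assume "e \<in> set (path_edges (w a))" "e \<inter> V b \<noteq> {}"
        then have "e \<in> E b" using step by (simp add: E_def)
        then show "e \<subseteq> V b" using VE[OF ab(2)] by blast
      next
        have "e0 \<subseteq> V a" "e0 \<subseteq> V b" using VE[OF ab(1)] VE[OF ab(2)] ab by blast+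
        then show "set (w a) \<inter> V b \<noteq> {}" using Ene[OF e0] unfolding V_def by blast
      qed
      then have 1: "V a \<subseteq> V b" by (simp add: V_def)
      have "e \<in> E b" if "e \<in> E a" for e
      proof -
        have "e \<subseteq> V a" using VE[OF ab(1)] that by blast
        then have "e \<inter> V b \<noteq> {}" using 1 Ene[OF that] by blast
        then show ?thesis using step that by blast
      qed
      with 1 show ?thesis by blast
    qed
    have E0q: "V 0 = V q" "E 0 = E q" using sub[of 0 q] sub[of q 0] p0 q e0 by auto
    have other: "V s \<inter> V 0 = {}" if s: "s < p" "s \<noteq> 0" "s \<noteq> q" for s
    proof (rule ccontr)
      assume "V s \<inter> V 0 \<noteq> {}"
      then obtain v where "v \<in> V s" "v \<in> V 0" "v \<in> V q" using E0q by blast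
      then show False using two[of v 0 q s] s p0 q by auto
    qed
    have dis: "E s \<inter> E 0 = {}" if s: "s < p" "s \<noteq> 0" "s \<noteq> q" for s
    proof (rule ccontr)
      assume "E s \<inter> E 0 \<noteq> {}"
      then obtain e where e: "e \<in> E s" "e \<in> E 0" by blast
      then have "e \<subseteq> V s" "e \<subseteq> V 0" using VE[OF s(1)] VE[OF p0] by blast+
      then show False using other[OF s] Ene[OF e(1)] by blast
    qed
    have main: "tmom E g {..<p} = tmom E g {0, q} * tmom E g ({..<p} - {0, q})"
    proof -
      have qp: "q \<in> {1..<p}" using q by simp
      have "tmom E g ({0, q} \<union> ({..<p} - {0, q})) = tmom E g {0, q} * tmom E g ({..<p} - {0, q})"
      proof (rule tmom_disjoint)
        fix s s' assume "s \<in> {0, q}" "s' \<in> {..<p} - {0, q}"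
        then show "E s \<inter> E s' = {}" using dis[of s'] E0q by auto
      qed (use fE in auto)
      then show ?thesis using rest[OF qp] by simp
    qed
    \<comment> \<open>For any other partner \<open>q'\<close> the edge \<open>e0\<close> is private
      to position 0 within the pair.\<close>
    have zero: "tmom E g {0, q'} = 0" if "q' \<in> {1..<p}" "q' \<noteq> q" for q'
      using dis[of q'] that e0 fE g[OF p0] by (intro tmom_zero[of _ E 0 e0]) auto
    have "(\<Sum>q'\<in>{1..<p}. tmom E g {0, q'} * tmom E g ({..<p} - {0, q'})) =
       (\<Sum>q'\<in>{q}. tmom E g {0, q'} * tmom E g ({..<p} - {0, q'}))"
      using q zero by (intro sum.mono_neutral_right) auto
    then show ?thesis using main by simp
  qed
  then show ?thesis unfolding E_def .
qed

text \<open>The booleans tag the cycles of the two matrices.\<close>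
lemma wick_bound:
  fixes g :: "bool \<Rightarrow> real poly" and k :: "bool \<Rightarrow> nat" and Xe :: "'v set \<Rightarrow> 'a \<Rightarrow> real"
  assumes iid: "iid_array M Xe I m" and p: "p \<ge> 2" and k: "\<And>b. k b \<ge> 1" and g: "\<And>b. poly_mom m (g b) = 0"
  shows "\<exists>C\<ge>0. \<forall>S T :: bool \<Rightarrow> 'v set. \<forall>\<omega> :: bool \<Rightarrow> real. \<forall>V.
    (\<forall>b. finite (S b) \<and> finite (T b) \<and> S b \<union> T b \<subseteq> V \<and> bip_edges (S b) (T b) \<subseteq> I) \<longrightarrow> finite V \<longrightarrow>
    (let F = (\<lambda>x. \<Sum>c\<in>(SIGMA b:UNIV. simple_walks (S b) (T b) (k b)). \<omega> (fst c) *
         (\<Prod>e\<in>set (path_edges (snd c)). poly (g (fst c)) (Xe e x)))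
     in (\<forall>n. integrable M (\<lambda>x. F x ^ n)) \<and>
       real (card V) * \<bar>(\<integral>x. F x ^ p \<partial>M) - real (p - 1) * (\<integral>x. F x ^ 2 \<partial>M) * (\<integral>x. F x ^ (p - 2) \<partial>M)\<bar>
       \<le> C * (\<Sum>b\<in>UNIV. \<bar>\<omega> b\<bar> * real (card V) ^ k b) ^ p)"
proof -
  interpret iid_array M Xe I m by fact
  define K where "K = k True + k False"
  have kK: "k b \<le> K" for b by (cases b) (auto simp: K_def)
  \<comment> \<open>A cycle of either kind has at most \<open>2 * K\<close> edges, so that a tuple
    of \<open>p\<close> cycles involves at most \<open>2 * p * K\<close> entries.\<close>
  define G where "G = tbound g p ^ (2 * p * K)"
  define C where "C = (G + real p * (G * G)) * real (p * K) ^ (2 * p * K)"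
  have G1: "G \<ge> 1" unfolding G_def using tbound_ge_1 by (intro one_le_power) auto
  have C0: "C \<ge> 0" unfolding C_def using G1 by simp
  show ?thesis
  proof (intro exI[of _ C] conjI C0 allI impI)
    fix S T :: "bool \<Rightarrow> 'v set" and \<omega> :: "bool \<Rightarrow> real" and V
    assume ST: "\<forall>b. finite (S b) \<and> finite (T b) \<and> S b \<union> T b \<subseteq> V \<and> bip_edges (S b) (T b) \<subseteq> I" and V: "finite V"
    define J where "J = (SIGMA b:UNIV. simple_walks (S b) (T b) (k b))"
    define \<xi> where "\<xi> c x = (\<Prod>e\<in>set (path_edges (snd c)). poly (g (fst c)) (Xe e x))" for c :: "bool \<times> 'v list" and x
    define F where "F x = (\<Sum>c\<in>J. \<omega> (fst c) * \<xi> c x)" for x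
    define \<mu> where "\<mu> A c = tmom (\<lambda>s. set (path_edges (snd (c s)))) (\<lambda>s. g (fst (c s))) A" for A and c :: "nat \<Rightarrow> bool \<times> 'v list"
    have fJ: "finite J" unfolding J_def using ST by (intro finite_SigmaI) auto
    have Jw: "snd c \<in> simple_walks (S (fst c)) (T (fst c)) (k (fst c))" if "c \<in> J" for c using that by (auto simp: J_def)
    have JE: "set (path_edges (snd c)) \<subseteq> I" if "c \<in> J" for c
      using Jw[OF that] path_edges_bip[OF cwalksD(1)] ST unfolding simple_walks_def by blast
    have pw: "F x ^ card A = (\<Sum>c\<in>PiE A (\<lambda>_. J). (\<Prod>s\<in>A. \<omega> (fst (c s))) * (\<Prod>s\<in>A. \<xi> (c s) x))" if "finite A" for A :: "nat set" and x
    proof -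
      have "F x ^ card A = (\<Prod>s\<in>A. \<Sum>c\<in>J. \<omega> (fst c) * \<xi> c x)" by (simp add: F_def)
      also have "\<dots> = (\<Sum>c\<in>PiE A (\<lambda>_. J). \<Prod>s\<in>A. \<omega> (fst (c s)) * \<xi> (c s) x)" using that fJ by (intro prod_sum_PiE) auto
      finally show ?thesis by (simp add: prod.distrib)
    qed
    have JA: "finite (set (path_edges (snd (c s)))) \<and> set (path_edges (snd (c s))) \<subseteq> I" if "c \<in> PiE A (\<lambda>_. J)" "s \<in> A" for c A and s :: nat
      using that JE[of "c s"] by auto
    have int: "integrable M (\<lambda>x. F x ^ card A)" if "finite A" for A :: "nat set"
      unfolding pw[OF that] \<xi>_def using that
      by (intro Bochner_Integration.integrable_sum integrable_mult_right integrable_tmom JA)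
    have E: "expectation (\<lambda>x. F x ^ card A) = (\<Sum>c\<in>PiE A (\<lambda>_. J). (\<Prod>s\<in>A. \<omega> (fst (c s))) * \<mu> A c)" if A: "finite A" for A :: "nat set"
    proof -
      have "expectation (\<lambda>x. F x ^ card A) = (\<Sum>c\<in>PiE A (\<lambda>_. J). expectation (\<lambda>x. (\<Prod>s\<in>A. \<omega> (fst (c s))) * (\<Prod>s\<in>A. \<xi> (c s) x)))"
        unfolding pw[OF A] \<xi>_def
        by (rule Bochner_Integration.integral_sum) (intro integrable_mult_right integrable_tmom A JA)
      also have "\<dots> = (\<Sum>c\<in>PiE A (\<lambda>_. J). (\<Prod>s\<in>A. \<omega> (fst (c s))) * \<mu> A c)"
      proof (rule sum.cong[OF refl])
        fix c assume c: "c \<in> PiE A (\<lambda>_. J)"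
        have "expectation (\<lambda>x. \<Prod>s\<in>A. \<xi> (c s) x) = \<mu> A c"
          unfolding \<xi>_def \<mu>_def by (rule expectation_tmom[OF A JA[OF c]])
        then show "expectation (\<lambda>x. (\<Prod>s\<in>A. \<omega> (fst (c s))) * (\<Prod>s\<in>A. \<xi> (c s) x)) = (\<Prod>s\<in>A. \<omega> (fst (c s))) * \<mu> A c"
          by simp
      qed
      finally show ?thesis .
    qed
    let ?P = "PiE {..<p} (\<lambda>_. J)"
    define H where "H c = \<mu> {..<p} c - (\<Sum>q\<in>{1..<p}. \<mu> {0, q} c * \<mu> ({..<p} - {0, q}) c)" for c
    \<comment> \<open>Here \<open>q\<close> is the partner of position 0. Each of the
      \<open>p - 1\<close> choices gives the same product of expectations, which produces the factor
      in the recursion.\<close>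
    have prodE: "expectation (\<lambda>x. F x ^ 2) * expectation (\<lambda>x. F x ^ (p - 2)) =
       (\<Sum>c\<in>?P. (\<Prod>s<p. \<omega> (fst (c s))) * (\<mu> {0, q} c * \<mu> ({..<p} - {0, q}) c))" if q: "q \<in> {1..<p}" for q
    proof -
      let ?A = "{0, q}" and ?B = "{..<p} - {0, q}"
      have un: "?A \<union> ?B = {..<p}" using q by auto
      have cA: "card ?A = 2" "card ?B = p - 2" using q by (auto simp: card_Diff_subset)
      have "expectation (\<lambda>x. F x ^ 2) * expectation (\<lambda>x. F x ^ (p - 2)) =
        (\<Sum>c\<in>PiE ?A (\<lambda>_. J). (\<Prod>s\<in>?A. \<omega> (fst (c s))) * \<mu> ?A c) * (\<Sum>c\<in>PiE ?B (\<lambda>_. J). (\<Prod>s\<in>?B. \<omega> (fst (c s))) * \<mu> ?B c)"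
        using E[of ?A] E[of ?B] unfolding cA by simp
      also have "\<dots> = (\<Sum>c\<in>PiE (?A \<union> ?B) (\<lambda>_. J). ((\<Prod>s\<in>?A. \<omega> (fst (restrict c ?A s))) * \<mu> ?A (restrict c ?A)) *
          ((\<Prod>s\<in>?B. \<omega> (fst (restrict c ?B s))) * \<mu> ?B (restrict c ?B)))"
        by (rule sum_PiE_split) auto
      also have "\<dots> = (\<Sum>c\<in>?P. (\<Prod>s<p. \<omega> (fst (c s))) * (\<mu> ?A c * \<mu> ?B c))"
        unfolding un
      proof (intro sum.cong refl)
        fix c
        have r: "\<mu> D (restrict c D) = \<mu> D c" for D unfolding \<mu>_def by (rule tmom_cong) simp
        have r2: "(\<Prod>s\<in>D. \<omega> (fst (restrict c D s))) = (\<Prod>s\<in>D. \<omega> (fst (c s)))" for D by (intro prod.cong) auto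
        have r3: "(\<Prod>s<p. \<omega> (fst (c s))) = (\<Prod>s\<in>?A. \<omega> (fst (c s))) * (\<Prod>s\<in>?B. \<omega> (fst (c s)))"
        proof -
          have "prod f (?A \<union> ?B) = prod f ?A * prod f ?B" for f :: "nat \<Rightarrow> real" by (rule prod.union_disjoint) auto
          then show ?thesis unfolding un .
        qed
        show "((\<Prod>s\<in>?A. \<omega> (fst (restrict c ?A s))) * \<mu> ?A (restrict c ?A)) * ((\<Prod>s\<in>?B. \<omega> (fst (restrict c ?B s))) * \<mu> ?B (restrict c ?B))
          = (\<Prod>s<p. \<omega> (fst (c s))) * (\<mu> ?A c * \<mu> ?B c)"
          unfolding r r2 r3 by (simp only: mult_ac)
      qed
      finally show ?thesis .
    qed
    have diff: "expectation (\<lambda>x. F x ^ p) - real (p - 1) * expectation (\<lambda>x. F x ^ 2) * expectation (\<lambda>x. F x ^ (p - 2)) =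
       (\<Sum>c\<in>?P. (\<Prod>s<p. \<omega> (fst (c s))) * H c)"
    proof -
      have "real (p - 1) * expectation (\<lambda>x. F x ^ 2) * expectation (\<lambda>x. F x ^ (p - 2)) =
        (\<Sum>q\<in>{1..<p}. expectation (\<lambda>x. F x ^ 2) * expectation (\<lambda>x. F x ^ (p - 2)))" by simp
      also have "\<dots> = (\<Sum>q\<in>{1..<p}. \<Sum>c\<in>?P. (\<Prod>s<p. \<omega> (fst (c s))) * (\<mu> {0, q} c * \<mu> ({..<p} - {0, q}) c))"
        by (intro sum.cong refl prodE)
      also have "\<dots> = (\<Sum>c\<in>?P. \<Sum>q\<in>{1..<p}. (\<Prod>s<p. \<omega> (fst (c s))) * (\<mu> {0, q} c * \<mu> ({..<p} - {0, q}) c))" by (rule sum.swap)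
      finally show ?thesis using E[of "{..<p}"] unfolding H_def
        by (simp add: sum_subtractf right_diff_distrib sum_distrib_left)
    qed
    \<comment> \<open>Tuples are sorted by their tags, because the cycle lengths and with them the
      critical number of vertices depend on the tags.\<close>
    let ?Q = "\<lambda>\<tau>. {c \<in> ?P. restrict (\<lambda>s. fst (c s)) {..<p} = \<tau>}"
    let ?TT = "PiE {..<p} (\<lambda>_. UNIV :: bool set)"
    have tag: "fst (c s) = \<tau> s" if "c \<in> ?Q \<tau>" "s < p" for c s \<tau>
    proof -
      have "restrict (\<lambda>s. fst (c s)) {..<p} = \<tau>" using that(1) by blast
      then have "restrict (\<lambda>s. fst (c s)) {..<p} s = \<tau> s" by (rule fun_cong)
      then show ?thesis using that(2) by simp
    qed
    have fP: "finite ?P" using fJ by (intro finite_PiE) auto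
    have "(\<Sum>c\<in>?P. (\<Prod>s<p. \<omega> (fst (c s))) * H c) = (\<Sum>\<tau>\<in>?TT. \<Sum>c\<in>?Q \<tau>. (\<Prod>s<p. \<omega> (fst (c s))) * H c)"
    proof (rule sum.group[symmetric, OF fP])
      show "finite ?TT" by (rule finite_PiE) simp_all
      show "(\<lambda>c. restrict (\<lambda>s. fst (c s)) {..<p}) ` ?P \<subseteq> ?TT" by (intro image_subsetI restrict_PiE_iff[THEN iffD2]) simp
    qed
    also have "\<dots> = (\<Sum>\<tau>\<in>?TT. (\<Prod>s<p. \<omega> (\<tau> s)) * (\<Sum>c\<in>?Q \<tau>. H c))"
    proof (intro sum.cong refl)
      fix \<tau> assume "\<tau> \<in> ?TT"
      have "(\<Prod>s<p. \<omega> (fst (c s))) = (\<Prod>s<p. \<omega> (\<tau> s))" if "c \<in> ?Q \<tau>" for c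
        by (rule prod.cong[OF refl]) (simp add: tag[OF that])
      then show "(\<Sum>c\<in>?Q \<tau>. (\<Prod>s<p. \<omega> (fst (c s))) * H c) = (\<Prod>s<p. \<omega> (\<tau> s)) * (\<Sum>c\<in>?Q \<tau>. H c)"
        unfolding sum_distrib_left by (intro sum.cong refl) simp_all
    qed
    finally have diff2: "expectation (\<lambda>x. F x ^ p) - real (p - 1) * expectation (\<lambda>x. F x ^ 2) * expectation (\<lambda>x. F x ^ (p - 2)) =
       (\<Sum>\<tau>\<in>?TT. (\<Prod>s<p. \<omega> (\<tau> s)) * (\<Sum>c\<in>?Q \<tau>. H c))" unfolding diff .
    have Hb: "real (card V) * \<bar>\<Sum>c\<in>?Q \<tau>. H c\<bar> \<le> C * (\<Prod>s<p. real (card V) ^ k (\<tau> s))" if \<tau>: "\<tau> \<in> ?TT" for \<tau>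
    proof -
      define n where "n = (\<Sum>s<p. k (\<tau> s))"
      have np: "n \<ge> 1"
      proof -
        have "k (\<tau> 0) \<le> n" unfolding n_def using p by (intro member_le_sum) auto
        then show ?thesis using k[of "\<tau> 0"] by simp
      qed
      have nK: "n \<le> p * K" unfolding n_def using sum_mono[of "{..<p}" "\<lambda>s. k (\<tau> s)" "\<lambda>_. K"] kK by simp
      \<comment> \<open>The vertices of all cycles in one list of length \<open>2 * n\<close>.
        Repeated base points are dropped, and the lengths prescribed by \<tau> make the
        concatenation injective.\<close>
      let ?\<phi> = "\<lambda>c. concat (map (\<lambda>s. butlast (snd (c s))) [0..<p])"
      have wk: "snd (c s) \<in> simple_walks (S (\<tau> s)) (T (\<tau> s)) (k (\<tau> s))" "fst (c s) = \<tau> s" if "c \<in> ?Q \<tau>" "s < p" for c s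
      proof -
        show "fst (c s) = \<tau> s" by (rule tag[OF that])
        moreover have "c \<in> ?P" using that(1) by blast
        then have "c s \<in> J" using that(2) by (auto dest: PiE_mem)
        ultimately show "snd (c s) \<in> simple_walks (S (\<tau> s)) (T (\<tau> s)) (k (\<tau> s))" using Jw[of "c s"] by simp
      qed
      have wcw: "snd (c s) \<in> cwalks (S (\<tau> s)) (T (\<tau> s)) (k (\<tau> s))" if "c \<in> ?Q \<tau>" "s < p" for c s
        using wk[OF that] by (simp add: simple_walks_def)
      have set\<phi>: "set (?\<phi> c) = (\<Union>s<p. set (snd (c s)))" if c: "c \<in> ?Q \<tau>" for c
      proof -
        have "set (butlast (snd (c s))) = set (snd (c s))" if "s < p" for s
          using butlast_closed(1)[OF wcw[OF c that]] k by simp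
        then show ?thesis by (auto simp: atLeast0LessThan)
      qed
      have len: "length (butlast (snd (c s))) = 2 * k (\<tau> s)" if "c \<in> ?Q \<tau>" "s < p" for c s
        using butlast_closed(2)[OF wcw[OF that]] k by simp
      have "\<bar>\<Sum>c\<in>?Q \<tau>. H c\<bar> \<le> (G + real p * (G * G)) * real (n - 1) ^ (2 * n) * real (card V) ^ (n - 1)"
      proof (rule sum_few_values[where \<phi> = ?\<phi>])
        show "finite (?Q \<tau>)" using fP by simp
        show "2 * n > 0" using np by simp
        show "inj_on ?\<phi> (?Q \<tau>)"
        proof (rule inj_onI)
          fix c d assume c: "c \<in> ?Q \<tau>" and d: "d \<in> ?Q \<tau>" and eq: "?\<phi> c = ?\<phi> d"
          have "map (\<lambda>s. butlast (snd (c s))) [0..<p] = map (\<lambda>s. butlast (snd (d s))) [0..<p]"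
            using eq by (subst concat_eq_concat_iff[symmetric]) (use len[OF c] len[OF d] in \<open>auto simp: set_zip\<close>)
          then have bl: "butlast (snd (c s)) = butlast (snd (d s))" if "s < p" for s using that by simp
          have "snd (c s) = snd (d s)" if "s < p" for s
            using butlast_closed(3,4)[OF wcw[OF c that]] butlast_closed(3,4)[OF wcw[OF d that]] k bl[OF that] by metis
          then have "c s = d s" if "s < p" for s using wk(2)[OF c that] wk(2)[OF d that] that by (simp add: prod_eq_iff)
          then show "c = d" using c d by (intro PiE_ext[of c "{..<p}" "\<lambda>_. J" d]) auto
        qed
        show "0 \<le> G + real p * (G * G)" using G1 by simp
        fix c assume c: "c \<in> ?Q \<tau>"
        have "length (?\<phi> c) = (\<Sum>s\<leftarrow>[0..<p]. 2 * k (\<tau> s))"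
          unfolding length_concat map_map comp_def using len[OF c] by (intro arg_cong[of _ _ sum_list] map_cong) auto
        also have "\<dots> = 2 * n" unfolding n_def by (simp add: interv_sum_list_conv_sum_set_nat atLeast0LessThan sum_distrib_left)
        finally have l: "length (?\<phi> c) = 2 * n" .
        have "set (snd (c s)) \<subseteq> V" if "s < p" for s using cwalksD(5)[OF wcw[OF c that]] ST by blast
        then show "set (?\<phi> c) \<subseteq> V \<and> length (?\<phi> c) = 2 * n" unfolding set\<phi>[OF c] using l by auto
        assume H: "H c \<noteq> 0"
        \<comment> \<open>Tuples with at least \<open>n\<close> vertices satisfy the recursion
          exactly, by \<open>wick_exact\<close>; the error comes from those with at most
          \<open>n - 1\<close>.\<close>
        have "\<not> n \<le> card (\<Union>s<p. set (snd (c s)))"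
        proof
          assume many: "n \<le> card (\<Union>s<p. set (snd (c s)))"
          have "\<mu> {..<p} c = (\<Sum>q\<in>{1..<p}. \<mu> {0, q} c * \<mu> ({..<p} - {0, q}) c)"
            unfolding \<mu>_def by (rule wick_exact[OF iid p, of "\<lambda>s. k (\<tau> s)" "\<lambda>s. snd (c s)" "\<lambda>s. S (\<tau> s)" "\<lambda>s. T (\<tau> s)"])
              (use k g wk[OF c] many in \<open>auto simp: n_def\<close>)
          then show False using H unfolding H_def by simp
        qed
        then have few: "card (set (?\<phi> c)) \<le> n - 1" unfolding set\<phi>[OF c] by simp
        have mb: "\<bar>\<mu> A c\<bar> \<le> G" if A: "A \<subseteq> {..<p}" for A
          unfolding \<mu>_def G_def
        proof (rule abs_tmom_le)
          show fA: "finite A" using A finite_subset by blast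
          show "card A \<le> p" using card_mono[OF _ A] by simp
          have "card (\<Union>s\<in>A. set (path_edges (snd (c s)))) \<le> (\<Sum>s\<in>A. card (set (path_edges (snd (c s)))))"
            by (rule card_UN_le[OF fA])
          also have "\<dots> \<le> (\<Sum>s\<in>A. 2 * K)"
          proof (rule sum_mono)
            fix s assume "s \<in> A"
            then have "length (path_edges (snd (c s))) = 2 * k (\<tau> s)" using A cwalksD(6)[OF wcw[OF c, of s]] by auto
            then show "card (set (path_edges (snd (c s)))) \<le> 2 * K"
              using card_length[of "path_edges (snd (c s))"] kK[of "\<tau> s"] by linarith
          qed
          also have "\<dots> \<le> p * (2 * K)" using card_mono[OF _ A] by simp
          finally show "card (\<Union>s\<in>A. set (path_edges (snd (c s)))) \<le> 2 * p * K" by simp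
        qed
        have "\<bar>H c\<bar> \<le> G + (\<Sum>q\<in>{1..<p}. G * G)"
          unfolding H_def
        proof (rule order_trans[OF abs_triangle_ineq4 add_mono[OF mb order_trans[OF sum_abs sum_mono]]])
          fix q assume "q \<in> {1..<p}"
          then show "\<bar>\<mu> {0, q} c * \<mu> ({..<p} - {0, q}) c\<bar> \<le> G * G"
            unfolding abs_mult using G1 by (intro mult_mono mb) auto
        qed simp
        also have "\<dots> \<le> G + real p * (G * G)" using G1 by (simp add: mult_right_mono)
        finally show "card (set (?\<phi> c)) \<le> n - 1 \<and> \<bar>H c\<bar> \<le> G + real p * (G * G)" using few by simp
      qed (rule V)
      also have "\<dots> \<le> C * real (card V) ^ (n - 1)"
      proof (rule mult_right_mono)
        have "n - 1 \<le> p * K" using nK by simp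
        then have "real (n - 1) \<le> real (p * K)" by (rule of_nat_mono)
        then have "real (n - 1) ^ (2 * n) \<le> real (p * K) ^ (2 * n)" by (intro power_mono) auto
        also have "\<dots> \<le> real (p * K) ^ (2 * p * K)"
        proof (rule power_increasing)
          show "2 * n \<le> 2 * p * K" using nK by simp
          show "1 \<le> real (p * K)" using np nK by linarith
        qed
        finally show "(G + real p * (G * G)) * real (n - 1) ^ (2 * n) \<le> C"
          unfolding C_def using G1 by (intro mult_left_mono) auto
      qed simp
      finally have "real (card V) * \<bar>\<Sum>c\<in>?Q \<tau>. H c\<bar> \<le> real (card V) * (C * real (card V) ^ (n - 1))" by (intro mult_left_mono) auto
      also have "\<dots> = C * real (card V) ^ n" using np by (cases n) auto
      finally have "real (card V) * \<bar>\<Sum>c\<in>?Q \<tau>. H c\<bar> \<le> C * real (card V) ^ n" .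
      moreover have "real (card V) ^ n = (\<Prod>s<p. real (card V) ^ k (\<tau> s))" unfolding n_def by (rule power_sum)
      ultimately show ?thesis by (simp only:)
    qed
    define Z where "Z \<tau> = (\<Sum>c\<in>?Q \<tau>. H c)" for \<tau>
    have "real (card V) * \<bar>\<Sum>\<tau>\<in>?TT. (\<Prod>s<p. \<omega> (\<tau> s)) * Z \<tau>\<bar> \<le>
        real (card V) * (\<Sum>\<tau>\<in>?TT. \<bar>(\<Prod>s<p. \<omega> (\<tau> s)) * Z \<tau>\<bar>)" by (intro mult_left_mono sum_abs) auto
    also have "\<dots> = (\<Sum>\<tau>\<in>?TT. (\<Prod>s<p. \<bar>\<omega> (\<tau> s)\<bar>) * (real (card V) * \<bar>Z \<tau>\<bar>))"
      unfolding sum_distrib_left abs_mult abs_prod by (intro sum.cong refl) (simp only: mult_ac)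
    also have "\<dots> \<le> (\<Sum>\<tau>\<in>?TT. (\<Prod>s<p. \<bar>\<omega> (\<tau> s)\<bar>) * (C * (\<Prod>s<p. real (card V) ^ k (\<tau> s))))"
    proof (rule sum_mono, rule mult_left_mono)
      fix \<tau> assume "\<tau> \<in> ?TT"
      then show "real (card V) * \<bar>Z \<tau>\<bar> \<le> C * (\<Prod>s<p. real (card V) ^ k (\<tau> s))" unfolding Z_def by (rule Hb)
    next
      fix \<tau> show "0 \<le> (\<Prod>s<p. \<bar>\<omega> (\<tau> s)\<bar>)" by (rule prod_nonneg) simp
    qed
    also have "\<dots> = C * (\<Sum>\<tau>\<in>?TT. \<Prod>s<p. \<bar>\<omega> (\<tau> s)\<bar> * real (card V) ^ k (\<tau> s))"
      unfolding sum_distrib_left prod.distrib by (intro sum.cong refl) (simp only: mult_ac)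
    also have "(\<Sum>\<tau>\<in>?TT. \<Prod>s<p. \<bar>\<omega> (\<tau> s)\<bar> * real (card V) ^ k (\<tau> s)) = (\<Prod>s<p. \<Sum>b\<in>UNIV. \<bar>\<omega> b\<bar> * real (card V) ^ k b)"
      by (rule prod_sum_PiE[symmetric]) auto
    also have "\<dots> = (\<Sum>b\<in>UNIV. \<bar>\<omega> b\<bar> * real (card V) ^ k b) ^ p" by simp
    finally have fin: "real (card V) * \<bar>expectation (\<lambda>x. F x ^ p) - real (p - 1) * expectation (\<lambda>x. F x ^ 2) * expectation (\<lambda>x. F x ^ (p - 2))\<bar>
      \<le> C * (\<Sum>b\<in>UNIV. \<bar>\<omega> b\<bar> * real (card V) ^ k b) ^ p" unfolding diff2 Z_def .
    have int': "integrable M (\<lambda>x. F x ^ n)" for n using int[of "{..<n}"] by simp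
    have "(\<forall>n. integrable M (\<lambda>x. F x ^ n)) \<and>
      real (card V) * \<bar>expectation (\<lambda>x. F x ^ p) - real (p - 1) * expectation (\<lambda>x. F x ^ 2) * expectation (\<lambda>x. F x ^ (p - 2))\<bar>
      \<le> C * (\<Sum>b\<in>UNIV. \<bar>\<omega> b\<bar> * real (card V) ^ k b) ^ p"
      by (intro conjI allI int' fin)
    then show "let F = (\<lambda>x. \<Sum>c\<in>(SIGMA b:UNIV. simple_walks (S b) (T b) (k b)). \<omega> (fst c) *
         (\<Prod>e\<in>set (path_edges (snd c)). poly (g (fst c)) (Xe e x)))
     in (\<forall>n. integrable M (\<lambda>x. F x ^ n)) \<and>
       real (card V) * \<bar>(\<integral>x. F x ^ p \<partial>M) - real (p - 1) * (\<integral>x. F x ^ 2 \<partial>M) * (\<integral>x. F x ^ (p - 2) \<partial>M)\<bar>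
       \<le> C * (\<Sum>b\<in>UNIV. \<bar>\<omega> b\<bar> * real (card V) ^ k b) ^ p"
      unfolding Let_def F_def \<xi>_def J_def .
  qed
qed

subsection \<open>Gaussian moments and characteristic functions\<close>

text \<open>The moments of the centered Gaussian law of variance \<open>v\<close>, given by Wick's
  recursion.\<close>

fun gauss_moment :: "real \<Rightarrow> nat \<Rightarrow> real" where
  "gauss_moment v 0 = 1"
| "gauss_moment v (Suc 0) = 0"
| "gauss_moment v (Suc (Suc p)) = real (Suc p) * v * gauss_moment v p"

lemma gauss_moment_even: "gauss_moment v (2 * r) / fact (2 * r) = (v / 2) ^ r / fact r"
proof (induction r)
  case (Suc r)
  have f: "(fact (2 * Suc r) :: real) = 2 * real (Suc r) * (real (Suc (2 * r)) * fact (2 * r))" by simp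
  have g: "gauss_moment v (2 * Suc r) = real (Suc (2 * r)) * v * gauss_moment v (2 * r)" by simp
  have "real (Suc (2 * r)) \<noteq> 0" by simp
  then have "gauss_moment v (2 * Suc r) / fact (2 * Suc r) = (v / (2 * real (Suc r))) * (gauss_moment v (2 * r) / fact (2 * r))"
    unfolding f g by (simp del: of_nat_Suc)
  also have "\<dots> = (v / 2) ^ Suc r / fact (Suc r)" unfolding Suc by (simp add: field_simps)
  finally show ?case .
qed simp

lemma gauss_moment_odd: "gauss_moment v (Suc (2 * r)) = 0"
  by (induction r) auto

lemma tendsto_gauss_moments:
  fixes mom :: "nat \<Rightarrow> nat \<Rightarrow> real"
  assumes "\<And>N. mom N 0 = 1" "\<And>N. mom N 1 = 0" "(\<lambda>N. mom N 2) \<longlonglongrightarrow> v"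
    and rec: "\<And>p. p \<ge> 2 \<Longrightarrow> (\<lambda>N. mom N p - real (p - 1) * mom N 2 * mom N (p - 2)) \<longlonglongrightarrow> 0"
  shows "(\<lambda>N. mom N p) \<longlonglongrightarrow> gauss_moment v p"
proof (induction p rule: induct_nat_012)
  case (ge2 p)
  have "(\<lambda>N. (mom N (Suc (Suc p)) - real (Suc p) * mom N 2 * mom N p) + real (Suc p) * mom N 2 * mom N p) \<longlonglongrightarrow>
     0 + real (Suc p) * v * gauss_moment v p"
    using rec[of "Suc (Suc p)"] by (intro tendsto_intros assms(3) ge2) simp
  then show ?case by simp
qed (use assms in auto)

text \<open>Taylor expansion to an even order \<open>2 * r\<close>, so that the remainder is itself
  a moment. The limit \<open>2 * (v / 2)^r / r!\<close> of the remainder bound is small for large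
  \<open>r\<close>, which is fixed before \<open>N\<close> tends to infinity.\<close>

lemma char_from_moments:
  fixes X :: "nat \<Rightarrow> 'a \<Rightarrow> real"
  assumes "prob_space M" and int: "\<And>N p. integrable M (\<lambda>\<omega>. X N \<omega> ^ p)"
    and lim: "\<And>p. (\<lambda>N. \<integral>\<omega>. X N \<omega> ^ p \<partial>M) \<longlonglongrightarrow> gauss_moment v p"
  shows "(\<lambda>N. CLINT \<omega>|M. iexp (X N \<omega>)) \<longlonglongrightarrow> exp (- v / 2)"
proof -
  interpret prob_space M by fact
  have meas [measurable]: "X N \<in> borel_measurable M" for N using int[of N 1] by auto
  define a where "a N = (CLINT \<omega>|M. iexp (X N \<omega>))" for N
  define P where "P r N = (\<Sum>k\<le>2 * r. \<i> ^ k / fact k * complex_of_real (\<integral>\<omega>. X N \<omega> ^ k \<partial>M))" for r N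
  define Q where "Q r = (\<Sum>j\<le>r. (- v / 2) ^ j / fact j)" for r
  have approx: "cmod (a N - P r N) \<le> 2 / fact (2 * r) * (\<integral>\<omega>. X N \<omega> ^ (2 * r) \<partial>M)" for r N
  proof -
    have "char (distr M borel (X N)) 1 = a N"
      unfolding a_def char_def by (subst integral_distr) auto
    moreover have "\<bar>X N \<omega>\<bar> ^ (2 * r) = X N \<omega> ^ (2 * r)" for \<omega> by (simp add: power_even_abs)
    ultimately show ?thesis
      using char_approx1'[where n = "2 * r" and X = "X N" and t = 1, OF int meas refl] by (simp add: P_def)
  qed
  have PQ: "P r \<longlonglongrightarrow> complex_of_real (Q r)" for r
  proof -
    have "P r \<longlonglongrightarrow> (\<Sum>k\<le>2 * r. \<i> ^ k / fact k * complex_of_real (gauss_moment v k))"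
      unfolding P_def by (intro tendsto_sum tendsto_mult_left tendsto_of_real lim)
    also have "(\<Sum>k\<le>2 * r. \<i> ^ k / fact k * complex_of_real (gauss_moment v k)) = complex_of_real (Q r)"
    proof (induction r)
      case (Suc r)
      have "\<i> ^ (2 * Suc r) / fact (2 * Suc r) * complex_of_real (gauss_moment v (2 * Suc r)) =
         (-1) ^ Suc r * complex_of_real (gauss_moment v (2 * Suc r) / fact (2 * Suc r))"
        by (simp add: power_mult del: fact_Suc power_Suc gauss_moment.simps mult_Suc_right)
      also have "\<dots> = complex_of_real ((- v / 2) ^ Suc r / fact (Suc r))"
      proof -
        have "(- v / 2) ^ Suc r = (-1) ^ Suc r * (v / 2) ^ Suc r"
          unfolding power_mult_distrib[symmetric] by simp
        then have "complex_of_real ((- v / 2) ^ Suc r / fact (Suc r)) =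
            complex_of_real ((-1) ^ Suc r) * complex_of_real ((v / 2) ^ Suc r / fact (Suc r))"
          by (simp only: of_real_mult[symmetric] times_divide_eq_right)
        moreover have "complex_of_real ((-1) ^ Suc r) = (-1) ^ Suc r" by (simp del: power_Suc)
        ultimately show ?thesis unfolding gauss_moment_even by (simp only:)
      qed
      finally have e: "\<i> ^ (2 * Suc r) / fact (2 * Suc r) * complex_of_real (gauss_moment v (2 * Suc r)) =
         complex_of_real ((- v / 2) ^ Suc r / fact (Suc r))" .
      have "(\<Sum>k\<le>2 * Suc r. \<i> ^ k / fact k * complex_of_real (gauss_moment v k)) =
        (\<Sum>k\<le>2 * r. \<i> ^ k / fact k * complex_of_real (gauss_moment v k)) +
        \<i> ^ (2 * Suc r) / fact (2 * Suc r) * complex_of_real (gauss_moment v (2 * Suc r))"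
        using gauss_moment_odd[of v r] by (simp add: numeral_2_eq_2 del: fact_Suc power_Suc gauss_moment.simps(3))
      then show ?case unfolding Suc e Q_def by simp
    qed (simp add: Q_def)
    finally show ?thesis .
  qed
  have Qlim: "Q \<longlonglongrightarrow> exp (- v / 2)"
  proof -
    have "(\<lambda>n. (- v / 2) ^ n / fact n) = (\<lambda>n. (- v / 2) ^ n /\<^sub>R fact n)"
      unfolding real_scaleR_def by (rule ext) (rule divide_inverse_commute)
    then have "(\<lambda>n. (- v / 2) ^ n / fact n) sums exp (- v / 2)" using exp_converges[of "- v / 2"] by (simp only:)
    then show ?thesis unfolding Q_def sums_def_le .
  qed
  have small: "(\<lambda>r. 2 * ((v / 2) ^ r / fact r)) \<longlonglongrightarrow> 2 * 0"
  proof (rule tendsto_mult_left)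
    have "(\<lambda>r. (v / 2) ^ r / fact r) = (\<lambda>r. inverse (fact r) * (v / 2) ^ r)"
      by (rule ext) (rule divide_inverse_commute)
    then show "(\<lambda>r. (v / 2) ^ r / fact r) \<longlonglongrightarrow> 0"
      using summable_LIMSEQ_zero[OF summable_exp[of "v / 2"]] by (simp only:)
  qed
  have "a \<longlonglongrightarrow> complex_of_real (exp (- v / 2))"
  proof (rule LIMSEQ_I)
    fix e :: real assume e: "e > 0"
    from LIMSEQ_D[OF Qlim, of "e / 4"] e obtain r1 where r1: "\<And>r. r \<ge> r1 \<Longrightarrow> norm (Q r - exp (- v / 2)) < e / 4" by auto
    from LIMSEQ_D[OF small, of "e / 4"] e obtain r2 where r2: "\<And>r. r \<ge> r2 \<Longrightarrow> norm (2 * ((v / 2) ^ r / fact r) - 2 * 0) < e / 4" by auto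
    define r where "r = max r1 r2"
    have r: "r \<ge> r1" "r \<ge> r2" by (simp_all add: r_def)
    have near: "x < d + d" if "norm (x - y) < d" "norm (y - 2 * 0) < d" for x y d :: real
      using that by (simp add: abs_less_iff)
    from LIMSEQ_D[OF PQ[of r], of "e / 4"] e obtain n1 where n1: "\<And>n. n \<ge> n1 \<Longrightarrow> norm (P r n - complex_of_real (Q r)) < e / 4" by auto
    have "(\<lambda>N. 2 / fact (2 * r) * (\<integral>\<omega>. X N \<omega> ^ (2 * r) \<partial>M)) \<longlonglongrightarrow> 2 / fact (2 * r) * gauss_moment v (2 * r)"
      by (intro tendsto_mult_left lim)
    also have "2 / fact (2 * r) * gauss_moment v (2 * r) = 2 * ((v / 2) ^ r / fact r)"
      using gauss_moment_even[of v r] by simp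
    finally have "(\<lambda>N. 2 / fact (2 * r) * (\<integral>\<omega>. X N \<omega> ^ (2 * r) \<partial>M)) \<longlonglongrightarrow> 2 * ((v / 2) ^ r / fact r)" .
    from LIMSEQ_D[OF this, of "e / 4"] e obtain n2 where
      n2: "\<And>n. n \<ge> n2 \<Longrightarrow> norm (2 / fact (2 * r) * (\<integral>\<omega>. X n \<omega> ^ (2 * r) \<partial>M) - 2 * ((v / 2) ^ r / fact r)) < e / 4" by auto
    \<comment> \<open>Two quarters of \<open>e\<close> go to the Taylor remainder, one to the
      convergence of the moments and one to the exponential series.\<close>
    have "norm (a n - complex_of_real (exp (- v / 2))) < e" if n: "n \<ge> max n1 n2" for n
    proof -
      have "2 / fact (2 * r) * (\<integral>\<omega>. X n \<omega> ^ (2 * r) \<partial>M) < e / 4 + e / 4"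
        using n2[of n] r2[of r] n r by (intro near) auto
      then have 1: "norm (a n - P r n) < e / 4 + e / 4" using approx[of n r] by linarith
      have 2: "norm (P r n - complex_of_real (Q r)) < e / 4" using n1[of n] n by simp
      have 3: "norm (complex_of_real (Q r) - complex_of_real (exp (- v / 2))) < e / 4"
        using r1[OF r(1)] unfolding of_real_diff[symmetric] norm_of_real real_norm_def .
      have "a n - complex_of_real (exp (- v / 2)) = (a n - P r n) + (P r n - complex_of_real (Q r)) + (complex_of_real (Q r) - complex_of_real (exp (- v / 2)))"
        by simp
      then show ?thesis using 1 2 3 norm_triangle_ineq[of "(a n - P r n) + (P r n - complex_of_real (Q r))" "complex_of_real (Q r) - complex_of_real (exp (- v / 2))"]
        norm_triangle_ineq[of "a n - P r n" "P r n - complex_of_real (Q r)"] by simp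
    qed
    then show "\<exists>no. \<forall>n\<ge>no. norm (a n - complex_of_real (exp (- v / 2))) < e" by blast
  qed
  then show ?thesis unfolding a_def by simp
qed

subsection \<open>Weak convergence in the plane\<close>

lemma pair_integral_mult:
  fixes f :: "'c \<Rightarrow> 'b :: {real_normed_field, banach, second_countable_topology}" and g :: "'d \<Rightarrow> 'b"
  assumes "sigma_finite_measure A" "sigma_finite_measure B" "integrable A f" "integrable B g"
  shows "integrable (A \<Otimes>\<^sub>M B) (\<lambda>z. f (fst z) * g (snd z))"
    and "(\<integral>z. f (fst z) * g (snd z) \<partial>(A \<Otimes>\<^sub>M B)) = (\<integral>x. f x \<partial>A) * (\<integral>y. g y \<partial>B)"
proof -
  interpret A: sigma_finite_measure A by fact
  interpret B: sigma_finite_measure B by fact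
  interpret pair_sigma_finite A B ..
  have [measurable]: "f \<in> borel_measurable A" "g \<in> borel_measurable B" using assms by auto
  have I: "integrable (A \<Otimes>\<^sub>M B) (\<lambda>(x, y). f x * g y)"
    by (rule Fubini_integrable) (use assms in \<open>auto simp: norm_mult\<close>)
  then show "integrable (A \<Otimes>\<^sub>M B) (\<lambda>z. f (fst z) * g (snd z))" by (simp add: case_prod_unfold)
  have "(\<integral>z. f (fst z) * g (snd z) \<partial>(A \<Otimes>\<^sub>M B)) = (\<integral>x. (\<integral>y. f x * g y \<partial>B) \<partial>A)"
    using integral_fst'[OF I] by (simp add: case_prod_unfold)
  then show "(\<integral>z. f (fst z) * g (snd z) \<partial>(A \<Otimes>\<^sub>M B)) = (\<integral>x. f x \<partial>A) * (\<integral>y. g y \<partial>B)" by simp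
qed

abbreviation (input) "N01 \<equiv> (std_normal_distribution :: real measure)"

lemma prob_N01: "prob_space N01"
  by (rule prob_space_normal_density) simp

lemma iexp_N01: "(CLINT x|N01. iexp (t * x)) = complex_of_real (exp (- (t\<^sup>2) / 2))"
  using char_std_normal_distribution unfolding char_def fun_eq_iff by simp

lemma integrable_iexp_N01: "integrable N01 (\<lambda>x. iexp (t * x))"
proof -
  interpret prob_space N01 by (rule prob_N01)
  show ?thesis by (rule integrable_const_bound[where B = 1]) auto
qed

lemma iexp_pair_N01:
  "(CLINT z|(N01 \<Otimes>\<^sub>M N01). iexp (s * fst z + t * snd z)) = complex_of_real (exp (- (s\<^sup>2 + t\<^sup>2) / 2))"
proof -
  have "(CLINT z|(N01 \<Otimes>\<^sub>M N01). iexp (s * fst z + t * snd z)) = (CLINT z|(N01 \<Otimes>\<^sub>M N01). iexp (s * fst z) * iexp (t * snd z))"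
    by (intro Bochner_Integration.integral_cong refl) (simp add: distrib_left exp_add)
  also have "\<dots> = (CLINT x|N01. iexp (s * x)) * (CLINT y|N01. iexp (t * y))"
    by (intro pair_integral_mult(2) integrable_iexp_N01 prob_space_imp_sigma_finite prob_N01)
  finally show ?thesis unfolding iexp_N01 by (simp add: add_divide_distrib exp_add[symmetric] of_real_mult[symmetric] del: of_real_mult)
qed

locale plane_law = prob_space \<nu> for \<nu> :: "(real \<times> real) measure" +
  assumes sets_nu: "sets \<nu> = sets borel"
begin

lemma sets_nu_prod [measurable_cong]: "sets \<nu> = sets (borel \<Otimes>\<^sub>M borel)"
  unfolding sets_nu borel_prod ..

end

definition char2 :: "(real \<times> real) measure \<Rightarrow> real \<Rightarrow> real \<Rightarrow> complex" where
  "char2 \<nu> s t = (CLINT z|\<nu>. iexp (s * fst z + t * snd z))"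

context plane_law
begin

lemma measurable_char2 [measurable]: "(\<lambda>x. char2 \<nu> (fst x / e) (snd x / e)) \<in> borel_measurable (N01 \<Otimes>\<^sub>M N01)"
  unfolding char2_def by measurable

lemma norm_char2: "norm (char2 \<nu> s t) \<le> 1"
proof -
  have "norm (char2 \<nu> s t) \<le> (\<integral>z. norm (iexp (s * fst z + t * snd z)) \<partial>\<nu>)" unfolding char2_def by (rule integral_norm_bound)
  also have "\<dots> = 1" by (simp add: prob_space)
  finally show ?thesis .
qed

text \<open>The Gaussian function is its own Fourier transform up to scaling; by Fubini its integral
  against the law becomes a Gaussian average of the characteristic function.\<close>

lemma gauss_kernel_integral:
  assumes e: "e > 0"
  shows "complex_of_real (\<integral>z. exp (- ((fst z - a)\<^sup>2 + (snd z - b)\<^sup>2) / (2 * e\<^sup>2)) \<partial>\<nu>) =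
    (CLINT x|(N01 \<Otimes>\<^sub>M N01). iexp (- (a * fst x + b * snd x) / e) * char2 \<nu> (fst x / e) (snd x / e))"
proof -
  interpret N: prob_space N01 by (rule prob_N01)
  interpret NN: pair_prob_space N01 N01 ..
  interpret Q: pair_prob_space \<nu> "N01 \<Otimes>\<^sub>M N01" ..
  let ?f = "\<lambda>z x. iexp ((fst z - a) / e * fst x + (snd z - b) / e * snd x)"
  have int: "integrable (\<nu> \<Otimes>\<^sub>M (N01 \<Otimes>\<^sub>M N01)) (\<lambda>(z, x). ?f z x)"
  proof (rule Q.integrable_const_bound[where B = 1])
    show "(\<lambda>(z, x). ?f z x) \<in> borel_measurable (\<nu> \<Otimes>\<^sub>M (N01 \<Otimes>\<^sub>M N01))" by measurable
  qed (auto simp: case_prod_unfold)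
  have "complex_of_real (\<integral>z. exp (- ((fst z - a)\<^sup>2 + (snd z - b)\<^sup>2) / (2 * e\<^sup>2)) \<partial>\<nu>) =
    (CLINT z|\<nu>. complex_of_real (exp (- (((fst z - a) / e)\<^sup>2 + ((snd z - b) / e)\<^sup>2) / 2)))"
    unfolding integral_complex_of_real[symmetric] using e
    by (intro Bochner_Integration.integral_cong refl arg_cong[of _ _ complex_of_real] arg_cong[of _ _ exp]) (simp add: power_divide field_simps)
  also have "\<dots> = (CLINT z|\<nu>. (CLINT x|(N01 \<Otimes>\<^sub>M N01). ?f z x))" unfolding iexp_pair_N01 ..
  also have "\<dots> = (CLINT x|(N01 \<Otimes>\<^sub>M N01). (CLINT z|\<nu>. ?f z x))"
    by (rule Q.Fubini_integral[symmetric, OF int])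
  also have "\<dots> = (CLINT x|(N01 \<Otimes>\<^sub>M N01). iexp (- (a * fst x + b * snd x) / e) * char2 \<nu> (fst x / e) (snd x / e))"
  proof (intro Bochner_Integration.integral_cong refl)
    fix x :: "real \<times> real"
    have "?f z x = iexp (- (a * fst x + b * snd x) / e) * iexp (fst x / e * fst z + snd x / e * snd z)" for z
      unfolding exp_add[symmetric] using e by (intro arg_cong[of _ _ exp]) (simp add: field_simps)
    then show "(CLINT z|\<nu>. ?f z x) = iexp (- (a * fst x + b * snd x) / e) * char2 \<nu> (fst x / e) (snd x / e)"
      unfolding char2_def by simp
  qed
  finally show ?thesis .
qed

end

text \<open>Characteristic functions are bounded by 1, so that their pointwise convergence passes
  through the Gaussian average.\<close>

lemma gauss_kernel_tendsto:
  assumes \<nu>: "\<And>N. plane_law (\<nu> N)" and \<mu>: "plane_law \<mu>"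
    and lim: "\<And>s t. (\<lambda>N. char2 (\<nu> N) s t) \<longlonglongrightarrow> char2 \<mu> s t" and e: "e > 0"
  shows "(\<lambda>N. \<integral>z. exp (- ((fst z - a)\<^sup>2 + (snd z - b)\<^sup>2) / (2 * e\<^sup>2)) \<partial>\<nu> N) \<longlonglongrightarrow>
     (\<integral>z. exp (- ((fst z - a)\<^sup>2 + (snd z - b)\<^sup>2) / (2 * e\<^sup>2)) \<partial>\<mu>)"
proof -
  interpret N: prob_space N01 by (rule prob_N01)
  interpret NN: pair_prob_space N01 N01 ..
  have "(\<lambda>N. CLINT x|(N01 \<Otimes>\<^sub>M N01). iexp (- (a * fst x + b * snd x) / e) * char2 (\<nu> N) (fst x / e) (snd x / e)) \<longlonglongrightarrow>
     (CLINT x|(N01 \<Otimes>\<^sub>M N01). iexp (- (a * fst x + b * snd x) / e) * char2 \<mu> (fst x / e) (snd x / e))"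
  proof (rule integral_dominated_convergence[where w = "\<lambda>_. 1"])
    have m1: "(\<lambda>x. iexp (- (a * fst x + b * snd x) / e)) \<in> borel_measurable (N01 \<Otimes>\<^sub>M N01)" by measurable
    show "(\<lambda>x. iexp (- (a * fst x + b * snd x) / e) * char2 \<mu> (fst x / e) (snd x / e)) \<in> borel_measurable (N01 \<Otimes>\<^sub>M N01)"
      by (rule borel_measurable_times[OF m1 plane_law.measurable_char2[OF \<mu>]])
    show "(\<lambda>x. iexp (- (a * fst x + b * snd x) / e) * char2 (\<nu> N) (fst x / e) (snd x / e)) \<in> borel_measurable (N01 \<Otimes>\<^sub>M N01)" for N
      by (rule borel_measurable_times[OF m1 plane_law.measurable_char2[OF \<nu>]])
    show "integrable (N01 \<Otimes>\<^sub>M N01) (\<lambda>_. 1 :: real)" by simp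
    show "AE x in N01 \<Otimes>\<^sub>M N01. (\<lambda>N. iexp (- (a * fst x + b * snd x) / e) * char2 (\<nu> N) (fst x / e) (snd x / e))
       \<longlonglongrightarrow> iexp (- (a * fst x + b * snd x) / e) * char2 \<mu> (fst x / e) (snd x / e)"
      by (intro AE_I2 tendsto_mult_left lim)
    show "AE x in N01 \<Otimes>\<^sub>M N01. norm (iexp (- (a * fst x + b * snd x) / e) * char2 (\<nu> N) (fst x / e) (snd x / e)) \<le> 1" for N
    proof (rule AE_I2)
      fix x :: "real \<times> real"
      show "norm (iexp (- (a * fst x + b * snd x) / e) * char2 (\<nu> N) (fst x / e) (snd x / e)) \<le> 1"
        unfolding norm_mult norm_exp_i_times using plane_law.norm_char2[OF \<nu>, of N "fst x / e" "snd x / e"] by simp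
    qed
  qed
  then show ?thesis
    unfolding plane_law.gauss_kernel_integral[OF \<nu> e, symmetric] plane_law.gauss_kernel_integral[OF \<mu> e, symmetric]
    by (rule tendsto_of_real_iff[THEN iffD1])
qed

text \<open>The density at \<open>w\<close> of the Gaussian law around \<open>z\<close> with
  covariance \<open>e^2\<close> times the identity; it is symmetric in \<open>z\<close> and
  \<open>w\<close>.\<close>

definition gauss_kernel :: "real \<Rightarrow> real \<times> real \<Rightarrow> real \<times> real \<Rightarrow> real" where
  "gauss_kernel e z w = exp (- ((fst z - fst w)\<^sup>2 + (snd z - snd w)\<^sup>2) / (2 * e\<^sup>2)) / (2 * pi * e\<^sup>2)"

lemma measurable_gauss_kernel [measurable]:
  "(\<lambda>x. gauss_kernel e (fst x) (snd x)) \<in> borel_measurable ((borel \<Otimes>\<^sub>M borel) \<Otimes>\<^sub>M (borel \<Otimes>\<^sub>M borel))"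
  unfolding gauss_kernel_def by measurable

lemma gauss_kernel_nonneg: "0 \<le> gauss_kernel e z w"
  unfolding gauss_kernel_def by simp

lemma gauss_kernel_le: "gauss_kernel e z w \<le> 1 / (2 * pi * e\<^sup>2)"
  unfolding gauss_kernel_def by (intro divide_right_mono) (auto intro!: divide_nonpos_nonneg)

lemma gauss_kernel_eq_normal:
  assumes "e > 0"
  shows "gauss_kernel e z w = normal_density (fst z) e (fst w) * normal_density (snd z) e (snd w)"
proof -
  have s: "sqrt (2 * pi * e\<^sup>2) * sqrt (2 * pi * e\<^sup>2) = 2 * pi * e\<^sup>2" by simp
  have "normal_density (fst z) e (fst w) * normal_density (snd z) e (snd w) =
     exp (- (fst w - fst z)\<^sup>2 / (2 * e\<^sup>2)) * exp (- (snd w - snd z)\<^sup>2 / (2 * e\<^sup>2)) / (sqrt (2 * pi * e\<^sup>2) * sqrt (2 * pi * e\<^sup>2))"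
    unfolding normal_density_def by simp
  also have "\<dots> = gauss_kernel e z w"
    unfolding gauss_kernel_def s exp_add[symmetric] power2_commute[of "fst w" "fst z"] power2_commute[of "snd w" "snd z"]
    by (simp add: add_divide_distrib diff_divide_distrib)
  finally show ?thesis ..
qed

lemma gauss_kernel_moments:
  assumes e: "e > 0"
  shows "integrable lborel (gauss_kernel e z)" "(\<integral>w. gauss_kernel e z w \<partial>lborel) = 1"
    and "integrable lborel (\<lambda>w. gauss_kernel e z w * (dist w z)\<^sup>2)"
    and "(\<integral>w. gauss_kernel e z w * (dist w z)\<^sup>2 \<partial>lborel) = 2 * e\<^sup>2"
proof -
  have 0: "integrable lborel (normal_density c e)" "(\<integral>x. normal_density c e x \<partial>lborel) = 1" for c
    using e by (auto intro: integral_normal_density)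
  have 2: "integrable lborel (\<lambda>x. normal_density c e x * (x - c)\<^sup>2)" "(\<integral>x. normal_density c e x * (x - c)\<^sup>2 \<partial>lborel) = e\<^sup>2" for c
    using normal_moment_even[OF e, of c 1] integrable_normal_moment[OF e, of c 2] e
    by (auto dest: has_bochner_integral_integral_eq simp: numeral_2_eq_2)
  note pim = pair_integral_mult[OF sigma_finite_lborel sigma_finite_lborel, unfolded lborel_prod]
  have k: "gauss_kernel e z = (\<lambda>w. normal_density (fst z) e (fst w) * normal_density (snd z) e (snd w))"
    by (rule ext) (rule gauss_kernel_eq_normal[OF e])
  show "integrable lborel (gauss_kernel e z)" "(\<integral>w. gauss_kernel e z w \<partial>lborel) = 1"
    unfolding k using pim[OF 0(1)[of "fst z"] 0(1)[of "snd z"]] 0(2) by auto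
  have d: "gauss_kernel e z w * (dist w z)\<^sup>2 =
     (normal_density (fst z) e (fst w) * (fst w - fst z)\<^sup>2) * normal_density (snd z) e (snd w) +
     normal_density (fst z) e (fst w) * (normal_density (snd z) e (snd w) * (snd w - snd z)\<^sup>2)" for w
    unfolding k dist_prod_def by (simp add: dist_real_def algebra_simps)
  show "integrable lborel (\<lambda>w. gauss_kernel e z w * (dist w z)\<^sup>2)"
    "(\<integral>w. gauss_kernel e z w * (dist w z)\<^sup>2 \<partial>lborel) = 2 * e\<^sup>2"
    unfolding d using pim[OF 2(1)[of "fst z"] 0(1)[of "snd z"]] pim[OF 0(1)[of "fst z"] 2(1)[of "snd z"]] 0(2) 2(2) by auto
qed

text \<open>Within distance \<open>d\<close> of \<open>z\<close> the oscillation of \<phi> is at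
  most \<eta>. Beyond, it is at most \<open>2 * B\<close> and thus at most
  \<open>2 * B * (dist w z / d)^2\<close>; the kernel has mean squared distance
  \<open>2 * e^2\<close>.\<close>

lemma mollification_error:
  fixes \<phi> :: "real \<times> real \<Rightarrow> real"
  assumes [measurable]: "\<phi> \<in> borel_measurable borel" and B: "\<And>z. \<bar>\<phi> z\<bar> \<le> B"
    and d: "d > 0" "\<And>z w. dist w z < d \<Longrightarrow> \<bar>\<phi> w - \<phi> z\<bar> \<le> \<eta>" and \<eta>: "\<eta> \<ge> 0" and e: "e > 0"
  shows "\<bar>(\<integral>w. gauss_kernel e z w * \<phi> w \<partial>lborel) - \<phi> z\<bar> \<le> \<eta> + 2 * B / d\<^sup>2 * (2 * e\<^sup>2)"
proof -
  note m = gauss_kernel_moments[OF e, of z]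
  have B0: "B \<ge> 0" using B[of z] by linarith
  have [measurable]: "gauss_kernel e z \<in> borel_measurable borel" using m(1) by simp
  have i: "integrable lborel (\<lambda>w. gauss_kernel e z w * \<phi> w)"
  proof (rule Bochner_Integration.integrable_bound)
    show "integrable lborel (\<lambda>w. gauss_kernel e z w * B)" using m(1) by simp
    show "AE w in lborel. norm (gauss_kernel e z w * \<phi> w) \<le> norm (gauss_kernel e z w * B)"
      unfolding real_norm_def abs_mult using B B0 by (intro AE_I2 mult_left_mono) auto
  qed simp
  have b: "norm (gauss_kernel e z w * (\<phi> w - \<phi> z)) \<le> \<eta> * gauss_kernel e z w + 2 * B / d\<^sup>2 * (gauss_kernel e z w * (dist w z)\<^sup>2)" for w
  proof -
    have "\<bar>\<phi> w - \<phi> z\<bar> \<le> \<eta> + 2 * B / d\<^sup>2 * (dist w z)\<^sup>2"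
    proof (cases "dist w z < d")
      case True
      moreover have "0 \<le> 2 * B / d\<^sup>2 * (dist w z)\<^sup>2" using B0 by simp
      ultimately show ?thesis using d(2)[of w z] by linarith
    next
      case False
      then have "1 \<le> (dist w z / d)\<^sup>2" using d(1) by (simp add: one_le_power)
      then have "2 * B * 1 \<le> 2 * B * (dist w z / d)\<^sup>2" using B0 by (intro mult_left_mono) auto
      moreover have "2 * B * (dist w z / d)\<^sup>2 = 2 * B / d\<^sup>2 * (dist w z)\<^sup>2" by (simp add: power_divide)
      ultimately show ?thesis using B[of w] B[of z] \<eta> by linarith
    qed
    then have "gauss_kernel e z w * \<bar>\<phi> w - \<phi> z\<bar> \<le> gauss_kernel e z w * (\<eta> + 2 * B / d\<^sup>2 * (dist w z)\<^sup>2)"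
      by (rule mult_left_mono[OF _ gauss_kernel_nonneg])
    then show ?thesis unfolding real_norm_def abs_mult abs_of_nonneg[OF gauss_kernel_nonneg]
      by (simp add: algebra_simps)
  qed
  have "(\<integral>w. gauss_kernel e z w * \<phi> w \<partial>lborel) - \<phi> z = (\<integral>w. gauss_kernel e z w * \<phi> w \<partial>lborel) - (\<integral>w. gauss_kernel e z w * \<phi> z \<partial>lborel)"
    using m(2) by simp
  also have "\<dots> = (\<integral>w. gauss_kernel e z w * (\<phi> w - \<phi> z) \<partial>lborel)"
    using i m(1) by (simp add: right_diff_distrib)
  finally have "\<bar>(\<integral>w. gauss_kernel e z w * \<phi> w \<partial>lborel) - \<phi> z\<bar> = norm (\<integral>w. gauss_kernel e z w * (\<phi> w - \<phi> z) \<partial>lborel)" by simp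
  also have "\<dots> \<le> (\<integral>w. \<eta> * gauss_kernel e z w + 2 * B / d\<^sup>2 * (gauss_kernel e z w * (dist w z)\<^sup>2) \<partial>lborel)"
  proof (rule Bochner_Integration.integral_norm_bound_integral)
    show "integrable lborel (\<lambda>w. gauss_kernel e z w * (\<phi> w - \<phi> z))" using i m(1) by (simp add: right_diff_distrib)
    show "integrable lborel (\<lambda>w. \<eta> * gauss_kernel e z w + 2 * B / d\<^sup>2 * (gauss_kernel e z w * (dist w z)\<^sup>2))"
      by (intro Bochner_Integration.integrable_add integrable_mult_right m(1) m(3))
  qed (rule b)
  also have "\<dots> = \<eta> + 2 * B / d\<^sup>2 * (2 * e\<^sup>2)" using m by simp
  finally show ?thesis .
qed

text \<open>By Fubini the smoothing is moved from the test function to the law.\<close>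

lemma (in plane_law) mollification_swap:
  fixes \<phi> :: "real \<times> real \<Rightarrow> real"
  assumes \<phi>: "integrable lborel \<phi>" and e: "e > 0"
  shows "integrable \<nu> (\<lambda>z. \<integral>w. gauss_kernel e z w * \<phi> w \<partial>lborel)"
    and "(\<integral>z. (\<integral>w. gauss_kernel e z w * \<phi> w \<partial>lborel) \<partial>\<nu>) = (\<integral>w. (\<integral>z. gauss_kernel e z w \<partial>\<nu>) * \<phi> w \<partial>lborel)"
proof -
  interpret L: sigma_finite_measure "lborel :: (real \<times> real) measure" by (rule sigma_finite_lborel)
  interpret Q: pair_sigma_finite \<nu> "lborel :: (real \<times> real) measure" ..
  have [measurable]: "\<phi> \<in> borel_measurable (borel \<Otimes>\<^sub>M borel)" using \<phi> unfolding borel_prod by simp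
  have [measurable_cong]: "sets (lborel :: (real \<times> real) measure) = sets (borel \<Otimes>\<^sub>M borel)" unfolding borel_prod by simp
  have i: "integrable (\<nu> \<Otimes>\<^sub>M lborel) (\<lambda>(z, w). gauss_kernel e z w * \<phi> w)"
  proof (rule Bochner_Integration.integrable_bound)
    show "integrable (\<nu> \<Otimes>\<^sub>M lborel) (\<lambda>x. 1 / (2 * pi * e\<^sup>2) * \<phi> (snd x))"
      by (rule pair_integral_mult(1)) (use \<phi> sigma_finite_lborel sigma_finite_measure_axioms in auto)
    show "(\<lambda>(z, w). gauss_kernel e z w * \<phi> w) \<in> borel_measurable (\<nu> \<Otimes>\<^sub>M lborel)"
      unfolding case_prod_unfold by measurable
    show "AE x in \<nu> \<Otimes>\<^sub>M lborel. norm (case x of (z, w) \<Rightarrow> gauss_kernel e z w * \<phi> w) \<le> norm (1 / (2 * pi * e\<^sup>2) * \<phi> (snd x))"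
      using gauss_kernel_nonneg gauss_kernel_le
      by (intro AE_I2) (auto simp: abs_mult case_prod_unfold simp del: times_divide_eq_left intro!: mult_right_mono)
  qed
  show "integrable \<nu> (\<lambda>z. \<integral>w. gauss_kernel e z w * \<phi> w \<partial>lborel)"
    using Q.integrable_fst[OF i] .
  have "(\<integral>z. (\<integral>w. gauss_kernel e z w * \<phi> w \<partial>lborel) \<partial>\<nu>) = (\<integral>w. (\<integral>z. gauss_kernel e z w * \<phi> w \<partial>\<nu>) \<partial>lborel)"
    by (rule Q.Fubini_integral[symmetric, OF i])
  then show "(\<integral>z. (\<integral>w. gauss_kernel e z w * \<phi> w \<partial>lborel) \<partial>\<nu>) = (\<integral>w. (\<integral>z. gauss_kernel e z w \<partial>\<nu>) * \<phi> w \<partial>lborel)"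
    by simp
qed

text \<open>The smoothed densities converge pointwise and are bounded by
  \<open>1 / (2 * pi * e^2)\<close>, so that integrability of \<phi> provides a majorant.\<close>

lemma mollified_tendsto:
  fixes \<phi> :: "real \<times> real \<Rightarrow> real"
  assumes \<nu>: "\<And>N. plane_law (\<nu> N)" and \<mu>: "plane_law \<mu>"
    and lim: "\<And>s t. (\<lambda>N. char2 (\<nu> N) s t) \<longlonglongrightarrow> char2 \<mu> s t" and e: "e > 0"
    and \<phi>: "integrable lborel \<phi>"
  shows "(\<lambda>N. \<integral>z. (\<integral>w. gauss_kernel e z w * \<phi> w \<partial>lborel) \<partial>\<nu> N) \<longlonglongrightarrow> (\<integral>z. (\<integral>w. gauss_kernel e z w * \<phi> w \<partial>lborel) \<partial>\<mu>)"
proof -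
  have [measurable]: "\<phi> \<in> borel_measurable borel" using \<phi> by simp
  have meas: "(\<lambda>w. \<integral>z. gauss_kernel e z w \<partial>\<rho>) \<in> borel_measurable borel" if "plane_law \<rho>" for \<rho>
  proof -
    interpret plane_law \<rho> by fact
    have "(\<lambda>w. \<integral>z. gauss_kernel e z w \<partial>\<rho>) \<in> borel_measurable (borel \<Otimes>\<^sub>M borel)"
      unfolding gauss_kernel_def by measurable
    then show ?thesis unfolding borel_prod .
  qed
  have bound: "\<bar>\<integral>z. gauss_kernel e z w \<partial>\<rho>\<bar> \<le> 1 / (2 * pi * e\<^sup>2)" if "plane_law \<rho>" for \<rho> w
  proof -
    interpret plane_law \<rho> by fact
    have [measurable]: "(\<lambda>z. gauss_kernel e z w) \<in> borel_measurable \<rho>" unfolding gauss_kernel_def by measurable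
    have "integrable \<rho> (\<lambda>z. gauss_kernel e z w)"
      by (rule integrable_const_bound[where B = "1 / (2 * pi * e\<^sup>2)"]) (use gauss_kernel_nonneg gauss_kernel_le in auto)
    then have "(\<integral>z. gauss_kernel e z w \<partial>\<rho>) \<le> 1 / (2 * pi * e\<^sup>2)" by (rule integral_le_const) (use gauss_kernel_le in auto)
    moreover have "0 \<le> (\<integral>z. gauss_kernel e z w \<partial>\<rho>)" by (intro Bochner_Integration.integral_nonneg gauss_kernel_nonneg)
    ultimately show ?thesis by simp
  qed
  have pt: "(\<lambda>N. \<integral>z. gauss_kernel e z w \<partial>\<nu> N) \<longlonglongrightarrow> (\<integral>z. gauss_kernel e z w \<partial>\<mu>)" for w
    unfolding gauss_kernel_def integral_divide_zero
    by (intro tendsto_divide tendsto_const gauss_kernel_tendsto[OF \<nu> \<mu> lim e]) (use e in auto)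
  have "(\<lambda>N. \<integral>w. (\<integral>z. gauss_kernel e z w \<partial>\<nu> N) * \<phi> w \<partial>lborel) \<longlonglongrightarrow> (\<integral>w. (\<integral>z. gauss_kernel e z w \<partial>\<mu>) * \<phi> w \<partial>lborel)"
  proof (rule integral_dominated_convergence[where w = "\<lambda>w. 1 / (2 * pi * e\<^sup>2) * \<bar>\<phi> w\<bar>"])
    show "AE w in lborel. norm ((\<integral>z. gauss_kernel e z w \<partial>\<nu> N) * \<phi> w) \<le> 1 / (2 * pi * e\<^sup>2) * \<bar>\<phi> w\<bar>" for N
      unfolding real_norm_def abs_mult by (intro AE_I2 mult_right_mono bound \<nu>) simp
  qed (use meas[OF \<nu>] meas[OF \<mu>] \<phi> pt in \<open>auto intro!: tendsto_mult_right\<close>)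
  then show ?thesis
    unfolding plane_law.mollification_swap(2)[OF \<nu> \<phi> e] plane_law.mollification_swap(2)[OF \<mu> \<phi> e] .
qed

lemma weak_limit_uniformly_continuous:
  fixes \<phi> :: "real \<times> real \<Rightarrow> real"
  assumes \<nu>: "\<And>N. plane_law (\<nu> N)" and \<mu>: "plane_law \<mu>"
    and lim: "\<And>s t. (\<lambda>N. char2 (\<nu> N) s t) \<longlonglongrightarrow> char2 \<mu> s t"
    and \<phi>: "integrable lborel \<phi>" and B: "\<And>z. \<bar>\<phi> z\<bar> \<le> B" and uc: "uniformly_continuous_on UNIV \<phi>"
  shows "(\<lambda>N. \<integral>z. \<phi> z \<partial>\<nu> N) \<longlonglongrightarrow> (\<integral>z. \<phi> z \<partial>\<mu>)"
proof (rule LIMSEQ_I)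
  fix \<eta> :: real assume \<eta>: "\<eta> > 0"
  have B0: "B \<ge> 0" using B[of 0] by linarith
  have [measurable]: "\<phi> \<in> borel_measurable borel" using \<phi> by simp
  obtain d where d: "d > 0" "\<And>z w. dist w z < d \<Longrightarrow> dist (\<phi> w) (\<phi> z) < \<eta> / 6"
    using uc \<eta> unfolding uniformly_continuous_on_def by (metis UNIV_I divide_pos_pos zero_less_numeral)
  have d2: "\<bar>\<phi> w - \<phi> z\<bar> \<le> \<eta> / 6" if "dist w z < d" for z w using d(2)[OF that] by (simp add: dist_real_def)
  \<comment> \<open>Makes \<open>2 * B / d^2 * (2 * e^2)\<close> at most \<open>\<eta> / 6\<close>;
    the 1 in \<open>B + 1\<close> covers \<open>B = 0\<close>.\<close>
  define e where "e = d * sqrt (\<eta> / (24 * (B + 1)))"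
  have e: "e > 0" using d(1) \<eta> B0 by (simp add: e_def)
  have "2 * B / d\<^sup>2 * (2 * e\<^sup>2) = \<eta> / 6 * (B / (B + 1))"
    using d(1) \<eta> B0 by (simp add: e_def power_mult_distrib field_simps)
  also have "\<dots> \<le> \<eta> / 6 * 1" using \<eta> B0 by (intro mult_left_mono) auto
  finally have e2: "2 * B / d\<^sup>2 * (2 * e\<^sup>2) \<le> \<eta> / 6" by simp
  define S where "S z = (\<integral>w. gauss_kernel e z w * \<phi> w \<partial>lborel)" for z
  have err: "\<bar>S z - \<phi> z\<bar> \<le> \<eta> / 3" for z
    using mollification_error[where \<phi> = \<phi> and B = B and z = z and \<eta> = "\<eta> / 6", OF _ B d(1) d2 _ e] \<eta> e2 unfolding S_def by simp
  have close: "\<bar>(\<integral>z. S z \<partial>\<rho>) - (\<integral>z. \<phi> z \<partial>\<rho>)\<bar> \<le> \<eta> / 3" if \<rho>: "plane_law \<rho>" for \<rho>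
  proof -
    interpret plane_law \<rho> by fact
    have [measurable_cong]: "sets \<rho> = sets borel" by (rule sets_nu)
    have 1: "integrable \<rho> S" unfolding S_def by (rule mollification_swap(1)[OF \<phi> e])
    have 2: "integrable \<rho> \<phi>" by (rule integrable_const_bound[where B = B]) (use B in auto)
    have "\<bar>(\<integral>z. S z \<partial>\<rho>) - (\<integral>z. \<phi> z \<partial>\<rho>)\<bar> = norm (\<integral>z. S z - \<phi> z \<partial>\<rho>)" using 1 2 by simp
    also have "\<dots> \<le> (\<integral>z. \<eta> / 3 \<partial>\<rho>)" by (rule Bochner_Integration.integral_norm_bound_integral) (use 1 2 err in auto)
    finally show ?thesis by (simp add: prob_space)
  qed
  have "(\<lambda>N. \<integral>z. S z \<partial>\<nu> N) \<longlonglongrightarrow> (\<integral>z. S z \<partial>\<mu>)" unfolding S_def by (rule mollified_tendsto[OF \<nu> \<mu> lim e \<phi>])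
  from LIMSEQ_D[OF this, of "\<eta> / 3"] \<eta> obtain n where
    n: "\<And>N. N \<ge> n \<Longrightarrow> \<bar>(\<integral>z. S z \<partial>\<nu> N) - (\<integral>z. S z \<partial>\<mu>)\<bar> < \<eta> / 3" by auto
  have "norm ((\<integral>z. \<phi> z \<partial>\<nu> N) - (\<integral>z. \<phi> z \<partial>\<mu>)) < \<eta>" if "N \<ge> n" for N
    unfolding real_norm_def using n[OF that] close[OF \<nu>[of N]] close[OF \<mu>] by linarith
  then show "\<exists>n. \<forall>N\<ge>n. norm ((\<integral>z. \<phi> z \<partial>\<nu> N) - (\<integral>z. \<phi> z \<partial>\<mu>)) < \<eta>" by blast
qed

text \<open>The bounded second moments provide tightness: outside a ball of radius \<open>K\<close>
  a bounded function contributes at most \<open>B * C / K^2\<close>. It may therefore be cut off to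
  compact support, where it is integrable and uniformly continuous.\<close>

theorem weak_limit_from_char2:
  assumes \<nu>: "\<And>N. plane_law (\<nu> N)" and \<mu>: "plane_law \<mu>"
    and lim: "\<And>s t. (\<lambda>N. char2 (\<nu> N) s t) \<longlonglongrightarrow> char2 \<mu> s t"
    and tight: "\<And>N. integrable (\<nu> N) (\<lambda>z. (norm z)\<^sup>2)" "\<And>N. (\<integral>z. (norm z)\<^sup>2 \<partial>\<nu> N) \<le> C"
      "integrable \<mu> (\<lambda>z. (norm z)\<^sup>2)" "(\<integral>z. (norm z)\<^sup>2 \<partial>\<mu>) \<le> C"
  shows "converges_weakly \<nu> \<mu>"
  unfolding converges_weakly_def
proof (intro allI impI)
  fix \<phi> :: "real \<times> real \<Rightarrow> real" assume cont: "continuous_on UNIV \<phi>" and bd: "bounded (range \<phi>)"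
  have [measurable]: "\<phi> \<in> borel_measurable borel" by (rule borel_measurable_continuous_onI[OF cont])
  obtain B where B: "\<And>z. \<bar>\<phi> z\<bar> \<le> B" using bd unfolding bounded_iff by auto
  have B0: "B \<ge> 0" using B[of 0] by linarith
  have C0: "C \<ge> 0" using tight(4) by (rule order_trans[rotated]) (intro Bochner_Integration.integral_nonneg, simp)
  show "(\<lambda>N. \<integral>z. \<phi> z \<partial>\<nu> N) \<longlonglongrightarrow> (\<integral>z. \<phi> z \<partial>\<mu>)"
  proof (rule LIMSEQ_I)
    fix \<eta> :: real assume \<eta>: "\<eta> > 0"
    define K where "K = 1 + 3 * B * C / \<eta>"
    have K: "K \<ge> 1" using B0 C0 \<eta> by (simp add: K_def)
    have "3 * B * C \<le> \<eta> * K" using \<eta> by (simp add: K_def field_simps)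
    also have "\<dots> \<le> \<eta> * K\<^sup>2" using \<eta> K by (intro mult_left_mono) (auto simp: power2_eq_square)
    finally have K2: "B * C / K\<^sup>2 \<le> \<eta> / 3" using K by (simp add: field_simps)
    \<comment> \<open>The cutoff is 1 up to norm \<open>K\<close> and 0 from norm
      \<open>2 * K\<close> on.\<close>
    define \<psi> where "\<psi> z = \<phi> z * max 0 (min 1 (2 - norm z / K))" for z
    have cp: "continuous_on A \<psi>" for A
      unfolding \<psi>_def by (intro continuous_intros continuous_on_subset[OF cont]) (use K in auto)
    have [measurable]: "\<psi> \<in> borel_measurable borel" by (rule borel_measurable_continuous_onI[OF cp])
    have supp: "\<psi> z = 0" if "norm z \<ge> 2 * K" for z using that K by (simp add: \<psi>_def field_simps)
    have \<psi>B: "\<bar>\<psi> z\<bar> \<le> B" for z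
    proof -
      have "\<bar>\<phi> z\<bar> * \<bar>max 0 (min 1 (2 - norm z / K))\<bar> \<le> B * 1" using B B0 by (intro mult_mono) auto
      then show ?thesis by (simp add: \<psi>_def abs_mult)
    qed
    have int: "integrable lborel \<psi>"
    proof -
      have "integrable lborel (\<lambda>z. indicator (cball 0 (2 * K)) z *\<^sub>R \<psi> z)"
        by (rule borel_integrable_compact) (use cp in auto)
      moreover have "(\<lambda>z. indicator (cball 0 (2 * K)) z *\<^sub>R \<psi> z) = \<psi>"
        using supp by (auto simp: fun_eq_iff indicator_def)
      ultimately show ?thesis by simp
    qed
    have uc: "uniformly_continuous_on UNIV \<psi>"
      unfolding uniformly_continuous_on_def
    proof (intro allI impI)
      fix r :: real assume r: "r > 0"
      have "uniformly_continuous_on (cball 0 (2 * K + 1)) \<psi>"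
        by (rule compact_uniformly_continuous[OF cp compact_cball])
      then obtain d where d: "d > 0" "\<And>x y. x \<in> cball 0 (2 * K + 1) \<Longrightarrow> y \<in> cball 0 (2 * K + 1) \<Longrightarrow> dist y x < d \<Longrightarrow> dist (\<psi> y) (\<psi> x) < r"
        using r unfolding uniformly_continuous_on_def by meson
      \<comment> \<open>Points at distance below 1 lie either both in the ball of radius
        \<open>2 * K + 1\<close> or both where \<psi> vanishes.\<close>
      have "dist (\<psi> y) (\<psi> x) < r" if xy: "dist y x < min d 1" for x y
      proof (cases "norm x \<le> 2 * K + 1 \<and> norm y \<le> 2 * K + 1")
        case True then show ?thesis using d(2)[of x y] xy by simp
      next
        case False
        have "norm (x - y) < 1" using xy by (simp add: dist_norm norm_minus_commute)
        then have "norm x \<ge> 2 * K" "norm y \<ge> 2 * K"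
          using False norm_triangle_ineq2[of x y] norm_triangle_ineq2[of y x] norm_minus_commute[of x y] by linarith+
        then show ?thesis using supp r by simp
      qed
      then show "\<exists>d>0. \<forall>x\<in>UNIV. \<forall>y\<in>UNIV. dist y x < d \<longrightarrow> dist (\<psi> y) (\<psi> x) < r"
        using d(1) by (intro exI[of _ "min d 1"]) auto
    qed
    have close: "\<bar>(\<integral>z. \<phi> z \<partial>\<rho>) - (\<integral>z. \<psi> z \<partial>\<rho>)\<bar> \<le> \<eta> / 3"
      if \<rho>: "plane_law \<rho>" and t: "integrable \<rho> (\<lambda>z. (norm z)\<^sup>2)" "(\<integral>z. (norm z)\<^sup>2 \<partial>\<rho>) \<le> C" for \<rho>
    proof -
      interpret plane_law \<rho> by fact
      have [measurable_cong]: "sets \<rho> = sets borel" by (rule sets_nu)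
      have 1: "integrable \<rho> \<phi>" by (rule integrable_const_bound[where B = B]) (use B in auto)
      have 2: "integrable \<rho> \<psi>" by (rule integrable_const_bound[where B = B]) (use \<psi>B in auto)
      have 3: "norm (\<phi> z - \<psi> z) \<le> B / K\<^sup>2 * (norm z)\<^sup>2" for z
      proof -
        have eq: "\<phi> z - \<psi> z = \<phi> z * (1 - max 0 (min 1 (2 - norm z / K)))" by (simp add: \<psi>_def algebra_simps)
        have "1 - max 0 (min 1 (2 - norm z / K)) \<le> (norm z / K)\<^sup>2"
        proof (cases "norm z \<le> K")
          case True then show ?thesis using K by (simp add: field_simps)
        next
          case False
          then have "1 \<le> (norm z / K)\<^sup>2" using K by (simp add: one_le_power)
          then show ?thesis by linarith
        qed
        then have "\<bar>\<phi> z\<bar> * \<bar>1 - max 0 (min 1 (2 - norm z / K))\<bar> \<le> B * (norm z / K)\<^sup>2"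
          using B B0 by (intro mult_mono) auto
        then show ?thesis unfolding eq by (simp add: abs_mult power_divide)
      qed
      have "\<bar>(\<integral>z. \<phi> z \<partial>\<rho>) - (\<integral>z. \<psi> z \<partial>\<rho>)\<bar> = norm (\<integral>z. \<phi> z - \<psi> z \<partial>\<rho>)" using 1 2 by simp
      also have "\<dots> \<le> (\<integral>z. B / K\<^sup>2 * (norm z)\<^sup>2 \<partial>\<rho>)"
        by (rule Bochner_Integration.integral_norm_bound_integral[OF _ _ 3]) (use 1 2 t in auto)
      also have "\<dots> = B / K\<^sup>2 * (\<integral>z. (norm z)\<^sup>2 \<partial>\<rho>)" by simp
      also have "\<dots> \<le> B / K\<^sup>2 * C" using t(2) B0 by (intro mult_left_mono) auto
      finally show ?thesis using K2 by (simp only: times_divide_eq_left)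
    qed
    have "(\<lambda>N. \<integral>z. \<psi> z \<partial>\<nu> N) \<longlonglongrightarrow> (\<integral>z. \<psi> z \<partial>\<mu>)"
      by (rule weak_limit_uniformly_continuous[OF \<nu> \<mu> lim int \<psi>B uc])
    from LIMSEQ_D[OF this, of "\<eta> / 3"] \<eta> obtain n where
      n: "\<And>N. N \<ge> n \<Longrightarrow> \<bar>(\<integral>z. \<psi> z \<partial>\<nu> N) - (\<integral>z. \<psi> z \<partial>\<mu>)\<bar> < \<eta> / 3" by auto
    have "norm ((\<integral>z. \<phi> z \<partial>\<nu> N) - (\<integral>z. \<phi> z \<partial>\<mu>)) < \<eta>" if "N \<ge> n" for N
      unfolding real_norm_def using n[OF that] close[OF \<nu>[of N] tight(1,2)] close[OF \<mu> tight(3,4)] by linarith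
    then show "\<exists>n. \<forall>N\<ge>n. norm ((\<integral>z. \<phi> z \<partial>\<nu> N) - (\<integral>z. \<phi> z \<partial>\<mu>)) < \<eta>" by blast
  qed
qed

subsection \<open>The limiting law\<close>

text \<open>The image of two independent standard normal variables under a triangular (Cholesky)
  matrix: variances \<open>a^2\<close> and \<open>b^2 + d^2\<close>, covariance
  \<open>a * b\<close>.\<close>

definition gauss2 :: "real \<Rightarrow> real \<Rightarrow> real \<Rightarrow> (real \<times> real) measure" where
  "gauss2 a b d = distr (N01 \<Otimes>\<^sub>M N01) borel (\<lambda>x. (a * fst x, b * fst x + d * snd x))"

lemma measurable_gauss2_map [measurable]:
  "(\<lambda>x. (a * fst x, b * fst x + d * snd x)) \<in> measurable (N01 \<Otimes>\<^sub>M N01) (borel :: (real \<times> real) measure)"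
  unfolding borel_prod[symmetric] by measurable

lemma prob_N01_pair: "prob_space (N01 \<Otimes>\<^sub>M N01)"
proof -
  interpret N: prob_space N01 by (rule prob_N01)
  interpret NN: pair_prob_space N01 N01 ..
  show ?thesis by (rule NN.prob_space_axioms)
qed

lemma plane_law_gauss2: "plane_law (gauss2 a b d)"
proof -
  interpret prob_space "N01 \<Otimes>\<^sub>M N01" by (rule prob_N01_pair)
  show ?thesis unfolding plane_law_def plane_law_axioms_def gauss2_def
    by (auto intro: prob_space_distr)
qed

lemma char2_gauss2: "char2 (gauss2 a b d) s t = complex_of_real (exp (- ((s * a + t * b)\<^sup>2 + (t * d)\<^sup>2) / 2))"
proof -
  have "char2 (gauss2 a b d) s t = (CLINT x|(N01 \<Otimes>\<^sub>M N01). iexp ((s * a + t * b) * fst x + (t * d) * snd x))"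
    unfolding char2_def gauss2_def
    by (subst integral_distr[OF measurable_gauss2_map])
       (auto simp: algebra_simps borel_prod[symmetric])
  then show ?thesis unfolding iexp_pair_N01 .
qed

lemma N01_moments:
  shows "integrable N01 (\<lambda>x. x)" "(\<integral>x. x \<partial>N01) = 0" "integrable N01 (\<lambda>x. x * x)" "(\<integral>x. x * x \<partial>N01) = 1"
proof -
  have 1: "has_bochner_integral lborel (\<lambda>x. std_normal_density x * x) 0"
    using std_normal_moment_odd[of 0] by simp
  have 2: "has_bochner_integral lborel (\<lambda>x. std_normal_density x * (x * x)) 1"
    using std_normal_moment_even[of 1] by (simp add: power2_eq_square fact_numeral)
  show "integrable N01 (\<lambda>x. x)" "integrable N01 (\<lambda>x. x * x)"
    using 1 2 by (subst integrable_density; auto simp: has_bochner_integral_iff)+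
  show "(\<integral>x. x \<partial>N01) = 0" "(\<integral>x. x * x \<partial>N01) = 1"
    using 1 2 by (subst integral_density; auto simp: has_bochner_integral_iff)+
qed

lemma gauss2_moments:
  shows "(\<integral>z. fst z \<partial>gauss2 a b d) = 0" "(\<integral>z. snd z \<partial>gauss2 a b d) = 0"
    and "(\<integral>z. fst z * snd z \<partial>gauss2 a b d) = a * b"
    and "integrable (gauss2 a b d) (\<lambda>z. (norm z)\<^sup>2)"
proof -
  let ?P = "N01 \<Otimes>\<^sub>M N01"
  interpret prob_space N01 by (rule prob_N01)
  have one: "integrable N01 (\<lambda>x. 1 :: real)" "(\<integral>x. 1 \<partial>N01) = (1 :: real)" using prob_space by auto
  note pim = pair_integral_mult[OF sigma_finite_measure_axioms sigma_finite_measure_axioms]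
  note m = N01_moments
  have i: "integrable ?P fst" "integrable ?P snd" "integrable ?P (\<lambda>z. fst z * fst z)"
     "integrable ?P (\<lambda>z. fst z * snd z)" "integrable ?P (\<lambda>z. snd z * snd z)"
    using pim(1)[OF m(1) one(1)] pim(1)[OF one(1) m(1)] pim(1)[OF m(3) one(1)] pim(1)[OF m(1) m(1)] pim(1)[OF one(1) m(3)]
    by simp_all
  have v: "(\<integral>z. fst z \<partial>?P) = 0" "(\<integral>z. snd z \<partial>?P) = 0" "(\<integral>z. fst z * fst z \<partial>?P) = 1"
     "(\<integral>z. fst z * snd z \<partial>?P) = 0"
    using pim(2)[OF m(1) one(1)] pim(2)[OF one(1) m(1)] pim(2)[OF m(3) one(1)] pim(2)[OF m(1) m(1)] m one
    by simp_all
  have [measurable]: "fst \<in> borel_measurable (borel :: (real \<times> real) measure)" "snd \<in> borel_measurable (borel :: (real \<times> real) measure)"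
    by (simp_all add: borel_prod[symmetric])
  show "(\<integral>z. fst z \<partial>gauss2 a b d) = 0"
    unfolding gauss2_def by (subst integral_distr) (use v in simp_all)
  show "(\<integral>z. snd z \<partial>gauss2 a b d) = 0"
    unfolding gauss2_def by (subst integral_distr) (use v i in simp_all)
  show "(\<integral>z. fst z * snd z \<partial>gauss2 a b d) = a * b"
  proof -
    have "(\<integral>z. fst z * snd z \<partial>gauss2 a b d) = (\<integral>x. (a * b) * (fst x * fst x) + (a * d) * (fst x * snd x) \<partial>?P)"
      unfolding gauss2_def by (subst integral_distr) (simp_all add: algebra_simps)
    then show ?thesis using i v by simp
  qed
  have "integrable ?P (\<lambda>x. (a * a + b * b) * (fst x * fst x) + (2 * b * d) * (fst x * snd x) + (d * d) * (snd x * snd x))"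
    using i by simp
  moreover have "(\<lambda>x. (norm (a * fst x, b * fst x + d * snd x))\<^sup>2) =
      (\<lambda>x. (a * a + b * b) * (fst x * fst x) + (2 * b * d) * (fst x * snd x) + (d * d) * (snd x * snd x))"
    by (rule ext) (simp add: norm_prod_def real_sqrt_pow2, simp add: power2_eq_square algebra_simps)
  ultimately show "integrable (gauss2 a b d) (\<lambda>z. (norm z)\<^sup>2)"
    unfolding gauss2_def by (subst integrable_distr_eq) simp_all
qed

text \<open>Every linear image has the characteristic function of a centered Gaussian law of
  variance \<open>v\<close>, and the uniqueness theorem identifies it; \<open>v = 0\<close> gives
  the point mass at 0.\<close>

lemma bivariate_gaussian_gauss2: "bivariate_gaussian (gauss2 a b d)"
  unfolding bivariate_gaussian_def
proof (intro conjI allI)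
  show "sets (gauss2 a b d) = sets borel" by (simp add: gauss2_def)
  fix s t :: real
  interpret plane_law "gauss2 a b d" by (rule plane_law_gauss2)
  interpret N: prob_space N01 by (rule prob_N01)
  let ?L = "\<lambda>z :: real \<times> real. s * fst z + t * snd z"
  let ?\<rho> = "distr (gauss2 a b d) borel ?L"
  have [measurable]: "?L \<in> borel_measurable (gauss2 a b d)" by measurable
  interpret R: prob_space ?\<rho> by (rule prob_space_distr) simp
  have R: "real_distribution ?\<rho>" by unfold_locales auto
  define v where "v = (s * a + t * b)\<^sup>2 + (t * d)\<^sup>2"
  have v: "v \<ge> 0" by (simp add: v_def)
  have ch: "char ?\<rho> u = complex_of_real (exp (- (u\<^sup>2 * v) / 2))" for u
  proof -
    have "char ?\<rho> u = char2 (gauss2 a b d) (u * s) (u * t)"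
      unfolding char_def char2_def by (subst integral_distr) (auto simp: algebra_simps)
    moreover have "(u * s * a + u * t * b)\<^sup>2 + (u * t * d)\<^sup>2 = u\<^sup>2 * v"
      by (simp add: v_def power2_eq_square algebra_simps)
    ultimately show ?thesis unfolding char2_gauss2 by simp
  qed
  have "gaussian_law ?\<rho>"
  proof (cases "v = 0")
    case True
    have D: "real_distribution (return borel (0 :: real))"
      unfolding real_distribution_def real_distribution_axioms_def by (auto intro: prob_space_return)
    have "char (return borel 0) = char ?\<rho>"
      unfolding fun_eq_iff ch True by (simp add: char_def integral_return)
    then have "?\<rho> = return borel 0" using Levy_uniqueness[OF R D] by simp
    then show ?thesis unfolding gaussian_law_def by blast
  next
    case False
    then have pos: "sqrt v > 0" using v by simp
    have "distributed N01 lborel (\<lambda>x. x) std_normal_density"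
      unfolding distributed_def by (auto simp: distr_id2)
    from N.normal_density_affine[OF this _ , of "sqrt v" 0] pos
    have "distributed N01 lborel (\<lambda>x. sqrt v * x) (normal_density 0 (sqrt v))" by simp
    then have "distr N01 lborel (\<lambda>x. sqrt v * x) = density lborel (normal_density 0 (sqrt v))"
      unfolding distributed_def by blast
    then have eq: "density lborel (normal_density 0 (sqrt v)) = distr N01 borel (\<lambda>x. sqrt v * x)"
      by (metis distr_cong sets_lborel)
    have D: "real_distribution (density lborel (normal_density 0 (sqrt v)))"
      unfolding real_distribution_def real_distribution_axioms_def using prob_space_normal_density[OF pos] by auto
    have "char (density lborel (normal_density 0 (sqrt v))) u = char ?\<rho> u" for u
    proof -
      have "char (density lborel (normal_density 0 (sqrt v))) u = (CLINT x|N01. iexp ((u * sqrt v) * x))"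
        unfolding eq char_def by (subst integral_distr) (auto simp: mult.assoc)
      then show ?thesis unfolding iexp_N01 ch using v by (simp add: power_mult_distrib)
    qed
    then have "?\<rho> = density lborel (normal_density 0 (sqrt v))" using Levy_uniqueness[OF R D] by (auto simp: fun_eq_iff)
    then show ?thesis unfolding gaussian_law_def using pos by blast
  qed
  then show "gaussian_law (distr (gauss2 a b d) borel (\<lambda>(x, y). s * x + t * y))" by (simp add: case_prod_unfold)
qed

subsection \<open>Spectra of sample covariance matrices\<close>

definition mtrace :: "'a :: comm_ring_1 mat \<Rightarrow> 'a" where
  "mtrace A = (\<Sum>i<dim_row A. A $$ (i, i))"

lemma index_mult_sum:
  assumes "A \<in> carrier_mat n m" "B \<in> carrier_mat m p" "i < n" "j < p"
  shows "(A * B) $$ (i, j) = (\<Sum>l<m. A $$ (i, l) * B $$ (l, j))"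
  using assms by (auto simp: scalar_prod_def atLeast0LessThan intro!: sum.cong)

lemma mtrace_mult_commute:
  assumes A: "A \<in> carrier_mat n m" and B: "B \<in> carrier_mat m n"
  shows "mtrace (A * B) = mtrace (B * A)"
proof -
  have "mtrace (A * B) = (\<Sum>i<n. \<Sum>l<m. A $$ (i, l) * B $$ (l, i))"
    unfolding mtrace_def using A B by (auto intro!: sum.cong index_mult_sum simp del: index_mult_mat(1))
  also have "\<dots> = (\<Sum>l<m. \<Sum>i<n. B $$ (l, i) * A $$ (i, l))"
    by (subst sum.swap) (simp add: mult.commute)
  also have "\<dots> = mtrace (B * A)"
    unfolding mtrace_def using A B by (auto intro!: sum.cong index_mult_sum[symmetric] simp del: index_mult_mat(1))
  finally show ?thesis .
qed

lemma pow_upper_triangular: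
  fixes B :: "'a :: comm_ring_1 mat"
  assumes B: "B \<in> carrier_mat n n" and ut: "\<And>i j. i < n \<Longrightarrow> j < i \<Longrightarrow> B $$ (i, j) = 0"
  shows "(\<forall>i<n. \<forall>j<i. (B ^\<^sub>m k) $$ (i, j) = 0) \<and> (\<forall>i<n. (B ^\<^sub>m k) $$ (i, i) = (B $$ (i, i)) ^ k)"
proof (induction k)
  case 0 show ?case using B by auto
next
  case (Suc k)
  have P: "B ^\<^sub>m k \<in> carrier_mat n n" using B by (rule pow_carrier_mat)
  have e: "(B ^\<^sub>m Suc k) $$ (i, j) = (\<Sum>l<n. (B ^\<^sub>m k) $$ (i, l) * B $$ (l, j))" if "i < n" "j < n" for i j
    unfolding pow_mat.simps by (rule index_mult_sum[OF P B that])
  show ?case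
  proof (intro conjI allI impI)
    fix i j assume ij: "i < n" "j < i"
    have "(B ^\<^sub>m k) $$ (i, l) * B $$ (l, j) = 0" if "l < n" for l
    proof (cases "l < i")
      case True then show ?thesis using Suc ij by simp
    next
      case False
      then have "j < l" using ij by simp
      then show ?thesis using ut[OF that] by simp
    qed
    then show "(B ^\<^sub>m Suc k) $$ (i, j) = 0" using e[of i j] ij by simp
  next
    fix i assume i: "i < n"
    have "(\<Sum>l<n. (B ^\<^sub>m k) $$ (i, l) * B $$ (l, i)) = (\<Sum>l<n. if l = i then (B ^\<^sub>m k) $$ (i, i) * B $$ (i, i) else 0)"
    proof (intro sum.cong refl)
      fix l assume "l \<in> {..<n}"
      then have l: "l < n" by simp
      show "(B ^\<^sub>m k) $$ (i, l) * B $$ (l, i) = (if l = i then (B ^\<^sub>m k) $$ (i, i) * B $$ (i, i) else 0)"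
        using Suc i ut[OF l, of i] by (cases l i rule: linorder_cases) auto
    qed
    then show "(B ^\<^sub>m Suc k) $$ (i, i) = (B $$ (i, i)) ^ Suc k" unfolding e[OF i i] using i Suc by (simp add: mult.commute)
  qed
qed

text \<open>For a complex eigenvector the quadratic form \<open>q\<close> is real by symmetry, and
  it equals the eigenvalue times the positive squared norm \<open>s\<close>.\<close>

lemma char_poly_real_symmetric_splits:
  fixes A :: "real mat"
  assumes A: "A \<in> carrier_mat n n" and sym: "\<And>i j. i < n \<Longrightarrow> j < n \<Longrightarrow> A $$ (i, j) = A $$ (j, i)"
  shows "\<exists>es. char_poly A = (\<Prod>a\<leftarrow>es. [:- a, 1:])"
proof -
  let ?C = "map_mat complex_of_real A"
  have C: "?C \<in> carrier_mat n n" using A by simp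
  obtain cs where cs: "char_poly ?C = (\<Prod>a\<leftarrow>cs. [:- a, 1:])" using char_poly_factorized[OF C] by blast
  have real: "complex_of_real (Re a) = a" if "a \<in> set cs" for a
  proof -
    have "poly (char_poly ?C) a = 0" unfolding cs poly_prod_list using that by (auto simp: prod_list_zero_iff)
    then obtain v where v: "v \<in> carrier_vec n" "v \<noteq> 0\<^sub>v n" "?C *\<^sub>v v = a \<cdot>\<^sub>v v"
      using eigenvalue_root_char_poly[OF C] C unfolding eigenvalue_def eigenvector_def by auto
    have ev: "(\<Sum>j<n. complex_of_real (A $$ (i, j)) * v $ j) = a * v $ i" if i: "i < n" for i
    proof -
      have "(?C *\<^sub>v v) $ i = (\<Sum>j<n. complex_of_real (A $$ (i, j)) * v $ j)"
        using A v(1) i by (auto simp: scalar_prod_def atLeast0LessThan intro!: sum.cong)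
      then show ?thesis unfolding v(3) using v(1) i by simp
    qed
    define q where "q = (\<Sum>i<n. \<Sum>j<n. cnj (v $ i) * (complex_of_real (A $$ (i, j)) * v $ j))"
    define s where "s = (\<Sum>i<n. (cmod (v $ i))\<^sup>2)"
    have "q = (\<Sum>i<n. cnj (v $ i) * (a * v $ i))" unfolding q_def sum_distrib_left[symmetric] using ev by simp
    also have "\<dots> = a * complex_of_real s" unfolding s_def of_real_sum sum_distrib_left complex_norm_square
      by (intro sum.cong refl) (simp add: algebra_simps)
    finally have q1: "q = a * complex_of_real s" .
    have "cnj q = (\<Sum>j<n. \<Sum>i<n. v $ i * (complex_of_real (A $$ (i, j)) * cnj (v $ j)))"
      unfolding q_def cnj_sum by (subst sum.swap) simp
    also have "\<dots> = q" unfolding q_def using sym by (intro sum.cong refl) (simp add: algebra_simps)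
    finally have q2: "cnj q = q" .
    obtain i where i: "i < n" "v $ i \<noteq> 0" using v(1,2) by (metis carrier_vecD eq_vecI index_zero_vec(1) index_zero_vec(2))
    have "0 < (cmod (v $ i))\<^sup>2" using i by simp
    also have "\<dots> \<le> s" unfolding s_def by (rule member_le_sum) (use i in auto)
    finally have s: "s > 0" .
    have "cnj a = a" using q2 s unfolding q1 by simp
    then show ?thesis by (metis complex_cnj_cancel_iff Reals_cnj_iff of_real_Re)
  qed
  have "poly (char_poly A) x = poly (\<Prod>a\<leftarrow>map Re cs. [:- a, 1:]) x" for x
  proof -
    have "complex_of_real (poly (char_poly A) x) = poly (char_poly ?C) (complex_of_real x)"
      unfolding of_real_hom.char_poly_hom[OF A] by simp
    also have "\<dots> = (\<Prod>a\<leftarrow>cs. complex_of_real x - a)" unfolding cs poly_prod_list by (simp add: comp_def)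
    also have "\<dots> = (\<Prod>a\<leftarrow>cs. complex_of_real (x - Re a))"
      by (intro arg_cong[of _ _ prod_list] map_cong refl) (simp add: real)
    also have "\<dots> = complex_of_real (\<Prod>a\<leftarrow>cs. x - Re a)" by (induction cs) auto
    also have "(\<Prod>a\<leftarrow>cs. x - Re a) = poly (\<Prod>a\<leftarrow>map Re cs. [:- a, 1:]) x" unfolding poly_prod_list by (simp add: comp_def)
    finally show ?thesis by simp
  qed
  then have "char_poly A = (\<Prod>a\<leftarrow>map Re cs. [:- a, 1:])" unfolding poly_eq_poly_eq_iff[symmetric] by (intro ext)
  then show ?thesis by blast
qed

lemma order_prod_linear: "order (e :: real) (\<Prod>a\<leftarrow>es. [:- a, 1:]) = count_list es e"
proof (induction es)
  case (Cons a es)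
  have "order e [:- a, 1:] = (if a = e then 1 else 0)"
    using order_power_n_n[of a 1] by (auto intro: order_0I)
  moreover have "[:- a, 1:] * (\<Prod>a\<leftarrow>es. [:- a, 1:]) \<noteq> 0"
    unfolding mult_eq_0_iff by (auto simp: prod_list_zero_iff)
  ultimately show ?case using Cons by (simp add: order_mult del: mult_pCons_left)
qed simp

lemma lin_stat_eq_sum_list:
  assumes W: "W \<in> carrier_mat n n" and es: "char_poly W = (\<Prod>a\<leftarrow>es. [:- a, 1:])"
  shows "lin_stat f W = (\<Sum>a\<leftarrow>es. f a)"
proof -
  have "spectrum W = set es"
    unfolding spectrum_def using eigenvalue_root_char_poly[OF W] unfolding es poly_prod_list by (auto simp: prod_list_zero_iff)
  moreover have "(\<Sum>a\<leftarrow>es. f a) = (\<Sum>a\<in>set es. real (count_list es a) * f a)" for es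
  proof -
    have gen: "finite X \<Longrightarrow> set es \<subseteq> X \<Longrightarrow> (\<Sum>a\<leftarrow>es. f a) = (\<Sum>a\<in>X. real (count_list es a) * f a)" for X
    proof (induction es)
      case (Cons b es)
      have "(\<Sum>a\<in>X. real (count_list (b # es) a) * f a) = (\<Sum>a\<in>X. (if a = b then f b else 0) + real (count_list es a) * f a)"
        by (intro sum.cong refl) (auto simp: algebra_simps)
      then show ?case using Cons by (simp add: sum.distrib)
    qed simp
    show ?thesis by (rule gen) auto
  qed
  ultimately show ?thesis unfolding lin_stat_def es order_prod_linear by simp
qed

text \<open>\<open>W\<close> has a Schur triangular form with diagonal \<open>es\<close>; the affine
  image \<open>H\<close> has the triangular form \<open>G\<close> under the same similarity.\<close>

lemma mtrace_pow_affine: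
  fixes W :: "real mat"
  assumes W: "W \<in> carrier_mat n n" and es: "char_poly W = (\<Prod>a\<leftarrow>es. [:- a, 1:])"
    and H: "H \<in> carrier_mat n n" "\<And>i j. i < n \<Longrightarrow> j < n \<Longrightarrow> H $$ (i, j) = c * W $$ (i, j) + (if i = j then s else 0)"
  shows "mtrace (H ^\<^sub>m k) = (\<Sum>a\<leftarrow>es. (c * a + s) ^ k)"
proof -
  obtain B P Q where "schur_decomposition W es = (B, P, Q)" by (cases "schur_decomposition W es") auto
  from schur_decomposition[OF W es this] have sim: "similar_mat_wit W B P Q" and ut: "upper_triangular B" and di: "diag_mat B = es" by auto
  have cr: "B \<in> carrier_mat n n" "P \<in> carrier_mat n n" "Q \<in> carrier_mat n n" and PQ: "P * Q = 1\<^sub>m n" "Q * P = 1\<^sub>m n"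
    and WB: "W = P * B * Q"
    using sim W unfolding similar_mat_wit_def Let_def by auto
  define G where "G = c \<cdot>\<^sub>m B + s \<cdot>\<^sub>m 1\<^sub>m n"
  have G: "G \<in> carrier_mat n n" using cr by (simp add: G_def)
  have "P * G * Q = P * (c \<cdot>\<^sub>m B) * Q + P * (s \<cdot>\<^sub>m 1\<^sub>m n) * Q"
    unfolding G_def using cr by (simp add: mult_add_distrib_mat[of P n n _ n] add_mult_distrib_mat[of _ n n _ Q n])
  also have "P * (c \<cdot>\<^sub>m B) * Q = c \<cdot>\<^sub>m W" unfolding WB using cr
    by (simp add: mult_smult_distrib[of P n n B n] mult_smult_assoc_mat[of "P * B" n n Q n])
  also have "P * (s \<cdot>\<^sub>m 1\<^sub>m n) * Q = s \<cdot>\<^sub>m 1\<^sub>m n" using cr PQ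
    by (simp add: mult_smult_distrib[of P n n "1\<^sub>m n" n] mult_smult_assoc_mat[of P n n Q n])
  also have "c \<cdot>\<^sub>m W + s \<cdot>\<^sub>m 1\<^sub>m n = H" using W H by (intro eq_matI) auto
  finally have HG: "H = P * G * Q" ..
  have "similar_mat_wit H G P Q"
    by (rule similar_mat_witI[OF PQ HG H(1) G cr(2,3)])
  then have "H ^\<^sub>m k = P * G ^\<^sub>m k * Q" by (rule similar_mat_wit_pow_id)
  then have "mtrace (H ^\<^sub>m k) = mtrace (Q * (P * G ^\<^sub>m k))"
    using mtrace_mult_commute[of "P * G ^\<^sub>m k" n n Q] cr G by (simp add: pow_carrier_mat)
  also have "Q * (P * G ^\<^sub>m k) = G ^\<^sub>m k"
    using cr PQ G by (simp add: assoc_mult_mat[of Q n n P n "G ^\<^sub>m k" n, symmetric] pow_carrier_mat)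
  finally have 1: "mtrace (H ^\<^sub>m k) = mtrace (G ^\<^sub>m k)" .
  have Gut: "G $$ (i, j) = 0" if "i < n" "j < i" for i j
    using that ut cr unfolding G_def upper_triangular_def by auto
  have Gd: "(G ^\<^sub>m k) $$ (i, i) = (c * B $$ (i, i) + s) ^ k" if "i < n" for i
  proof -
    have "G $$ (i, i) = c * B $$ (i, i) + s" using that cr by (simp add: G_def)
    then show ?thesis using pow_upper_triangular[OF G Gut, of k] that by auto
  qed
  have "mtrace (G ^\<^sub>m k) = (\<Sum>i<n. (c * B $$ (i, i) + s) ^ k)"
    unfolding mtrace_def using pow_carrier_mat[OF G, of k] Gd by auto
  also have "\<dots> = (\<Sum>a\<leftarrow>es. (c * a + s) ^ k)"
    unfolding di[symmetric] diag_mat_def using cr(1) by (simp add: comp_def interv_sum_list_conv_sum_set_nat atLeast0LessThan)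
  finally show ?thesis using 1 by simp
qed

section \<open>Gram matrices and walk sums\<close>

lemma bij_betw_pick: "finite R \<Longrightarrow> bij_betw (pick R) {..<card R} R"
proof -
  assume R: "finite R"
  have inj: "inj_on (pick R) {..<card R}"
    by (rule inj_onI) (metis lessThan_iff linorder_neqE_nat less_irrefl pick_mono)
  have "pick R ` {..<card R} \<subseteq> R" by (auto intro: pick_in_set)
  moreover have "card (pick R ` {..<card R}) = card R" using card_image[OF inj] by simp
  ultimately have "pick R ` {..<card R} = R" using R card_subset_eq by blast
  with inj show ?thesis by (simp add: bij_betw_def)
qed

lemma walk_sum_2:
  fixes R C :: "nat set" and x :: "(nat + nat) set \<Rightarrow> real"
  assumes "finite R" "finite C" "p \<in> R" "p' \<in> R"
  shows "walk_sum (Inl ` R) (Inr ` C) x 2 (Inl p) (Inl p') = (\<Sum>q\<in>C. x {Inl p, Inr q} * x {Inl p', Inr q})"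
proof -
  let ?S = "Inl ` R :: (nat + nat) set" and ?T = "Inr ` C :: (nat + nat) set"
  have f: "finite ?S" "finite ?T" "?S \<inter> ?T = {}" using assms by auto
  note adj = adj_def[OF f] and walk_sum = walk_sum.simps[OF f]
  have one: "walk_sum ?S ?T x 1 z (Inl p') = adj ?S ?T x z (Inl p')" for z
  proof -
    have "walk_sum ?S ?T x 1 z (Inl p') = (\<Sum>z'\<in>?S \<union> ?T. if z' = Inl p' then adj ?S ?T x z z' else 0)"
      unfolding One_nat_def walk_sum by (intro sum.cong refl) simp
    then show ?thesis using assms by simp
  qed
  have "walk_sum ?S ?T x 2 (Inl p) (Inl p') = (\<Sum>z\<in>?S \<union> ?T. adj ?S ?T x (Inl p) z * adj ?S ?T x z (Inl p'))"
    unfolding one[symmetric] numeral_2_eq_2 walk_sum(2)[of _ "Suc 0"] by simp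
  also have "\<dots> = (\<Sum>z\<in>?T. adj ?S ?T x (Inl p) z * adj ?S ?T x z (Inl p'))"
    by (rule sum.mono_neutral_right) (use assms in \<open>auto simp: adj\<close>)
  also have "\<dots> = (\<Sum>q\<in>C. x {Inl p, Inr q} * x {Inl p', Inr q})"
    using assms by (subst sum.reindex) (auto simp: adj insert_commute intro!: sum.cong)
  finally show ?thesis .
qed

text \<open>Each factor of the Gram matrix is a sum over two steps, from a row over a column to a
  row. Rows are tagged by \<open>Inl\<close> and columns by \<open>Inr\<close>.\<close>

lemma gram_pow_eq_mp:
  fixes x :: "nat \<Rightarrow> nat \<Rightarrow> real"
  assumes R: "finite R" and C: "finite C" and y: "\<And>p q. y {Inl p, Inr q} = x p q"
    and A: "A = submat x R C"
  shows "i < card R \<Longrightarrow> i' < card R \<Longrightarrow> ((A * transpose_mat A) ^\<^sub>m n) $$ (i, i') =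
     walk_sum (Inl ` R) (Inr ` C) y (2 * n) (Inl (pick R i)) (Inl (pick R i'))"
proof (induction n arbitrary: i i')
  let ?S = "Inl ` R :: (nat + nat) set" and ?T = "Inr ` C :: (nat + nat) set"
  let ?H = "A * transpose_mat A"
  have Ac: "A \<in> carrier_mat (card R) (card C)" unfolding A submat_def by simp
  have Hc: "?H \<in> carrier_mat (card R) (card R)" using Ac by simp
  have bR: "bij_betw (pick R) {..<card R} R" and bC: "bij_betw (pick C) {..<card C} C" using R C by (simp_all add: bij_betw_pick)
  note pR = bij_betwE[OF bR]
  {
    case 0
    have "pick R i = pick R i' \<longleftrightarrow> i = i'" using bR 0 unfolding bij_betw_def inj_on_def by auto
    moreover have "dim_row A = card R" using Ac by simp
    moreover have "finite ?S" "finite ?T" "?S \<inter> ?T = {}" using R C by auto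
    note walk_sum.simps(1)[OF this, of y]
    ultimately show ?case using 0 by simp
  next
    case (Suc n)
    have H: "?H $$ (j, j') = walk_sum ?S ?T y 2 (Inl (pick R j)) (Inl (pick R j'))" if "j < card R" "j' < card R" for j j'
    proof -
      have "?H $$ (j, j') = (\<Sum>l<card C. A $$ (j, l) * transpose_mat A $$ (l, j'))"
        by (rule index_mult_sum[OF Ac _ that]) (use Ac in simp)
      also have "\<dots> = (\<Sum>l<card C. x (pick R j) (pick C l) * x (pick R j') (pick C l))"
        using that unfolding A submat_def by (intro sum.cong refl) simp
      also have "\<dots> = (\<Sum>q\<in>C. x (pick R j) q * x (pick R j') q)" by (rule sum.reindex_bij_betw[OF bC])
      finally show ?thesis using walk_sum_2[OF R C, of "pick R j" "pick R j'" y] pR that y by simp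
    qed
    have u: "Inl (pick R i) \<in> ?S \<union> ?T" "Inl (pick R i') \<in> ?S \<union> ?T" using pR Suc.prems by auto
    have "(?H ^\<^sub>m Suc n) $$ (i, i') = (\<Sum>j<card R. (?H ^\<^sub>m n) $$ (i, j) * ?H $$ (j, i'))"
      unfolding pow_mat.simps by (rule index_mult_sum[OF pow_carrier_mat[OF Hc] Hc Suc.prems])
    also have "\<dots> = (\<Sum>j<card R. walk_sum ?S ?T y (2 * n) (Inl (pick R i)) (Inl (pick R j)) * walk_sum ?S ?T y 2 (Inl (pick R j)) (Inl (pick R i')))"
      using Suc H by (intro sum.cong refl) simp
    also have "\<dots> = (\<Sum>p\<in>R. walk_sum ?S ?T y (2 * n) (Inl (pick R i)) (Inl p) * walk_sum ?S ?T y 2 (Inl p) (Inl (pick R i')))"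
      by (rule sum.reindex_bij_betw[OF bR])
    also have "\<dots> = (\<Sum>z\<in>?S. walk_sum ?S ?T y (2 * n) (Inl (pick R i)) z * walk_sum ?S ?T y 2 z (Inl (pick R i')))"
      by (subst sum.reindex) auto
    also have "\<dots> = (\<Sum>z\<in>?S \<union> ?T. walk_sum ?S ?T y (2 * n) (Inl (pick R i)) z * walk_sum ?S ?T y 2 z (Inl (pick R i')))"
    proof (rule sum.mono_neutral_left)
      show "\<forall>z\<in>?S \<union> ?T - ?S. walk_sum ?S ?T y (2 * n) (Inl (pick R i)) z * walk_sum ?S ?T y 2 z (Inl (pick R i')) = 0"
      proof
        fix z assume z: "z \<in> ?S \<union> ?T - ?S"
        then have "walk_sum ?S ?T y 2 z (Inl (pick R i')) = 0"
          using walk_sum_parity[of ?S ?T z "Inl (pick R i')" y 2] u R C pR Suc.prems by auto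
        then show "walk_sum ?S ?T y (2 * n) (Inl (pick R i)) z * walk_sum ?S ?T y 2 z (Inl (pick R i')) = 0" by simp
      qed
    qed (use R C in auto)
    also have "\<dots> = walk_sum ?S ?T y (2 * n + 2) (Inl (pick R i)) (Inl (pick R i'))"
      by (rule walk_sum_add[symmetric]) (use R C u in auto)
    finally show ?case by simp
  }
qed

text \<open>An eigenvalue \<open>a\<close> of \<open>W\<close> corresponds to the eigenvalue
  \<open>2 * h * a + s\<close> of the Gram matrix; \<open>chebT\<close> undoes this affine map after
  division by \<open>h\<close>.\<close>

theorem lin_stat_chebyshev:
  fixes x :: "nat \<Rightarrow> nat \<Rightarrow> real"
  assumes R: "finite R" "R \<noteq> {}" and C: "finite C" "C \<noteq> {}" and y: "\<And>p q. y {Inl p, Inr q} = x p q"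
    and h: "h = sqrt (real (card R) * real (card C))"
  shows "lin_stat (poly (chebyshev_T k)) (norm_sample_cov (submat x R C)) =
    (\<Sum>n\<le>k. coeff (chebT ((real (card R) + real (card C)) / h) k) n / h ^ n *
      (\<Sum>w\<in>cwalks (Inl ` R) (Inr ` C) n. list_prod y (path_edges w)))"
proof -
  define A where "A = submat x R C"
  define W where "W = norm_sample_cov A"
  let ?m = "card R" and ?n = "card C"
  define s where "s = real ?m + real ?n"
  let ?H = "A * transpose_mat A"
  have pos: "card R > 0" "card C > 0" using R C by (simp_all add: card_gt_0_iff)
  have h0: "h > 0" using pos h by simp
  have Ac: "A \<in> carrier_mat ?m ?n" unfolding A_def submat_def by simp
  have Hc: "?H \<in> carrier_mat ?m ?m" using Ac by simp
  have Wdef: "W = (1 / (2 * h)) \<cdot>\<^sub>m (?H - s \<cdot>\<^sub>m 1\<^sub>m ?m)"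
    unfolding W_def norm_sample_cov_def h s_def using Ac by auto
  have Wc: "W \<in> carrier_mat ?m ?m" unfolding Wdef by (intro smult_carrier_mat minus_carrier_mat) simp
  have Wi: "W $$ (i, j) = (?H $$ (i, j) - (if i = j then s else 0)) / (2 * h)" if "i < ?m" "j < ?m" for i j
    unfolding Wdef using Hc that by auto
  have sym: "?H $$ (i, j) = ?H $$ (j, i)" if "i < ?m" "j < ?m" for i j
    using Ac that by (auto simp: scalar_prod_def mult.commute)
  have symW: "W $$ (i, j) = W $$ (j, i)" if "i < ?m" "j < ?m" for i j
    unfolding Wi[OF that] Wi[OF that(2,1)] sym[OF that] by (simp only: eq_commute[of i j])
  obtain es where es: "char_poly W = (\<Prod>a\<leftarrow>es. [:- a, 1:])"
    using char_poly_real_symmetric_splits[OF Wc symW] by blast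
  have Hi: "?H $$ (i, j) = (2 * h) * W $$ (i, j) + (if i = j then s else 0)" if "i < ?m" "j < ?m" for i j
    using Wi[OF that] h0 by simp
  have tr: "(\<Sum>w\<in>cwalks (Inl ` R) (Inr ` C) n. list_prod y (path_edges w)) = (\<Sum>a\<leftarrow>es. (2 * h * a + s) ^ n)" for n
  proof -
    have "(\<Sum>w\<in>cwalks (Inl ` R) (Inr ` C) n. list_prod y (path_edges w)) =
        (\<Sum>u\<in>Inl ` R. walk_sum (Inl ` R) (Inr ` C) y (2 * n) u u)"
      by (rule sum_cwalks_eq_mp) (use R C in auto)
    also have "\<dots> = (\<Sum>p\<in>R. walk_sum (Inl ` R) (Inr ` C) y (2 * n) (Inl p) (Inl p))" by (subst sum.reindex) auto
    also have "\<dots> = (\<Sum>i<?m. walk_sum (Inl ` R) (Inr ` C) y (2 * n) (Inl (pick R i)) (Inl (pick R i)))"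
      by (rule sum.reindex_bij_betw[OF bij_betw_pick[OF R(1)], symmetric])
    also have "\<dots> = mtrace (?H ^\<^sub>m n)"
      unfolding mtrace_def using gram_pow_eq_mp[OF R(1) C(1) y A_def] pow_carrier_mat[OF Hc, of n] by auto
    also have "\<dots> = (\<Sum>a\<leftarrow>es. (2 * h * a + s) ^ n)" by (rule mtrace_pow_affine[OF Wc es Hc Hi])
    finally show ?thesis .
  qed
  let ?q = "chebT (s / h) k"
  have "(\<Sum>n\<le>k. coeff ?q n / h ^ n * (\<Sum>a\<leftarrow>es. (2 * h * a + s) ^ n)) =
      (\<Sum>a\<leftarrow>es. \<Sum>n\<le>k. coeff ?q n * ((2 * h * a + s) / h) ^ n)"
    by (induction es) (simp_all add: sum.distrib distrib_left power_divide)
  also have "\<dots> = (\<Sum>a\<leftarrow>es. poly (chebyshev_T k) a)"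
  proof (intro arg_cong[of _ _ sum_list] map_cong refl)
    fix a
    have "(\<Sum>n\<le>k. coeff ?q n * ((2 * h * a + s) / h) ^ n) = poly ?q ((2 * h * a + s) / h)"
      unfolding poly_altdef by (rule sum.mono_neutral_right) (use degree_chebT[of "s / h" k] in \<open>auto simp: coeff_eq_0\<close>)
    also have "\<dots> = poly (chebyshev_T k) a"
      unfolding chebT_def poly_pcompose using h0 by (intro arg_cong[of _ _ "poly (chebyshev_T k)"]) (simp add: field_simps)
    finally show "(\<Sum>n\<le>k. coeff ?q n * ((2 * h * a + s) / h) ^ n) = poly (chebyshev_T k) a" .
  qed
  also have "\<dots> = lin_stat (poly (chebyshev_T k)) W" by (rule lin_stat_eq_sum_list[OF Wc es, symmetric])
  finally show ?thesis unfolding tr s_def W_def A_def by simp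
qed

subsection \<open>Covariances of cycle sums\<close>

text \<open>The disjointness fixes the side of each vertex: one that lies in \<open>S\<close> and in
  \<open>S' \<union> T'\<close> must lie in \<open>S'\<close>.\<close>

lemma paths_Int:
  assumes w: "w \<in> paths S T L" and s: "set w \<subseteq> S' \<union> T'" and d: "(S \<union> S') \<inter> (T \<union> T') = {}"
  shows "w \<in> paths (S \<inter> S') (T \<inter> T') L"
proof -
  have "w ! i \<in> (if even i then S \<inter> S' else T \<inter> T')" if i: "i \<le> L" for i
  proof -
    have "w ! i \<in> S' \<union> T'" using subsetD[OF s nth_mem[of i w]] i length_paths[OF w] by simp
    then show ?thesis using nth_paths[OF w i] d by (auto split: if_splits)
  qed
  then show ?thesis using length_paths[OF w] by (simp add: paths_iff)
qed

lemma simple_walks_1: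
  assumes "S \<inter> T = {}"
  shows "simple_walks S T 1 = (\<lambda>(u, v). [u, v, u]) ` (S \<times> T)" "cwalks S T 1 = (\<lambda>(u, v). [u, v, u]) ` (S \<times> T)"
proof -
  have c: "cwalks S T 1 = (\<lambda>(u, v). [u, v, u]) ` (S \<times> T)"
    unfolding cwalks_def by (auto simp: numeral_2_eq_2)
  then show "cwalks S T 1 = (\<lambda>(u, v). [u, v, u]) ` (S \<times> T)" .
  show "simple_walks S T 1 = (\<lambda>(u, v). [u, v, u]) ` (S \<times> T)"
    unfolding simple_walks_def c using assms by auto
qed

text \<open>The centered contribution of one entry. A cycle of length 2 passes its only edge twice
  and contributes a square, recentered by \<open>m 2 = 1\<close>; longer cycles pass each edge
  once.\<close>

definition cycle_poly :: "nat \<Rightarrow> real poly" where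
  "cycle_poly k = (if k = 1 then [:-1, 0, 1:] else [:0, 1:])"

text \<open>The second moment of \<open>cycle_term\<close>: the variance of a squared entry for
  \<open>k = 1\<close>, and a product of second moments 1 otherwise.\<close>

definition cycle_var :: "(nat \<Rightarrow> real) \<Rightarrow> nat \<Rightarrow> real" where
  "cycle_var m k = (if k = 1 then m 4 - 1 else 1)"

definition cycle_term :: "('v set \<Rightarrow> 'a \<Rightarrow> real) \<Rightarrow> nat \<Rightarrow> 'v list \<Rightarrow> 'a \<Rightarrow> real" where
  "cycle_term Xe k w \<omega> = (\<Prod>e\<in>set (path_edges w). poly (cycle_poly k) (Xe e \<omega>))"

definition cycle_sum :: "('v set \<Rightarrow> 'a \<Rightarrow> real) \<Rightarrow> 'v set \<Rightarrow> 'v set \<Rightarrow> nat \<Rightarrow> 'a \<Rightarrow> real" where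
  "cycle_sum Xe S T k \<omega> = (\<Sum>w\<in>simple_walks S T k. cycle_term Xe k w \<omega>)"

lemma poly_mom_cycle_poly: "moments m \<Longrightarrow> poly_mom m (cycle_poly k) = 0"
  unfolding moments_def cycle_poly_def poly_mom_def by (simp add: numeral_2_eq_2)

lemma poly_mom_cycle_poly_square: "moments m \<Longrightarrow> poly_mom m (cycle_poly k * cycle_poly k) = cycle_var m k"
  unfolding moments_def cycle_poly_def cycle_var_def poly_mom_def by (simp add: eval_nat_numeral)

lemma simple_walk_edges:
  assumes w: "w \<in> simple_walks S T k" and k: "k \<ge> 1"
  shows "\<Union> (set (path_edges w)) = set w" "set (path_edges w) \<subseteq> bip_edges S T" "set (path_edges w) \<noteq> {}"
proof -
  have c: "w \<in> cwalks S T k" using w by (simp add: simple_walks_def)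
  note D = cwalksD[OF c]
  show 1: "\<Union> (set (path_edges w)) = set w" using D(3) k by (intro Union_path_edges) simp
  show "set (path_edges w) \<subseteq> bip_edges S T" by (rule path_edges_bip[OF D(1)])
  show "set (path_edges w) \<noteq> {}" using D(6) k by (cases "path_edges w") auto
qed

lemma
  fixes Xe :: "'v set \<Rightarrow> 'a \<Rightarrow> real"
  assumes iid: "iid_array M Xe I m"
    and w: "w \<in> simple_walks S T k" and k: "k \<ge> 1" and I: "bip_edges S T \<subseteq> I"
  shows integrable_cycle_term: "integrable M (cycle_term Xe k w)"
    and expectation_cycle_term: "(\<integral>\<omega>. cycle_term Xe k w \<omega> \<partial>M) = 0"
proof -
  interpret iid_array M Xe I m by fact
  note E = simple_walk_edges[OF w k]
  have e: "set (path_edges w) \<subseteq> I" using E I by blast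
  show "integrable M (cycle_term Xe k w)"
    unfolding cycle_term_def[abs_def] by (rule integrable_prod_poly[OF finite_set e])
  show "(\<integral>\<omega>. cycle_term Xe k w \<omega> \<partial>M) = 0"
    unfolding cycle_term_def expectation_prod_poly[OF finite_set e] poly_mom_cycle_poly[OF moments_axioms]
    using E(3) by (simp add: card_gt_0_iff)
qed

text \<open>If the edge sets differ, some entry occurs in one of the products only and has mean zero
  there. Equal edge sets force equal vertex sets and thus equal lengths.\<close>

lemma
  fixes Xe :: "'v set \<Rightarrow> 'a \<Rightarrow> real"
  assumes iid: "iid_array M Xe I m"
    and w: "w \<in> simple_walks S T k" and w': "w' \<in> simple_walks S' T' l" and k: "k \<ge> 1" "l \<ge> 1"
    and I: "bip_edges S T \<subseteq> I" "bip_edges S' T' \<subseteq> I" and disj: "S \<inter> T = {}"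
  shows integrable_cycle_term2: "integrable M (\<lambda>\<omega>. cycle_term Xe k w \<omega> * cycle_term Xe l w' \<omega>)"
    and expectation_cycle_term2: "(\<integral>\<omega>. cycle_term Xe k w \<omega> * cycle_term Xe l w' \<omega> \<partial>M) =
      (if k = l \<and> set (path_edges w) = set (path_edges w') then cycle_var m k else 0)"
proof -
  interpret iid_array M Xe I m by fact
  define E E' where "E = set (path_edges w)" and "E' = set (path_edges w')"
  have E: "\<Union> E = set w" "E \<subseteq> I" "E \<noteq> {}" and E': "\<Union> E' = set w'" "E' \<subseteq> I"
    using simple_walk_edges[OF w k(1)] simple_walk_edges[OF w' k(2)] I unfolding E_def E'_def by blast+
  have fin: "finite E" "finite E'" unfolding E_def E'_def by auto
  define q where "q e = (if e \<in> E then cycle_poly k else 1) * (if e \<in> E' then cycle_poly l else 1)" for e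
  have eq: "cycle_term Xe k w \<omega> * cycle_term Xe l w' \<omega> = (\<Prod>e\<in>E \<union> E'. poly (q e) (Xe e \<omega>))" for \<omega>
  proof -
    have "cycle_term Xe k w \<omega> = (\<Prod>e\<in>E \<union> E'. poly (if e \<in> E then cycle_poly k else 1) (Xe e \<omega>))"
      unfolding cycle_term_def E_def[symmetric] using fin by (intro prod.mono_neutral_cong_left) auto
    moreover have "cycle_term Xe l w' \<omega> = (\<Prod>e\<in>E \<union> E'. poly (if e \<in> E' then cycle_poly l else 1) (Xe e \<omega>))"
      unfolding cycle_term_def E'_def[symmetric] using fin by (intro prod.mono_neutral_cong_left) auto
    ultimately show ?thesis unfolding q_def poly_mult prod.distrib by simp
  qed
  have F: "finite (E \<union> E')" "E \<union> E' \<subseteq> I" using fin E E' by auto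
  show "integrable M (\<lambda>\<omega>. cycle_term Xe k w \<omega> * cycle_term Xe l w' \<omega>)"
    unfolding eq by (rule integrable_prod_poly[OF F])
  have ex: "(\<integral>\<omega>. cycle_term Xe k w \<omega> * cycle_term Xe l w' \<omega> \<partial>M) = (\<Prod>e\<in>E \<union> E'. poly_mom m (q e))"
    unfolding eq by (rule expectation_prod_poly[OF F])
  show "(\<integral>\<omega>. cycle_term Xe k w \<omega> * cycle_term Xe l w' \<omega> \<partial>M) =
      (if k = l \<and> set (path_edges w) = set (path_edges w') then cycle_var m k else 0)"
  proof (cases "E = E'")
    case False
    then obtain e where e: "e \<in> E \<union> E'" "\<not> (e \<in> E \<and> e \<in> E')" by auto
    then have "poly_mom m (q e) = 0" unfolding q_def using poly_mom_cycle_poly[OF moments_axioms] by auto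
    then have "(\<Prod>e\<in>E \<union> E'. poly_mom m (q e)) = 0" using F(1) e(1) by (intro prod_zero) auto
    then show ?thesis using ex False by (simp add: E_def E'_def)
  next
    case True
    then have "set w = set w'" using E E' by simp
    then have kl: "k = l" using card_set_simple_walk[OF w k(1)] card_set_simple_walk[OF w' k(2)] by simp
    have "(\<Prod>e\<in>E \<union> E'. poly_mom m (q e)) = (\<Prod>e\<in>E. cycle_var m k)"
      using True kl poly_mom_cycle_poly_square[OF moments_axioms] by (intro prod.cong) (auto simp: q_def)
    also have "\<dots> = cycle_var m k"
    proof (cases "k = 1")
      case True
      then obtain u v where "w = [u, v, u]" using w simple_walks_1(1)[OF disj] by auto
      then have "E = {{u, v}}" unfolding E_def by (auto simp: insert_commute)
      then show ?thesis by simp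
    qed (simp add: cycle_var_def)
    finally show ?thesis using ex True kl by (simp add: E_def E'_def)
  qed
qed

text \<open>Cycles with the same edges have the same vertices, and these belong to both
  submatrices.\<close>

lemma same_edge_pairs_Int:
  assumes fin: "finite S" "finite T" "finite S'" "finite T'" and d: "(S \<union> S') \<inter> (T \<union> T') = {}" and k: "k \<ge> 1"
  shows "(\<Sum>w\<in>simple_walks S T k. \<Sum>w'\<in>simple_walks S' T' k.
     if set (path_edges w) = set (path_edges w') then 1 else 0) = same_edge_pairs (S \<inter> S') (T \<inter> T') k"
proof -
  let ?D = "simple_walks (S \<inter> S') (T \<inter> T') k"
  let ?f = "\<lambda>w w'. if set (path_edges w) = set (path_edges w') then 1 else 0 :: real"
  have sub: "?D \<subseteq> simple_walks S T k" "?D \<subseteq> simple_walks S' T' k"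
    unfolding simple_walks_def cwalks_def
    using paths_mono[of "S \<inter> S'" S "T \<inter> T'" T] paths_mono[of "S \<inter> S'" S' "T \<inter> T'" T'] by blast+
  have D: "w \<in> ?D \<and> w' \<in> ?D" if w: "w \<in> simple_walks S T k" "w' \<in> simple_walks S' T' k"
    and e: "set (path_edges w) = set (path_edges w')" for w w'
  proof -
    have ww: "set w = set w'"
      using simple_walk_edges(1)[OF w(1) k] simple_walk_edges(1)[OF w(2) k] e by simp
    have c: "w \<in> cwalks S T k" "w' \<in> cwalks S' T' k" using w by (auto simp: simple_walks_def)
    have "w \<in> paths (S \<inter> S') (T \<inter> T') (2 * k)"
      by (rule paths_Int[OF cwalksD(1)[OF c(1)]]) (use cwalksD(5)[OF c(2)] ww d in auto)
    moreover have "w' \<in> paths (S' \<inter> S) (T' \<inter> T) (2 * k)"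
      by (rule paths_Int[OF cwalksD(1)[OF c(2)]]) (use cwalksD(5)[OF c(1)] ww d in auto)
    ultimately show ?thesis using w unfolding simple_walks_def cwalks_def by (simp add: Int_commute)
  qed
  have "(\<Sum>w\<in>simple_walks S T k. \<Sum>w'\<in>simple_walks S' T' k. ?f w w') = (\<Sum>w\<in>simple_walks S T k. \<Sum>w'\<in>?D. ?f w w')"
    by (intro sum.cong refl sum.mono_neutral_right ballI) (use fin sub D in auto)
  also have "\<dots> = (\<Sum>w\<in>?D. \<Sum>w'\<in>?D. ?f w w')"
    by (intro sum.mono_neutral_right ballI sum.neutral) (use fin sub D in auto)
  finally show ?thesis unfolding same_edge_pairs_def .
qed

lemma
  fixes Xe :: "'v set \<Rightarrow> 'a \<Rightarrow> real"
  assumes iid: "iid_array M Xe I m" and k: "k \<ge> 1" "l \<ge> 1"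
    and fin: "finite S" "finite T" "finite S'" "finite T'" and d: "(S \<union> S') \<inter> (T \<union> T') = {}"
    and I: "bip_edges S T \<subseteq> I" "bip_edges S' T' \<subseteq> I"
  shows integrable_cycle_sum: "integrable M (cycle_sum Xe S T k)"
    and expectation_cycle_sum: "(\<integral>\<omega>. cycle_sum Xe S T k \<omega> \<partial>M) = 0"
    and integrable_cycle_sum2: "integrable M (\<lambda>\<omega>. cycle_sum Xe S T k \<omega> * cycle_sum Xe S' T' l \<omega>)"
    and expectation_cycle_sum2: "(\<integral>\<omega>. cycle_sum Xe S T k \<omega> * cycle_sum Xe S' T' l \<omega> \<partial>M) =
      (if k = l then cycle_var m k * same_edge_pairs (S \<inter> S') (T \<inter> T') k else 0)"
proof -
  have disj: "S \<inter> T = {}" using d by auto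
  note t1 = integrable_cycle_term[OF iid _ k(1) I(1)] expectation_cycle_term[OF iid _ k(1) I(1)]
  note t2 = integrable_cycle_term2[OF iid _ _ k I disj] expectation_cycle_term2[OF iid _ _ k I disj]
  show "integrable M (cycle_sum Xe S T k)"
    unfolding cycle_sum_def[abs_def] by (intro Bochner_Integration.integrable_sum t1)
  show "(\<integral>\<omega>. cycle_sum Xe S T k \<omega> \<partial>M) = 0"
    unfolding cycle_sum_def by (subst Bochner_Integration.integral_sum) (use t1 in \<open>auto intro: sum.neutral\<close>)
  have eq: "cycle_sum Xe S T k \<omega> * cycle_sum Xe S' T' l \<omega> =
     (\<Sum>w\<in>simple_walks S T k. \<Sum>w'\<in>simple_walks S' T' l. cycle_term Xe k w \<omega> * cycle_term Xe l w' \<omega>)" for \<omega>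
    unfolding cycle_sum_def sum_product ..
  show "integrable M (\<lambda>\<omega>. cycle_sum Xe S T k \<omega> * cycle_sum Xe S' T' l \<omega>)"
    unfolding eq by (intro Bochner_Integration.integrable_sum t2)
  have "(\<integral>\<omega>. cycle_sum Xe S T k \<omega> * cycle_sum Xe S' T' l \<omega> \<partial>M) =
     (\<Sum>w\<in>simple_walks S T k. \<integral>\<omega>. (\<Sum>w'\<in>simple_walks S' T' l. cycle_term Xe k w \<omega> * cycle_term Xe l w' \<omega>) \<partial>M)"
    unfolding eq by (intro Bochner_Integration.integral_sum Bochner_Integration.integrable_sum t2(1))
  also have "\<dots> = (\<Sum>w\<in>simple_walks S T k. \<Sum>w'\<in>simple_walks S' T' l. \<integral>\<omega>. cycle_term Xe k w \<omega> * cycle_term Xe l w' \<omega> \<partial>M)"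
    by (intro sum.cong refl Bochner_Integration.integral_sum t2(1))
  also have "\<dots> = (\<Sum>w\<in>simple_walks S T k. \<Sum>w'\<in>simple_walks S' T' l.
      if k = l \<and> set (path_edges w) = set (path_edges w') then cycle_var m k else 0)"
    by (intro sum.cong refl t2(2))
  also have "\<dots> = (if k = l then cycle_var m k * same_edge_pairs (S \<inter> S') (T \<inter> T') k else 0)"
  proof (cases "k = l")
    case True
    have "(\<Sum>w\<in>simple_walks S T k. \<Sum>w'\<in>simple_walks S' T' l.
        if k = l \<and> set (path_edges w) = set (path_edges w') then cycle_var m k else 0) =
      cycle_var m k * (\<Sum>w\<in>simple_walks S T k. \<Sum>w'\<in>simple_walks S' T' k.
        if set (path_edges w) = set (path_edges w') then 1 else 0)"
      unfolding sum_distrib_left True by (intro sum.cong refl) simp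
    then show ?thesis unfolding same_edge_pairs_Int[OF fin d k(1)] using True by simp
  qed simp
  finally show "(\<integral>\<omega>. cycle_sum Xe S T k \<omega> * cycle_sum Xe S' T' l \<omega> \<partial>M) =
      (if k = l then cycle_var m k * same_edge_pairs (S \<inter> S') (T \<inter> T') k else 0)" .
qed

lemma same_edge_pairs_1:
  assumes "finite S" "finite T" "S \<inter> T = {}"
  shows "same_edge_pairs S T 1 = real (card S) * real (card T)"
proof -
  let ?g = "\<lambda>(u, v). [u, v, u]"
  have inj: "inj_on ?g (S \<times> T)" by (auto simp: inj_on_def)
  have "same_edge_pairs S T 1 = (\<Sum>x\<in>S \<times> T. \<Sum>y\<in>S \<times> T. if set (path_edges (?g x)) = set (path_edges (?g y)) then 1 else 0)"
    unfolding same_edge_pairs_def simple_walks_1(1)[OF assms(3)] sum.reindex[OF inj] comp_def ..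
  also have "\<dots> = (\<Sum>x\<in>S \<times> T. \<Sum>y\<in>S \<times> T. if y = x then 1 else 0)"
    by (intro sum.cong refl if_cong) (use assms(3) in \<open>auto simp: insert_commute doubleton_eq_iff\<close>)
  also have "\<dots> = real (card S) * real (card T)" using assms by (simp add: card_cartesian_product)
  finally show ?thesis .
qed

text \<open>The number of rooted oriented cycles on given edges: \<open>k\<close> base points in
  \<open>S\<close> and two directions. For \<open>k = 1\<close> the walk u, v, u is the only
  one.\<close>

definition cycle_mult :: "nat \<Rightarrow> real" where
  "cycle_mult k = (if k = 1 then 1 else 2 * real k)"

context sizes
begin

lemma same_edge_pairs_limit:
  assumes k: "k \<ge> 1"
  shows "(\<lambda>N. same_edge_pairs (S N) (T N) k / h N ^ (2 * k)) \<longlonglongrightarrow> cycle_mult k"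
proof (cases "k = 1")
  case True
  have "same_edge_pairs (S N) (T N) k / h N ^ (2 * k) = 1" for N
  proof -
    have "same_edge_pairs (S N) (T N) k = h N ^ 2"
      unfolding True h_square by (rule same_edge_pairs_1[OF finS finT disj])
    then show ?thesis using True h_pos[of N] by simp
  qed
  then have "(\<lambda>N. same_edge_pairs (S N) (T N) k / h N ^ (2 * k)) = (\<lambda>_. 1)" by (rule ext)
  then show ?thesis using True by (simp add: cycle_mult_def)
next
  case False
  then have "k \<ge> 2" using k by simp
  from same_edges_limit[OF this] False show ?thesis by (simp add: cycle_mult_def)
qed

definition cheb_walks :: "('v set \<Rightarrow> 'a \<Rightarrow> real) \<Rightarrow> nat \<Rightarrow> nat \<Rightarrow> 'a \<Rightarrow> real" where
  "cheb_walks Xe k N \<omega> = (\<Sum>n\<le>k. cf k N n * (\<Sum>w\<in>cwalks (S N) (T N) n. list_prod (\<lambda>e. Xe e \<omega>) (path_edges w)))"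

text \<open>Tr H is the sum of the squared entries, and each square is 1 plus the term of its
  cycle.\<close>

lemma cheb_walks_1:
  fixes Xe :: "'v set \<Rightarrow> 'a \<Rightarrow> real"
  shows "\<exists>c. \<forall>\<omega>. cheb_walks Xe 1 N \<omega> = c + cf 1 N 1 * cycle_sum Xe (S N) (T N) 1 \<omega>"
proof -
  let ?g = "\<lambda>(u, v). [u, v, u]"
  have inj: "inj_on ?g (S N \<times> T N)" by (auto simp: inj_on_def)
  define c where "c = cf 1 N 0 * real (card (cwalks (S N) (T N) 0)) + cf 1 N 1 * real (card (S N \<times> T N))"
  have "cheb_walks Xe 1 N \<omega> = c + cf 1 N 1 * cycle_sum Xe (S N) (T N) 1 \<omega>" for \<omega>
  proof -
    have "(\<Sum>w\<in>cwalks (S N) (T N) 0. list_prod (\<lambda>e. Xe e \<omega>) (path_edges w)) = (\<Sum>w\<in>cwalks (S N) (T N) 0. 1)"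
      by (intro sum.cong refl) (auto simp: cwalks_def list_prod_def)
    moreover have "(\<Sum>w\<in>cwalks (S N) (T N) 1. list_prod (\<lambda>e. Xe e \<omega>) (path_edges w)) =
        (\<Sum>x\<in>S N \<times> T N. 1 + cycle_term Xe 1 (?g x) \<omega>)"
      unfolding simple_walks_1(2)[OF disj] sum.reindex[OF inj] comp_def
      by (intro sum.cong refl) (auto simp: cycle_term_def cycle_poly_def list_prod_def insert_commute)
    moreover have "(\<Sum>x\<in>S N \<times> T N. cycle_term Xe 1 (?g x) \<omega>) = cycle_sum Xe (S N) (T N) 1 \<omega>"
      unfolding cycle_sum_def simple_walks_1(1)[OF disj] sum.reindex[OF inj] comp_def ..
    ultimately show ?thesis unfolding cheb_walks_def c_def by (simp add: sum.distrib algebra_simps)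
  qed
  then show ?thesis by blast
qed

text \<open>For \<open>k = 1\<close> the difference is identically 0 by \<open>cheb_walks_1\<close>.
  For \<open>k \<ge> 2\<close> the edges of a cycle are distinct, so that the product over the edge
  set is the product along the walk.\<close>

lemma reduction_to_cycle_sum:
  fixes Xe :: "'v set \<Rightarrow> 'a \<Rightarrow> real"
  assumes iid: "iid_array M Xe I m" and I: "\<And>N. bip_edges (S N) (T N) \<subseteq> I" and k: "k \<ge> 1"
  shows "(\<lambda>N. \<integral>\<omega>. (cheb_walks Xe k N \<omega> - (\<integral>\<omega>. cheb_walks Xe k N \<omega> \<partial>M) -
     cf k N k * cycle_sum Xe (S N) (T N) k \<omega>)\<^sup>2 \<partial>M) \<longlonglongrightarrow> 0"
proof (cases "k = 1")
  case True
  interpret iid_array M Xe I m by fact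
  have "cheb_walks Xe k N \<omega> - (\<integral>\<omega>. cheb_walks Xe k N \<omega> \<partial>M) - cf k N k * cycle_sum Xe (S N) (T N) k \<omega> = 0" for N \<omega>
  proof -
    obtain c where c: "cheb_walks Xe k N \<omega> = c + cf k N k * cycle_sum Xe (S N) (T N) k \<omega>" for \<omega>
      using cheb_walks_1[of Xe N] True by blast
    have d: "(S N \<union> S N) \<inter> (T N \<union> T N) = {}" using disj by simp
    note Y = integrable_cycle_sum[OF iid k k finS finT finS finT d I I] expectation_cycle_sum[OF iid k k finS finT finS finT d I I]
    show ?thesis unfolding c using Y by (simp add: prob_space)
  qed
  then show ?thesis by simp
next
  case False
  then have k2: "k \<ge> 2" using k by simp
  have "cycle_sum Xe (S N) (T N) k \<omega> = (\<Sum>w\<in>simple_walks (S N) (T N) k. list_prod (\<lambda>e. Xe e \<omega>) (path_edges w))" for N \<omega>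
    unfolding cycle_sum_def
  proof (intro sum.cong refl)
    fix w assume "w \<in> simple_walks (S N) (T N) k"
    then have "distinct (path_edges w)" by (rule distinct_path_edges[OF _ k2 disj])
    then show "cycle_term Xe k w \<omega> = list_prod (\<lambda>e. Xe e \<omega>) (path_edges w)"
      using False unfolding cycle_term_def cycle_poly_def list_prod_def by (simp add: prod.distinct_set_conv_list)
  qed
  then show ?thesis using reduction_to_cycles[OF iid I k2] unfolding cheb_walks_def by simp
qed

lemma integrable_cheb_walks:
  fixes Xe :: "'v set \<Rightarrow> 'a \<Rightarrow> real"
  assumes iid: "iid_array M Xe I m" and I: "\<And>N. bip_edges (S N) (T N) \<subseteq> I"
  shows "integrable M (cheb_walks Xe k N)" "integrable M (\<lambda>\<omega>. (cheb_walks Xe k N \<omega>)\<^sup>2)"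
proof -
  interpret iid_array M Xe I m by fact
  define W where "W = (SIGMA n:{..k}. cwalks (S N) (T N) n)"
  have eq: "cheb_walks Xe k N \<omega> = (\<Sum>c\<in>W. cf k N (fst c) * list_prod (\<lambda>e. Xe e \<omega>) (path_edges (snd c)))" for \<omega>
    unfolding cheb_walks_def W_def sum_distrib_left
    by (subst sum.Sigma) (auto simp: finite_cwalks finS finT case_prod_unfold)
  have W: "finite W" unfolding W_def by (auto simp: finite_cwalks finS finT)
  have l: "set (path_edges (snd c)) \<subseteq> I" if "c \<in> W" for c
    using path_edges_bip[OF cwalksD(1), of "snd c" "S N" "T N" "fst c"] that
    by (intro order_trans[OF _ I[of N]]) (auto simp: W_def)
  show "integrable M (cheb_walks Xe k N)" unfolding eq[abs_def] by (rule integrable_sum_list_prod[OF W l])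
  show "integrable M (\<lambda>\<omega>. (cheb_walks Xe k N \<omega>)\<^sup>2)"
    unfolding eq power2_eq_square by (rule integrable_sum_list_prod2[OF W l W l])
qed

end

subsection \<open>Joint limit of the cycle sums\<close>

text \<open>The pairs of coinciding cycles come from the common submatrix and have the order
  \<open>hD^(2 * k)\<close>; the normalization \<open>4 * hA^k * hB^k\<close> leaves the power
  \<open>k\<close> of the ratio that tends to \<gamma>.\<close>

lemma cycle_covariance_limit:
  fixes Xe :: "'v set \<Rightarrow> 'a \<Rightarrow> real"
  assumes iid: "iid_array M Xe I m" and k: "k \<ge> 1" "l \<ge> 1"
    and A: "sizes SA TA hA \<alpha> \<beta>" and B: "sizes SB TB hB \<alpha>' \<beta>'"
    and D: "sizes (\<lambda>N. SA N \<inter> SB N) (\<lambda>N. TA N \<inter> TB N) hD \<alpha>'' \<beta>''"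
    and disj: "\<And>N. (SA N \<union> SB N) \<inter> (TA N \<union> TB N) = {}"
    and I: "\<And>N. bip_edges (SA N) (TA N) \<subseteq> I" "\<And>N. bip_edges (SB N) (TB N) \<subseteq> I"
    and \<gamma>: "(\<lambda>N. hD N ^ 2 / (hA N * hB N)) \<longlonglongrightarrow> \<gamma>"
  shows "(\<lambda>N. 1 / (2 * hA N ^ k) * (1 / (2 * hB N ^ l)) *
      (\<integral>\<omega>. cycle_sum Xe (SA N) (TA N) k \<omega> * cycle_sum Xe (SB N) (TB N) l \<omega> \<partial>M)) \<longlonglongrightarrow>
    (if k = l then cycle_var m k * cycle_mult k / 4 * \<gamma> ^ k else 0)"
proof -
  interpret A: sizes SA TA hA \<alpha> \<beta> by fact
  interpret B: sizes SB TB hB \<alpha>' \<beta>' by fact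
  interpret D: sizes "\<lambda>N. SA N \<inter> SB N" "\<lambda>N. TA N \<inter> TB N" hD \<alpha>'' \<beta>'' by fact
  note ex = expectation_cycle_sum2[OF iid k A.finS A.finT B.finS B.finT disj I]
  show ?thesis
  proof (cases "k = l")
    case False then show ?thesis unfolding ex by simp
  next
    case True
    have e: "1 / (2 * hA N ^ k) * (1 / (2 * hB N ^ l)) * (cycle_var m k * P) =
       cycle_var m k / 4 * (P / hD N ^ (2 * k)) * (hD N ^ 2 / (hA N * hB N)) ^ k" for P :: real and N
      using A.h_pos[of N] B.h_pos[of N] D.h_pos[of N] True
      by (simp add: power_divide power_mult_distrib power_mult[symmetric])
    have "(\<lambda>N. cycle_var m k / 4 * (same_edge_pairs (SA N \<inter> SB N) (TA N \<inter> TB N) k / hD N ^ (2 * k)) *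
        (hD N ^ 2 / (hA N * hB N)) ^ k) \<longlonglongrightarrow> cycle_var m k / 4 * cycle_mult k * \<gamma> ^ k"
      by (intro tendsto_mult tendsto_const D.same_edge_pairs_limit tendsto_power \<gamma> k)
    then have "(\<lambda>N. 1 / (2 * hA N ^ k) * (1 / (2 * hB N ^ l)) * (cycle_var m k * same_edge_pairs (SA N \<inter> SB N) (TA N \<inter> TB N) k))
        \<longlonglongrightarrow> cycle_var m k / 4 * cycle_mult k * \<gamma> ^ k" unfolding e .
    then show ?thesis unfolding ex using True by simp
  qed
qed

text \<open>The error in Wick's recursion is of the order \<open>1 / hA\<close>: the weights absorb
  the powers of the number of vertices, which is at most a multiple of both \<open>hA\<close> and
  \<open>hB\<close>.\<close>

lemma cycle_sums_gauss_moments: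
  fixes Xe :: "'v set \<Rightarrow> 'a \<Rightarrow> real" and s u c :: real
  assumes iid: "iid_array M Xe I m" and k: "k \<ge> 1" "l \<ge> 1"
    and A: "sizes SA TA hA \<alpha> \<beta>" and B: "sizes SB TB hB \<alpha>' \<beta>'"
    and D: "sizes (\<lambda>N. SA N \<inter> SB N) (\<lambda>N. TA N \<inter> TB N) hD \<alpha>'' \<beta>''"
    and disj: "\<And>N. (SA N \<union> SB N) \<inter> (TA N \<union> TB N) = {}"
    and I: "\<And>N. bip_edges (SA N) (TA N) \<subseteq> I" "\<And>N. bip_edges (SB N) (TB N) \<subseteq> I"
    and \<gamma>: "(\<lambda>N. hD N ^ 2 / (hA N * hB N)) \<longlonglongrightarrow> \<gamma>"
    and c: "\<And>N. real (card (SA N \<union> TA N \<union> SB N \<union> TB N)) \<le> c * hA N" "\<And>N. real (card (SA N \<union> TA N \<union> SB N \<union> TB N)) \<le> c * hB N"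
  defines "L \<equiv> \<lambda>N \<omega>. s / (2 * hA N ^ k) * cycle_sum Xe (SA N) (TA N) k \<omega> + u / (2 * hB N ^ l) * cycle_sum Xe (SB N) (TB N) l \<omega>"
  defines "v \<equiv> s\<^sup>2 * (cycle_var m k * cycle_mult k / 4) +
     2 * s * u * (if k = l then cycle_var m k * cycle_mult k / 4 * \<gamma> ^ k else 0) + u\<^sup>2 * (cycle_var m l * cycle_mult l / 4)"
  shows "integrable M (\<lambda>\<omega>. L N \<omega> ^ p)" "(\<lambda>N. \<integral>\<omega>. L N \<omega> ^ p \<partial>M) \<longlonglongrightarrow> gauss_moment v p"
proof -
  interpret iid_array M Xe I m by fact
  interpret A: sizes SA TA hA \<alpha> \<beta> by fact
  interpret B: sizes SB TB hB \<alpha>' \<beta>' by fact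
  define V where "V N = SA N \<union> TA N \<union> SB N \<union> TB N" for N
  have fV: "finite (V N)" for N unfolding V_def using A.finS A.finT B.finS B.finT by simp
  have hV: "hA N \<le> real (card (V N))" for N
  proof -
    have "card (SA N) \<le> card (V N)" "card (TA N) \<le> card (V N)"
      by (rule card_mono[OF fV], simp add: V_def sup.coboundedI1)+
    then have "(hA N)\<^sup>2 \<le> (real (card (V N)))\<^sup>2"
      unfolding A.h_square power2_eq_square[of "real (card (V N))"] by (intro mult_mono) auto
    then show ?thesis by (rule power2_le_imp_le) simp
  qed
  have c0: "c \<ge> 0"
  proof -
    have "0 < real (card (V 0))" using hV[of 0] A.h_pos[of 0] by linarith
    then have "0 < c * hA 0" using c(1)[of 0] unfolding V_def by linarith
    then show ?thesis using A.h_pos[of 0] by (simp add: zero_less_mult_iff)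
  qed
  \<comment> \<open>The tag \<open>True\<close> stands for the first matrix and \<open>False\<close>
    for the second.\<close>
  define sz tz :: "nat \<Rightarrow> bool \<Rightarrow> 'v set" where "sz N b = (if b then SA N else SB N)" and "tz N b = (if b then TA N else TB N)" for N b
  define kz :: "bool \<Rightarrow> nat" where "kz b = (if b then k else l)" for b
  define wz :: "nat \<Rightarrow> bool \<Rightarrow> real" where "wz N b = (if b then s / (2 * hA N ^ k) else u / (2 * hB N ^ l))" for N b
  have ok: "(\<forall>b. finite (sz N b) \<and> finite (tz N b) \<and> sz N b \<union> tz N b \<subseteq> V N \<and> bip_edges (sz N b) (tz N b) \<subseteq> I)" for N
    using A.finS A.finT B.finS B.finT I unfolding sz_def tz_def V_def by auto
  have L: "(\<Sum>q\<in>(SIGMA b:UNIV. simple_walks (sz N b) (tz N b) (kz b)). wz N (fst q) *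
         (\<Prod>e\<in>set (path_edges (snd q)). poly (cycle_poly (kz (fst q))) (Xe e \<omega>))) = L N \<omega>" for N \<omega>
  proof -
    have "(\<Sum>q\<in>(SIGMA b:UNIV. simple_walks (sz N b) (tz N b) (kz b)). wz N (fst q) *
         (\<Prod>e\<in>set (path_edges (snd q)). poly (cycle_poly (kz (fst q))) (Xe e \<omega>))) =
       (\<Sum>b\<in>UNIV. \<Sum>w\<in>simple_walks (sz N b) (tz N b) (kz b). wz N b * cycle_term Xe (kz b) w \<omega>)"
      unfolding cycle_term_def using ok[of N] by (subst sum.Sigma) (auto simp: case_prod_unfold)
    also have "\<dots> = L N \<omega>"
      unfolding UNIV_bool L_def cycle_sum_def by (simp add: sz_def tz_def kz_def wz_def sum_distrib_left)
    finally show ?thesis .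
  qed
  have kz1: "kz b \<ge> 1" for b using k by (simp add: kz_def)
  have g0: "poly_mom m (cycle_poly (kz b)) = 0" for b by (rule poly_mom_cycle_poly[OF moments_axioms])
  define gap where "gap N p = \<bar>(\<integral>x. L N x ^ p \<partial>M) - real (p - 1) * (\<integral>x. L N x ^ 2 \<partial>M) * (\<integral>x. L N x ^ (p - 2) \<partial>M)\<bar>" for N p
  have wick: "\<exists>C. C \<ge> 0 \<and> (\<forall>N. (\<forall>n. integrable M (\<lambda>x. L N x ^ n)) \<and>
       real (card (V N)) * gap N p \<le> C * (\<Sum>b\<in>UNIV. \<bar>wz N b\<bar> * real (card (V N)) ^ kz b) ^ p)" if p: "p \<ge> 2" for p
  proof -
    from wick_bound[OF iid p, of kz "\<lambda>b. cycle_poly (kz b)", OF kz1 g0] obtain C where C: "C \<ge> 0"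
      "\<forall>S T \<omega> V. (\<forall>b. finite (S b) \<and> finite (T b) \<and> S b \<union> T b \<subseteq> V \<and> bip_edges (S b) (T b) \<subseteq> I) \<longrightarrow> finite V \<longrightarrow>
      (let F = (\<lambda>x. \<Sum>c\<in>(SIGMA b:UNIV. simple_walks (S b) (T b) (kz b)). \<omega> (fst c) *
         (\<Prod>e\<in>set (path_edges (snd c)). poly (cycle_poly (kz (fst c))) (Xe e x)))
     in (\<forall>n. integrable M (\<lambda>x. F x ^ n)) \<and>
       real (card V) * \<bar>(\<integral>x. F x ^ p \<partial>M) - real (p - 1) * (\<integral>x. F x ^ 2 \<partial>M) * (\<integral>x. F x ^ (p - 2) \<partial>M)\<bar>
       \<le> C * (\<Sum>b\<in>UNIV. \<bar>\<omega> b\<bar> * real (card V) ^ kz b) ^ p)" by blast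
    show ?thesis
    proof (rule exI[of _ C], rule conjI[OF C(1)], rule allI)
      fix N
      show "(\<forall>n. integrable M (\<lambda>x. L N x ^ n)) \<and>
       real (card (V N)) * gap N p \<le> C * (\<Sum>b\<in>UNIV. \<bar>wz N b\<bar> * real (card (V N)) ^ kz b) ^ p"
        using C(2)[THEN spec[of _ "sz N"], THEN spec[of _ "tz N"], THEN spec[of _ "wz N"], THEN spec[of _ "V N"],
          THEN HOL.mp, OF ok, THEN HOL.mp, OF fV]
        unfolding Let_def L gap_def .
    qed
  qed
  have int: "integrable M (\<lambda>\<omega>. L N \<omega> ^ p)" for N p
    using wick[of 2] by auto
  then show "integrable M (\<lambda>\<omega>. L N \<omega> ^ p)" .
  show "(\<lambda>N. \<integral>\<omega>. L N \<omega> ^ p \<partial>M) \<longlonglongrightarrow> gauss_moment v p"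
  proof (rule tendsto_gauss_moments)
    show "(\<integral>\<omega>. L N \<omega> ^ 0 \<partial>M) = 1" for N by (simp add: prob_space)
    have dA: "(SA N \<union> SA N) \<inter> (TA N \<union> TA N) = {}" and dB: "(SB N \<union> SB N) \<inter> (TB N \<union> TB N) = {}" for N
      using A.disj[of N] B.disj[of N] by simp_all
    note mA = integrable_cycle_sum[OF iid k(1) k(1) A.finS A.finT A.finS A.finT dA I(1) I(1)]
      expectation_cycle_sum[OF iid k(1) k(1) A.finS A.finT A.finS A.finT dA I(1) I(1)]
      integrable_cycle_sum2[OF iid k(1) k(1) A.finS A.finT A.finS A.finT dA I(1) I(1)]
    note mB = integrable_cycle_sum[OF iid k(2) k(2) B.finS B.finT B.finS B.finT dB I(2) I(2)]
      expectation_cycle_sum[OF iid k(2) k(2) B.finS B.finT B.finS B.finT dB I(2) I(2)]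
      integrable_cycle_sum2[OF iid k(2) k(2) B.finS B.finT B.finS B.finT dB I(2) I(2)]
    note mAB = integrable_cycle_sum2[OF iid k A.finS A.finT B.finS B.finT disj I]
    show "(\<integral>\<omega>. L N \<omega> ^ 1 \<partial>M) = 0" for N
      unfolding L_def using mA mB by simp
    have L2: "(\<integral>\<omega>. L N \<omega> ^ 2 \<partial>M) =
       s\<^sup>2 * (1 / (2 * hA N ^ k) * (1 / (2 * hA N ^ k)) * (\<integral>\<omega>. cycle_sum Xe (SA N) (TA N) k \<omega> * cycle_sum Xe (SA N) (TA N) k \<omega> \<partial>M)) +
       2 * s * u * (1 / (2 * hA N ^ k) * (1 / (2 * hB N ^ l)) * (\<integral>\<omega>. cycle_sum Xe (SA N) (TA N) k \<omega> * cycle_sum Xe (SB N) (TB N) l \<omega> \<partial>M)) +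
       u\<^sup>2 * (1 / (2 * hB N ^ l) * (1 / (2 * hB N ^ l)) * (\<integral>\<omega>. cycle_sum Xe (SB N) (TB N) l \<omega> * cycle_sum Xe (SB N) (TB N) l \<omega> \<partial>M))" for N
    proof -
      define a b where "a = 1 / (2 * hA N ^ k)" and "b = 1 / (2 * hB N ^ l)"
      have "L N \<omega> ^ 2 = s\<^sup>2 * (a * a) * (cycle_sum Xe (SA N) (TA N) k \<omega> * cycle_sum Xe (SA N) (TA N) k \<omega>) +
        2 * s * u * (a * b) * (cycle_sum Xe (SA N) (TA N) k \<omega> * cycle_sum Xe (SB N) (TB N) l \<omega>) +
        u\<^sup>2 * (b * b) * (cycle_sum Xe (SB N) (TB N) l \<omega> * cycle_sum Xe (SB N) (TB N) l \<omega>)" for \<omega>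
      proof -
        have "L N \<omega> = s * a * cycle_sum Xe (SA N) (TA N) k \<omega> + u * b * cycle_sum Xe (SB N) (TB N) l \<omega>"
          unfolding L_def a_def b_def by simp
        then show ?thesis by (simp add: power2_eq_square algebra_simps)
      qed
      then show ?thesis unfolding a_def[symmetric] b_def[symmetric] using mA(3) mB(3) mAB by simp
    qed
    \<comment> \<open>A variance is treated as the covariance of a matrix with itself, where the
      overlap is the whole matrix and the ratio is 1.\<close>
    have DA: "sizes (\<lambda>N. SA N \<inter> SA N) (\<lambda>N. TA N \<inter> TA N) hA \<alpha> \<beta>" using A by simp
    have DB: "sizes (\<lambda>N. SB N \<inter> SB N) (\<lambda>N. TB N \<inter> TB N) hB \<alpha>' \<beta>'" using B by simp
    have gA: "(\<lambda>N. hA N ^ 2 / (hA N * hA N)) \<longlonglongrightarrow> 1" and gB: "(\<lambda>N. hB N ^ 2 / (hB N * hB N)) \<longlonglongrightarrow> 1"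
      using A.h_pos B.h_pos by (simp_all add: power2_eq_square less_imp_neq[symmetric])
    show "(\<lambda>N. \<integral>\<omega>. L N \<omega> ^ 2 \<partial>M) \<longlonglongrightarrow> v"
      unfolding L2 v_def
      using cycle_covariance_limit[OF iid k(1) k(1) A A DA dA I(1) I(1) gA]
        cycle_covariance_limit[OF iid k(2) k(2) B B DB dB I(2) I(2) gB]
        cycle_covariance_limit[OF iid k A B D disj I \<gamma>]
      by (intro tendsto_add tendsto_mult_left) simp_all
    fix p :: nat assume p: "p \<ge> 2"
    from wick[OF p] obtain C where C: "C \<ge> 0"
      "\<And>N. real (card (V N)) * gap N p \<le> C * (\<Sum>b\<in>UNIV. \<bar>wz N b\<bar> * real (card (V N)) ^ kz b) ^ p" by blast
    define K where "K = \<bar>s\<bar> / 2 * c ^ k + \<bar>u\<bar> / 2 * c ^ l"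
    have wzK: "(\<Sum>b\<in>UNIV. \<bar>wz N b\<bar> * real (card (V N)) ^ kz b) \<le> K" for N
    proof -
      have gen: "\<bar>a / (2 * H ^ n)\<bar> * real (card (V N)) ^ n \<le> \<bar>a\<bar> / 2 * c ^ n"
        if "real (card (V N)) \<le> c * H" "H > 0" for a H n
      proof -
        have "real (card (V N)) ^ n \<le> (c * H) ^ n" using that by (intro power_mono) auto
        then have "\<bar>a / (2 * H ^ n)\<bar> * real (card (V N)) ^ n \<le> \<bar>a / (2 * H ^ n)\<bar> * (c * H) ^ n" by (intro mult_left_mono) auto
        also have "\<dots> = \<bar>a\<bar> / 2 * c ^ n" using that(2) by (simp add: power_mult_distrib abs_mult)
        finally show ?thesis .
      qed
      have "(\<Sum>b\<in>UNIV. \<bar>wz N b\<bar> * real (card (V N)) ^ kz b) =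
          \<bar>s / (2 * hA N ^ k)\<bar> * real (card (V N)) ^ k + \<bar>u / (2 * hB N ^ l)\<bar> * real (card (V N)) ^ l"
        by (simp add: UNIV_bool wz_def kz_def)
      then show ?thesis unfolding K_def
        using gen[OF c(1)[of N, folded V_def] A.h_pos, of s k] gen[OF c(2)[of N, folded V_def] B.h_pos, of u l]
        by linarith
    qed
    have bd: "norm (gap N p) \<le> (C * K ^ p) * (1 / hA N)" for N
    proof -
      have g: "norm (gap N p) = gap N p" by (simp add: gap_def)
      have "hA N * gap N p \<le> real (card (V N)) * gap N p" using hV by (rule mult_right_mono) (simp add: gap_def)
      also have "\<dots> \<le> C * (\<Sum>b\<in>UNIV. \<bar>wz N b\<bar> * real (card (V N)) ^ kz b) ^ p" by (rule C(2))
      also have "\<dots> \<le> C * K ^ p" using wzK C(1) by (intro mult_left_mono power_mono sum_nonneg) auto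
      finally show ?thesis unfolding g using A.h_pos[of N] by (simp add: pos_le_divide_eq mult.commute)
    qed
    have "(\<lambda>N. (C * K ^ p) * (1 / hA N)) \<longlonglongrightarrow> (C * K ^ p) * 0" by (intro tendsto_mult_left A.h_inverse)
    then have "(\<lambda>N. (C * K ^ p) * (1 / hA N)) \<longlonglongrightarrow> 0" by simp
    then show "(\<lambda>N. (\<integral>x. L N x ^ p \<partial>M) - real (p - 1) * (\<integral>x. L N x ^ 2 \<partial>M) * (\<integral>x. L N x ^ (p - 2) \<partial>M)) \<longlonglongrightarrow> 0"
    proof -
      assume "(\<lambda>N. (C * K ^ p) * (1 / hA N)) \<longlonglongrightarrow> 0"
      then have "(\<lambda>N. gap N p) \<longlonglongrightarrow> 0" by (rule Lim_null_comparison[OF always_eventually[OF allI[OF bd]]])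
      then show ?thesis unfolding gap_def tendsto_rabs_zero_iff .
    qed
  qed
qed

text \<open>The map \<open>iexp\<close> is Lipschitz with constant 1, so that the characteristic
  functions differ by at most the L1 distance and hence by at most the L2 distance.\<close>

lemma char_transfer:
  fixes f g :: "nat \<Rightarrow> 'a \<Rightarrow> real"
  assumes "prob_space M" and [measurable]: "\<And>N. f N \<in> borel_measurable M" "\<And>N. g N \<in> borel_measurable M"
    and int: "\<And>N. integrable M (\<lambda>\<omega>. (f N \<omega> - g N \<omega>)\<^sup>2)"
    and lim: "(\<lambda>N. \<integral>\<omega>. (f N \<omega> - g N \<omega>)\<^sup>2 \<partial>M) \<longlonglongrightarrow> 0" "(\<lambda>N. CLINT \<omega>|M. iexp (g N \<omega>)) \<longlonglongrightarrow> L"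
  shows "(\<lambda>N. CLINT \<omega>|M. iexp (f N \<omega>)) \<longlonglongrightarrow> L"
proof -
  interpret prob_space M by fact
  have ie: "integrable M (\<lambda>\<omega>. iexp (f N \<omega>))" "integrable M (\<lambda>\<omega>. iexp (g N \<omega>))" for N
    by (rule integrable_const_bound[where B = 1], auto)+
  have ia: "integrable M (\<lambda>\<omega>. \<bar>f N \<omega> - g N \<omega>\<bar>)" for N
    using square_integrable_imp_integrable[of "\<lambda>\<omega>. f N \<omega> - g N \<omega>"] int[of N] by auto
  have bd: "norm ((CLINT \<omega>|M. iexp (f N \<omega>)) - (CLINT \<omega>|M. iexp (g N \<omega>))) \<le> sqrt (\<integral>\<omega>. (f N \<omega> - g N \<omega>)\<^sup>2 \<partial>M)" for N
  proof -
    have b: "norm (iexp x - iexp y) \<le> \<bar>x - y\<bar>" for x y :: real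
    proof -
      have "iexp x - iexp y = iexp y * (iexp (x - y) - 1)"
        by (simp add: right_diff_distrib exp_add[symmetric] distrib_left[symmetric])
      then show ?thesis using iexp_approx1[of "x - y" 0] by (simp add: norm_mult)
    qed
    have "norm (CLINT \<omega>|M. iexp (f N \<omega>) - iexp (g N \<omega>)) \<le> (\<integral>\<omega>. norm (iexp (f N \<omega>) - iexp (g N \<omega>)) \<partial>M)"
      by (rule integral_norm_bound)
    also have "\<dots> \<le> (\<integral>\<omega>. \<bar>f N \<omega> - g N \<omega>\<bar> \<partial>M)"
      by (intro integral_mono integrable_norm Bochner_Integration.integrable_diff ie ia b)
    also have "\<dots> \<le> sqrt (\<integral>\<omega>. (f N \<omega> - g N \<omega>)\<^sup>2 \<partial>M)"
    proof (rule real_le_rsqrt)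
      have "0 \<le> variance (\<lambda>\<omega>. \<bar>f N \<omega> - g N \<omega>\<bar>)" by simp
      also have "\<dots> = (\<integral>\<omega>. (\<bar>f N \<omega> - g N \<omega>\<bar>)\<^sup>2 \<partial>M) - (\<integral>\<omega>. \<bar>f N \<omega> - g N \<omega>\<bar> \<partial>M)\<^sup>2"
        by (rule variance_eq[OF ia]) (use int in simp)
      finally show "(\<integral>\<omega>. \<bar>f N \<omega> - g N \<omega>\<bar> \<partial>M)\<^sup>2 \<le> (\<integral>\<omega>. (f N \<omega> - g N \<omega>)\<^sup>2 \<partial>M)" by simp
    qed
    finally show ?thesis by (simp add: ie)
  qed
  have "(\<lambda>N. sqrt (\<integral>\<omega>. (f N \<omega> - g N \<omega>)\<^sup>2 \<partial>M)) \<longlonglongrightarrow> 0" using tendsto_real_sqrt[OF lim(1)] by simp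
  then have "(\<lambda>N. (CLINT \<omega>|M. iexp (f N \<omega>)) - (CLINT \<omega>|M. iexp (g N \<omega>))) \<longlonglongrightarrow> 0"
    by (rule Lim_null_comparison[OF always_eventually[OF allI[OF bd]]])
  from tendsto_add[OF this lim(2)] show ?thesis by simp
qed

lemma integrable_square_add:
  fixes f g :: "'a \<Rightarrow> real"
  assumes [measurable]: "f \<in> borel_measurable M" "g \<in> borel_measurable M"
    and "integrable M (\<lambda>\<omega>. (f \<omega>)\<^sup>2)" "integrable M (\<lambda>\<omega>. (g \<omega>)\<^sup>2)"
  shows "integrable M (\<lambda>\<omega>. (f \<omega> + g \<omega>)\<^sup>2)"
    and "(\<integral>\<omega>. (f \<omega> + g \<omega>)\<^sup>2 \<partial>M) \<le> 2 * (\<integral>\<omega>. (f \<omega>)\<^sup>2 \<partial>M) + 2 * (\<integral>\<omega>. (g \<omega>)\<^sup>2 \<partial>M)"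
proof -
  have b: "(x + y)\<^sup>2 \<le> 2 * x\<^sup>2 + 2 * y\<^sup>2" for x y :: real
    using zero_le_power2[of "x - y"] by (simp add: power2_sum power2_diff)
  have i: "integrable M (\<lambda>\<omega>. 2 * (f \<omega>)\<^sup>2 + 2 * (g \<omega>)\<^sup>2)" using assms by simp
  show j: "integrable M (\<lambda>\<omega>. (f \<omega> + g \<omega>)\<^sup>2)"
    by (rule Bochner_Integration.integrable_bound[OF i]) (use b in auto)
  have "(\<integral>\<omega>. (f \<omega> + g \<omega>)\<^sup>2 \<partial>M) \<le> (\<integral>\<omega>. 2 * (f \<omega>)\<^sup>2 + 2 * (g \<omega>)\<^sup>2 \<partial>M)"
    by (rule integral_mono[OF j i b])
  then show "(\<integral>\<omega>. (f \<omega> + g \<omega>)\<^sup>2 \<partial>M) \<le> 2 * (\<integral>\<omega>. (f \<omega>)\<^sup>2 \<partial>M) + 2 * (\<integral>\<omega>. (g \<omega>)\<^sup>2 \<partial>M)" using assms by simp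
qed

lemma (in sizes) cheb_walks_L2:
  fixes Xe :: "'v set \<Rightarrow> 'a \<Rightarrow> real"
  assumes iid: "iid_array M Xe I m" and I: "\<And>N. bip_edges (S N) (T N) \<subseteq> I" and k: "k \<ge> 1"
  defines "Z \<equiv> \<lambda>N. centered M (cheb_walks Xe k N)"
    and "Y \<equiv> \<lambda>N \<omega>. 1 / (2 * h N ^ k) * cycle_sum Xe (S N) (T N) k \<omega>"
  shows "Z N \<in> borel_measurable M" "Y N \<in> borel_measurable M" "integrable M (\<lambda>\<omega>. (Z N \<omega>)\<^sup>2)"
    and "integrable M (\<lambda>\<omega>. (Z N \<omega> - Y N \<omega>)\<^sup>2)"
    and "(\<lambda>N. \<integral>\<omega>. (Z N \<omega> - Y N \<omega>)\<^sup>2 \<partial>M) \<longlonglongrightarrow> 0"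
    and "\<exists>K. \<forall>N. (\<integral>\<omega>. (Z N \<omega>)\<^sup>2 \<partial>M) \<le> K"
    and "cycle_var m k * cycle_mult k \<ge> 0"
proof -
  interpret iid_array M Xe I m by fact
  have d: "(S N \<union> S N) \<inter> (T N \<union> T N) = {}" for N using disj by simp
  note cs = integrable_cycle_sum[OF iid k k finS finT finS finT d I I] integrable_cycle_sum2[OF iid k k finS finT finS finT d I I]
  note cw = integrable_cheb_walks[OF iid I]
  have mZ: "Z N \<in> borel_measurable M" for N unfolding Z_def centered_def using cw(1)[of k N] by measurable
  have mY: "Y N \<in> borel_measurable M" for N unfolding Y_def using cs(1)[of N] by measurable
  have iZ: "integrable M (\<lambda>\<omega>. (Z N \<omega>)\<^sup>2)" for N
    using integrable_square_add(1)[of "cheb_walks Xe k N" M "\<lambda>_. - expectation (cheb_walks Xe k N)"] cw[of k N]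
    by (auto simp: Z_def centered_def)
  have iY: "integrable M (\<lambda>\<omega>. (Y N \<omega>)\<^sup>2)" for N
    using cs(2)[of N] unfolding Y_def power_mult_distrib by (simp add: power2_eq_square)
  have iD: "integrable M (\<lambda>\<omega>. (Z N \<omega> - Y N \<omega>)\<^sup>2)" for N
    using integrable_square_add(1)[of "Z N" M "\<lambda>\<omega>. - Y N \<omega>"] mZ mY iZ iY by auto
  show "Z N \<in> borel_measurable M" "Y N \<in> borel_measurable M" "integrable M (\<lambda>\<omega>. (Z N \<omega>)\<^sup>2)"
    "integrable M (\<lambda>\<omega>. (Z N \<omega> - Y N \<omega>)\<^sup>2)" by (fact mZ mY iZ iD)+
  show D: "(\<lambda>N. \<integral>\<omega>. (Z N \<omega> - Y N \<omega>)\<^sup>2 \<partial>M) \<longlonglongrightarrow> 0"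
    using reduction_to_cycle_sum[OF iid I k] unfolding Z_def Y_def centered_def cf_top[OF k] .
  have sz: "sizes S T h \<alpha> \<beta>" by (rule sizes_axioms)
  have DA: "sizes (\<lambda>N. S N \<inter> S N) (\<lambda>N. T N \<inter> T N) h \<alpha> \<beta>" using sz by simp
  have g: "(\<lambda>N. h N ^ 2 / (h N * h N)) \<longlonglongrightarrow> 1"
    using h_pos by (simp add: power2_eq_square less_imp_neq[symmetric])
  have Y2: "(\<integral>\<omega>. (Y N \<omega>)\<^sup>2 \<partial>M) = 1 / (2 * h N ^ k) * (1 / (2 * h N ^ k)) * (\<integral>\<omega>. cycle_sum Xe (S N) (T N) k \<omega> * cycle_sum Xe (S N) (T N) k \<omega> \<partial>M)" for N
    unfolding Y_def power_mult_distrib by (simp add: power2_eq_square)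
  have limY: "(\<lambda>N. \<integral>\<omega>. (Y N \<omega>)\<^sup>2 \<partial>M) \<longlonglongrightarrow> cycle_var m k * cycle_mult k / 4"
    unfolding Y2 using cycle_covariance_limit[OF iid k k sz sz DA d I I g] by simp
  \<comment> \<open>Nonnegativity is inherited from the second moments; for \<open>k = 1\<close>
    this is \<open>m 4 \<ge> 1\<close>.\<close>
  have "0 \<le> cycle_var m k * cycle_mult k / 4"
    by (rule LIMSEQ_le_const[OF limY]) (auto intro!: Bochner_Integration.integral_nonneg)
  then show "cycle_var m k * cycle_mult k \<ge> 0" by simp
  have "(\<lambda>N. 2 * (\<integral>\<omega>. (Y N \<omega>)\<^sup>2 \<partial>M) + 2 * (\<integral>\<omega>. (Z N \<omega> - Y N \<omega>)\<^sup>2 \<partial>M)) \<longlonglongrightarrow> 2 * (cycle_var m k * cycle_mult k / 4) + 2 * 0"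
    by (intro tendsto_add tendsto_mult_left limY D)
  then have "Bseq (\<lambda>N. 2 * (\<integral>\<omega>. (Y N \<omega>)\<^sup>2 \<partial>M) + 2 * (\<integral>\<omega>. (Z N \<omega> - Y N \<omega>)\<^sup>2 \<partial>M))"
    by (rule convergent_imp_Bseq[OF convergentI])
  then obtain K where K: "\<And>N. norm (2 * (\<integral>\<omega>. (Y N \<omega>)\<^sup>2 \<partial>M) + 2 * (\<integral>\<omega>. (Z N \<omega> - Y N \<omega>)\<^sup>2 \<partial>M)) \<le> K"
    unfolding Bseq_def by blast
  have "(\<integral>\<omega>. (Z N \<omega>)\<^sup>2 \<partial>M) \<le> K" for N
  proof -
    have mD: "(\<lambda>\<omega>. Z N \<omega> - Y N \<omega>) \<in> borel_measurable M" using mZ mY by measurable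
    have "(\<integral>\<omega>. (Y N \<omega> + (Z N \<omega> - Y N \<omega>))\<^sup>2 \<partial>M) \<le> 2 * (\<integral>\<omega>. (Y N \<omega>)\<^sup>2 \<partial>M) + 2 * (\<integral>\<omega>. (Z N \<omega> - Y N \<omega>)\<^sup>2 \<partial>M)"
      by (rule integrable_square_add(2)[OF mY mD iY iD])
    moreover have "Y N \<omega> + (Z N \<omega> - Y N \<omega>) = Z N \<omega>" for \<omega> by simp
    ultimately have "(\<integral>\<omega>. (Z N \<omega>)\<^sup>2 \<partial>M) \<le> 2 * (\<integral>\<omega>. (Y N \<omega>)\<^sup>2 \<partial>M) + 2 * (\<integral>\<omega>. (Z N \<omega> - Y N \<omega>)\<^sup>2 \<partial>M)" by simp
    also have "\<dots> \<le> K" by (rule order_trans[OF abs_ge_self K[unfolded real_norm_def]])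
    finally show ?thesis .
  qed
  then show "\<exists>K. \<forall>N. (\<integral>\<omega>. (Z N \<omega>)\<^sup>2 \<partial>M) \<le> K" by blast
qed

text \<open>The overlap is contained in both submatrices, whence \<open>hD^2 \<le> hA * hB\<close>.
  This makes \<open>\<gamma>^k\<close> admissible as a correlation coefficient.\<close>

lemma overlap_le_1:
  assumes A: "sizes SA TA hA \<alpha> \<beta>" and B: "sizes SB TB hB \<alpha>' \<beta>'"
    and D: "sizes (\<lambda>N. SA N \<inter> SB N) (\<lambda>N. TA N \<inter> TB N) hD \<alpha>'' \<beta>''"
    and \<gamma>: "(\<lambda>N. hD N ^ 2 / (hA N * hB N)) \<longlonglongrightarrow> \<gamma>"
  shows "0 \<le> \<gamma>" "\<gamma> \<le> 1"
proof -
  interpret A: sizes SA TA hA \<alpha> \<beta> by fact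
  interpret B: sizes SB TB hB \<alpha>' \<beta>' by fact
  interpret D: sizes "\<lambda>N. SA N \<inter> SB N" "\<lambda>N. TA N \<inter> TB N" hD \<alpha>'' \<beta>'' by fact
  have "hD N ^ 2 \<le> hA N * hB N" for N
  proof (rule power2_le_imp_le)
    have c: "real (card (SA N \<inter> SB N)) \<le> card (SA N)" "real (card (SA N \<inter> SB N)) \<le> card (SB N)"
      "real (card (TA N \<inter> TB N)) \<le> card (TA N)" "real (card (TA N \<inter> TB N)) \<le> card (TB N)"
      using A.finS A.finT B.finS B.finT by (auto intro!: card_mono)
    have "(hD N ^ 2)\<^sup>2 = (real (card (SA N \<inter> SB N)) * card (TA N \<inter> TB N)) * (real (card (SA N \<inter> SB N)) * card (TA N \<inter> TB N))"
      unfolding D.h_square by (simp add: power2_eq_square)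
    also have "\<dots> \<le> (real (card (SA N)) * card (TA N)) * (real (card (SB N)) * card (TB N))"
      using c by (intro mult_mono) auto
    also have "\<dots> = (hA N * hB N)\<^sup>2" unfolding power_mult_distrib A.h_square B.h_square ..
    finally show "(hD N ^ 2)\<^sup>2 \<le> (hA N * hB N)\<^sup>2" .
    show "0 \<le> hA N * hB N" using A.h_pos[of N] B.h_pos[of N] by simp
  qed
  then have b: "0 \<le> hD N ^ 2 / (hA N * hB N)" "hD N ^ 2 / (hA N * hB N) \<le> 1" for N
    using A.h_pos[of N] B.h_pos[of N] by auto
  show "0 \<le> \<gamma>" by (rule LIMSEQ_le_const[OF \<gamma>]) (use b in auto)
  show "\<gamma> \<le> 1" by (rule LIMSEQ_le_const2[OF \<gamma>]) (use b in auto)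
qed

text \<open>Each linear combination of the two cycle sums has Gaussian limit moments. The resulting
  limit of characteristic functions passes to the Chebyshev sums because these are close to the
  cycle sums in mean square.\<close>

theorem overlapping_walks_clt:
  fixes Xe :: "'v set \<Rightarrow> 'a \<Rightarrow> real" and c :: real
  assumes iid: "iid_array M Xe I m" and k: "k \<ge> 1" "l \<ge> 1"
    and A: "sizes SA TA hA \<alpha> \<beta>" and B: "sizes SB TB hB \<alpha>' \<beta>'"
    and D: "sizes (\<lambda>N. SA N \<inter> SB N) (\<lambda>N. TA N \<inter> TB N) hD \<alpha>'' \<beta>''"
    and disj: "\<And>N. (SA N \<union> SB N) \<inter> (TA N \<union> TB N) = {}"
    and I: "\<And>N. bip_edges (SA N) (TA N) \<subseteq> I" "\<And>N. bip_edges (SB N) (TB N) \<subseteq> I"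
    and \<gamma>: "(\<lambda>N. hD N ^ 2 / (hA N * hB N)) \<longlonglongrightarrow> \<gamma>"
    and c: "\<And>N. real (card (SA N \<union> TA N \<union> SB N \<union> TB N)) \<le> c * hA N" "\<And>N. real (card (SA N \<union> TA N \<union> SB N \<union> TB N)) \<le> c * hB N"
  shows "\<exists>\<mu>. bivariate_gaussian \<mu> \<and> (\<integral>z. fst z \<partial>\<mu>) = 0 \<and> (\<integral>z. snd z \<partial>\<mu>) = 0 \<and>
    covariance \<mu> fst snd = (if k = l then cycle_var m k * cycle_mult k / 4 * \<gamma> ^ k else 0) \<and>
    converges_weakly (\<lambda>N. distr M borel (\<lambda>\<omega>.
      (centered M (sizes.cheb_walks SA TA hA Xe k N) \<omega>, centered M (sizes.cheb_walks SB TB hB Xe l N) \<omega>))) \<mu>"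
proof -
  interpret iid_array M Xe I m by fact
  interpret A: sizes SA TA hA \<alpha> \<beta> by fact
  interpret B: sizes SB TB hB \<alpha>' \<beta>' by fact
  define ZA where "ZA N = centered M (A.cheb_walks Xe k N)" for N
  define ZB where "ZB N = centered M (B.cheb_walks Xe l N)" for N
  define YA where "YA N \<omega> = 1 / (2 * hA N ^ k) * cycle_sum Xe (SA N) (TA N) k \<omega>" for N \<omega>
  define YB where "YB N \<omega> = 1 / (2 * hB N ^ l) * cycle_sum Xe (SB N) (TB N) l \<omega>" for N \<omega>
  note fA = A.cheb_walks_L2[OF iid I(1) k(1), folded ZA_def YA_def]
  note fB = B.cheb_walks_L2[OF iid I(2) k(2), folded ZB_def YB_def]
  note [measurable] = fA(1,2) fB(1,2)
  define \<nu> where "\<nu> N = distr M borel (\<lambda>\<omega>. (ZA N \<omega>, ZB N \<omega>))" for N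
  have walk_sum [measurable]: "(\<lambda>\<omega>. (ZA N \<omega>, ZB N \<omega>)) \<in> M \<rightarrow>\<^sub>M borel" for N by (rule borel_measurable_Pair) measurable
  have \<nu>: "plane_law (\<nu> N)" for N
    unfolding plane_law_def plane_law_axioms_def \<nu>_def using prob_space_distr[OF walk_sum] by simp
  define sk sl where "sk = cycle_var m k * cycle_mult k / 4" and "sl = cycle_var m l * cycle_mult l / 4"
  have sk: "sk \<ge> 0" and sl: "sl \<ge> 0" using fA(7) fB(7) by (simp_all add: sk_def sl_def)
  \<comment> \<open>Plays the role of the correlation coefficient. For \<open>k = l\<close> the two
    limit variances coincide, so that the covariance is \<open>sk * \<gamma>^k\<close>.\<close>
  define \<rho> where "\<rho> = (if k = l then \<gamma> ^ k else 0)"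
  have "0 \<le> \<rho>" "\<rho> \<le> 1" using overlap_le_1[OF A B D \<gamma>] by (auto simp: \<rho>_def power_le_one)
  then have \<rho>1: "\<rho>\<^sup>2 \<le> 1" by (simp add: power_le_one)
  \<comment> \<open>The triangular form of the law with variances \<open>sk\<close> and
    \<open>sl\<close> and covariance \<rho> times the product of their square roots; it remains
    correct if a variance is 0.\<close>
  define \<mu> where "\<mu> = gauss2 (sqrt sk) (\<rho> * sqrt sl) (sqrt sl * sqrt (1 - \<rho>\<^sup>2))"
  have \<mu>: "plane_law \<mu>" unfolding \<mu>_def by (rule plane_law_gauss2)
  have cov: "sqrt sk * (\<rho> * sqrt sl) = (if k = l then cycle_var m k * cycle_mult k / 4 * \<gamma> ^ k else 0)"
  proof (cases "k = l")
    case True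
    then have "sl = sk" by (simp add: sk_def sl_def)
    then have "sqrt sk * (\<rho> * sqrt sl) = sk * \<gamma> ^ k" using sk True by (simp add: \<rho>_def)
    then show ?thesis using True by (simp add: sk_def)
  qed (simp add: \<rho>_def)
  have char: "(\<lambda>N. char2 (\<nu> N) s u) \<longlonglongrightarrow> char2 \<mu> s u" for s u
  proof -
    define v where "v = s\<^sup>2 * (cycle_var m k * cycle_mult k / 4) +
     2 * s * u * (if k = l then cycle_var m k * cycle_mult k / 4 * \<gamma> ^ k else 0) + u\<^sup>2 * (cycle_var m l * cycle_mult l / 4)"
    have "(s * sqrt sk + u * (\<rho> * sqrt sl))\<^sup>2 + (u * (sqrt sl * sqrt (1 - \<rho>\<^sup>2)))\<^sup>2 = v"
    proof -
      have r: "sqrt sk * sqrt sk = sk" "sqrt sl * sqrt sl = sl" "sqrt (1 - \<rho>\<^sup>2) * sqrt (1 - \<rho>\<^sup>2) = 1 - \<rho>\<^sup>2" using sk sl \<rho>1 by auto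
      have gen: "(s * a + u * (\<rho> * b))\<^sup>2 + (u * (b * d))\<^sup>2 =
         s\<^sup>2 * (a * a) + 2 * s * u * (a * (\<rho> * b)) + u\<^sup>2 * \<rho>\<^sup>2 * (b * b) + u\<^sup>2 * (b * b) * (d * d)" for a b d :: real
        by (simp add: power2_eq_square algebra_simps)
      have "(s * sqrt sk + u * (\<rho> * sqrt sl))\<^sup>2 + (u * (sqrt sl * sqrt (1 - \<rho>\<^sup>2)))\<^sup>2 =
         s\<^sup>2 * (sqrt sk * sqrt sk) + 2 * s * u * (sqrt sk * (\<rho> * sqrt sl)) + u\<^sup>2 * \<rho>\<^sup>2 * (sqrt sl * sqrt sl) +
         u\<^sup>2 * (sqrt sl * sqrt sl) * (sqrt (1 - \<rho>\<^sup>2) * sqrt (1 - \<rho>\<^sup>2))"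
        by (rule gen)
      also have "\<dots> = v" unfolding r cov v_def sk_def[symmetric] sl_def[symmetric] by (simp add: algebra_simps)
      finally show ?thesis .
    qed
    then have tgt: "char2 \<mu> s u = complex_of_real (exp (- v / 2))" unfolding \<mu>_def char2_gauss2 by simp
    have src: "char2 (\<nu> N) s u = (CLINT \<omega>|M. iexp (s * ZA N \<omega> + u * ZB N \<omega>))" for N
      unfolding char2_def \<nu>_def by (subst integral_distr[OF walk_sum]) (simp_all add: borel_prod[symmetric])
    define L where "L N \<omega> = s * YA N \<omega> + u * YB N \<omega>" for N \<omega>
    have Leq: "L N \<omega> = s / (2 * hA N ^ k) * cycle_sum Xe (SA N) (TA N) k \<omega> + u / (2 * hB N ^ l) * cycle_sum Xe (SB N) (TB N) l \<omega>" for N \<omega>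
      unfolding L_def YA_def YB_def by simp
    note gm = cycle_sums_gauss_moments[OF iid k A B D disj I \<gamma> c, where s = s and u = u, folded Leq v_def]
    have chL: "(\<lambda>N. CLINT \<omega>|M. iexp (L N \<omega>)) \<longlonglongrightarrow> complex_of_real (exp (- v / 2))"
      using char_from_moments[OF prob_space_axioms, of L v, OF gm] by simp
    have "(\<lambda>N. CLINT \<omega>|M. iexp (s * ZA N \<omega> + u * ZB N \<omega>)) \<longlonglongrightarrow> complex_of_real (exp (- v / 2))"
    proof (rule char_transfer[OF prob_space_axioms _ _ _ _ chL])
      have eq: "(s * ZA N \<omega> + u * ZB N \<omega> - L N \<omega>)\<^sup>2 = (s * (ZA N \<omega> - YA N \<omega>) + u * (ZB N \<omega> - YB N \<omega>))\<^sup>2" for N \<omega>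
        unfolding L_def by (intro arg_cong[of _ _ "\<lambda>x. x\<^sup>2"]) (simp add: algebra_simps)
      have i: "integrable M (\<lambda>\<omega>. (s * (ZA N \<omega> - YA N \<omega>))\<^sup>2)" "integrable M (\<lambda>\<omega>. (u * (ZB N \<omega> - YB N \<omega>))\<^sup>2)" for N
        unfolding power_mult_distrib by (intro integrable_mult_right fA(4) fB(4))+
      have m: "(\<lambda>\<omega>. s * (ZA N \<omega> - YA N \<omega>)) \<in> borel_measurable M" "(\<lambda>\<omega>. u * (ZB N \<omega> - YB N \<omega>)) \<in> borel_measurable M" for N
        by measurable
      note sq = integrable_square_add[OF m i]
      show "integrable M (\<lambda>\<omega>. (s * ZA N \<omega> + u * ZB N \<omega> - L N \<omega>)\<^sup>2)" for N unfolding eq by (rule sq(1))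
      have lim: "(\<lambda>N. 2 * (s\<^sup>2 * (\<integral>\<omega>. (ZA N \<omega> - YA N \<omega>)\<^sup>2 \<partial>M)) + 2 * (u\<^sup>2 * (\<integral>\<omega>. (ZB N \<omega> - YB N \<omega>)\<^sup>2 \<partial>M))) \<longlonglongrightarrow>
          2 * (s\<^sup>2 * 0) + 2 * (u\<^sup>2 * 0)"
        by (intro tendsto_add tendsto_mult_left fA(5) fB(5))
      show "(\<lambda>N. \<integral>\<omega>. (s * ZA N \<omega> + u * ZB N \<omega> - L N \<omega>)\<^sup>2 \<partial>M) \<longlonglongrightarrow> 0"
      proof (rule tendsto_sandwich[OF _ _ tendsto_const])
        show "(\<lambda>N. 2 * (s\<^sup>2 * (\<integral>\<omega>. (ZA N \<omega> - YA N \<omega>)\<^sup>2 \<partial>M)) + 2 * (u\<^sup>2 * (\<integral>\<omega>. (ZB N \<omega> - YB N \<omega>)\<^sup>2 \<partial>M))) \<longlonglongrightarrow> 0"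
          using lim by simp
        show "\<forall>\<^sub>F N in sequentially. 0 \<le> (\<integral>\<omega>. (s * ZA N \<omega> + u * ZB N \<omega> - L N \<omega>)\<^sup>2 \<partial>M)"
          by (intro always_eventually allI Bochner_Integration.integral_nonneg) simp
        show "\<forall>\<^sub>F N in sequentially. (\<integral>\<omega>. (s * ZA N \<omega> + u * ZB N \<omega> - L N \<omega>)\<^sup>2 \<partial>M) \<le>
          2 * (s\<^sup>2 * (\<integral>\<omega>. (ZA N \<omega> - YA N \<omega>)\<^sup>2 \<partial>M)) + 2 * (u\<^sup>2 * (\<integral>\<omega>. (ZB N \<omega> - YB N \<omega>)\<^sup>2 \<partial>M))"
          unfolding eq using sq(2) by (intro always_eventually allI) (simp add: power_mult_distrib)
      qed
    qed (use gm(1)[of _ 1] in \<open>auto simp: L_def\<close>)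
    then show ?thesis unfolding src tgt .
  qed
  obtain KA KB where K: "\<And>N. (\<integral>\<omega>. (ZA N \<omega>)\<^sup>2 \<partial>M) \<le> KA" "\<And>N. (\<integral>\<omega>. (ZB N \<omega>)\<^sup>2 \<partial>M) \<le> KB"
    using fA(6) fB(6) by blast
  \<comment> \<open>One bound on the second moments of all the laws and of the limit, which is the
    tightness required below.\<close>
  define K where "K = max (KA + KB) (\<integral>z. (norm z)\<^sup>2 \<partial>\<mu>)"
  have n2: "(norm (x, y))\<^sup>2 = x\<^sup>2 + y\<^sup>2" for x y :: real by (simp add: norm_prod_def)
  have weak: "converges_weakly \<nu> \<mu>"
  proof (rule weak_limit_from_char2[OF \<nu> \<mu> char])
    show "integrable (\<nu> N) (\<lambda>z. (norm z)\<^sup>2)" for N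
      unfolding \<nu>_def using fA(3)[of N] fB(3)[of N] by (subst integrable_distr_eq[OF walk_sum]) (simp_all add: n2)
    have nn: "(\<integral>z. (norm z)\<^sup>2 \<partial>\<nu> N) = (\<integral>\<omega>. (ZA N \<omega>)\<^sup>2 \<partial>M) + (\<integral>\<omega>. (ZB N \<omega>)\<^sup>2 \<partial>M)" for N
      unfolding \<nu>_def using fA(3)[of N] fB(3)[of N] by (subst integral_distr[OF walk_sum]) (simp_all add: n2)
    show "(\<integral>z. (norm z)\<^sup>2 \<partial>\<nu> N) \<le> K" for N
    proof -
      have "(\<integral>z. (norm z)\<^sup>2 \<partial>\<nu> N) \<le> KA + KB" unfolding nn by (rule add_mono[OF K])
      also have "\<dots> \<le> K" unfolding K_def by (rule max.cobounded1)
      finally show ?thesis .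
    qed
    show "integrable \<mu> (\<lambda>z. (norm z)\<^sup>2)" unfolding \<mu>_def by (rule gauss2_moments)
    show "(\<integral>z. (norm z)\<^sup>2 \<partial>\<mu>) \<le> K" by (simp add: K_def)
  qed
  have cv: "covariance \<mu> fst snd = (if k = l then cycle_var m k * cycle_mult k / 4 * \<gamma> ^ k else 0)"
    unfolding cov[symmetric] covariance_def centered_def \<mu>_def gauss2_moments(1,2) diff_0_right by (rule gauss2_moments(3))
  show ?thesis
  proof (intro exI[of _ \<mu>] conjI)
    show "bivariate_gaussian \<mu>" "(\<integral>z. fst z \<partial>\<mu>) = 0" "(\<integral>z. snd z \<partial>\<mu>) = 0"
      unfolding \<mu>_def by (rule bivariate_gaussian_gauss2 gauss2_moments)+
    show "converges_weakly (\<lambda>N. distr M borel (\<lambda>\<omega>. (centered M (A.cheb_walks Xe k N) \<omega>, centered M (B.cheb_walks Xe l N) \<omega>))) \<mu>"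
      using weak unfolding \<nu>_def[abs_def] ZA_def ZB_def .
  qed (rule cv)
qed

subsection \<open>Submatrices of an infinite random matrix\<close>

text \<open>Carries independence from the index pairs \<open>(i, j)\<close> over to the edges
  \<open>{Inl i, Inr j}\<close>.\<close>

lemma (in prob_space) indep_vars_reindex:
  assumes f: "inj_on f J" "f ` J \<subseteq> I" and X: "indep_vars M' X I"
  shows "indep_vars (\<lambda>j. M' (f j)) (\<lambda>j. X (f j)) J"
  unfolding indep_vars_def2
proof (intro conjI ballI indep_setsI)
  let ?F = "\<lambda>i. {X i -` A \<inter> space M |A. A \<in> sets (M' i)}"
  have X': "indep_sets ?F I" "\<And>i. i \<in> I \<Longrightarrow> random_variable (M' i) (X i)" using X unfolding indep_vars_def2 by auto
  show "random_variable (M' (f j)) (X (f j))" if "j \<in> J" for j using X'(2) f(2) that by blast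
  show "?F (f j) \<subseteq> events" if "j \<in> J" for j using X'(1) f(2) that unfolding indep_sets_def by blast
  fix A K assume K: "K \<noteq> {}" "K \<subseteq> J" "finite K" "\<forall>j\<in>K. A j \<in> ?F (f j)"
  have inj: "inj_on f K" using f(1) K(2) by (rule inj_on_subset)
  have fK: "f ` K \<subseteq> I" using K(2) f(2) by blast
  have inv: "inv_into K f (f j) = j" if "j \<in> K" for j using inj that by (rule inv_into_f_f)
  have "prob (\<Inter>i\<in>f ` K. A (inv_into K f i)) = (\<Prod>i\<in>f ` K. prob (A (inv_into K f i)))"
    by (rule indep_setsD[OF X'(1)]) (use K fK inv in auto)
  moreover have "(\<Inter>i\<in>f ` K. A (inv_into K f i)) = (\<Inter>j\<in>K. A j)" using inv by auto
  moreover have "(\<Prod>i\<in>f ` K. prob (A (inv_into K f i))) = (\<Prod>j\<in>K. prob (A j))"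
    unfolding prod.reindex[OF inj] comp_def by (intro prod.cong refl) (simp add: inv)
  ultimately show "prob (\<Inter>j\<in>K. A j) = (\<Prod>j\<in>K. prob (A j))" by simp
qed

text \<open>Passes from the normalization by \<open>t\<close> to that by \<open>h\<close>, whose
  ratio to \<open>t\<close> has a positive limit.\<close>

lemma sizes_from_limits:
  fixes R C :: "nat \<Rightarrow> nat set" and t :: "nat \<Rightarrow> real"
  assumes fin: "\<And>N. finite (R N)" "\<And>N. finite (C N)" and ne: "\<And>N. R N \<noteq> {}" "\<And>N. C N \<noteq> {}"
    and t: "\<And>N. t N > 0" "filterlim t at_top sequentially"
    and lim: "(\<lambda>N. real (card (R N)) / t N) \<longlonglongrightarrow> a" "(\<lambda>N. real (card (C N)) / t N) \<longlonglongrightarrow> b" and ab: "a > 0" "b > 0"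
  defines "h \<equiv> \<lambda>N. sqrt (real (card (R N)) * real (card (C N)))"
  shows "(\<lambda>N. h N / t N) \<longlonglongrightarrow> sqrt (a * b)"
    and "sizes (\<lambda>N. Inl ` R N :: (nat + nat) set) (\<lambda>N. Inr ` C N) h (a / sqrt (a * b)) (b / sqrt (a * b))"
proof -
  have ht: "h N / t N = sqrt ((real (card (R N)) / t N) * (real (card (C N)) / t N))" for N
    using t(1)[of N] unfolding h_def by (simp add: real_sqrt_divide real_sqrt_mult)
  show lh: "(\<lambda>N. h N / t N) \<longlonglongrightarrow> sqrt (a * b)"
    unfolding ht by (intro tendsto_real_sqrt tendsto_mult lim)
  have pos: "sqrt (a * b) > 0" using ab by simp
  have cl: "card (Inl ` R N :: (nat + nat) set) = card (R N)" "card (Inr ` C N :: (nat + nat) set) = card (C N)" for N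
    by (auto intro: card_image)
  show "sizes (\<lambda>N. Inl ` R N :: (nat + nat) set) (\<lambda>N. Inr ` C N) h (a / sqrt (a * b)) (b / sqrt (a * b))"
  proof (unfold_locales, unfold cl)
    show "filterlim h at_top sequentially"
      using filterlim_tendsto_pos_mult_at_top[OF lh pos t(2)] t(1) by (simp add: less_imp_neq[symmetric])
    have q: "real n / h N = (real n / t N) / (h N / t N)" for n N using t(1)[of N] by simp
    show "(\<lambda>N. real (card (R N)) / h N) \<longlonglongrightarrow> a / sqrt (a * b)" "(\<lambda>N. real (card (C N)) / h N) \<longlonglongrightarrow> b / sqrt (a * b)"
      unfolding q[abs_def] by (rule tendsto_divide[OF lim(1) lh less_imp_neq[OF pos, symmetric]], rule tendsto_divide[OF lim(2) lh less_imp_neq[OF pos, symmetric]])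
  qed (use fin ne in \<open>auto simp: h_def\<close>)
qed

lemma ratio_bounded:
  fixes n h t :: "nat \<Rightarrow> real"
  assumes "\<And>N. t N > 0" "\<And>N. h N > 0" "(\<lambda>N. n N / t N) \<longlonglongrightarrow> a" "(\<lambda>N. h N / t N) \<longlonglongrightarrow> b" "b > 0"
  shows "\<exists>c. \<forall>N. n N \<le> c * h N"
proof -
  have "(\<lambda>N. (n N / t N) / (h N / t N)) \<longlonglongrightarrow> a / b" using assms(5) by (intro tendsto_divide assms(3,4)) simp
  then have "Bseq (\<lambda>N. (n N / t N) / (h N / t N))" by (rule convergent_imp_Bseq[OF convergentI])
  then obtain c where c: "\<And>N. norm ((n N / t N) / (h N / t N)) \<le> c" unfolding Bseq_def by blast
  have "n N \<le> c * h N" for N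
  proof -
    have "n N / h N = (n N / t N) / (h N / t N)" using assms(1)[of N] by simp
    also have "\<dots> \<le> c" by (rule order_trans[OF abs_ge_self c[unfolded real_norm_def]])
    finally show ?thesis using assms(2)[of N] by (simp add: pos_divide_le_eq)
  qed
  then show ?thesis by blast
qed

lemma converges_weakly_offset: "converges_weakly (\<lambda>N. \<mu>s (N + n)) \<mu> \<Longrightarrow> converges_weakly \<mu>s \<mu>"
  unfolding converges_weakly_def by (blast intro: LIMSEQ_offset)

text \<open>Entries are labelled by unordered edges in the walk sums. Row and column are recovered
  from the tags \<open>Inl\<close> and \<open>Inr\<close>, here and in
  \<open>edge_col\<close>.\<close>

definition edge_row :: "(nat + nat) set \<Rightarrow> nat" where "edge_row e = (THE i. Inl i \<in> e)"
definition edge_col :: "(nat + nat) set \<Rightarrow> nat" where "edge_col e = (THE j. Inr j \<in> e)"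

lemma edge_row_col [simp]: "edge_row {Inl i, Inr j} = i" "edge_col {Inl i, Inr j} = j"
  by (auto simp: edge_row_def edge_col_def)

text \<open>Equal laws have equal moments, so that the moment sequence read off at the entry
  \<open>(0, 0)\<close> serves all entries.\<close>

lemma iid_array_edges:
  fixes X :: "nat \<Rightarrow> nat \<Rightarrow> 'a \<Rightarrow> real"
  assumes "prob_space M" and ind: "prob_space.indep_vars M (\<lambda>_. borel) (\<lambda>(i, j). X i j) UNIV"
    and id: "\<And>i j. distr M borel (X i j) = distr M borel (X 0 0)"
    and int: "\<And>i j p. integrable M (\<lambda>\<omega>. X i j \<omega> ^ p)"
    and mean: "\<And>i j. (\<integral>\<omega>. X i j \<omega> \<partial>M) = 0" and var: "\<And>i j. (\<integral>\<omega>. X i j \<omega> ^ 2 \<partial>M) = 1"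
  shows "iid_array M (\<lambda>e. X (edge_row e) (edge_col e)) (bip_edges (range Inl) (range Inr)) (\<lambda>p. \<integral>\<omega>. X 0 0 \<omega> ^ p \<partial>M)"
proof -
  interpret prob_space M by fact
  have meas: "X i j \<in> borel_measurable M" for i j using int[of i j 1] by auto
  have "(\<integral>\<omega>. X i j \<omega> ^ p \<partial>M) = (\<integral>x. x ^ p \<partial>distr M borel (X i j))" for i j p
    by (subst integral_distr[OF meas]) auto
  then have eq: "(\<integral>\<omega>. X i j \<omega> ^ p \<partial>M) = (\<integral>\<omega>. X 0 0 \<omega> ^ p \<partial>M)" for i j p using id by metis
  let ?I = "bip_edges (range Inl) (range Inr) :: (nat + nat) set set"
  have inj: "inj_on (\<lambda>e. (edge_row e, edge_col e)) ?I"
    by (auto simp: inj_on_def bip_edges_def)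
  show ?thesis
  proof unfold_locales
    show "indep_vars (\<lambda>_. borel) (\<lambda>e. X (edge_row e) (edge_col e)) ?I"
      using indep_vars_reindex[OF inj subset_UNIV ind] by simp
  qed (use int eq mean var prob_space in auto)
qed

theorem theorem1p2:
  fixes M :: "'a measure"
    and X :: "nat \<Rightarrow> nat \<Rightarrow> 'a \<Rightarrow> real"
    and m4 :: real
    and RA CA RB CB :: "nat \<Rightarrow> nat set"
    and t :: "nat \<Rightarrow> real"
    and a1 a2 b1 b2 \<Delta>1 \<Delta>2 \<gamma> :: real
    and WA WB :: "nat \<Rightarrow> 'a \<Rightarrow> real mat"
    and k l :: nat
  assumes "prob_space M"
    and "prob_space.indep_vars M (\<lambda>_. borel) (\<lambda>(i, j). X i j) UNIV"
    and "\<And>i j. distr M borel (X i j) = distr M borel (X 0 0)"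
    and "\<And>i j p. integrable M (\<lambda>\<omega>. X i j \<omega> ^ p)"
    and "\<And>i j. (\<integral>\<omega>. X i j \<omega> \<partial>M) = 0"
    and "\<And>i j. (\<integral>\<omega>. X i j \<omega> ^ 2 \<partial>M) = 1"
    and "\<And>i j. (\<integral>\<omega>. X i j \<omega> ^ 4 \<partial>M) = m4"
    and "\<And>N. finite (RA N)" "\<And>N. finite (CA N)" "\<And>N. finite (RB N)" "\<And>N. finite (CB N)"
    and "filterlim t at_top sequentially"
    and "(\<lambda>N. real (card (RA N)) / t N) \<longlonglongrightarrow> a1" "(\<lambda>N. real (card (CA N)) / t N) \<longlonglongrightarrow> a2"
    and "(\<lambda>N. real (card (RB N)) / t N) \<longlonglongrightarrow> b1" "(\<lambda>N. real (card (CB N)) / t N) \<longlonglongrightarrow> b2"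
    and "(\<lambda>N. real (card (RA N \<inter> RB N)) / t N) \<longlonglongrightarrow> \<Delta>1"
    and "(\<lambda>N. real (card (CA N \<inter> CB N)) / t N) \<longlonglongrightarrow> \<Delta>2"
    and "a1 > 0" "a2 > 0" "b1 > 0" "b2 > 0" "\<Delta>1 > 0" "\<Delta>2 > 0"
    and "\<gamma> = \<Delta>1 * \<Delta>2 / sqrt (a1 * a2 * b1 * b2)"
    and "\<And>N \<omega>. WA N \<omega> = norm_sample_cov (submat (\<lambda>i j. X i j \<omega>) (RA N) (CA N))"
    and "\<And>N \<omega>. WB N \<omega> = norm_sample_cov (submat (\<lambda>i j. X i j \<omega>) (RB N) (CB N))"
    and "k \<ge> 1" "l \<ge> 1"
  shows "\<exists>\<mu>. bivariate_gaussian \<mu>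
      \<and> (\<integral>z. fst z \<partial>\<mu>) = 0 \<and> (\<integral>z. snd z \<partial>\<mu>) = 0
      \<and> covariance \<mu> fst snd =
          (if k > 1 then (if k = l then 1 else 0) * (real k / 2) * \<gamma> ^ k
           else (if k = l then 1 else 0) * ((m4 - 1) / 4) * \<gamma>)
      \<and> converges_weakly
          (\<lambda>N. distr M borel (\<lambda>\<omega>.
             (centered M (\<lambda>\<omega>'. lin_stat (poly (chebyshev_T k)) (WA N \<omega>')) \<omega>,
              centered M (\<lambda>\<omega>'. lin_stat (poly (chebyshev_T l)) (WB N \<omega>')) \<omega>)))
          \<mu>"
proof -
  note fin = assms(8-11) and lims = assms(13-18) and pos = assms(19-24)
  define Xe where "Xe e = X (edge_row e) (edge_col e)" for e
  define m where "m p = (\<integral>\<omega>. X 0 0 \<omega> ^ p \<partial>M)" for p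
  let ?I = "bip_edges (range Inl) (range Inr) :: (nat + nat) set set"
  have iid: "iid_array M Xe ?I m"
    using iid_array_edges[OF assms(1-6)] unfolding Xe_def m_def .
  \<comment> \<open>\<open>sizes\<close> asks for nonempty sides at every index, whereas the
    hypotheses give them only eventually. The positive limits of the overlaps provide them from some
    \<open>n\<close> on, for the overlap and hence for both matrices; all sequences are then shifted
    by \<open>n\<close>, which does not affect weak convergence.\<close>
  have "eventually (\<lambda>N. t N > 0 \<and> card (RA N \<inter> RB N) \<noteq> 0 \<and> card (CA N \<inter> CB N) \<noteq> 0) sequentially"
    using filterlim_at_top_dense[THEN iffD1, OF assms(12), rule_format, of 0]
      order_tendstoD(1)[OF lims(5) pos(5)] order_tendstoD(1)[OF lims(6) pos(6)]
    by eventually_elim (simp add: zero_less_divide_iff)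
  then obtain n where n: "\<And>N. N \<ge> n \<Longrightarrow> t N > 0 \<and> card (RA N \<inter> RB N) \<noteq> 0 \<and> card (CA N \<inter> CB N) \<noteq> 0"
    unfolding eventually_sequentially by blast
  define s where "s N = t (N + n)" for N
  have s: "s N > 0" for N using n[of "N + n"] by (simp add: s_def)
  have stop: "filterlim s at_top sequentially"
    unfolding s_def by (rule filterlim_compose[OF assms(12)]) (rule filterlim_add_const_nat_at_top)
  note lims' = lims[THEN LIMSEQ_ignore_initial_segment[where k = n], folded s_def]
  have neD: "RA (N + n) \<inter> RB (N + n) \<noteq> {}" "CA (N + n) \<inter> CB (N + n) \<noteq> {}" for N
    using n[of "N + n"] by auto
  then have ne: "RA (N + n) \<noteq> {}" "RB (N + n) \<noteq> {}" "CA (N + n) \<noteq> {}" "CB (N + n) \<noteq> {}" for N by blast+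
  define hA where "hA N = sqrt (real (card (RA (N + n))) * real (card (CA (N + n))))" for N
  define hB where "hB N = sqrt (real (card (RB (N + n))) * real (card (CB (N + n))))" for N
  define hD where "hD N = sqrt (real (card (RA (N + n) \<inter> RB (N + n))) * real (card (CA (N + n) \<inter> CB (N + n))))" for N
  note A = sizes_from_limits[OF fin(1) fin(2) ne(1) ne(3) s stop lims'(1,2) pos(1,2), folded hA_def]
  note B = sizes_from_limits[OF fin(3) fin(4) ne(2) ne(4) s stop lims'(3,4) pos(3,4), folded hB_def]
  note D = sizes_from_limits[OF finite_Int[OF disjI1[OF fin(1)]] finite_Int[OF disjI1[OF fin(2)]] neD s stop lims'(5,6) pos(5,6), folded hD_def]
  interpret A: sizes "\<lambda>N. Inl ` RA (N + n) :: (nat + nat) set" "\<lambda>N. Inr ` CA (N + n)" hA "a1 / sqrt (a1 * a2)" "a2 / sqrt (a1 * a2)"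
    by (rule A(2))
  interpret B: sizes "\<lambda>N. Inl ` RB (N + n) :: (nat + nat) set" "\<lambda>N. Inr ` CB (N + n)" hB "b1 / sqrt (b1 * b2)" "b2 / sqrt (b1 * b2)"
    by (rule B(2))
  have D': "sizes (\<lambda>N. Inl ` RA (N + n) \<inter> Inl ` RB (N + n) :: (nat + nat) set) (\<lambda>N. Inr ` CA (N + n) \<inter> Inr ` CB (N + n)) hD
      (\<Delta>1 / sqrt (\<Delta>1 * \<Delta>2)) (\<Delta>2 / sqrt (\<Delta>1 * \<Delta>2))"
    using D(2) by (simp add: image_Int)
  have gam: "(\<lambda>N. hD N ^ 2 / (hA N * hB N)) \<longlonglongrightarrow> \<gamma>"
  proof -
    have l: "(\<lambda>N. (hD N / s N) ^ 2 / ((hA N / s N) * (hB N / s N))) \<longlonglongrightarrow> sqrt (\<Delta>1 * \<Delta>2) ^ 2 / (sqrt (a1 * a2) * sqrt (b1 * b2))"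
      using pos by (intro tendsto_divide tendsto_power tendsto_mult A(1) B(1) D(1)) auto
    have e: "(hD N / s N) ^ 2 / ((hA N / s N) * (hB N / s N)) = hD N ^ 2 / (hA N * hB N)" for N
      using s[of N] by (simp add: power_divide power2_eq_square)
    have g: "sqrt (\<Delta>1 * \<Delta>2) ^ 2 / (sqrt (a1 * a2) * sqrt (b1 * b2)) = \<gamma>"
      using pos unfolding assms(25) by (simp add: real_sqrt_mult[symmetric] mult.assoc)
    show ?thesis using l unfolding e g .
  qed
  \<comment> \<open>The sum of all four dimensions bounds the number of vertices and is comparable
    with both \<open>hA\<close> and \<open>hB\<close>.\<close>
  define V where "V N = real (card (RA (N + n))) + real (card (CA (N + n))) + real (card (RB (N + n))) + real (card (CB (N + n)))" for N
  have V: "real (card (Inl ` RA (N + n) \<union> Inr ` CA (N + n) \<union> Inl ` RB (N + n) \<union> Inr ` CB (N + n) :: (nat + nat) set)) \<le> V N" for N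
  proof -
    let ?a = "Inl ` RA (N + n) :: (nat + nat) set" and ?b = "Inr ` CA (N + n) :: (nat + nat) set"
      and ?c = "Inl ` RB (N + n) :: (nat + nat) set" and ?d = "Inr ` CB (N + n) :: (nat + nat) set"
    have "card ?a = card (RA (N + n))" "card ?b = card (CA (N + n))" "card ?c = card (RB (N + n))" "card ?d = card (CB (N + n))"
      by (auto intro: card_image)
    then show ?thesis
      using card_Un_le[of "?a \<union> ?b \<union> ?c" ?d] card_Un_le[of "?a \<union> ?b" ?c] card_Un_le[of ?a ?b] unfolding V_def by linarith
  qed
  have limV: "(\<lambda>N. V N / s N) \<longlonglongrightarrow> a1 + a2 + b1 + b2"
    unfolding V_def add_divide_distrib by (intro tendsto_add lims')
  obtain cA where cA: "\<And>N. V N \<le> cA * hA N"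
    using ratio_bounded[OF s A.h_pos limV A(1)] pos by auto
  obtain cB where cB: "\<And>N. V N \<le> cB * hB N"
    using ratio_bounded[OF s B.h_pos limV B(1)] pos by auto
  have c: "V N \<le> max cA cB * hA N" "V N \<le> max cA cB * hB N" for N
    by (rule order_trans[OF cA mult_right_mono[OF max.cobounded1 less_imp_le[OF A.h_pos]]])
      (rule order_trans[OF cB mult_right_mono[OF max.cobounded2 less_imp_le[OF B.h_pos]]])
  have y: "Xe {Inl p, Inr q} \<omega> = X p q \<omega>" for p q \<omega> by (simp add: Xe_def)
  have cl: "card (Inl ` P :: (nat + nat) set) = card P" "card (Inr ` P :: (nat + nat) set) = card P" for P :: "nat set"
    by (auto intro: card_image)
  have LA: "lin_stat (poly (chebyshev_T k)) (WA (N + n) \<omega>) = A.cheb_walks Xe k N \<omega>" for N \<omega>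
    unfolding assms(26) A.cheb_walks_def A.cf_def A.\<kappa>N_def cl
    by (rule lin_stat_chebyshev[where x = "\<lambda>i j. X i j \<omega>" and y = "\<lambda>e. Xe e \<omega>", OF fin(1) ne(1) fin(2) ne(3) y hA_def])
  have LB: "lin_stat (poly (chebyshev_T l)) (WB (N + n) \<omega>) = B.cheb_walks Xe l N \<omega>" for N \<omega>
    unfolding assms(27) B.cheb_walks_def B.cf_def B.\<kappa>N_def cl
    by (rule lin_stat_chebyshev[where x = "\<lambda>i j. X i j \<omega>" and y = "\<lambda>e. Xe e \<omega>", OF fin(3) ne(2) fin(4) ne(4) y hB_def])
  have dj: "(Inl ` RA (N + n) \<union> Inl ` RB (N + n)) \<inter> (Inr ` CA (N + n) \<union> Inr ` CB (N + n)) = ({} :: (nat + nat) set)" for N by auto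
  have sub: "bip_edges (Inl ` P) (Inr ` Q) \<subseteq> ?I" for P Q by (auto simp: bip_edges_def)
  obtain \<mu> where \<mu>: "bivariate_gaussian \<mu>" "(\<integral>z. fst z \<partial>\<mu>) = 0" "(\<integral>z. snd z \<partial>\<mu>) = 0"
    "covariance \<mu> fst snd = (if k = l then cycle_var m k * cycle_mult k / 4 * \<gamma> ^ k else 0)"
    "converges_weakly (\<lambda>N. distr M borel (\<lambda>\<omega>. (centered M (A.cheb_walks Xe k N) \<omega>, centered M (B.cheb_walks Xe l N) \<omega>))) \<mu>"
    using overlapping_walks_clt[OF iid assms(28,29) A(2) B(2) D' dj sub sub gam
        order_trans[OF V c(1)] order_trans[OF V c(2)]] by blast
  have "converges_weakly (\<lambda>N. distr M borel (\<lambda>\<omega>.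
             (centered M (\<lambda>\<omega>'. lin_stat (poly (chebyshev_T k)) (WA (N + n) \<omega>')) \<omega>,
              centered M (\<lambda>\<omega>'. lin_stat (poly (chebyshev_T l)) (WB (N + n) \<omega>')) \<omega>))) \<mu>"
    using \<mu>(5) unfolding LA LB .
  then have "converges_weakly (\<lambda>N. distr M borel (\<lambda>\<omega>.
             (centered M (\<lambda>\<omega>'. lin_stat (poly (chebyshev_T k)) (WA N \<omega>')) \<omega>,
              centered M (\<lambda>\<omega>'. lin_stat (poly (chebyshev_T l)) (WB N \<omega>')) \<omega>))) \<mu>"
    by (rule converges_weakly_offset)
  \<comment> \<open>For \<open>k > 1\<close> the factor \<open>cycle_mult k / 4\<close> is
    \<open>k / 2\<close>; for \<open>k = 1\<close> the constants combine to
    \<open>(m4 - 1) / 4\<close>.\<close>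
  moreover have "(if k = l then cycle_var m k * cycle_mult k / 4 * \<gamma> ^ k else 0) =
     (if k > 1 then (if k = l then 1 else 0) * (real k / 2) * \<gamma> ^ k
           else (if k = l then 1 else 0) * ((m4 - 1) / 4) * \<gamma>)"
    using assms(28) assms(7)[of 0 0] by (auto simp: cycle_var_def cycle_mult_def m_def)
  ultimately show ?thesis using \<mu>(1-4) by (intro exI[of _ \<mu>]) simp
qed

end
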